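(* Let $d\ge2$, $p\in[1,\infty]$, and let $\mathcal{T}_0$ be an initial triangulation of $\Omega\subset\mathbb{R}^d$ satisfying the matching neighbor condition. Let $\mathcal{T}$ be any mesh resulting from successive application of the BiSec-MT algorithm to $\mathcal{T}_0$, and let $\rho\in L^1(\Omega)$ be a weight with grading $\gamma_\rho$ (with respect to the face-based distance $\delta_{\mathrm{CR}}$ on $\mathcal{T}$) such that $$\gamma_\rho\,2^{\left|\frac12-\frac1p\right|}<\frac{d+\sqrt{d+2}}{d-\sqrt{d+2}}$$ (the right-hand side being $\infty$ for $d=2$). Then $$\|\rho\,Q_{\mathrm{CR}}u\|_p\le c\,\|\rho u\|_p\qquad\text{for all }u\in L^p(\Omega),$$ where the constant $c$ depends solely on the initial triangulation $\mathcal{T}_0$ and $\gamma_\rho$. In particular, (unweighted) $L^p$-stability $\|Q_{\mathrm{CR}}u\|_p\le c\|u\|_p$ for all $u\in L^p(\Omega)$ holds for all $p\in[1,\infty]$ and all dimensions $2\le d\le35$.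
   Context: $\Omega\subset\mathbb{R}^d$ is a bounded polyhedral (connected) domain. For a regular triangulation $\mathcal{T}$ of $\Omega$ into closed simplices, $\mathcal{F}$ is the set of faces ($(d-1)$-simplices), $\mathrm{mid}(f)$ the barycenter of $f\in\mathcal{F}$, and the Crouzeix–Raviart space $\mathrm{CR}^1(\mathcal{T})$ consists of the functions $v\in L^\infty(\Omega)$ that are affine on each $T\in\mathcal{T}$ and continuous at $\mathrm{mid}(f)$ for all $f\in\mathcal{F}$. $Q_{\mathrm{CR}}$ is the $L^2$-projection onto it: $\langle Q_{\mathrm{CR}}u,v\rangle=\langle u,v\rangle$ for all $v\in\mathrm{CR}^1(\mathcal{T})$, where $\langle\cdot,\cdot\rangle$ is the $L^2(\Omega)$ pairing, extended to $u\in L^1(\Omega)$ by the same formula. $\|\cdot\|_p$ is the norm of $L^p(\Omega)$. Distance $\delta_{\mathrm{CR}}$: distinct $T,T'\in\mathcal{T}$ are (face) neighbors if they share a face $f\in\mathcal{F}$; $\delta_{\mathrm{CR}}(T,T')$ is the smallest $N\in\mathbb{N}_0$ such that there are $T_0=T,\dots,T_N=T'$ in $\mathcal{T}$ with consecutive ones being face neighbors. A positive function $\rho\in L^1(\Omega)$ is a weight with grading $\gamma_\rho\ge1$ if for all $T,T'\in\mathcal{T}$: $\operatorname{ess\,sup}_T\rho\le\gamma_\rho\operatorname{ess\,inf}_T\rho$; and if $\delta_{\mathrm{CR}}(T,T')=1$, then $\operatorname{ess\,sup}_{T'}\rho\le\gamma_\rho\operatorname{ess\,sup}_T\rho$ and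 $\operatorname{ess\,inf}_{T'}\rho\le\gamma_\rho\operatorname{ess\,inf}_T\rho$. BiSec-MT (bisection of Maubach and Traxler, in Stevenson's notation). A tagged simplex $T=(x_0,\dots,x_d)_\gamma$ is a $d$-simplex with ordered vertices and type $\gamma\in\{0,\dots,d-1\}$. Its refinement edge is $x_0x_d$ and its children, obtained by bisection at $\bar x=\frac{x_0+x_d}2$, are $(x_0,\bar x,x_1,\dots,x_\gamma,x_{\gamma+1},\dots,x_{d-1})_{(\gamma+1)\bmod d}$ and $(x_d,\bar x,x_1,\dots,x_\gamma,x_{d-1},\dots,x_{\gamma+1})_{(\gamma+1)\bmod d}$. Put $T_R=(x_d,x_1,\dots,x_\gamma,x_{d-1},\dots,x_{\gamma+1},x_0)_\gamma$. Two tagged simplices $T,T'$ are reflected neighbors if they share a $(d-1)$-face, have the same type, and the ordered vertex sequence of $T$ or of $T_R$ coincides with that of $T'$ in all but one position. Matching neighbor condition: $\mathcal{T}_0$ is a conforming triangulation of $\Omega$ into tagged simplices of the same type such that for any $T,T'\in\mathcal{T}_0$ sharing a $(d-1)$-face: if the refinement edge of $T$ or $T'$ is contained in $T\cap T'$, then $T,T'$ are reflected neighbors; otherwise the pair of neighboring children of $T$ and $T'$ are reflected neighbors. A mesh resulting from successive application of BiSec-MT to $\mathcal{T}_0$ is obtained by repeatedly marking simplices, bisecting them, and taking the smallest conforming refinement (by further bisections); such meshes are conforming. *)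

theory Defs
  imports "HOL-Analysis.Analysis" "HOL-Probability.Essential_Supremum"
begin

section \<open>Lebesgue spaces on a set\<close>

text \<open>The exponent \<open>p\<close> ranges over \<open>ennreal\<close>, so that \<open>p = \<infinity>\<close> is included. Functions are total;
  only their values almost everywhere on \<open>\<Omega>\<close> matter.\<close>

definition Lp_norm :: "ennreal \<Rightarrow> 'a::euclidean_space set \<Rightarrow> ('a \<Rightarrow> real) \<Rightarrow> ennreal" where
  "Lp_norm p \<Omega> f =
     (if p = \<infinity> then esssup (lebesgue_on \<Omega>) (\<lambda>x. ennreal \<bar>f x\<bar>)
      else let I = (\<integral>\<^sup>+ x. ennreal (\<bar>f x\<bar> powr enn2real p) \<partial>lebesgue_on \<Omega>)
           in if I = \<infinity> then \<infinity> else ennreal (enn2real I powr (1 / enn2real p)))"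

definition Lp_space :: "ennreal \<Rightarrow> 'a::euclidean_space set \<Rightarrow> ('a \<Rightarrow> real) set" where
  "Lp_space p \<Omega> = {f. f \<in> borel_measurable (lebesgue_on \<Omega>) \<and> Lp_norm p \<Omega> f < \<infinity>}"

definition L2_pairing :: "'a::euclidean_space set \<Rightarrow> ('a \<Rightarrow> real) \<Rightarrow> ('a \<Rightarrow> real) \<Rightarrow> real" where
  "L2_pairing \<Omega> u v = (LINT x|lebesgue_on \<Omega>. u x * v x)"

definition ess_sup_on :: "'a::euclidean_space set \<Rightarrow> ('a \<Rightarrow> real) \<Rightarrow> ereal" where
  "ess_sup_on S f = esssup (lebesgue_on S) (\<lambda>x. ereal (f x))"

definition ess_inf_on :: "'a::euclidean_space set \<Rightarrow> ('a \<Rightarrow> real) \<Rightarrow> ereal" where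
  "ess_inf_on S f = - esssup (lebesgue_on S) (\<lambda>x. - ereal (f x))"


section \<open>Polyhedral domains and conforming triangulations\<close>

definition polyhedral_domain :: "(real^'n) set \<Rightarrow> bool" where
  "polyhedral_domain \<Omega> \<longleftrightarrow>
     \<Omega> \<noteq> {} \<and> open \<Omega> \<and> connected \<Omega> \<and> bounded \<Omega> \<and>
     (\<exists>\<P>. finite \<P> \<and> (\<forall>P\<in>\<P>. polytope P) \<and> frontier \<Omega> = \<Union>\<P>)"

text \<open>The library notion \<^const>\<open>triangulation\<close> already demands finiteness and that any two simplices
  meet in a (possibly empty) common face.\<close>

definition triangulation_of :: "(real^'n) set \<Rightarrow> (real^'n) set set \<Rightarrow> bool" where
  "triangulation_of \<Omega> \<T> \<longleftrightarrow>
     triangulation \<T> \<and> (\<forall>T\<in>\<T>. int CARD('n) simplex T) \<and> \<Union>\<T> = closure \<Omega>"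

definition faces :: "(real^'n) set set \<Rightarrow> (real^'n) set set" where
  "faces \<T> = {f. \<exists>T\<in>\<T>. f facet_of T}"

definition share_facet :: "(real^'n) set \<Rightarrow> (real^'n) set \<Rightarrow> bool" where
  "share_facet T T' \<longleftrightarrow> T \<noteq> T' \<and> (\<exists>f. f facet_of T \<and> f facet_of T')"

definition mid :: "(real^'n) set \<Rightarrow> real^'n" where
  "mid f = (\<Sum>x | x extreme_point_of f. x) /\<^sub>R real (card {x. x extreme_point_of f})"

definition delta_CR :: "(real^'n) set set \<Rightarrow> (real^'n) set \<Rightarrow> (real^'n) set \<Rightarrow> nat" where
  "delta_CR \<T> T T' =
     (LEAST N. \<exists>S :: nat \<Rightarrow> (real^'n) set. S 0 = T \<and> S N = T' \<and>
        (\<forall>i\<le>N. S i \<in> \<T>) \<and> (\<forall>i<N. share_facet (S i) (S (Suc i))))"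

definition weight_with_grading ::
    "(real^'n) set \<Rightarrow> (real^'n) set set \<Rightarrow> real \<Rightarrow> (real^'n \<Rightarrow> real) \<Rightarrow> bool" where
  "weight_with_grading \<Omega> \<T> \<gamma> \<rho> \<longleftrightarrow>
     1 \<le> \<gamma> \<and> integrable (lebesgue_on \<Omega>) \<rho> \<and> (AE x in lebesgue_on \<Omega>. 0 < \<rho> x) \<and>
     (\<forall>T\<in>\<T>. ess_sup_on T \<rho> \<le> ereal \<gamma> * ess_inf_on T \<rho>) \<and>
     (\<forall>T\<in>\<T>. \<forall>T'\<in>\<T>. delta_CR \<T> T T' = 1 \<longrightarrow>
        ess_sup_on T' \<rho> \<le> ereal \<gamma> * ess_sup_on T \<rho> \<and>
        ess_inf_on T' \<rho> \<le> ereal \<gamma> * ess_inf_on T \<rho>)"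


section \<open>The Crouzeix--Raviart space and its \<open>L\<^sup>2\<close>-projection\<close>

text \<open>Elements of \<open>L\<^sup>\<infinity>(\<Omega>)\<close> are classes modulo null sets, so the pointwise requirements are imposed
  on a representative \<open>w\<close>. It is affine in the interior of each simplex only: its values on the faces,
  a null set, are free, since two neighbouring simplices generally induce different values there.
  Continuity at the barycenter of an inner face says that the traces from both sides agree at this
  point; at the barycenter of a boundary face it is no restriction.\<close>

definition CR_space :: "(real^'n) set \<Rightarrow> (real^'n) set set \<Rightarrow> (real^'n \<Rightarrow> real) set" where
  "CR_space \<Omega> \<T> = {v \<in> Lp_space \<infinity> \<Omega>. \<exists>w.
      (AE x in lebesgue_on \<Omega>. v x = w x) \<and>
      (\<forall>T\<in>\<T>. \<exists>a b. \<forall>x\<in>interior T. w x = a \<bullet> x + b) \<and>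
      (\<forall>f\<in>faces \<T>. continuous (at (mid f) within closure \<Omega>) w)}"

text \<open>The projection is determined up to null sets; one representative is chosen.\<close>

definition Q_CR :: "(real^'n) set \<Rightarrow> (real^'n) set set \<Rightarrow> (real^'n \<Rightarrow> real) \<Rightarrow> real^'n \<Rightarrow> real" where
  "Q_CR \<Omega> \<T> u = (SOME w. w \<in> CR_space \<Omega> \<T> \<and>
      (\<forall>v\<in>CR_space \<Omega> \<T>. L2_pairing \<Omega> w v = L2_pairing \<Omega> u v))"

definition CR_threshold :: "nat \<Rightarrow> ereal" where
  "CR_threshold d =
     (if d = 2 then \<infinity> else ereal ((real d + sqrt (real d + 2)) / (real d - sqrt (real d + 2))))"


section \<open>Bisection of tagged simplices\<close>

text \<open>A tagged simplex \<open>(x\<^sub>0, \<dots>, x\<^sub>d)\<^sub>\<gamma>\<close> is the pair of its vertex list and its type. In the list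
  functions below, \<open>butlast (tl xs)\<close> is \<open>[x\<^sub>1, \<dots>, x\<^bsub>d-1\<^esub>]\<close>, so that \<open>take \<gamma>\<close> and \<open>drop \<gamma>\<close> of it are
  \<open>[x\<^sub>1, \<dots>, x\<^sub>\<gamma>]\<close> and \<open>[x\<^bsub>\<gamma>+1\<^esub>, \<dots>, x\<^bsub>d-1\<^esub>]\<close>.\<close>

type_synonym 'n tagged_simplex = "(real^'n) list \<times> nat"

definition is_tagged_simplex :: "'n::finite tagged_simplex \<Rightarrow> bool" where
  "is_tagged_simplex = (\<lambda>(xs, \<gamma>). length xs = CARD('n) + 1 \<and> distinct xs \<and>
      \<not> affine_dependent (set xs) \<and> \<gamma> < CARD('n))"

definition simplex_of :: "'n::finite tagged_simplex \<Rightarrow> (real^'n) set" where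
  "simplex_of T = convex hull (set (fst T))"

definition refinement_edge :: "'n::finite tagged_simplex \<Rightarrow> (real^'n) set" where
  "refinement_edge T = closed_segment (hd (fst T)) (last (fst T))"

definition children :: "'n::finite tagged_simplex \<Rightarrow> 'n tagged_simplex set" where
  "children = (\<lambda>(xs, \<gamma>).
     let x0 = hd xs; xd = last xs; xm = midpoint x0 xd; ys = butlast (tl xs);
         \<gamma>' = (\<gamma> + 1) mod CARD('n)
     in {(x0 # xm # take \<gamma> ys @ drop \<gamma> ys, \<gamma>'),
         (xd # xm # take \<gamma> ys @ rev (drop \<gamma> ys), \<gamma>')})"

definition reflected :: "'n::finite tagged_simplex \<Rightarrow> 'n tagged_simplex" where
  "reflected = (\<lambda>(xs, \<gamma>).
     let ys = butlast (tl xs)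
     in (last xs # take \<gamma> ys @ rev (drop \<gamma> ys) @ [hd xs], \<gamma>))"

definition agree_but_one :: "'a list \<Rightarrow> 'a list \<Rightarrow> bool" where
  "agree_but_one xs ys \<longleftrightarrow> length xs = length ys \<and> card {i. i < length xs \<and> xs ! i \<noteq> ys ! i} = 1"

definition reflected_neighbors :: "'n::finite tagged_simplex \<Rightarrow> 'n tagged_simplex \<Rightarrow> bool" where
  "reflected_neighbors T T' \<longleftrightarrow>
     share_facet (simplex_of T) (simplex_of T') \<and> snd T = snd T' \<and>
     (agree_but_one (fst T) (fst T') \<or> agree_but_one (fst (reflected T)) (fst T'))"

text \<open>If two neighbours both have their refinement edge outside the common facet, then this facet
  is a facet of exactly one child on each side, so there is exactly one pair of neighbouring
  children.\<close>

definition matching_neighbor_condition ::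
    "(real^'n) set \<Rightarrow> 'n::finite tagged_simplex set \<Rightarrow> bool" where
  "matching_neighbor_condition \<Omega> \<T>\<^sub>0 \<longleftrightarrow>
     (\<forall>T\<in>\<T>\<^sub>0. is_tagged_simplex T) \<and>
     inj_on simplex_of \<T>\<^sub>0 \<and> triangulation_of \<Omega> (simplex_of ` \<T>\<^sub>0) \<and>
     (\<forall>T\<in>\<T>\<^sub>0. \<forall>T'\<in>\<T>\<^sub>0. snd T = snd T') \<and>
     (\<forall>T\<in>\<T>\<^sub>0. \<forall>T'\<in>\<T>\<^sub>0. share_facet (simplex_of T) (simplex_of T') \<longrightarrow>
        (if refinement_edge T \<subseteq> simplex_of T \<inter> simplex_of T' \<or>
            refinement_edge T' \<subseteq> simplex_of T \<inter> simplex_of T'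
         then reflected_neighbors T T'
         else \<forall>C\<in>children T. \<forall>C'\<in>children T'.
                share_facet (simplex_of C) (simplex_of C') \<longrightarrow> reflected_neighbors C C'))"

definition bisect :: "'n::finite tagged_simplex set \<Rightarrow> 'n tagged_simplex set \<Rightarrow> 'n tagged_simplex set" where
  "bisect \<M> \<P> = (\<P> - \<M>) \<union> (\<Union>T\<in>\<M>. children T)"

definition bisection_refinement ::
    "'n::finite tagged_simplex set \<Rightarrow> 'n tagged_simplex set \<Rightarrow> bool" where
  "bisection_refinement = (\<lambda>\<P> \<P>'. \<exists>T\<in>\<P>. \<P>' = bisect {T} \<P>)\<^sup>*\<^sup>*"

text \<open>One loop of the algorithm bisects a set \<open>\<M>\<close> of marked simplices and passes to the smallest
  conforming refinement.\<close>

definition smallest_conforming_refinement ::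
    "(real^'n) set \<Rightarrow> 'n::finite tagged_simplex set \<Rightarrow> 'n tagged_simplex set \<Rightarrow> bool" where
  "smallest_conforming_refinement \<Omega> \<P> \<P>' \<longleftrightarrow>
     bisection_refinement \<P> \<P>' \<and> triangulation_of \<Omega> (simplex_of ` \<P>') \<and>
     (\<forall>\<P>''. bisection_refinement \<P> \<P>'' \<and> triangulation_of \<Omega> (simplex_of ` \<P>'')
        \<longrightarrow> bisection_refinement \<P>' \<P>'')"

inductive_set BiSec_MT_meshes ::
    "(real^'n) set \<Rightarrow> 'n::finite tagged_simplex set \<Rightarrow> 'n tagged_simplex set set"
  for \<Omega> :: "(real^'n) set" and \<T>\<^sub>0 :: "'n tagged_simplex set" where
  initial: "\<T>\<^sub>0 \<in> BiSec_MT_meshes \<Omega> \<T>\<^sub>0"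
| refine: "\<P> \<in> BiSec_MT_meshes \<Omega> \<T>\<^sub>0 \<Longrightarrow> \<M> \<subseteq> \<P> \<Longrightarrow>
    smallest_conforming_refinement \<Omega> (bisect \<M> \<P>) \<P>' \<Longrightarrow> \<P>' \<in> BiSec_MT_meshes \<Omega> \<T>\<^sub>0"

end

theory Submission
  imports Defs
begin

text \<open>In terms of the values \<open>x\<^sub>f\<close> at the centers of the faces, the mass matrix of a simplex \<open>T\<close> is
  \<open>|T| / ((d+1)(d+2)) (d\<^sup>2 I - (d-2) E)\<close> with the matrix \<open>E\<close> of ones. Testing the equation for
  the projection with \<open>w\<^sub>f x\<^sub>f\<close>, where \<open>w\<^sub>f\<close> is the product of the weights of the two simplices
  at \<open>f\<close>, yields a weighted \<open>L\<^sup>2\<close> bound for all weights whose ratio \<open>q\<close> between neighbours satisfies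
  \<open>(d-2)(d+1)(q+2+1/q) \<le> 4d\<^sup>2\<close>; equality is the threshold of the theorem. To keep the constant
  uniform in \<open>p\<close> up to the threshold one needs slightly more: the ratio may exceed \<open>q\<close> between a simplex
  and a larger neighbour, of the previous generation. This is paid for by moving a small part of the mass of
  each face from the larger to the smaller simplex.

  For \<open>p \<noteq> 2\<close>, powers of the discrete function (or of the data) are absorbed into the weight. They are not graded, but
  are dominated by a graded majorant, a sum over all simplices with a kernel that decays geometrically
  in the number of steps of a chain of neighbours. The majorant is bounded because the simplices reached
  by \<open>u\<close> steps to larger neighbours and \<open>v\<close> others fill at most \<open>C (u+v+1)\<^sup>d 2\<^sup>u\<close> times the volume of
  the first one. This uses shape regularity and that generations of neighbours differ by at most one,
  both consequences of the bisection rule: descendants of the same generation with a common facet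
  again satisfy the matching condition. The case \<open>p = \<infinity>\<close> is the limit of the others.\<close>

section \<open>Weighted stability on abstract meshes\<close>

text \<open>The threshold has two sources. On one simplex, Cauchy-Schwarz bounds the negative term
  of the mass matrix by the sum of \<tau> + 2 + 1/\<tau> over the faces, \<tau> being the
  neighbour's weight divided by the own one; each term is at most 2 + q + 1/q, whence the condition
  on \<open>q\<close>. The factor 2^|1/2-1/p| comes from volumes: a step to a larger neighbour may
  double the volume, so a majorant H is summable only if its decay \<open>a\<close> per such step
  satisfies 2a < 1. With H^s in the weight, s = |1/2-1/p|, and \<gamma> used up by \<rho>, a grading
  bound Q allows a = (\<gamma>/Q)^(1/s), and then 2a \<le> (q/Q)^(1/s). This is below 1 only if Q >
  q, whereas the local condition leaves no room beyond q. Both can be had because \<open>Q\<close>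
  is needed only for growth towards smaller simplices: a simplex with at least as many larger as
  smaller neighbours gains from the mass shift, any other one gains from unequal factors in
  Cauchy-Schwarz. All constants are fixed before p, and the estimates carry M^p, as the limit to p =
  \<infinity> requires.\<close>

lemma add_recip_mono:
  fixes s r :: real assumes "1 \<le> s" "s \<le> r" shows "s + 1/s \<le> r + 1/r"
proof -
  have "(r + 1/r) - (s + 1/s) = (r - s) * (1 - 1/(r * s))"
    using assms by (simp add: field_simps)
  moreover have "1/(r * s) \<le> 1" using assms mult_mono[of 1 r 1 s] by (simp add: divide_simps)
  ultimately show ?thesis using assms by (smt (verit) mult_nonneg_nonneg)
qed

text \<open>The expression increases on [1, \<infinity>) and is invariant under s -> 1/s, so only
  the end points of the range of a weight ratio matter.\<close>

lemma add_recip_le: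
  fixes s l r B :: real
  assumes "0 < l" "l \<le> s" "s \<le> r" "l + 1/l \<le> B" "r + 1/r \<le> B"
  shows "s + 1/s \<le> B"
proof (cases "1 \<le> s")
  case True then show ?thesis using add_recip_mono[of s r] assms by linarith
next
  case False
  then have "1 \<le> 1/s" "1/s \<le> 1/l" using assms by (auto simp: divide_simps)
  then have "1/s + 1/(1/s) \<le> 1/l + 1/(1/l)" by (rule add_recip_mono)
  then show ?thesis using assms by simp
qed

text \<open>The share of a face in the mass of a simplex, after moving mass from the larger to the smaller
  neighbour; \<open>l\<close> is the generation of the simplex minus that of its neighbour.\<close>

definition mass_share :: "real \<Rightarrow> int \<Rightarrow> real" where
  "mass_share e l = (if 0 < l then 1 + 2*e else if l < 0 then 1 - e else 1)"

section \<open>The local inequality on one simplex, with slack\<close>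

lemma sum_by_sign:
  fixes lab :: "'f \<Rightarrow> int" and a b c :: real
  assumes "finite A"
  shows "(\<Sum>f\<in>A. if 0 < lab f then a else if lab f < 0 then b else c)
     = real (card {f\<in>A. 0 < lab f}) * a + real (card {f\<in>A. lab f < 0}) * b
       + real (card {f\<in>A. lab f = 0}) * c"
    "card A = card {f\<in>A. 0 < lab f} + card {f\<in>A. lab f < 0} + card {f\<in>A. lab f = 0}"
proof -
  have A: "A = {f\<in>A. 0 < lab f} \<union> ({f\<in>A. lab f < 0} \<union> {f\<in>A. lab f = 0})" (is "_ = ?U \<union> (?W \<union> ?Z)") by auto
  have fin: "finite ?U" "finite ?W" "finite ?Z" using assms by auto
  have "sum h A = sum h ?U + sum h ?W + sum h ?Z" for h :: "'f \<Rightarrow> real"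
    by (subst A, subst sum.union_disjoint; (subst sum.union_disjoint)?) (use fin in \<open>auto simp: add.assoc\<close>)
  from this[of "\<lambda>f. if 0 < lab f then a else if lab f < 0 then b else c"]
  show "(\<Sum>f\<in>A. if 0 < lab f then a else if lab f < 0 then b else c)
     = real (card {f\<in>A. 0 < lab f}) * a + real (card {f\<in>A. lab f < 0}) * b
       + real (card {f\<in>A. lab f = 0}) * c"
    by simp
  show "card A = card ?U + card ?W + card ?Z"
    by (subst A, subst card_Un_disjoint; (subst card_Un_disjoint)?) (use fin in auto)
qed

text \<open>Here \<open>u\<close> counts faces to larger and \<open>w\<close> faces to smaller
  neighbours. The first order terms in e are -2u + w, at most -(u+w)/2 since w \<le> u; for e \<le>
  1/16 half of this survives the quadratic terms. That a gain is twice a loss makes even the case u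
  = w profitable.\<close>

lemma mass_shift_balance:
  fixes u w e :: real assumes "w \<le> u" "0 \<le> w" "0 < e" "e \<le> 1/16"
  shows "u/(1+2*e) + w/(1-e) \<le> (u+w)*(1 - e/4)"
proof -
  have "1/(1+2*e) \<le> 1 - 2*e + 4*e^2" "1/(1-e) \<le> 1 + e + 2*e^2"
    using assms by (auto simp: divide_simps power2_eq_square power3_eq_cube algebra_simps)
  then have "u*(1/(1+2*e)) + w*(1/(1-e)) \<le> u*(1 - 2*e + 4*e^2) + w*(1 + e + 2*e^2)"
    using assms by (intro add_mono mult_left_mono) auto
  also have "\<dots> = (u+w)*(1-e/4) + e*(-(7/4)*u + (5/4)*w + 4*(e*u) + 2*(e*w))"
    by (simp add: field_simps power2_eq_square)
  also have "\<dots> \<le> (u+w)*(1-e/4)"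
  proof -
    have "e*u \<le> u/16" "e*w \<le> w/16"
      using assms mult_right_mono[of e "1/16" u] mult_right_mono[of e "1/16" w] by auto
    then have "-(7/4)*u + (5/4)*w + 4*(e*u) + 2*(e*w) \<le> 0" using assms by linarith
    then show ?thesis using assms by (simp add: mult_nonneg_nonpos)
  qed
  finally show ?thesis by simp
qed

text \<open>\<open>\<tau> f\<close> is meant as the weight of the neighbour at \<open>f\<close>
  divided by the own weight. Only the ratio of a smaller simplex to a larger neighbour may reach
  \<open>Q\<close>; every other ratio is bounded by \<open>g\<close>, which will be below
  \<open>q\<close>.\<close>

definition labels_ok :: "real \<Rightarrow> real \<Rightarrow> 'f set \<Rightarrow> ('f \<Rightarrow> int) \<Rightarrow> ('f \<Rightarrow> real) \<Rightarrow> bool" where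
  "labels_ok g Q A lab \<tau> \<longleftrightarrow> (\<forall>f\<in>A. 0 < \<tau> f \<and>
     (0 < lab f \<longrightarrow> 1/Q \<le> \<tau> f \<and> \<tau> f \<le> g) \<and>
     (lab f < 0 \<longrightarrow> 1/g \<le> \<tau> f \<and> \<tau> f \<le> Q) \<and>
     (lab f = 0 \<longrightarrow> 1/g \<le> \<tau> f \<and> \<tau> f \<le> g))"

text \<open>With at least as many larger as smaller neighbours the mass shift alone suffices. Its
  relative gain is at least x/4 on the faces between different generations, and the excess of
  \<open>Q\<close> over \<open>q\<close> consumes at most half of it; faces between equal
  generations have slack because g < q.\<close>

lemma slack_balanced:
  fixes g q Q e x :: real
  assumes "1 \<le> g" "g < q" "q < Q" "0 < x" "x \<le> e" "e \<le> 1/16" "Q - q \<le> x/8*(2+q+1/q)"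
    and "finite A" "card A = n" "1 \<le> n" "labels_ok g Q A lab \<tau>"
    and "card {f\<in>A. lab f < 0} \<le> card {f\<in>A. 0 < lab f}"
  shows "(\<Sum>f\<in>A. (\<tau> f + 2 + 1/\<tau> f)/mass_share e (lab f))
     \<le> n*(2+q+1/q) - min (x/8*(2+q+1/q)) (q+1/q-(g+1/g))"
proof -
  define u w z where "u = real (card {f\<in>A. 0 < lab f})" and "w = real (card {f\<in>A. lab f < 0})"
    and "z = real (card {f\<in>A. lab f = 0})"
  have n: "real n = u + w + z" using sum_by_sign(2)[OF assms(8), of lab] assms(9)
    by (simp add: u_def w_def z_def)
  have pos: "0 \<le> u" "0 \<le> w" "0 \<le> z" "w \<le> u" using assms(12) by (auto simp: u_def w_def z_def)
  define m m' mQ where "m = q + 1/q" and "m' = g + 1/g" and "mQ = Q + 1/Q"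
  have m'm: "m' < m"
  proof -
    have "(q + 1/q) - (g + 1/g) = (q - g) * (1 - 1/(q*g))" using assms by (simp add: field_simps)
    moreover have "1/(q*g) < 1" using assms mult_strict_mono[of 1 q 1 g] mult_less_le_imp_less[of 1 q 1 g] 
      by (simp add: divide_simps)
    ultimately show ?thesis using assms unfolding m_def m'_def
      by (metis diff_gt_0_iff_gt mult_pos_pos)
  qed
  have mQ: "mQ \<le> m + (Q - q)" "m \<le> mQ"
  proof -
    have "1/Q \<le> 1/q" using assms by (simp add: frac_le)
    then show "mQ \<le> m + (Q - q)" by (simp add: m_def mQ_def)
    show "m \<le> mQ" unfolding m_def mQ_def using assms by (intro add_recip_mono) auto
  qed
  have "(\<Sum>f\<in>A. (\<tau> f + 2 + 1/\<tau> f)/mass_share e (lab f))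
     \<le> (\<Sum>f\<in>A. if 0 < lab f then (2+mQ)/(1+2*e) else if lab f < 0 then (2+mQ)/(1-e) else 2+m')"
  proof (rule sum_mono)
    fix f assume f: "f \<in> A"
    have L: "0 < \<tau> f" "0 < lab f \<longrightarrow> 1/Q \<le> \<tau> f \<and> \<tau> f \<le> g" "lab f < 0 \<longrightarrow> 1/g \<le> \<tau> f \<and> \<tau> f \<le> Q"
     "lab f = 0 \<longrightarrow> 1/g \<le> \<tau> f \<and> \<tau> f \<le> g" using assms(11) f unfolding labels_ok_def by auto
    have Q: "0 < 1/Q" "0 < 1/g" "m' \<le> mQ" "1/Q + 1/(1/Q) = mQ" "1/g + 1/(1/g) = m'" "Q + 1/Q = mQ" "g + 1/g = m'"
      using assms(1-3) m'm mQ by (auto simp: mQ_def m'_def)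
    have 1: "0 < lab f \<Longrightarrow> \<tau> f + 1/\<tau> f \<le> mQ"
      by (rule add_recip_le[of "1/Q" _ g]) (use L(2) Q in linarith)+
    have 2: "lab f < 0 \<Longrightarrow> \<tau> f + 1/\<tau> f \<le> mQ"
      by (rule add_recip_le[of "1/g" _ Q]) (use L(3) Q in linarith)+
    have 3: "lab f = 0 \<Longrightarrow> \<tau> f + 1/\<tau> f \<le> m'"
      by (rule add_recip_le[of "1/g" _ g]) (use L(4) Q in linarith)+
    show "(\<tau> f + 2 + 1/\<tau> f)/mass_share e (lab f) \<le> (if 0 < lab f then (2+mQ)/(1+2*e) else if lab f < 0 then (2+mQ)/(1-e) else 2+m')"
      using 1 2 3 assms(4-6) by (auto simp: mass_share_def intro!: divide_right_mono)
  qed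
  also have "\<dots> = (2+mQ)*(u/(1+2*e) + w/(1-e)) + z*(2+m')"
    unfolding sum_by_sign(1)[OF assms(8)] by (simp add: u_def w_def z_def algebra_simps add_divide_distrib)
  also have "\<dots> \<le> (2+mQ)*((u+w)*(1-e/4)) + z*(2+m')"
  proof -
    have "0 \<le> 2 + mQ" using assms by (simp add: mQ_def)
    then show ?thesis
    using mass_shift_balance[of w u e] pos assms by (intro add_right_mono mult_left_mono) auto
  qed
  also have "\<dots> \<le> (2+m+x/8*(2+m))*((u+w)*(1-x/4)) + z*(2+m')"
  proof -
    have "2+mQ \<le> 2+m+x/8*(2+m)" 
    proof -
      have "x/8*(2+q+1/q) = x/8*(2+m)" by (simp add: m_def add.assoc)
      then show ?thesis using mQ(1) assms(7) by linarith
    qed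
    moreover have "0 \<le> 2 + m" using assms(1,2) by (simp add: m_def)
    ultimately show ?thesis
      using assms(4-6) pos by (intro add_right_mono mult_mono) auto
  qed
  also have "\<dots> \<le> (u+w)*((2+m) - x/8*(2+m)) + z*(2+m')"
  proof -
    have "(2+m+x/8*(2+m))*(1-x/4) = (2+m) - x/8*(2+m) - x^2/32*(2+m)"
      by (simp add: field_simps power2_eq_square)
    moreover have "0 \<le> x^2/32*(2+m)" using assms by (simp add: m_def)
    ultimately have "(2+m+x/8*(2+m))*(1-x/4) \<le> (2+m) - x/8*(2+m)" by linarith
    then have "(u+w)*((2+m+x/8*(2+m))*(1-x/4)) \<le> (u+w)*((2+m) - x/8*(2+m))"
      using pos by (intro mult_left_mono) auto
    then have "(2+m+x/8*(2+m))*((u+w)*(1-x/4)) \<le> (u+w)*((2+m) - x/8*(2+m))"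
      unfolding mult.left_commute[of "2+m+x/8*(2+m)" "u+w" "1-x/4"] .
    then show ?thesis by (rule add_right_mono)
  qed
  also have "\<dots> \<le> (u+w)*((2+m) - min (x/8*(2+m)) (m-m')) + z*((2+m) - min (x/8*(2+m)) (m-m'))"
    using pos by (intro add_mono mult_left_mono) linarith+
  also have "\<dots> = n*(2+m) - n * min (x/8*(2+m)) (m-m')" by (simp add: n algebra_simps)
  also have "\<dots> \<le> n*(2+m) - 1 * min (x/8*(2+m)) (m-m')"
    using assms m'm by (intro diff_left_mono mult_right_mono) (auto simp: m_def)
  finally show ?thesis by (simp add: m_def m'_def add.assoc)
qed

text \<open>With more smaller than larger neighbours the mass shift costs something, and the gain
  comes from the factor 1+\<theta> in Cauchy-Schwarz. Dividing all ratios by it lowers the terms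
  near q and raises those near 1/q by about \<theta>\<beta> each, where \<beta> = q - 1/q is the
  derivative of s + 1/s with respect to log s at q. Smaller neighbours are in the majority, so a
  multiple of \<theta>\<beta> remains; \<open>e\<close> and \<open>Q - q\<close> are small compared
  with it.\<close>

lemma slack_tilted:
  fixes g q Q e \<theta> :: real
  defines "m \<equiv> q + 1/q" and "m' \<equiv> g + 1/g" and "\<beta> \<equiv> q - 1/q"
  assumes "1 \<le> g" "g < q" "q \<le> Q" "Q \<le> q + 1" "0 \<le> e" "e \<le> 1/16"
    and \<theta>: "0 < \<theta>" "\<theta> \<le> 1" "\<theta> * (4 * (n*m)) \<le> \<beta>" "(1+\<theta>)*m' \<le> m - q*\<theta>" "q*\<theta> \<le> \<beta>/2"
    and small: "2*e*(n*(q+6)) \<le> \<theta>*\<beta>/16" "2*(n*(Q-q)) \<le> \<theta>*\<beta>/16"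
    and "finite A" "card A = n" "labels_ok g Q A lab \<tau>"
    and "card {f\<in>A. 0 < lab f} < card {f\<in>A. lab f < 0}"
  shows "(\<Sum>f\<in>A. (\<tau> f/(1+\<theta>) + 2 + (1+\<theta>)/\<tau> f)/mass_share e (lab f)) \<le> n*(2+m) - \<theta>*\<beta>/8"
proof -
  define u w z where "u = real (card {f\<in>A. 0 < lab f})" and "w = real (card {f\<in>A. lab f < 0})"
    and "z = real (card {f\<in>A. lab f = 0})"
  have n: "real n = u + w + z" using sum_by_sign(2)[OF \<open>finite A\<close>, of lab] \<open>card A = n\<close>
    by (simp add: u_def w_def z_def)
  have pos: "0 \<le> u" "0 \<le> w" "0 \<le> z" "u + 1 \<le> w" using assms(20) by (auto simp: u_def w_def z_def)
  define \<kappa> where "\<kappa> = 1 + \<theta>"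
  have \<kappa>: "1 < \<kappa>" "\<kappa> \<le> 2" using \<theta> by (auto simp: \<kappa>_def)
  have q: "1 < q" "0 < g" "0 < Q" using assms by auto
  define U D where "U = q*\<kappa> + 1/(q*\<kappa>)" and "D = q/\<kappa> + \<kappa>/q"
  define UQ DQ where "UQ = Q*\<kappa> + 1/(Q*\<kappa>)" and "DQ = Q/\<kappa> + \<kappa>/Q"
  have ik: "1/\<kappa> \<le> 1" "1 - \<theta> \<le> 1/\<kappa>"
    using \<kappa> \<theta> by (auto simp: \<kappa>_def divide_simps algebra_simps)
  have qk1: "\<beta>/2 \<le> q/\<kappa> - 1/q"
  proof -
    have "q*(1-\<theta>) \<le> q*(1/\<kappa>)" using ik q by (intro mult_left_mono) auto
    then have "q - \<beta>/2 \<le> q/\<kappa>" using \<theta>(5) by (simp add: algebra_simps)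
    moreover have "\<beta> = q - 1/q" by (simp add: \<beta>_def)
    ultimately show ?thesis by linarith
  qed
  have mD: "m - D = \<theta>*(q/\<kappa> - 1/q)"
  proof -
    have "m - D = (\<kappa>-1)*(q/\<kappa> - 1/q)" using \<kappa> q by (simp add: m_def D_def field_simps)
    then show ?thesis by (simp add: \<kappa>_def)
  qed
  \<comment> \<open>The first order changes of \<open>U\<close> and \<open>D\<close> cancel, so at
    order \<theta> only the surplus of smaller neighbours contributes.\<close>
  have UD: "U + D - 2*m \<le> m*\<theta>^2"
  proof -
    have "U + D - 2*m = m*(\<kappa> + 1/\<kappa> - 2)" using \<kappa> q by (simp add: U_def D_def m_def field_simps)
    also have "\<kappa> + 1/\<kappa> - 2 = \<theta>^2/\<kappa>" using \<kappa> by (simp add: \<kappa>_def field_simps power2_eq_square)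
    also have "\<dots> \<le> \<theta>^2" using \<kappa> mult_left_mono[of 1 \<kappa> "\<theta>^2"] by (simp add: divide_le_eq)
    finally show ?thesis using q by (simp add: m_def mult_left_mono)
  qed
  have main: "u*(2+U) + w*(2+D) \<le> (u+w)*(2+m) - \<theta>*\<beta>/4"
  proof -
    have D: "\<theta>*(\<beta>/2) \<le> m - D" unfolding mD using qk1 \<theta> by (intro mult_left_mono) auto
    have "0 \<le> \<beta>" using \<theta>(5) mult_pos_pos[of q \<theta>] q \<theta>(1) by linarith
    then have D0: "0 \<le> m - D" using D mult_nonneg_nonneg[of \<theta> "\<beta>/2"] \<theta>(1) \<open>0 \<le> \<beta>\<close> by linarith
    have "u*(U - m) - w*(m - D) = u*(U + D - 2*m) - (w-u)*(m-D)" by (simp add: algebra_simps)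
    also have "\<dots> \<le> n*(m*\<theta>^2) - 1*(m-D)"
    proof (intro diff_mono)
      have "u*(U + D - 2*m) \<le> u*(m*\<theta>^2)" using pos UD by (intro mult_left_mono) auto
      also have "\<dots> \<le> n*(m*\<theta>^2)" using pos n q by (intro mult_right_mono) (auto simp: m_def)
      finally show "u*(U + D - 2*m) \<le> n*(m*\<theta>^2)" .
      show "1*(m-D) \<le> (w-u)*(m-D)" using pos D0 by (intro mult_right_mono) auto
    qed
    also have "n*(m*\<theta>^2) = \<theta>*(\<theta>*(4*(n*m)))/4" by (simp add: power2_eq_square)
    also have "\<dots> \<le> \<theta>*\<beta>/4" using \<theta> by (intro divide_right_mono mult_left_mono) auto
    finally show ?thesis using D by (simp add: algebra_simps)
  qed
  have UQ: "UQ \<le> U + 2*(Q-q)"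
  proof -
    have "1/(Q*\<kappa>) \<le> 1/(q*\<kappa>)" using \<kappa> q assms(6) by (intro divide_left_mono mult_right_mono) auto
    moreover have "(Q-q)*\<kappa> \<le> (Q-q)*2" using \<kappa> assms(6) by (intro mult_left_mono) auto
    ultimately show ?thesis by (simp add: UQ_def U_def algebra_simps)
  qed
  have DQ: "DQ \<le> D + 2*(Q-q)" "DQ \<le> q + 4"
  proof -
    have "\<kappa>/Q \<le> \<kappa>/q" using \<kappa> q assms(6) by (intro divide_left_mono) auto
    moreover have "(Q-q)*(1/\<kappa>) \<le> (Q-q)*2" using ik(1) assms(6) by (intro mult_left_mono) linarith+
    ultimately show "DQ \<le> D + 2*(Q-q)" by (simp add: DQ_def D_def algebra_simps diff_divide_distrib)
    have "Q*(1/\<kappa>) \<le> (q+1)*1" using assms(7) ik q \<kappa> by (intro mult_mono) auto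
    moreover have "\<kappa>/Q \<le> 2/1" using \<kappa> q assms(6) by (intro frac_le) auto
    ultimately show "DQ \<le> q + 4" by (simp add: DQ_def)
  qed
  \<comment> \<open>The gap between \<open>g\<close> and \<open>q\<close> is so large compared with
    \<theta> that the end points coming from \<open>g\<close> stay dominated after the tilt.\<close>
  have m'\<kappa>: "\<kappa>*m' \<le> m" "\<kappa>*m' \<le> U" "\<kappa>*m' \<le> UQ" "\<kappa>*m' \<le> DQ"
  proof -
    have q\<theta>: "0 \<le> q*\<theta>" using q \<theta> by simp
    then show 1: "\<kappa>*m' \<le> m" using \<theta>(4) by (simp add: \<kappa>_def)
    have "q \<le> q*\<kappa>" using q \<kappa> by simp
    then have "m \<le> U" unfolding m_def U_def using q by (intro add_recip_mono) auto
    then show 2: "\<kappa>*m' \<le> U" using 1 by simp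
    have "q*\<kappa> \<le> Q*\<kappa>" using \<kappa> assms(6) by auto
    moreover have "1 \<le> q*\<kappa>" using q \<open>q \<le> q*\<kappa>\<close> by linarith
    ultimately have "U \<le> UQ" unfolding U_def UQ_def by (intro add_recip_mono) auto
    then show "\<kappa>*m' \<le> UQ" using 2 by simp
    have "1 \<le> q/\<kappa>"
    proof -
      have "2*q \<le> q^2 + 1" using zero_le_power2[of "q-1"] by (simp add: power2_eq_square algebra_simps)
      then have "1 \<le> q - \<beta>/2" using q by (simp add: \<beta>_def field_simps power2_eq_square)
      moreover have "q*(1-\<theta>) \<le> q*(1/\<kappa>)" using ik q by (intro mult_left_mono) auto
      ultimately show ?thesis using \<theta>(5) by (simp add: algebra_simps)
    qed
    moreover have "q/\<kappa> \<le> Q/\<kappa>" using assms(6) \<kappa> by (intro divide_right_mono) auto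
    ultimately have "q/\<kappa> + 1/(q/\<kappa>) \<le> Q/\<kappa> + 1/(Q/\<kappa>)" by (intro add_recip_mono)
    then have "D \<le> DQ" by (simp add: D_def DQ_def)
    moreover have "m - D \<le> q*\<theta>"
    proof -
      have "q*(1/\<kappa>) - 1/q \<le> q*1 - 0" using q ik by (intro diff_mono mult_left_mono) auto
      then show ?thesis unfolding mD using \<theta>(1) by (simp add: mult.commute mult_right_mono)
    qed
    ultimately show "\<kappa>*m' \<le> DQ" using \<theta>(4) by (simp add: \<kappa>_def)
  qed
  have gk: "g*\<kappa> + 1/(g*\<kappa>) \<le> \<kappa>*m'" "g/\<kappa> + \<kappa>/g \<le> \<kappa>*m'"
  proof -
    have "1/(g*\<kappa>) \<le> \<kappa>/g" "g/\<kappa> \<le> \<kappa>*g" using \<kappa> q mult_mono[of 1 \<kappa> 1 \<kappa>] by (auto simp: divide_simps)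
    then show "g*\<kappa> + 1/(g*\<kappa>) \<le> \<kappa>*m'" "g/\<kappa> + \<kappa>/g \<le> \<kappa>*m'" by (simp_all add: m'_def algebra_simps)
  qed
  have iden: "0 < 1/(Q*\<kappa>)" "0 < 1/(g*\<kappa>)" "1/(Q*\<kappa>) + 1/(1/(Q*\<kappa>)) = UQ" "1/(g*\<kappa>) + 1/(1/(g*\<kappa>)) = g*\<kappa> + 1/(g*\<kappa>)"
    "Q/\<kappa> + 1/(Q/\<kappa>) = DQ" "g/\<kappa> + 1/(g/\<kappa>) = g/\<kappa> + \<kappa>/g"
    using \<kappa> q by (auto simp: UQ_def DQ_def)
  have "(\<Sum>f\<in>A. (\<tau> f/\<kappa> + 2 + \<kappa>/\<tau> f)/mass_share e (lab f))
     \<le> (\<Sum>f\<in>A. if 0 < lab f then 2+UQ else if lab f < 0 then (2+DQ)*(1+2*e) else 2+m)"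
  proof (rule sum_mono)
    fix f assume f: "f \<in> A"
    have L: "0 < \<tau> f" "0 < lab f \<longrightarrow> 1/Q \<le> \<tau> f \<and> \<tau> f \<le> g" "lab f < 0 \<longrightarrow> 1/g \<le> \<tau> f \<and> \<tau> f \<le> Q"
     "lab f = 0 \<longrightarrow> 1/g \<le> \<tau> f \<and> \<tau> f \<le> g" using assms(19) f unfolding labels_ok_def by auto
    have dk: "a \<le> \<tau> f \<Longrightarrow> a/\<kappa> \<le> \<tau> f/\<kappa>" "\<tau> f \<le> a \<Longrightarrow> \<tau> f/\<kappa> \<le> a/\<kappa>" for a
      using \<kappa> by (auto intro: divide_right_mono)
    have s: "\<kappa>/\<tau> f = 1/(\<tau> f/\<kappa>)" using \<kappa> by simp
    have 1: "\<tau> f/\<kappa> + \<kappa>/\<tau> f \<le> UQ" if "0 < lab f"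
      unfolding s by (rule add_recip_le[of "1/(Q*\<kappa>)" _ "g/\<kappa>"])
        (use L(2) that dk[of "1/Q"] dk[of g] iden m'\<kappa> gk in auto)
    have 2: "\<tau> f/\<kappa> + \<kappa>/\<tau> f \<le> DQ" if "lab f < 0"
      unfolding s by (rule add_recip_le[of "1/(g*\<kappa>)" _ "Q/\<kappa>"])
        (use L(3) that dk[of "1/g"] dk[of Q] iden m'\<kappa> gk in auto)
    have 3: "\<tau> f/\<kappa> + \<kappa>/\<tau> f \<le> m" if "lab f = 0"
      unfolding s by (rule add_recip_le[of "1/(g*\<kappa>)" _ "g/\<kappa>"])
        (use L(4) that dk[of "1/g"] dk[of g] iden m'\<kappa> gk in auto)
    have p: "0 \<le> \<tau> f/\<kappa> + 2 + \<kappa>/\<tau> f" using L(1) \<kappa> by (simp add: add_nonneg_nonneg)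
    have e: "1/(1+2*e) \<le> 1" "1/(1-e) \<le> 1+2*e"
    proof -
      have "0 \<le> e*(1-2*e)" using assms(8,9) by (intro mult_nonneg_nonneg) auto
      then show "1/(1-e) \<le> 1+2*e" using assms(8,9) by (simp add: divide_simps algebra_simps)
    qed (use assms(8) in simp)
    consider "0 < lab f" | "lab f < 0" | "lab f = 0" by linarith
    then show "(\<tau> f/\<kappa> + 2 + \<kappa>/\<tau> f)/mass_share e (lab f)
      \<le> (if 0 < lab f then 2+UQ else if lab f < 0 then (2+DQ)*(1+2*e) else 2+m)"
    proof cases
      case 1
      have "(\<tau> f/\<kappa> + 2 + \<kappa>/\<tau> f)*(1/(1+2*e)) \<le> (2+UQ)*1"
        using p e(1) \<open>0 < lab f \<Longrightarrow> _\<close> 1 assms(8) by (intro mult_mono) auto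
      then show ?thesis using 1 by (simp add: mass_share_def)
    next
      case 2
      have "(\<tau> f/\<kappa> + 2 + \<kappa>/\<tau> f)*(1/(1-e)) \<le> (2+DQ)*(1+2*e)"
        using p e(2) \<open>lab f < 0 \<Longrightarrow> _\<close> 2 assms(8,9) by (intro mult_mono) auto
      then show ?thesis using 2 by (simp add: mass_share_def)
    next
      case 3
      then show ?thesis using \<open>lab f = 0 \<Longrightarrow> _\<close> by (simp add: mass_share_def)
    qed
  qed
  also have "\<dots> = u*(2+UQ) + w*(2+DQ) + z*(2+m) + 2*e*(w*(2+DQ))"
    unfolding sum_by_sign(1)[OF \<open>finite A\<close>] by (simp add: u_def w_def z_def algebra_simps)
  also have "\<dots> \<le> u*(2+(U + 2*(Q-q))) + w*(2+(D+2*(Q-q))) + z*(2+m) + 2*e*(n*(q+6))"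
  proof -
    have "u*(2+UQ) \<le> u*(2+(U + 2*(Q-q)))" using UQ pos by (intro mult_left_mono) auto
    moreover have "w*(2+DQ) \<le> w*(2+(D + 2*(Q-q)))" using DQ(1) pos by (intro mult_left_mono) auto
    moreover have "2*e*(w*(2+DQ)) \<le> 2*e*(n*(q+6))"
    proof -
      have "0 \<le> DQ" using q \<kappa> by (simp add: DQ_def)
      then have "w*(2+DQ) \<le> n*(q+6)" using DQ(2) pos n q by (intro mult_mono) auto
      then show ?thesis using assms(8) by (intro mult_left_mono) auto
    qed
    ultimately show ?thesis by (intro add_mono order_refl)
  qed
  also have "\<dots> = u*(2+U) + w*(2+D) + z*(2+m) + 2*((u+w)*(Q-q)) + 2*e*(n*(q+6))"
    by (simp add: algebra_simps)
  also have "\<dots> \<le> u*(2+U) + w*(2+D) + z*(2+m) + 2*(n*(Q-q)) + 2*e*(n*(q+6))"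
  proof -
    have "(u+w)*(Q-q) \<le> n*(Q-q)" using pos n assms(6) by (intro mult_right_mono) auto
    then show ?thesis by linarith
  qed
  also have "\<dots> \<le> n*(2+m) - \<theta>*\<beta>/8"
    using main small by (simp add: n algebra_simps)
  finally show ?thesis by (simp add: \<kappa>_def)
qed

text \<open>Order of choice: \<theta> from \<open>g\<close>, \<open>q\<close> and \<open>n\<close>,
  then \<open>e1\<close> small against \<theta>, finally \<open>Q\<close> close to \<open>q\<close>
  relative to both \<theta> and the smallest possible shift \<open>r * e1\<close>. The factor
  \<open>r\<close> enters because the shift relative to the volume varies from simplex to
  simplex.\<close>

lemma slack_constants:
  fixes g q r :: real and n :: nat
  assumes "1 \<le> g" "g < q" "0 < r" "r \<le> 1" "1 \<le> n"
  shows "\<exists>e1 Q \<eta>. 0 < e1 \<and> e1 \<le> 1/16 \<and> q < Q \<and> 0 < \<eta> \<and>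
    (\<forall>(A::'f set) lab \<tau> e. finite A \<and> card A = n \<and> r*e1 \<le> e \<and> e \<le> e1 \<and> labels_ok g Q A lab \<tau> \<longrightarrow>
      (\<exists>\<kappa>>0. (\<Sum>f\<in>A. (\<tau> f/\<kappa> + 2 + \<kappa>/\<tau> f)/mass_share e (lab f)) \<le> n*(2+q+1/q) - \<eta>))"
proof -
  define m m' \<beta> where "m = q + 1/q" and "m' = g + 1/g" and "\<beta> = q - 1/q"
  have q: "1 < q" "0 < g" using assms by auto
  have \<beta>: "0 < \<beta>"
  proof -
    have "1/q < 1" using q by simp
    then show ?thesis using q by (simp add: \<beta>_def del: divide_less_eq_1_pos less_divide_eq_1_pos)
  qed
  have m'm: "m' < m"
  proof -
    have "(q + 1/q) - (g + 1/g) = (q - g) * (1 - 1/(q*g))" using q by (simp add: field_simps)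
    moreover have "1/(q*g) < 1" using assms mult_less_le_imp_less[of 1 q 1 g] by (simp add: divide_simps)
    ultimately show ?thesis using assms unfolding m_def m'_def by (metis diff_gt_0_iff_gt mult_pos_pos)
  qed
  have mp: "0 < m" "0 < m'" using q by (auto simp: m_def m'_def add_pos_pos)
  define \<theta> where "\<theta> = min (min 1 (\<beta>/(4*(n*m)))) (min ((m-m')/(m'+q)) (\<beta>/(2*q)))"
  have n: "0 < real n" using assms by simp
  have \<theta>: "0 < \<theta>" "\<theta> \<le> 1" "\<theta> \<le> \<beta>/(4*(n*m))" "\<theta> \<le> (m-m')/(m'+q)" "\<theta> \<le> \<beta>/(2*q)"
    using \<beta> m'm mp q n by (auto simp: \<theta>_def)
  have \<theta>': "\<theta> * (4*(n*m)) \<le> \<beta>" "(1+\<theta>)*m' \<le> m - q*\<theta>" "q*\<theta> \<le> \<beta>/2"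
  proof -
    show "\<theta> * (4*(n*m)) \<le> \<beta>" using \<theta>(3) n mp by (simp add: pos_le_divide_eq)
    have "\<theta> * (m'+q) \<le> m - m'" using \<theta>(4) mp q by (simp add: pos_le_divide_eq)
    then show "(1+\<theta>)*m' \<le> m - q*\<theta>" by (simp add: algebra_simps)
    show "q*\<theta> \<le> \<beta>/2" using \<theta>(5) q by (simp add: pos_le_divide_eq algebra_simps)
  qed
  define e1 where "e1 = min (1/16) (\<theta>*\<beta>/(32*(n*(q+6))))"
  have e1: "0 < e1" "e1 \<le> 1/16" "e1 \<le> \<theta>*\<beta>/(32*(n*(q+6)))" using \<theta> \<beta> n q by (auto simp: e1_def)
  have e1': "2*e1*(n*(q+6)) \<le> \<theta>*\<beta>/16" using e1(3) n q by (simp add: pos_le_divide_eq)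
  define x where "x = r*e1"
  have x: "0 < x" "x \<le> e1" using assms e1 by (auto simp: x_def mult_le_cancel_right2)
  define h where "h = min 1 (min (\<theta>*\<beta>/(32*n)) (x/8*(2+q+1/q)))"
  have h: "0 < h" "h \<le> 1" "h \<le> \<theta>*\<beta>/(32*n)" "h \<le> x/8*(2+q+1/q)"
    unfolding h_def using \<theta>(1) \<beta> n x q by (simp_all only: min.cobounded1 min.coboundedI2 min.cobounded2)
      (simp_all add: add_pos_pos)
  have h': "2*(n*h) \<le> \<theta>*\<beta>/16" using h(3) n by (simp add: pos_le_divide_eq algebra_simps)
  define \<eta> where "\<eta> = min (min (x/8*(2+q+1/q)) (q+1/q-(g+1/g))) (\<theta>*\<beta>/8)"
  have \<eta>: "0 < \<eta>" using x q m'm \<theta> \<beta> by (auto simp: \<eta>_def m_def m'_def add_pos_pos)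
  have "\<exists>\<kappa>>0. (\<Sum>f\<in>A. (\<tau> f/\<kappa> + 2 + \<kappa>/\<tau> f)/mass_share e (lab f)) \<le> n*(2+q+1/q) - \<eta>"
    if A: "finite A" "card A = n" "r*e1 \<le> e" "e \<le> e1" "labels_ok g (q+h) A lab \<tau>"
    for A :: "'f set" and lab \<tau> e
  proof (cases "card {f\<in>A. lab f < 0} \<le> card {f\<in>A. 0 < lab f}")
    case True
    have "(\<Sum>f\<in>A. (\<tau> f + 2 + 1/\<tau> f)/mass_share e (lab f))
     \<le> n*(2+q+1/q) - min (x/8*(2+q+1/q)) (q+1/q-(g+1/g))"
      by (rule slack_balanced[OF assms(1,2) _ x(1) _ _ _ A(1,2) assms(5) A(5) True])
        (use A h e1 x in \<open>auto simp: x_def\<close>)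
    also have "\<dots> \<le> n*(2+q+1/q) - \<eta>" unfolding \<eta>_def by linarith
    finally show ?thesis by (intro exI[of _ 1]) simp
  next
    case False
    have e0: "0 \<le> e" using A(3) x(1) by (simp add: x_def)
    have se: "2*e*(n*(q+6)) \<le> \<theta>*\<beta>/16"
    proof -
      have "2*e*(n*(q+6)) \<le> 2*e1*(n*(q+6))" using A(4) n q by (intro mult_right_mono) auto
      then show ?thesis using e1' by linarith
    qed
    have "(\<Sum>f\<in>A. (\<tau> f/(1+\<theta>) + 2 + (1+\<theta>)/\<tau> f)/mass_share e (lab f)) \<le> n*(2+(q+1/q)) - \<theta>*(q-1/q)/8"
      by (rule slack_tilted[of g q "q+h" e \<theta> n A lab \<tau>])
        (use assms h e0 A e1 \<theta> \<theta>' se h' False in \<open>auto simp: m_def m'_def \<beta>_def\<close>)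
    also have "\<dots> \<le> n*(2+q+1/q) - \<eta>"
    proof -
      have "\<eta> \<le> \<theta>*(q-1/q)/8" unfolding \<eta>_def \<beta>_def by linarith
      then show ?thesis by (simp add: add.assoc)
    qed
    finally show ?thesis using \<theta>(1) by (intro exI[of _ "1+\<theta>"]) simp
  qed
  then show ?thesis using e1 h \<eta> by (intro exI[of _ e1] exI[of _ "q+h"] exI[of _ \<eta>]) auto
qed

text \<open>4AB \<le> (tA + B/t)^2 with t^2 = \<kappa> s, followed by Cauchy-Schwarz with weights
  \<open>a f * w f\<close>. This controls the term of the mass form that has no definite sign;
  \<open>\<kappa>\<close> is the free factor used against an unbalanced neighbourhood.\<close>

lemma weighted_product_bound:
  fixes x w a :: "'f \<Rightarrow> real"
  assumes "finite A" "0 < \<kappa>" "0 < s" "\<And>f. f \<in> A \<Longrightarrow> 0 < w f" "\<And>f. f \<in> A \<Longrightarrow> 0 < a f"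
  shows "4 * ((\<Sum>f\<in>A. x f) * (\<Sum>f\<in>A. w f * x f))
    \<le> (\<Sum>f\<in>A. a f * (w f * (x f)\<^sup>2)) * (\<Sum>f\<in>A. (w f/s/\<kappa> + 2 + \<kappa>/(w f/s)) / a f)"
proof -
  define t where "t = sqrt (\<kappa> * s)"
  have t: "0 < t" "t^2 = \<kappa> * s" using assms by (auto simp: t_def)
  have "4 * ((\<Sum>f\<in>A. x f) * (\<Sum>f\<in>A. w f * x f)) = 4 * ((t * (\<Sum>f\<in>A. x f)) * ((\<Sum>f\<in>A. w f * x f)/t))"
    using t by simp
  also have "\<dots> \<le> (t * (\<Sum>f\<in>A. x f) + (\<Sum>f\<in>A. w f * x f)/t)^2"
    using zero_le_power2[of "t * (\<Sum>f\<in>A. x f) - (\<Sum>f\<in>A. w f * x f)/t"] by (simp add: power2_eq_square algebra_simps)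
  also have "t * (\<Sum>f\<in>A. x f) + (\<Sum>f\<in>A. w f * x f)/t = (\<Sum>f\<in>A. (sqrt (a f * w f) * x f) * ((t + w f/t) / sqrt (a f * w f)))"
  proof -
    have "(sqrt (a f * w f) * x f) * ((t + w f/t) / sqrt (a f * w f)) = t * x f + w f * x f / t" if "f \<in> A" for f
      using assms(4,5)[OF that] t by (simp add: field_simps)
    then show ?thesis by (simp add: sum.distrib sum_distrib_left sum_divide_distrib cong: sum.cong)
  qed
  also have "\<dots>^2 \<le> (\<Sum>f\<in>A. (sqrt (a f * w f) * x f)^2) * (\<Sum>f\<in>A. ((t + w f/t) / sqrt (a f * w f))^2)"
    by (rule Cauchy_Schwarz_ineq_sum)
  also have "(\<Sum>f\<in>A. (sqrt (a f * w f) * x f)^2) = (\<Sum>f\<in>A. a f * (w f * (x f)\<^sup>2))"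
    using assms(4,5) by (intro sum.cong) (simp_all add: power_mult_distrib less_imp_le)
  also have "(\<Sum>f\<in>A. ((t + w f/t) / sqrt (a f * w f))^2) = (\<Sum>f\<in>A. (w f/s/\<kappa> + 2 + \<kappa>/(w f/s)) / a f)"
  proof (intro sum.cong refl)
    fix f assume f: "f \<in> A"
    have p: "0 < w f" "0 < a f" using assms(4,5)[OF f] by auto
    have "((t + w f/t) / sqrt (a f * w f))^2 = (t + w f/t)^2 / (a f * w f)"
      using p by (simp add: power_divide)
    also have "(t + w f/t)^2 = t^2 + 2 * w f + (w f)^2/t^2"
      using t(1) by (simp add: power2_eq_square field_simps)
    also have "(t^2 + 2 * w f + (w f)^2/t^2) / (a f * w f) = (w f/s/\<kappa> + 2 + \<kappa>/(w f/s)) / a f"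
      unfolding t(2) using p assms(2,3) by (simp add: field_simps power2_eq_square)
    finally show "((t + w f/t) / sqrt (a f * w f))^2 = (w f/s/\<kappa> + 2 + \<kappa>/(w f/s)) / a f" .
  qed
  finally show ?thesis .
qed

section \<open>Abstract meshes and coercivity of the weighted form\<close>

inductive reach :: "'b set \<Rightarrow> ('b \<Rightarrow> 'f set) \<Rightarrow> ('b \<Rightarrow> nat) \<Rightarrow> nat \<Rightarrow> nat \<Rightarrow> 'b \<Rightarrow> 'b \<Rightarrow> bool"
  for \<T> F gen where
  start: "T \<in> \<T> \<Longrightarrow> reach \<T> F gen 0 0 T T"
| up: "reach \<T> F gen u v T T' \<Longrightarrow> T'' \<in> \<T> \<Longrightarrow> T' \<noteq> T'' \<Longrightarrow> f \<in> F T' \<Longrightarrow> f \<in> F T'' \<Longrightarrow> gen T' = gen T'' + 1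
    \<Longrightarrow> reach \<T> F gen (Suc u) v T T''"
| level: "reach \<T> F gen u v T T' \<Longrightarrow> T'' \<in> \<T> \<Longrightarrow> T' \<noteq> T'' \<Longrightarrow> f \<in> F T' \<Longrightarrow> f \<in> F T'' \<Longrightarrow> gen T' \<noteq> gen T'' + 1
    \<Longrightarrow> reach \<T> F gen u (Suc v) T T''"

lemma reach_in: "reach \<T> F gen u v T T' \<Longrightarrow> T \<in> \<T> \<and> T' \<in> \<T>"
  by (induction rule: reach.induct) auto

text \<open>Only these data enter the discrete estimates, so a constant depending on
  \<open>d\<close>, \<open>V0\<close>, \<open>V1\<close> and \<open>Cg\<close> is automatically
  uniform over all meshes refined from one initial triangulation. \<open>growth\<close> is the
  volume bound for chains of neighbours.\<close>

locale discrete_mesh =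
  fixes \<T> :: "'b set" and F :: "'b \<Rightarrow> 'f set" and d :: nat and vol :: "'b \<Rightarrow> real"
    and gen :: "'b \<Rightarrow> nat" and V0 V1 Cg :: real
  assumes fin: "finite \<T>" and d2: "2 \<le> d"
    and finF: "\<And>T. T \<in> \<T> \<Longrightarrow> finite (F T)" and cardF: "\<And>T. T \<in> \<T> \<Longrightarrow> card (F T) = d + 1"
    and two: "\<And>T T' T'' f. T \<in> \<T> \<Longrightarrow> T' \<in> \<T> \<Longrightarrow> T'' \<in> \<T> \<Longrightarrow> f \<in> F T \<Longrightarrow> f \<in> F T' \<Longrightarrow> f \<in> F T''
      \<Longrightarrow> T = T' \<or> T = T'' \<or> T' = T''"
    and gen_step: "\<And>T T' f. T \<in> \<T> \<Longrightarrow> T' \<in> \<T> \<Longrightarrow> f \<in> F T \<Longrightarrow> f \<in> F T' \<Longrightarrow> gen T \<le> gen T' + 1"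
    and V0: "0 < V0" "V0 \<le> V1" and Cg: "0 \<le> Cg"
    and vol_gen: "\<And>T. T \<in> \<T> \<Longrightarrow> V0 \<le> vol T * 2 ^ gen T" "\<And>T. T \<in> \<T> \<Longrightarrow> vol T * 2 ^ gen T \<le> V1"
    and growth: "\<And>T u v. T \<in> \<T> \<Longrightarrow>
      (\<Sum>T'\<in>{T'. reach \<T> F gen u v T T'}. vol T') \<le> Cg * (real u + real v + 1) ^ d * 2 ^ u * vol T"
begin

lemma vol_pos: "T \<in> \<T> \<Longrightarrow> 0 < vol T"
  using vol_gen(1)[of T] V0 zero_less_mult_pos2[of "vol T" "2 ^ gen T"] by simp

text \<open>At a boundary face the simplex counts as its own neighbour: the weight ratio is then 1
  and the label 0. For each face, passing to the neighbour is an involution, so sums over pairs of a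
  simplex and a face can be reordered.\<close>

definition nbr :: "'b \<Rightarrow> 'f \<Rightarrow> 'b" where
  "nbr T f = (if \<exists>T'\<in>\<T>. T' \<noteq> T \<and> f \<in> F T' then (SOME T'. T' \<in> \<T> \<and> T' \<noteq> T \<and> f \<in> F T') else T)"

lemma nbr:
  assumes "T \<in> \<T>" "f \<in> F T"
  shows "nbr T f \<in> \<T>" "f \<in> F (nbr T f)" "nbr (nbr T f) f = T"
proof -
  have *: "nbr T f \<in> \<T> \<and> f \<in> F (nbr T f) \<and> nbr (nbr T f) f = T"
  proof (cases "\<exists>T'\<in>\<T>. T' \<noteq> T \<and> f \<in> F T'")
    case True
    then have n: "nbr T f \<in> \<T> \<and> nbr T f \<noteq> T \<and> f \<in> F (nbr T f)"
      unfolding nbr_def by (simp add: Bex_def) (rule someI_ex)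
    then have ex: "\<exists>T'\<in>\<T>. T' \<noteq> nbr T f \<and> f \<in> F T'" using assms by metis
    then have "nbr (nbr T f) f \<in> \<T> \<and> nbr (nbr T f) f \<noteq> nbr T f \<and> f \<in> F (nbr (nbr T f) f)"
      unfolding nbr_def[of "nbr T f"] by (simp add: Bex_def) (rule someI_ex)
    then show ?thesis using two n assms by metis
  qed (use assms in \<open>auto simp: nbr_def\<close>)
  then show "nbr T f \<in> \<T>" "f \<in> F (nbr T f)" "nbr (nbr T f) f = T" by auto
qed

lemma sum_nbr_swap:
  fixes h :: "'b \<Rightarrow> 'b \<Rightarrow> 'f \<Rightarrow> real"
  shows "(\<Sum>T\<in>\<T>. \<Sum>f\<in>F T. h T (nbr T f) f) = (\<Sum>T\<in>\<T>. \<Sum>f\<in>F T. h (nbr T f) T f)"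
proof -
  have "(\<Sum>(T,f)\<in>Sigma \<T> F. h T (nbr T f) f) = (\<Sum>(T,f)\<in>Sigma \<T> F. h (nbr T f) T f)"
    by (rule sum.reindex_bij_witness[of _ "\<lambda>(T,f). (nbr T f, f)" "\<lambda>(T,f). (nbr T f, f)"]) (auto simp: nbr)
  then show ?thesis using fin finF by (simp add: sum.Sigma)
qed

definition lab :: "'b \<Rightarrow> 'f \<Rightarrow> int" where "lab T f = int (gen T) - int (gen (nbr T f))"

lemma lab_bounds: "T \<in> \<T> \<Longrightarrow> f \<in> F T \<Longrightarrow> lab T f \<in> {-1,0,1}"
  using gen_step[of T "nbr T f" f] gen_step[of "nbr T f" T f] nbr[of T f] unfolding lab_def by force

text \<open>A larger simplex of generation k gives away \<epsilon>/2^k at each face with a smaller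
  neighbour; that neighbour has generation k+1 and receives 2\<epsilon>/2^(k+1). The factors 1+2e
  and 1-e with e = \<epsilon>/(|T| 2^gen) are made for this cancellation.\<close>

lemma mass_shift_sum:
  "(\<Sum>T\<in>\<T>. \<Sum>f\<in>F T. vol T * mass_share (\<epsilon> / (vol T * 2 ^ gen T)) (lab T f) * y f)
    = (\<Sum>T\<in>\<T>. \<Sum>f\<in>F T. vol T * y f)"
proof -
  define \<sigma> where "\<sigma> T T' f = (if gen T' < gen T then 2*\<epsilon>/2^gen T * y f else if gen T < gen T' then -(\<epsilon>/2^gen T) * y f else 0)"
    for T T' :: 'b and f
  have eq: "vol T * mass_share (\<epsilon> / (vol T * 2 ^ gen T)) (lab T f) * y f = vol T * y f + \<sigma> T (nbr T f) f"
    if "T \<in> \<T>" for T f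
    using vol_pos[OF that] by (simp add: mass_share_def lab_def \<sigma>_def field_simps)
  have anti: "\<sigma> (nbr T f) T f = - \<sigma> T (nbr T f) f" if Tf: "T \<in> \<T>" "f \<in> F T" for T f
  proof -
    consider "gen T = Suc (gen (nbr T f))" | "gen T = gen (nbr T f)" | "gen (nbr T f) = Suc (gen T)"
      using lab_bounds[OF Tf] unfolding lab_def by fastforce
    then show ?thesis by cases (simp_all add: \<sigma>_def)
  qed
  have "(\<Sum>T\<in>\<T>. \<Sum>f\<in>F T. \<sigma> T (nbr T f) f) = (\<Sum>T\<in>\<T>. \<Sum>f\<in>F T. - \<sigma> T (nbr T f) f)"
    unfolding sum_nbr_swap[of \<sigma>] using anti by (intro sum.cong) auto
  then have "(\<Sum>T\<in>\<T>. \<Sum>f\<in>F T. \<sigma> T (nbr T f) f) = 0" by (simp add: sum_negf)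
  then show ?thesis by (simp add: eq sum.distrib cong: sum.cong)
qed

lemma nbr_unique:
  assumes "T \<in> \<T>" "T' \<in> \<T>" "f \<in> F T" "f \<in> F T'" "T \<noteq> T'"
  shows "nbr T f = T'"
proof -
  have "\<exists>T'\<in>\<T>. T' \<noteq> T \<and> f \<in> F T'" using assms by auto
  then have "nbr T f \<in> \<T> \<and> nbr T f \<noteq> T \<and> f \<in> F (nbr T f)"
    unfolding nbr_def by (simp add: Bex_def) (rule someI_ex)
  then show ?thesis using two[of T "nbr T f" T' f] assms by metis
qed

text \<open>Growth towards a smaller simplex is limited by \<open>Q\<close>, every other change by
  \<open>g\<close>. The notion is applied to \<omega> or to 1/\<omega>, since for p < 2 the majorant
  enters through a denominator.\<close>

definition graded :: "real \<Rightarrow> real \<Rightarrow> ('b \<Rightarrow> real) \<Rightarrow> bool" where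
  "graded g Q \<omega> \<longleftrightarrow> (\<forall>T\<in>\<T>. 0 < \<omega> T) \<and> (\<forall>T\<in>\<T>. \<forall>T'\<in>\<T>. \<forall>f. T \<noteq> T' \<and> f \<in> F T \<and> f \<in> F T' \<longrightarrow>
     (gen T = gen T' \<longrightarrow> \<omega> T' \<le> g * \<omega> T) \<and> (gen T = gen T' + 1 \<longrightarrow> \<omega> T \<le> Q * \<omega> T' \<and> \<omega> T' \<le> g * \<omega> T))"

lemma graded_pos: "graded g Q \<omega> \<Longrightarrow> T \<in> \<T> \<Longrightarrow> 0 < \<omega> T"
  by (simp add: graded_def)

lemma graded_labels:
  assumes "graded g Q \<omega>" "1 \<le> g" "g \<le> Q" "T \<in> \<T>"
  shows "labels_ok g Q (F T) (lab T) (\<lambda>f. \<omega> (nbr T f) / \<omega> T)"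
  unfolding labels_ok_def
proof
  fix f assume f: "f \<in> F T"
  define N where "N = nbr T f"
  have N: "N \<in> \<T>" "f \<in> F N" using nbr[OF assms(4) f] by (auto simp: N_def)
  have p: "0 < \<omega> T" "0 < \<omega> N" using graded_pos[OF assms(1)] N assms(4) by auto
  have G: "gen A = gen B \<Longrightarrow> \<omega> B \<le> g * \<omega> A" "gen A = gen B + 1 \<Longrightarrow> \<omega> A \<le> Q * \<omega> B \<and> \<omega> B \<le> g * \<omega> A"
    if "A \<in> \<T>" "B \<in> \<T>" "A \<noteq> B" "f \<in> F A" "f \<in> F B" for A B
    using assms(1) that unfolding graded_def by blast+
  have gp: "0 < g" "0 < Q" using assms by auto
  have lN: "lab T f = int (gen T) - int (gen N)" by (simp add: lab_def N_def)
  have T1: "\<omega> T * 1 \<le> \<omega> T * g" using p assms by (intro mult_left_mono) auto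
  have up: "\<omega> T \<le> Q * \<omega> N \<and> \<omega> N \<le> g * \<omega> T" if "0 < lab T f"
  proof -
    have "gen T = gen N + 1" "T \<noteq> N" using that lab_bounds[OF assms(4) f] unfolding lN by auto
    then show ?thesis using G(2)[of T N] N assms(4) f by blast
  qed
  have down: "\<omega> N \<le> Q * \<omega> T \<and> \<omega> T \<le> g * \<omega> N" if "lab T f < 0"
  proof -
    have "gen N = gen T + 1" "T \<noteq> N" using that lab_bounds[OF assms(4) f] unfolding lN by auto
    then show ?thesis using G(2)[of N T] N assms(4) f by metis
  qed
  have eq: "\<omega> N \<le> g * \<omega> T \<and> \<omega> T \<le> g * \<omega> N" if "lab T f = 0"
  proof (cases "T = N")
    case True then show ?thesis using T1 by (simp add: mult.commute)
  next
    case False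
    have "gen T = gen N" using that unfolding lN by simp
    then show ?thesis using G(1)[of T N] G(1)[of N T] N assms(4) f False by metis
  qed
  have c: "x / \<omega> T \<le> y \<longleftrightarrow> x \<le> y * \<omega> T" "1/k \<le> \<omega> N/\<omega> T \<longleftrightarrow> \<omega> T \<le> k * \<omega> N" if "0 < k" for x y k
    using p that by (auto simp: divide_simps mult.commute)
  show "0 < \<omega> (nbr T f) / \<omega> T \<and>
     (0 < lab T f \<longrightarrow> 1/Q \<le> \<omega> (nbr T f) / \<omega> T \<and> \<omega> (nbr T f) / \<omega> T \<le> g) \<and>
     (lab T f < 0 \<longrightarrow> 1/g \<le> \<omega> (nbr T f) / \<omega> T \<and> \<omega> (nbr T f) / \<omega> T \<le> Q) \<and>
     (lab T f = 0 \<longrightarrow> 1/g \<le> \<omega> (nbr T f) / \<omega> T \<and> \<omega> (nbr T f) / \<omega> T \<le> g)"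
    unfolding N_def[symmetric] c(1)[OF zero_less_one] c(2)[OF gp(1)] c(2)[OF gp(2)]
    using up down eq p by auto
qed

definition face_weight :: "('b \<Rightarrow> real) \<Rightarrow> 'f \<Rightarrow> real" where
  "face_weight \<omega> f = (let T = SOME T. T \<in> \<T> \<and> f \<in> F T in \<omega> T * \<omega> (nbr T f))"

lemma face_weight:
  assumes "T \<in> \<T>" "f \<in> F T"
  shows "face_weight \<omega> f = \<omega> T * \<omega> (nbr T f)"
proof -
  define S where "S = (SOME T. T \<in> \<T> \<and> f \<in> F T)"
  have S: "S \<in> \<T> \<and> f \<in> F S" unfolding S_def by (rule someI[of _ T]) (use assms in auto)
  show ?thesis
  proof (cases "S = T")
    case False
    then have "nbr T f = S" "nbr S f = T" using nbr_unique S assms by auto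
    then show ?thesis by (simp add: face_weight_def Let_def S_def[symmetric])
  qed (simp add: face_weight_def Let_def S_def[symmetric])
qed

text \<open>Here \<open>x\<close> is tested with \<open>w x\<close>, where \<open>w f\<close> is the product of the weights of the two simplices
  at \<open>f\<close>. The form is coercive as soon as it is so on each simplex after the mass shift.\<close>

lemma coercive:
  assumes slack: "\<And>A lab \<tau> e. finite A \<Longrightarrow> card A = d + 1 \<Longrightarrow> V0/V1 * e1 \<le> e \<Longrightarrow> e \<le> e1 \<Longrightarrow>
      labels_ok g Q (A :: 'f set) lab \<tau> \<Longrightarrow>
      \<exists>\<kappa>>0. (\<Sum>f\<in>A. (\<tau> f/\<kappa> + 2 + \<kappa>/\<tau> f)/mass_share e (lab f)) \<le> (d+1)*(2+q+1/q) - \<eta>"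
    and e1: "0 < e1" "e1 \<le> 1/16" and \<eta>: "0 < \<eta>"
    and q: "(real d - 2) * ((d + 1) * (2 + q + 1/q)) \<le> 4 * (real d)^2"
    and g: "1 \<le> g" "g \<le> Q"
    and \<omega>: "graded g Q \<omega> \<or> graded g Q (\<lambda>T. 1 / \<omega> T)"
  shows "min 4 (\<eta>/4) / 2 * (\<Sum>T\<in>\<T>. vol T * (\<Sum>f\<in>F T. face_weight \<omega> f * (x f)\<^sup>2))
    \<le> (\<Sum>T\<in>\<T>. vol T * (\<Sum>f\<in>F T. (real d)^2 * (face_weight \<omega> f * (x f)\<^sup>2)
        - (real d - 2) * (\<Sum>f\<in>F T. x f) * (face_weight \<omega> f * x f)))"
proof -
  define w where "w = face_weight \<omega>"
  define a where "a T f = mass_share (e1 * V0 / (vol T * 2 ^ gen T)) (lab T f)" for T f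
  have \<omega>p: "0 < \<omega> T" if "T \<in> \<T>" for T using \<omega> graded_pos[of g Q _ T] that by force
  have e: "V0/V1 * e1 \<le> e1 * V0 / (vol T * 2 ^ gen T)" "e1 * V0 / (vol T * 2 ^ gen T) \<le> e1" if "T \<in> \<T>" for T
  proof -
    have "V0 \<le> vol T * 2 ^ gen T" "vol T * 2 ^ gen T \<le> V1" "0 < vol T * 2 ^ gen T"
      using vol_gen[OF that] vol_pos[OF that] by auto
    then show "V0/V1 * e1 \<le> e1 * V0 / (vol T * 2 ^ gen T)" "e1 * V0 / (vol T * 2 ^ gen T) \<le> e1"
      using V0 e1 by (auto simp: divide_simps mult_left_mono mult_right_mono mult.commute)
  qed
  have ep: "0 \<le> e1 * V0 / (vol T * 2 ^ gen T)" if "T \<in> \<T>" for T using e1 V0 vol_pos[OF that] by simp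
  have a: "1/2 \<le> a T f" if "T \<in> \<T>" for T f
    using e(2)[OF that] ep[OF that] e1 by (auto simp: a_def mass_share_def)
  have loc: "min 4 (\<eta>/4) / 2 * (\<Sum>f\<in>F T. w f * (x f)\<^sup>2)
     \<le> (real d)^2 * (\<Sum>f\<in>F T. a T f * (w f * (x f)\<^sup>2)) - (real d - 2) * ((\<Sum>f\<in>F T. x f) * (\<Sum>f\<in>F T. w f * x f))"
    if T: "T \<in> \<T>" for T
  proof -
    define S where "S = (\<Sum>f\<in>F T. a T f * (w f * (x f)\<^sup>2))"
    have wp: "0 < w f" if "f \<in> F T" for f
      using face_weight[OF T that] \<omega>p T nbr[OF T that] by (simp add: w_def)
    have S0: "0 \<le> S" unfolding S_def
      using a[OF T] wp by (intro sum_nonneg mult_nonneg_nonneg) (auto intro: less_imp_le order_trans[of 0 "1/2"])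
    have \<tau>: "w f / (\<omega> T)\<^sup>2 = \<omega> (nbr T f) / \<omega> T" if "f \<in> F T" for f
      using face_weight[OF T that] \<omega>p[OF T] by (simp add: w_def power2_eq_square)
    \<comment> \<open>If 1/\<omega> is graded, all ratios turn into their reciprocals and \<kappa>
      into 1/\<kappa>, and the bound for the sum is unchanged.\<close>
    obtain \<kappa> where \<kappa>: "0 < \<kappa>" "(\<Sum>f\<in>F T. (w f/(\<omega> T)\<^sup>2/\<kappa> + 2 + \<kappa>/(w f/(\<omega> T)\<^sup>2))/a T f) \<le> (d+1)*(2+q+1/q) - \<eta>"
      using \<omega>
    proof
      assume "graded g Q \<omega>"
      from slack[OF finF[OF T] cardF[OF T] e[OF T] graded_labels[OF this g T]] obtain \<kappa> where
        "\<kappa>>0" "(\<Sum>f\<in>F T. (\<omega> (nbr T f) / \<omega> T/\<kappa> + 2 + \<kappa>/(\<omega> (nbr T f) / \<omega> T))/a T f) \<le> (d+1)*(2+q+1/q) - \<eta>"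
        unfolding a_def by blast
      then show ?thesis using that[of \<kappa>] \<tau> by (simp cong: sum.cong)
    next
      assume "graded g Q (\<lambda>T. 1/\<omega> T)"
      from slack[OF finF[OF T] cardF[OF T] e[OF T] graded_labels[OF this g T]] obtain \<kappa> where
        k: "\<kappa>>0" "(\<Sum>f\<in>F T. (1/\<omega> (nbr T f) / (1/\<omega> T)/\<kappa> + 2 + \<kappa>/(1/\<omega> (nbr T f) / (1/\<omega> T)))/a T f) \<le> (d+1)*(2+q+1/q) - \<eta>"
        unfolding a_def by blast
      have "1/\<omega> (nbr T f) / (1/\<omega> T)/\<kappa> + 2 + \<kappa>/(1/\<omega> (nbr T f) / (1/\<omega> T)) = w f/(\<omega> T)\<^sup>2/(1/\<kappa>) + 2 + (1/\<kappa>)/(w f/(\<omega> T)\<^sup>2)"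
        if "f \<in> F T" for f
        unfolding \<tau>[OF that] using k(1) \<omega>p[OF T] \<omega>p[OF nbr(1)[OF T that]] by (simp add: field_simps)
      then have "(\<Sum>f\<in>F T. (w f/(\<omega> T)\<^sup>2/(1/\<kappa>) + 2 + (1/\<kappa>)/(w f/(\<omega> T)\<^sup>2))/a T f)
        = (\<Sum>f\<in>F T. (1/\<omega> (nbr T f) / (1/\<omega> T)/\<kappa> + 2 + \<kappa>/(1/\<omega> (nbr T f) / (1/\<omega> T)))/a T f)"
        by (intro sum.cong refl) (simp only:)
      then show ?thesis using k by (intro that[of "1/\<kappa>"]) (simp, simp only:)
    qed
    have alg: "c * (s * (m - h)) = s * (c * m) - c * h * s" for c s m h :: real
      by (simp add: algebra_simps)
    have "4 * ((\<Sum>f\<in>F T. x f) * (\<Sum>f\<in>F T. w f * x f))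
      \<le> S * (\<Sum>f\<in>F T. (w f/(\<omega> T)\<^sup>2/\<kappa> + 2 + \<kappa>/(w f/(\<omega> T)\<^sup>2))/a T f)"
      unfolding S_def using finF[OF T] \<kappa>(1) \<omega>p[OF T] wp a[OF T]
      by (intro weighted_product_bound) (auto intro: less_le_trans[of 0 "1/2"])
    also have "\<dots> \<le> S * ((d+1)*(2+q+1/q) - \<eta>)" using \<kappa>(2) S0 by (intro mult_left_mono)
    finally have "4 * ((\<Sum>f\<in>F T. x f) * (\<Sum>f\<in>F T. w f * x f)) \<le> S * ((d+1)*(2+q+1/q) - \<eta>)" .
    then have "(real d - 2) * (4 * ((\<Sum>f\<in>F T. x f) * (\<Sum>f\<in>F T. w f * x f))) \<le> (real d - 2) * (S * ((d+1)*(2+q+1/q) - \<eta>))"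
      using d2 by (intro mult_left_mono) auto
    also have "\<dots> = S * ((real d - 2) * ((d+1)*(2+q+1/q))) - (real d - 2) * \<eta> * S"
      by (rule alg)
    also have "\<dots> \<le> S * (4 * (real d)^2) - (real d - 2) * \<eta> * S" using q S0 by (intro diff_right_mono mult_left_mono)
    finally have *: "(real d - 2) * (4 * ((\<Sum>f\<in>F T. x f) * (\<Sum>f\<in>F T. w f * x f))) \<le> S * (4 * (real d)^2) - (real d - 2) * \<eta> * S" .
    \<comment> \<open>For d = 2 the product term disappears and d^2 = 4 is the constant; otherwise d
      - 2 \<ge> 1 preserves the slack \<eta>, divided by the 4 of the product bound.\<close>
    have "min 4 (\<eta>/4) * S \<le> (real d)^2 * S - (real d - 2) * ((\<Sum>f\<in>F T. x f) * (\<Sum>f\<in>F T. w f * x f))"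
    proof (cases "d = 2")
      case True then show ?thesis using S0 by (simp add: mult_right_mono)
    next
      case False
      have "\<eta> * 1 * S \<le> \<eta> * (real d - 2) * S" using False d2 \<eta> S0 by (intro mult_right_mono mult_left_mono) auto
      moreover have "min 4 (\<eta>/4) * S \<le> \<eta>/4 * S" using S0 by (intro mult_right_mono) auto
      ultimately show ?thesis using * by (simp add: algebra_simps)
    qed
    moreover have "min 4 (\<eta>/4) / 2 * (\<Sum>f\<in>F T. w f * (x f)\<^sup>2) \<le> min 4 (\<eta>/4) * S"
    proof -
      have "(\<Sum>f\<in>F T. 1/2 * (w f * (x f)\<^sup>2)) \<le> S" unfolding S_def
        using wp by (intro sum_mono mult_right_mono a[OF T] mult_nonneg_nonneg) (auto intro: less_imp_le)
      then have "1/2 * (\<Sum>f\<in>F T. w f * (x f)\<^sup>2) \<le> S" by (simp add: sum_distrib_left)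
      then have "min 4 (\<eta>/4) * (1/2 * (\<Sum>f\<in>F T. w f * (x f)\<^sup>2)) \<le> min 4 (\<eta>/4) * S"
        using \<eta> by (intro mult_left_mono) auto
      then show ?thesis by simp
    qed
    ultimately show ?thesis unfolding S_def by linarith
  qed
  have "min 4 (\<eta>/4) / 2 * (\<Sum>T\<in>\<T>. vol T * (\<Sum>f\<in>F T. w f * (x f)\<^sup>2))
     = (\<Sum>T\<in>\<T>. vol T * (min 4 (\<eta>/4) / 2 * (\<Sum>f\<in>F T. w f * (x f)\<^sup>2)))"
    unfolding sum_distrib_left[of _ _ \<T>] by (intro sum.cong refl) (rule mult.left_commute)
  also have "\<dots> \<le> (\<Sum>T\<in>\<T>. vol T * ((real d)^2 * (\<Sum>f\<in>F T. a T f * (w f * (x f)\<^sup>2)) - (real d - 2) * ((\<Sum>f\<in>F T. x f) * (\<Sum>f\<in>F T. w f * x f))))"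
    using loc vol_pos by (intro sum_mono mult_left_mono) (auto intro: less_imp_le)
  also have "\<dots> = (real d)^2 * (\<Sum>T\<in>\<T>. \<Sum>f\<in>F T. vol T * a T f * (w f * (x f)\<^sup>2))
      - (\<Sum>T\<in>\<T>. vol T * ((real d - 2) * ((\<Sum>f\<in>F T. x f) * (\<Sum>f\<in>F T. w f * x f))))"
    by (simp add: sum_distrib_left sum_subtractf right_diff_distrib mult_ac)
  also have "(\<Sum>T\<in>\<T>. \<Sum>f\<in>F T. vol T * a T f * (w f * (x f)\<^sup>2)) = (\<Sum>T\<in>\<T>. \<Sum>f\<in>F T. vol T * (w f * (x f)\<^sup>2))"
    unfolding a_def by (rule mass_shift_sum)
  also have "(real d)^2 * \<dots> - (\<Sum>T\<in>\<T>. vol T * ((real d - 2) * ((\<Sum>f\<in>F T. x f) * (\<Sum>f\<in>F T. w f * x f))))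
     = (\<Sum>T\<in>\<T>. vol T * (\<Sum>f\<in>F T. (real d)^2 * (w f * (x f)\<^sup>2) - (real d - 2) * (\<Sum>f\<in>F T. x f) * (w f * x f)))"
  proof -
    have "(\<Sum>f\<in>F T. (real d)^2 * (w f * (x f)\<^sup>2) - (real d - 2) * (\<Sum>f\<in>F T. x f) * (w f * x f))
      = (real d)^2 * (\<Sum>f\<in>F T. w f * (x f)\<^sup>2) - (real d - 2) * ((\<Sum>f\<in>F T. x f) * (\<Sum>f\<in>F T. w f * x f))" for T
      by (simp only: sum_subtractf mult.assoc sum_distrib_left[symmetric])
    then show ?thesis
      by (simp add: sum_distrib_left[of _ _ \<T>] sum_distrib_left[symmetric] sum_subtractf right_diff_distrib mult.left_commute)
  qed
  finally show ?thesis unfolding w_def .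
qed

lemma graded_nbr:
  assumes "graded g Q \<omega> \<or> graded g Q (\<lambda>T. 1 / \<omega> T)" "1 \<le> g" "g \<le> Q" "T \<in> \<T>" "f \<in> F T"
  shows "0 < \<omega> T" "\<omega> (nbr T f) \<le> Q * \<omega> T" "\<omega> T \<le> Q * \<omega> (nbr T f)"
proof -
  have p: "0 < \<omega> S" if "S \<in> \<T>" for S using assms(1) graded_pos[of g Q _ S] that by force
  then show "0 < \<omega> T" using assms(4) .
  have pN: "0 < \<omega> (nbr T f)" using p nbr(1)[OF assms(4,5)] .
  have r: "1/Q \<le> r \<and> r \<le> Q" if "labels_ok g Q (F T) (lab T) (\<lambda>f. R f)" "r = R f" for R r
  proof -
    have "1/Q \<le> 1/g" using assms by (simp add: frac_le)
    moreover have "0 < lab T f \<or> lab T f < 0 \<or> lab T f = 0" by auto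
    ultimately show ?thesis using that(1) assms(3,5) unfolding labels_ok_def that(2) by force
  qed
  have "1/Q \<le> \<omega> (nbr T f)/\<omega> T \<and> \<omega> (nbr T f)/\<omega> T \<le> Q"
    using assms(1)
  proof
    assume "graded g Q \<omega>"
    from r[OF graded_labels[OF this assms(2-4)] refl] show ?thesis .
  next
    assume "graded g Q (\<lambda>T. 1 / \<omega> T)"
    from r[OF graded_labels[OF this assms(2-4)] refl]
    have "1/Q \<le> \<omega> T/\<omega> (nbr T f) \<and> \<omega> T/\<omega> (nbr T f) \<le> Q" by simp
    then show ?thesis using p[OF assms(4)] pN assms(2,3) by (simp add: divide_simps mult.commute)
  qed
  then show "\<omega> (nbr T f) \<le> Q * \<omega> T" "\<omega> T \<le> Q * \<omega> (nbr T f)"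
    using p[OF assms(4)] pN assms(2,3) by (simp_all add: divide_simps mult.commute)
qed

text \<open>This is all that the discrete argument keeps of the projection equation: the left-hand
  side is (d+1)(d+2) times the pairing of the functions with face values x and y, and
  \<open>U\<close> will be the mean of |u|. It is required for all y because the test function is
  built from x and from weights that depend on x themselves.\<close>

definition tested :: "real \<Rightarrow> ('f \<Rightarrow> real) \<Rightarrow> ('b \<Rightarrow> real) \<Rightarrow> bool" where
  "tested cu x U \<longleftrightarrow> (\<forall>y.
     (\<Sum>T\<in>\<T>. vol T * (\<Sum>f\<in>F T. (real d)^2 * (y f * x f) - (real d - 2) * (\<Sum>f\<in>F T. x f) * y f))
     \<le> cu * (\<Sum>T\<in>\<T>. vol T * (\<Sum>f\<in>F T. \<bar>y f\<bar> * U T)))"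

text \<open>Coercivity with the test function y = w x; Young's inequality lets half of the left-hand
  side be absorbed. The face weight differs from the square of \<omega> by at most the factor
  \<open>Q\<close>, used once on each side, and d+1 counts the faces.\<close>

lemma weighted_L2_bound:
  assumes slack: "\<And>A lab \<tau> e. finite A \<Longrightarrow> card A = d + 1 \<Longrightarrow> V0/V1 * e1 \<le> e \<Longrightarrow> e \<le> e1 \<Longrightarrow>
      labels_ok g Q (A :: 'f set) lab \<tau> \<Longrightarrow>
      \<exists>\<kappa>>0. (\<Sum>f\<in>A. (\<tau> f/\<kappa> + 2 + \<kappa>/\<tau> f)/mass_share e (lab f)) \<le> (d+1)*(2+q+1/q) - \<eta>"
    and e1: "0 < e1" "e1 \<le> 1/16" and \<eta>: "0 < \<eta>"
    and q: "(real d - 2) * ((d + 1) * (2 + q + 1/q)) \<le> 4 * (real d)^2"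
    and g: "1 \<le> g" "g \<le> Q" and cu: "0 < cu"
    and \<omega>: "graded g Q \<omega> \<or> graded g Q (\<lambda>T. 1 / \<omega> T)"
    and tested: "tested cu x U"
  shows "(\<Sum>T\<in>\<T>. vol T * ((\<omega> T)\<^sup>2 * (\<Sum>f\<in>F T. (x f)\<^sup>2)))
    \<le> (cu / (min 4 (\<eta>/4) / 2))\<^sup>2 * (d+1) * Q\<^sup>2 * (\<Sum>T\<in>\<T>. vol T * ((\<omega> T)\<^sup>2 * (U T)\<^sup>2))"
proof -
  define c where "c = min 4 (\<eta>/4) / 2"
  have c: "0 < c" using \<eta> by (simp add: c_def)
  define w where "w = face_weight \<omega>"
  have Q: "0 < Q" using g by simp
  note gn = graded_nbr[OF \<omega> g]
  have w: "w f = \<omega> T * \<omega> (nbr T f)" if "T \<in> \<T>" "f \<in> F T" for T f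
    using face_weight[OF that] by (simp add: w_def)
  have wp: "0 < w f" "w f \<le> Q * (\<omega> T)\<^sup>2" "(\<omega> T)\<^sup>2 \<le> Q * w f" if "T \<in> \<T>" "f \<in> F T" for T f
  proof -
    have "0 < \<omega> T" "0 < \<omega> (nbr T f)" using gn(1) that nbr[OF that] by blast+
    then show "0 < w f" "w f \<le> Q * (\<omega> T)\<^sup>2" "(\<omega> T)\<^sup>2 \<le> Q * w f"
      using mult_left_mono[OF gn(2)[OF that], of "\<omega> T"] mult_left_mono[OF gn(3)[OF that], of "\<omega> T"]
      by (simp_all add: w[OF that] power2_eq_square mult_ac)
  qed
  define S where "S = (\<Sum>T\<in>\<T>. vol T * (\<Sum>f\<in>F T. w f * (x f)\<^sup>2))"
  define R where "R = (\<Sum>T\<in>\<T>. vol T * (\<Sum>f\<in>F T. w f * (U T)\<^sup>2))"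
  have "c * S \<le> (\<Sum>T\<in>\<T>. vol T * (\<Sum>f\<in>F T. (real d)^2 * (w f * (x f)\<^sup>2)
        - (real d - 2) * (\<Sum>f\<in>F T. x f) * (w f * x f)))"
    unfolding c_def S_def w_def by (rule coercive[OF slack e1 \<eta> q g \<omega>])
  also have "\<dots> = (\<Sum>T\<in>\<T>. vol T * (\<Sum>f\<in>F T. (real d)^2 * ((w f * x f) * x f)
        - (real d - 2) * (\<Sum>f\<in>F T. x f) * (w f * x f)))"
    by (simp add: power2_eq_square mult.assoc)
  also have "\<dots> \<le> cu * (\<Sum>T\<in>\<T>. vol T * (\<Sum>f\<in>F T. \<bar>w f * x f\<bar> * U T))"
    using tested unfolding tested_def by (rule allE)
  also have "\<dots> \<le> cu * (\<Sum>T\<in>\<T>. vol T * (\<Sum>f\<in>F T. w f * (c / (2*cu) * (x f)\<^sup>2 + cu / (2*c) * (U T)\<^sup>2)))"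
  proof (intro mult_left_mono sum_mono)
    fix T f assume Tf: "T \<in> \<T>" "f \<in> F T"
    have "\<bar>x f\<bar> * U T \<le> c / (2*cu) * (x f)\<^sup>2 + cu / (2*c) * (U T)\<^sup>2"
    proof -
      have "0 \<le> (c * \<bar>x f\<bar> - cu * U T)\<^sup>2" by simp
      then have "2 * (c * \<bar>x f\<bar>) * (cu * U T) \<le> c\<^sup>2 * (x f)\<^sup>2 + cu\<^sup>2 * (U T)\<^sup>2"
        by (simp add: power2_diff power_mult_distrib)
      then show ?thesis using c cu by (simp add: field_simps power2_eq_square)
    qed
    from mult_left_mono[OF this, of "w f"] show "\<bar>w f * x f\<bar> * U T \<le> w f * (c / (2*cu) * (x f)\<^sup>2 + cu / (2*c) * (U T)\<^sup>2)"
      using wp(1)[OF Tf] by (simp add: abs_mult mult.assoc)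
  qed (use cu vol_pos in \<open>auto intro: less_imp_le\<close>)
  also have "\<dots> = cu * (c / (2*cu) * S + cu / (2*c) * R)"
    unfolding S_def R_def by (simp add: sum_distrib_left sum.distrib distrib_left mult_ac)
  also have "\<dots> = c * S / 2 + cu\<^sup>2 / (2*c) * R"
    using c cu by (simp add: field_simps power2_eq_square)
  finally have "c * S / 2 \<le> cu\<^sup>2 / (2*c) * R" by linarith
  then have SR: "S \<le> (cu/c)\<^sup>2 * R" using c by (simp add: field_simps power2_eq_square)
  have "(\<Sum>T\<in>\<T>. vol T * ((\<omega> T)\<^sup>2 * (\<Sum>f\<in>F T. (x f)\<^sup>2))) \<le> Q * S"
  proof -
    have "vol T * ((\<omega> T)\<^sup>2 * (\<Sum>f\<in>F T. (x f)\<^sup>2)) \<le> Q * (vol T * (\<Sum>f\<in>F T. w f * (x f)\<^sup>2))" if T: "T \<in> \<T>" for T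
    proof -
      have "(\<Sum>f\<in>F T. (\<omega> T)\<^sup>2 * (x f)\<^sup>2) \<le> (\<Sum>f\<in>F T. Q * w f * (x f)\<^sup>2)"
        using wp(3)[OF T] by (intro sum_mono mult_right_mono) auto
      then have "(\<omega> T)\<^sup>2 * (\<Sum>f\<in>F T. (x f)\<^sup>2) \<le> Q * (\<Sum>f\<in>F T. w f * (x f)\<^sup>2)"
        by (simp add: sum_distrib_left mult.assoc)
      from mult_left_mono[OF this, of "vol T"] show ?thesis using vol_pos[OF T] by (simp add: mult.left_commute)
    qed
    then show ?thesis unfolding S_def sum_distrib_left[of Q] by (intro sum_mono)
  qed
  also have "\<dots> \<le> Q * ((cu/c)\<^sup>2 * R)" using SR Q by (intro mult_left_mono) auto
  finally have LR: "(\<Sum>T\<in>\<T>. vol T * ((\<omega> T)\<^sup>2 * (\<Sum>f\<in>F T. (x f)\<^sup>2))) \<le> Q * ((cu/c)\<^sup>2 * R)" .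
  have "R \<le> (d+1) * Q * (\<Sum>T\<in>\<T>. vol T * ((\<omega> T)\<^sup>2 * (U T)\<^sup>2))"
  proof -
    have "vol T * (\<Sum>f\<in>F T. w f * (U T)\<^sup>2) \<le> (d+1) * Q * (vol T * ((\<omega> T)\<^sup>2 * (U T)\<^sup>2))" if T: "T \<in> \<T>" for T
    proof -
      have "(\<Sum>f\<in>F T. w f * (U T)\<^sup>2) \<le> (\<Sum>f\<in>F T. Q * (\<omega> T)\<^sup>2 * (U T)\<^sup>2)"
        using wp(2)[OF T] by (intro sum_mono mult_right_mono) auto
      also have "\<dots> = (d+1) * Q * ((\<omega> T)\<^sup>2 * (U T)\<^sup>2)" by (simp add: cardF[OF T] mult.assoc)
      finally show ?thesis using vol_pos[OF T] by (simp add: mult.left_commute mult_left_mono)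
    qed
    then show ?thesis unfolding R_def sum_distrib_left[of "(d+1)*Q"] by (intro sum_mono)
  qed
  then have "Q * ((cu/c)\<^sup>2 * R) \<le> Q * ((cu/c)\<^sup>2 * ((d+1) * Q * (\<Sum>T\<in>\<T>. vol T * ((\<omega> T)\<^sup>2 * (U T)\<^sup>2))))"
    using Q by (intro mult_left_mono) auto
  also have "\<dots> = (cu/c)\<^sup>2 * (d+1) * Q\<^sup>2 * (\<Sum>T\<in>\<T>. vol T * ((\<omega> T)\<^sup>2 * (U T)\<^sup>2))"
    by (simp only: power2_eq_square mult_ac)
  finally show ?thesis using LR unfolding c_def[symmetric] by linarith
qed

end

section \<open>Decaying kernels and graded majorants\<close>

lemma summable_poly_geometric:
  fixes x :: real assumes "0 < x" "x < 1"
  shows "summable (\<lambda>n. (real n + 1) ^ d * x ^ n)"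
proof -
  define c where "c = (x + 1)/2"
  have c: "x < c" "c < 1" using assms by (auto simp: c_def)
  have "(\<lambda>n. (1 + 1 / (real n + 1)) ^ d * x) \<longlonglongrightarrow> (1 + 0) ^ d * x"
    using LIMSEQ_inverse_real_of_nat by (intro tendsto_intros) (simp add: inverse_eq_divide add.commute)
  then have "\<forall>\<^sub>F n in sequentially. (1 + 1 / (real n + 1)) ^ d * x < c"
    using c by (intro order_tendstoD(2)) auto
  then obtain N where N: "\<And>n. n \<ge> N \<Longrightarrow> (1 + 1 / (real n + 1)) ^ d * x < c"
    by (auto simp: eventually_sequentially)
  show ?thesis
  proof (rule summable_ratio_test[OF c(2), of N])
    fix n assume "N \<le> n"
    have "(real (Suc n) + 1) ^ d * x ^ Suc n = ((real n + 1) * (1 + 1 / (real n + 1))) ^ d * x * x ^ n"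
      by (simp add: distrib_left add.commute)
    also have "\<dots> = ((1 + 1 / (real n + 1)) ^ d * x) * ((real n + 1) ^ d * x ^ n)"
      by (simp only: power_mult_distrib mult_ac)
    also have "\<dots> \<le> c * ((real n + 1) ^ d * x ^ n)"
      using N[OF \<open>N \<le> n\<close>] assms by (intro mult_right_mono) auto
    finally show "norm ((real (Suc n) + 1) ^ d * x ^ Suc n) \<le> c * norm ((real n + 1) ^ d * x ^ n)"
      using assms by (simp add: abs_mult)
  qed
qed

lemma powr_split_square:
  fixes r p :: real assumes "0 < p"
  shows "r powr p = r powr 2 * (r powr p) powr (1 - 2/p)"
proof -
  have "2 + p * (1 - 2/p) = p" using assms by (simp add: field_simps)
  then show ?thesis by (metis powr_add powr_powr)
qed

lemma powr_pos: "0 < (x::real) \<Longrightarrow> 0 < x powr a"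
  by simp

definition poly_geom :: "nat \<Rightarrow> real \<Rightarrow> real" where
  "poly_geom d x = (\<Sum>n. (real n + 1) ^ d * x ^ n)"

lemma poly_geom:
  assumes "0 < x" "x < 1"
  shows "0 \<le> poly_geom d x" "finite I \<Longrightarrow> (\<Sum>n\<in>I. (real n + 1) ^ d * x ^ n) \<le> poly_geom d x"
  unfolding poly_geom_def using summable_poly_geometric[OF assms, of d] assms
  by (auto intro!: suminf_nonneg sum_le_suminf)

context discrete_mesh
begin

text \<open>The best chain counts, and 0 is the value if no chain joins the two simplices. With a
  supremum, prolonging chains by one step costs exactly a factor \<open>a\<close> or
  \<open>b\<close>, which becomes the grading of the majorant.\<close>

definition kern :: "real \<Rightarrow> real \<Rightarrow> 'b \<Rightarrow> 'b \<Rightarrow> real" where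
  "kern a b T T' = Sup (insert 0 {a ^ u * b ^ v | u v. reach \<T> F gen u v T T'})"

context
  fixes a b :: real assumes ab: "0 < a" "a < 1" "0 < b" "b < 1"
begin

lemma kern_bdd: "bdd_above (insert 0 {a ^ u * b ^ v | u v. reach \<T> F gen u v T T'})"
proof -
  have "a ^ u * b ^ v \<le> 1" for u v using ab by (intro mult_le_one power_le_one) auto
  then show ?thesis by (intro bdd_aboveI[of _ 1]) auto
qed

lemma kern_upper: "reach \<T> F gen u v T T' \<Longrightarrow> a ^ u * b ^ v \<le> kern a b T T'"
  unfolding kern_def by (rule cSup_upper[OF _ kern_bdd]) auto

lemma kern_nonneg: "0 \<le> kern a b T T'"
  unfolding kern_def by (rule cSup_upper[OF _ kern_bdd]) auto

lemma kern_le: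
  assumes "0 \<le> c" "\<And>u v. reach \<T> F gen u v T T' \<Longrightarrow> a ^ u * b ^ v \<le> c"
  shows "kern a b T T' \<le> c"
  unfolding kern_def using assms by (intro cSup_least) auto

lemma kern_self: "T \<in> \<T> \<Longrightarrow> 1 \<le> kern a b T T"
  using kern_upper[OF reach.start, of T] by simp

lemma kern_step:
  assumes "T' \<in> \<T>" "T'' \<in> \<T>" "T' \<noteq> T''" "f \<in> F T'" "f \<in> F T''"
  shows "gen T' = gen T'' + 1 \<Longrightarrow> a * kern a b T T' \<le> kern a b T T''"
    "gen T' \<noteq> gen T'' + 1 \<Longrightarrow> b * kern a b T T' \<le> kern a b T T''"
proof -
  assume "gen T' = gen T'' + 1"
  then have "a ^ u * b ^ v \<le> kern a b T T'' / a" if "reach \<T> F gen u v T T'" for u v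
    using kern_upper[OF reach.up[OF that assms(2-5)]] ab by (simp add: field_simps)
  then have "kern a b T T' \<le> kern a b T T'' / a" using kern_nonneg ab by (intro kern_le) auto
  then show "a * kern a b T T' \<le> kern a b T T''" using ab by (simp add: field_simps)
next
  assume "gen T' \<noteq> gen T'' + 1"
  then have "a ^ u * b ^ v \<le> kern a b T T'' / b" if "reach \<T> F gen u v T T'" for u v
    using kern_upper[OF reach.level[OF that assms(2-5)]] ab by (simp add: field_simps)
  then have "kern a b T T' \<le> kern a b T T'' / b" using kern_nonneg ab by (intro kern_le) auto
  then show "b * kern a b T T' \<le> kern a b T T''" using ab by (simp add: field_simps)
qed

text \<open>Each T' is charged to one nearly optimal chain (within a factor 2) and grouped by its
  numbers of steps, where \<open>growth\<close> applies. The 2^u there forces 2a < 1; since u+v+1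
  \<le> (u+1)(v+1), the double series splits into two polynomially weighted geometric
  series.\<close>

lemma kern_sum:
  assumes "2 * a \<le> \<alpha>" "\<alpha> < 1" "b \<le> \<nu>" "\<nu> < 1" "T \<in> \<T>"
  shows "(\<Sum>T'\<in>\<T>. vol T' * kern a b T T') \<le> 2 * Cg * poly_geom d \<alpha> * poly_geom d \<nu> * vol T"
proof -
  define P where "P = {T' \<in> \<T>. 0 < kern a b T T'}"
  have "\<exists>uv. reach \<T> F gen (fst uv) (snd uv) T T' \<and> kern a b T T' \<le> 2 * (a ^ fst uv * b ^ snd uv)"
    if "T' \<in> P" for T'
  proof (rule ccontr)
    assume neg: "\<not> ?thesis"
    have "kern a b T T' \<le> kern a b T T' / 2"
      using neg kern_nonneg[of T T'] by (intro kern_le) (force simp: not_le)+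
    then show False using that by (simp add: P_def)
  qed
  then obtain s where s: "\<And>T'. T' \<in> P \<Longrightarrow> reach \<T> F gen (fst (s T')) (snd (s T')) T T'"
    "\<And>T'. T' \<in> P \<Longrightarrow> kern a b T T' \<le> 2 * (a ^ fst (s T') * b ^ snd (s T'))" by metis
  have finP: "finite P" using fin by (simp add: P_def)
  define I J where "I = fst ` s ` P" and "J = snd ` s ` P"
  have finIJ: "finite I" "finite J" using finP by (auto simp: I_def J_def)
  have \<alpha>: "0 < \<alpha>" "0 < \<nu>" using ab assms by auto
  have "(\<Sum>T'\<in>\<T>. vol T' * kern a b T T') = (\<Sum>T'\<in>P. vol T' * kern a b T T')"
    using fin kern_nonneg by (intro sum.mono_neutral_right) (auto simp: P_def not_less antisym)
  also have "\<dots> \<le> (\<Sum>T'\<in>P. vol T' * (2 * (a ^ fst (s T') * b ^ snd (s T'))))"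
    using s(2) vol_pos by (intro sum_mono mult_left_mono) (auto simp: P_def intro: less_imp_le)
  also have "\<dots> = (\<Sum>y\<in>I \<times> J. \<Sum>T'\<in>{T'\<in>P. s T' = y}. vol T' * (2 * (a ^ fst (s T') * b ^ snd (s T'))))"
  proof -
    have "s ` P \<subseteq> I \<times> J" by (simp add: I_def J_def mem_Times_iff image_subset_iff)
    then show ?thesis using finP finIJ by (subst sum.group) auto
  qed
  also have "\<dots> \<le> (\<Sum>y\<in>I \<times> J. 2 * (a ^ fst y * b ^ snd y) * (Cg * (real (fst y) + real (snd y) + 1) ^ d * 2 ^ fst y * vol T))"
  proof (rule sum_mono)
    fix y
    have finr: "finite {T'. reach \<T> F gen (fst y) (snd y) T T'}"
      by (rule finite_subset[OF _ fin]) (auto dest: reach_in)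
    have "(\<Sum>T'\<in>{T'\<in>P. s T' = y}. vol T' * (2 * (a ^ fst (s T') * b ^ snd (s T'))))
       = 2 * (a ^ fst y * b ^ snd y) * (\<Sum>T'\<in>{T'\<in>P. s T' = y}. vol T')"
      unfolding sum_distrib_left by (intro sum.cong) auto
    also have "(\<Sum>T'\<in>{T'\<in>P. s T' = y}. vol T') \<le> (\<Sum>T'\<in>{T'. reach \<T> F gen (fst y) (snd y) T T'}. vol T')"
    proof (rule sum_mono2[OF finr])
      show "{T'\<in>P. s T' = y} \<subseteq> {T'. reach \<T> F gen (fst y) (snd y) T T'}" using s(1) by auto
    qed (auto dest!: reach_in intro: less_imp_le vol_pos)
    also have "\<dots> \<le> Cg * (real (fst y) + real (snd y) + 1) ^ d * 2 ^ fst y * vol T"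
      by (rule growth[OF assms(5)])
    finally show "(\<Sum>T'\<in>{T'\<in>P. s T' = y}. vol T' * (2 * (a ^ fst (s T') * b ^ snd (s T'))))
      \<le> 2 * (a ^ fst y * b ^ snd y) * (Cg * (real (fst y) + real (snd y) + 1) ^ d * 2 ^ fst y * vol T)"
      using ab by (simp add: mult_left_mono)
  qed
  also have "\<dots> \<le> (\<Sum>y\<in>I \<times> J. 2 * Cg * vol T * (((real (fst y) + 1) ^ d * \<alpha> ^ fst y) * ((real (snd y) + 1) ^ d * \<nu> ^ snd y)))"
  proof (rule sum_mono)
    fix y :: "nat \<times> nat"
    obtain u v where y: "y = (u,v)" by (cases y)
    have 1: "(real u + real v + 1) ^ d \<le> ((real u + 1) * (real v + 1)) ^ d"
      by (intro power_mono) (auto simp: algebra_simps)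
    have 2: "(2 * a) ^ u \<le> \<alpha> ^ u" "b ^ v \<le> \<nu> ^ v" using ab assms power_mono[of "2*a" \<alpha> u] power_mono[of b \<nu> v] by simp_all
    have "(real u + real v + 1) ^ d * ((2 * a) ^ u * b ^ v) \<le> ((real u + 1) * (real v + 1)) ^ d * (\<alpha> ^ u * \<nu> ^ v)"
      using 1 2 ab \<alpha> by (intro mult_mono) auto
    then have "2 * Cg * vol T * ((real u + real v + 1) ^ d * ((2 * a) ^ u * b ^ v))
      \<le> 2 * Cg * vol T * (((real u + 1) * (real v + 1)) ^ d * (\<alpha> ^ u * \<nu> ^ v))"
      using Cg vol_pos[OF assms(5)] by (intro mult_left_mono) auto
    then show "2 * (a ^ fst y * b ^ snd y) * (Cg * (real (fst y) + real (snd y) + 1) ^ d * 2 ^ fst y * vol T)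
      \<le> 2 * Cg * vol T * (((real (fst y) + 1) ^ d * \<alpha> ^ fst y) * ((real (snd y) + 1) ^ d * \<nu> ^ snd y))"
      by (simp add: y power_mult_distrib mult_ac)
  qed
  also have "\<dots> = 2 * Cg * vol T * ((\<Sum>u\<in>I. (real u + 1) ^ d * \<alpha> ^ u) * (\<Sum>v\<in>J. (real v + 1) ^ d * \<nu> ^ v))"
  proof -
    have "(\<Sum>u\<in>I. (real u + 1) ^ d * \<alpha> ^ u) * (\<Sum>v\<in>J. (real v + 1) ^ d * \<nu> ^ v)
      = (\<Sum>y\<in>I \<times> J. ((real (fst y) + 1) ^ d * \<alpha> ^ fst y) * ((real (snd y) + 1) ^ d * \<nu> ^ snd y))"
      unfolding sum_product sum.cartesian_product case_prod_beta ..
    then show ?thesis by (simp only: sum_distrib_left)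
  qed
  also have "\<dots> \<le> 2 * Cg * vol T * (poly_geom d \<alpha> * poly_geom d \<nu>)"
    using Cg vol_pos[OF assms(5)] \<alpha> assms finIJ
    by (intro mult_left_mono mult_mono poly_geom sum_nonneg) auto
  finally show ?thesis by (simp add: mult_ac)
qed

text \<open>H sums the kernel against g. The diagonal of the kernel is at least 1, the decay rates
  are those of \<open>kern_step\<close>, and exchanging the summations reduces the total to
  \<open>kern_sum\<close>.\<close>

lemma majorant:
  assumes "2 * a \<le> \<alpha>" "\<alpha> < 1" "b \<le> \<nu>" "\<nu> < 1" and g: "\<And>T. T \<in> \<T> \<Longrightarrow> 0 \<le> g T"
  obtains H where "\<And>T. T \<in> \<T> \<Longrightarrow> g T \<le> H T"
    "\<And>T T' f. T \<in> \<T> \<Longrightarrow> T' \<in> \<T> \<Longrightarrow> T \<noteq> T' \<Longrightarrow> f \<in> F T \<Longrightarrow> f \<in> F T' \<Longrightarrow> gen T = gen T' + 1 \<Longrightarrow> a * H T \<le> H T'"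
    "\<And>T T' f. T \<in> \<T> \<Longrightarrow> T' \<in> \<T> \<Longrightarrow> T \<noteq> T' \<Longrightarrow> f \<in> F T \<Longrightarrow> f \<in> F T' \<Longrightarrow> gen T \<noteq> gen T' + 1 \<Longrightarrow> b * H T \<le> H T'"
    "(\<Sum>T\<in>\<T>. vol T * H T) \<le> 2 * Cg * poly_geom d \<alpha> * poly_geom d \<nu> * (\<Sum>T\<in>\<T>. vol T * g T)"
proof -
  define H where "H T' = (\<Sum>T\<in>\<T>. g T * kern a b T T')" for T'
  have 1: "g T \<le> H T" if "T \<in> \<T>" for T
  proof -
    have "g T \<le> g T * kern a b T T" using g[OF that] kern_self[OF that] mult_left_mono[of 1 "kern a b T T" "g T"] by simp
    also have "\<dots> \<le> H T" unfolding H_def using g kern_nonneg fin that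
      by (intro member_le_sum[of T \<T> "\<lambda>S. g S * kern a b S T"]) auto
    finally show ?thesis .
  qed
  have step: "c * H T \<le> H T'" if "\<And>S. S \<in> \<T> \<Longrightarrow> c * kern a b S T \<le> kern a b S T'" for c T T'
    unfolding H_def sum_distrib_left
    by (intro sum_mono) (metis that g mult.left_commute mult_left_mono)
  have "(\<Sum>T\<in>\<T>. vol T * H T) = (\<Sum>S\<in>\<T>. g S * (\<Sum>T\<in>\<T>. vol T * kern a b S T))"
    unfolding H_def sum_distrib_left by (subst sum.swap) (simp add: mult.left_commute)
  also have "\<dots> \<le> (\<Sum>S\<in>\<T>. g S * (2 * Cg * poly_geom d \<alpha> * poly_geom d \<nu> * vol S))"
    using kern_sum[OF assms(1-4)] g by (intro sum_mono mult_left_mono) auto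
  also have "\<dots> = 2 * Cg * poly_geom d \<alpha> * poly_geom d \<nu> * (\<Sum>T\<in>\<T>. vol T * g T)"
    unfolding sum_distrib_left by (intro sum.cong refl) (simp only: mult_ac)
  finally show ?thesis
    using that[of H] 1 step kern_step by blast
qed

end

section \<open>Extrapolation to all exponents\<close>

lemma graded_times_powr:
  fixes \<rho> H :: "'b \<Rightarrow> real"
  assumes \<rho>: "\<And>T. T \<in> \<T> \<Longrightarrow> 0 < \<rho> T"
      "\<And>T T' f. T \<in> \<T> \<Longrightarrow> T' \<in> \<T> \<Longrightarrow> T \<noteq> T' \<Longrightarrow> f \<in> F T \<Longrightarrow> f \<in> F T' \<Longrightarrow> \<rho> T' \<le> \<gamma> * \<rho> T"
    and H: "\<And>T. T \<in> \<T> \<Longrightarrow> 0 < H T"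
     "\<And>T T' f. T \<in> \<T> \<Longrightarrow> T' \<in> \<T> \<Longrightarrow> T \<noteq> T' \<Longrightarrow> f \<in> F T \<Longrightarrow> f \<in> F T' \<Longrightarrow> gen T = gen T' + 1
        \<Longrightarrow> (\<gamma>/Q) powr (1/s) * H T \<le> H T'"
     "\<And>T T' f. T \<in> \<T> \<Longrightarrow> T' \<in> \<T> \<Longrightarrow> T \<noteq> T' \<Longrightarrow> f \<in> F T \<Longrightarrow> f \<in> F T' \<Longrightarrow> gen T \<noteq> gen T' + 1
        \<Longrightarrow> (\<gamma>/g) powr (1/s) * H T \<le> H T'"
    and c: "0 < \<gamma>" "0 < g" "0 < Q" "0 < s"
  shows "graded g Q (\<lambda>T. \<rho> T * H T powr s)"
proof -
  \<comment> \<open>The grading of \<rho> uses up the factor \<gamma>; the decay rate of H is such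
    that H^s may change by exactly the remaining factor k/\<gamma>.\<close>
  have key: "\<rho> T * H T powr s \<le> k * (\<rho> T' * H T' powr s)"
    if "T \<in> \<T>" "T' \<in> \<T>" "T \<noteq> T'" "f \<in> F T" "f \<in> F T'" "(\<gamma>/k) powr (1/s) * H T \<le> H T'" "0 < k" for T T' f k
  proof -
    have "((\<gamma>/k) powr (1/s) * H T) powr s \<le> H T' powr s"
      using that H(1)[OF that(1)] c by (intro powr_mono2) auto
    then have "\<gamma> / k * H T powr s \<le> H T' powr s"
      using H(1)[OF that(1)] c that by (simp add: powr_mult powr_powr)
    then have "H T powr s * \<gamma> \<le> k * H T' powr s" using that(7) by (simp add: field_simps)
    moreover have "\<rho> T \<le> \<gamma> * \<rho> T'" using \<rho>(2)[of T' T f] that by auto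
    ultimately have "\<rho> T * H T powr s \<le> \<gamma> * \<rho> T' * H T powr s" "\<rho> T' * (H T powr s * \<gamma>) \<le> \<rho> T' * (k * H T' powr s)"
      using \<rho>(1)[OF that(2)] by (auto intro!: mult_right_mono mult_left_mono)
    then show ?thesis by (simp add: mult_ac)
  qed
  show ?thesis unfolding graded_def
  proof (intro conjI ballI allI impI)
    fix T assume "T \<in> \<T>"
    then show "0 < \<rho> T * H T powr s" using \<rho>(1) H(1)[of T] by simp
  next
    fix T T' f assume a: "T \<in> \<T>" "T' \<in> \<T>" "T \<noteq> T' \<and> f \<in> F T \<and> f \<in> F T'"
    show "\<rho> T' * H T' powr s \<le> g * (\<rho> T * H T powr s)" if "gen T = gen T'"
      using a c that by (intro key[of _ _ f] H(3)[of _ _ f]) auto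
    show "\<rho> T * H T powr s \<le> Q * (\<rho> T' * H T' powr s)" if "gen T = gen T' + 1"
      using a c that by (intro key[of _ _ f] H(2)[of _ _ f]) auto
    show "\<rho> T' * H T' powr s \<le> g * (\<rho> T * H T powr s)" if "gen T = gen T' + 1"
      using a c that by (intro key[of _ _ f] H(3)[of _ _ f]) auto
  qed
qed

text \<open>Extrapolation from weighted \<open>L\<^sup>2\<close> bounds. For \<open>p > 2\<close> the function \<open>(\<rho> X)^(p-2)\<close> is
  absorbed into the weight, for \<open>p < 2\<close> one divides by \<open>(\<rho> U)^(2-p)\<close>; in both cases it is first
  replaced by a majorant which is graded.\<close>

lemma extrapolate:
  fixes X U \<rho> :: "'b \<Rightarrow> real" and p q \<gamma> g Q K :: real
  assumes L2: "\<And>\<omega>. graded g Q \<omega> \<or> graded g Q (\<lambda>T. 1 / \<omega> T) \<Longrightarrow>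
      (\<Sum>T\<in>\<T>. vol T * ((\<omega> T)\<^sup>2 * (X T)\<^sup>2)) \<le> K * (\<Sum>T\<in>\<T>. vol T * ((\<omega> T)\<^sup>2 * (U T)\<^sup>2))"
    and K: "0 < K" and X: "\<And>T. T \<in> \<T> \<Longrightarrow> 0 < X T" and U: "\<And>T. T \<in> \<T> \<Longrightarrow> 0 < U T"
    and \<rho>: "\<And>T. T \<in> \<T> \<Longrightarrow> 0 < \<rho> T"
      "\<And>T T' f. T \<in> \<T> \<Longrightarrow> T' \<in> \<T> \<Longrightarrow> T \<noteq> T' \<Longrightarrow> f \<in> F T \<Longrightarrow> f \<in> F T' \<Longrightarrow> \<rho> T' \<le> \<gamma> * \<rho> T"
    and c: "1 \<le> \<gamma>" "\<gamma> < g" "g \<le> Q" "\<gamma> < q" "q < Q" and p: "1 \<le> p" "\<gamma> * 2 powr \<bar>1/2 - 1/p\<bar> \<le> q"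
  defines "CK \<equiv> 2 * Cg * poly_geom d ((q/Q)\<^sup>2) * poly_geom d ((\<gamma>/g)\<^sup>2)"
  shows "(\<Sum>T\<in>\<T>. vol T * (\<rho> T * X T) powr p)
    \<le> ((K + 1) * (CK + 1)) powr p * (\<Sum>T\<in>\<T>. vol T * (\<rho> T * U T) powr p)"
proof -
  define M where "M = (K + 1) * (CK + 1)"
  define Y where "Y = (\<Sum>T\<in>\<T>. vol T * (\<rho> T * X T) powr p)"
  define Z where "Z = (\<Sum>T\<in>\<T>. vol T * (\<rho> T * U T) powr p)"
  define s where "s = \<bar>1/2 - 1/p\<bar>"
  have r: "0 < (q/Q)\<^sup>2" "(q/Q)\<^sup>2 < 1" "0 < (\<gamma>/g)\<^sup>2" "(\<gamma>/g)\<^sup>2 < 1"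
    using c by (auto simp: power_less_one_iff abs_square_less_1)
  have CK: "0 \<le> CK" unfolding CK_def using Cg poly_geom(1)[OF r(1,2)] poly_geom(1)[OF r(3,4)] by simp
  have M1: "1 \<le> M" unfolding M_def using CK K by (simp add: algebra_simps)
  have MK: "K \<le> M" "K + CK \<le> M" "CK \<le> M" unfolding M_def using CK K by (auto simp: algebra_simps)
  have Mp: "M \<le> M powr p" using powr_mono[OF p(1) M1] M1 by simp
  have Z0: "0 \<le> Z" "0 \<le> Y" unfolding Z_def Y_def using vol_pos by (auto intro!: sum_nonneg mult_nonneg_nonneg intro: less_imp_le)
  have vp: "0 \<le> vol T" if "T \<in> \<T>" for T using vol_pos[OF that] by simp
  have "Y \<le> M powr p * Z"
  proof (cases "p = 2")
    case True
    have "graded g Q \<rho>" unfolding graded_def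
    proof (intro conjI ballI allI impI)
      fix T assume "T \<in> \<T>" then show "0 < \<rho> T" by (rule \<rho>)
    next
      fix T T' f assume a: "T \<in> \<T>" "T' \<in> \<T>" "T \<noteq> T' \<and> f \<in> F T \<and> f \<in> F T'"
      then have "\<rho> T' \<le> \<gamma> * \<rho> T" "\<rho> T \<le> \<gamma> * \<rho> T'" using \<rho>(2)[of T T' f] \<rho>(2)[of T' T f] by auto
      moreover have "\<gamma> * \<rho> T \<le> g * \<rho> T" "\<gamma> * \<rho> T' \<le> Q * \<rho> T'" using c \<rho>(1) a by (auto intro!: mult_right_mono intro: less_imp_le)
      ultimately show "\<rho> T' \<le> g * \<rho> T" "\<rho> T \<le> Q * \<rho> T'" "\<rho> T' \<le> g * \<rho> T" by linarith+
    qed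
    then have "(\<Sum>T\<in>\<T>. vol T * ((\<rho> T)\<^sup>2 * (X T)\<^sup>2)) \<le> K * (\<Sum>T\<in>\<T>. vol T * ((\<rho> T)\<^sup>2 * (U T)\<^sup>2))"
      by (intro L2) simp
    moreover have "(\<rho> T * X T) powr p = (\<rho> T)\<^sup>2 * (X T)\<^sup>2" "(\<rho> T * U T) powr p = (\<rho> T)\<^sup>2 * (U T)\<^sup>2" if "T \<in> \<T>" for T
      using True \<rho>(1)[OF that] X[OF that] U[OF that] mult_pos_pos[of "\<rho> T" "X T"] mult_pos_pos[of "\<rho> T" "U T"]
      by (simp_all add: power_mult_distrib)
    ultimately have "Y \<le> K * Z" unfolding Y_def Z_def by simp
    also have "\<dots> \<le> M powr p * Z" using MK Mp Z0 by (intro mult_right_mono) auto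
    finally show ?thesis .
  next
    case False
    then have s: "0 < s" "s \<le> 1/2" using p(1) unfolding s_def by (auto simp: abs_if field_simps)
    define a b where "a = (\<gamma>/Q) powr (1/s)" and "b = (\<gamma>/g) powr (1/s)"
    have inv_s: "2 \<le> 1/s" using s by (simp add: field_simps)
    have ab: "0 < a" "a < 1" "0 < b" "b < 1" using c s powr_less_mono2[of "1/s" "\<gamma>/Q" 1] powr_less_mono2[of "1/s" "\<gamma>/g" 1] by (auto simp: a_def b_def)
    \<comment> \<open>Here the threshold is used: \<gamma> 2^s \<le> q reads 2 \<le>
      (q/\<gamma>)^(1/s), so the series ratio 2a is at most (q/Q)^(1/s). As 1/s \<ge> 2, it is
      bounded by (q/Q)^2, which does not depend on p.\<close>
    have a2: "2 * a \<le> (q/Q)\<^sup>2"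
    proof -
      have "2 powr s \<le> q / \<gamma>" using p(2) c by (simp add: s_def field_simps)
      then have "(2 powr s) powr (1/s) \<le> (q/\<gamma>) powr (1/s)" using s by (intro powr_mono2) auto
      then have "2 \<le> (q/\<gamma>) powr (1/s)" using s by (simp add: powr_powr)
      then have "2 * a \<le> (q/\<gamma>) powr (1/s) * a" using ab by (intro mult_right_mono) auto
      also have "\<dots> = (q/Q) powr (1/s)" unfolding a_def using c by (subst powr_mult[symmetric]) auto
      also have "\<dots> \<le> (q/Q) powr 2" using c inv_s by (intro powr_mono') auto
      finally show ?thesis using c by simp
    qed
    have b2: "b \<le> (\<gamma>/g)\<^sup>2"
    proof -
      have "b \<le> (\<gamma>/g) powr 2" unfolding b_def using c inv_s by (intro powr_mono') auto
      then show ?thesis using c by simp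
    qed
    note maj = majorant[OF ab a2 r(2) b2 r(4), folded CK_def]
    show ?thesis
    proof (cases "2 < p")
      case True
      then have sp: "s = 1/2 - 1/p" using p by (auto simp: s_def field_simps)
      obtain H where H: "\<And>T. T \<in> \<T> \<Longrightarrow> (\<rho> T * X T) powr p \<le> H T"
        "\<And>T T' f. T \<in> \<T> \<Longrightarrow> T' \<in> \<T> \<Longrightarrow> T \<noteq> T' \<Longrightarrow> f \<in> F T \<Longrightarrow> f \<in> F T' \<Longrightarrow> gen T = gen T' + 1 \<Longrightarrow> a * H T \<le> H T'"
        "\<And>T T' f. T \<in> \<T> \<Longrightarrow> T' \<in> \<T> \<Longrightarrow> T \<noteq> T' \<Longrightarrow> f \<in> F T \<Longrightarrow> f \<in> F T' \<Longrightarrow> gen T \<noteq> gen T' + 1 \<Longrightarrow> b * H T \<le> H T'"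
        "(\<Sum>T\<in>\<T>. vol T * H T) \<le> CK * Y"
        unfolding Y_def by (rule maj[of "\<lambda>T. (\<rho> T * X T) powr p"], simp, blast)
      have Hp: "0 < H T" if "T \<in> \<T>" for T
        using H(1)[OF that] powr_pos[OF mult_pos_pos[OF \<rho>(1)[OF that] X[OF that]], of p] by linarith
      have "graded g Q (\<lambda>T. \<rho> T * H T powr s)"
        by (rule graded_times_powr[where \<gamma> = \<gamma>]) (use \<rho> Hp H c s in \<open>auto simp: a_def b_def\<close>)
      then have L: "(\<Sum>T\<in>\<T>. vol T * ((\<rho> T * H T powr s)\<^sup>2 * (X T)\<^sup>2)) \<le> K * (\<Sum>T\<in>\<T>. vol T * ((\<rho> T * H T powr s)\<^sup>2 * (U T)\<^sup>2))"
        by (intro L2) simp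
      have Hs: "(H T powr s)\<^sup>2 = H T powr (1 - 2/p)" if "T \<in> \<T>" for T
        using Hp[OF that] by (simp add: sp power2_eq_square powr_add[symmetric])
      \<comment> \<open>With this D the right-hand integrand becomes (D (\<rho>U)^p)^(2/p)
        (H/(CK+1))^(1-2/p). Young's inequality then leaves (1-2/p) CK/(CK+1) Y from the majorant,
        less than (1-2/p) Y, which is absorbed on the left.\<close>
      define D where "D = (K * (CK+1) powr (1 - 2/p)) powr (p/2)"
      have D: "0 < D" "D powr (2/p) = K * (CK+1) powr (1 - 2/p)"
        using K CK p by (auto simp: D_def powr_powr)
      have "Y \<le> (\<Sum>T\<in>\<T>. vol T * ((\<rho> T * H T powr s)\<^sup>2 * (X T)\<^sup>2))"
        unfolding Y_def
      proof (intro sum_mono mult_left_mono vp)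
        fix T assume T: "T \<in> \<T>"
        have rX: "0 < \<rho> T * X T" using \<rho>(1)[OF T] X[OF T] by simp
        have "(\<rho> T * X T) powr p = (\<rho> T * X T) powr 2 * ((\<rho> T * X T) powr p) powr (1 - 2/p)"
          using p by (intro powr_split_square) auto
        also have "\<dots> \<le> (\<rho> T * X T) powr 2 * (H T powr (1 - 2/p))"
          using H(1)[OF T] True rX by (intro mult_left_mono powr_mono2) auto
        also have "\<dots> = (\<rho> T * H T powr s)\<^sup>2 * (X T)\<^sup>2"
          using rX Hs[OF T] by (simp add: power_mult_distrib)
        finally show "(\<rho> T * X T) powr p \<le> (\<rho> T * H T powr s)\<^sup>2 * (X T)\<^sup>2" .
      qed
      also note L
      also have "K * (\<Sum>T\<in>\<T>. vol T * ((\<rho> T * H T powr s)\<^sup>2 * (U T)\<^sup>2))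
         \<le> (\<Sum>T\<in>\<T>. vol T * (2/p * (D * (\<rho> T * U T) powr p) + (1 - 2/p) * (H T / (CK+1))))"
        unfolding sum_distrib_left
      proof (intro sum_mono)
        fix T assume T: "T \<in> \<T>"
        have rU: "0 < \<rho> T * U T" using \<rho>(1)[OF T] U[OF T] by simp
        have "K * ((\<rho> T * H T powr s)\<^sup>2 * (U T)\<^sup>2) = K * ((\<rho> T * U T) powr 2 * H T powr (1 - 2/p))"
          using rU Hs[OF T] by (simp add: power_mult_distrib)
        also have "\<dots> = (D * (\<rho> T * U T) powr p) powr (2/p) * (H T / (CK+1)) powr (1 - 2/p)"
          using rU D CK Hp[OF T] p by (simp add: powr_mult powr_divide powr_powr)
        also have "\<dots> \<le> 2/p * (D * (\<rho> T * U T) powr p) + (1 - 2/p) * (H T / (CK+1))"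
          using True CK Hp[OF T] by (intro Youngs_inequality_0 mult_pos_pos powr_pos rU D) auto
        finally have "K * ((\<rho> T * H T powr s)\<^sup>2 * (U T)\<^sup>2) \<le> 2/p * (D * (\<rho> T * U T) powr p) + (1 - 2/p) * (H T / (CK+1))" .
        from mult_left_mono[OF this vp[OF T]] show "K * (vol T * ((\<rho> T * H T powr s)\<^sup>2 * (U T)\<^sup>2))
          \<le> vol T * (2/p * (D * (\<rho> T * U T) powr p) + (1 - 2/p) * (H T / (CK+1)))" by (simp only: mult.left_commute)
      qed
      also have "\<dots> = 2/p * D * Z + (1 - 2/p) / (CK+1) * (\<Sum>T\<in>\<T>. vol T * H T)"
        unfolding Z_def sum_distrib_left sum.distrib[symmetric] by (intro sum.cong refl) (simp add: field_simps)
      also have "\<dots> \<le> 2/p * D * Z + (1 - 2/p) / (CK+1) * (CK * Y)"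
        using H(4) True CK by (intro add_left_mono mult_left_mono) auto
      also have "\<dots> \<le> 2/p * D * Z + (1 - 2/p) * Y"
      proof -
        have "CK * Y / (CK+1) \<le> Y" using CK Z0 by (simp add: divide_simps algebra_simps)
        then have "(1 - 2/p) * (CK * Y / (CK+1)) \<le> (1 - 2/p) * Y" using True by (intro mult_left_mono) auto
        then show ?thesis by simp
      qed
      finally have "2/p * Y \<le> 2/p * (D * Z)" by (simp add: algebra_simps)
      then have "Y \<le> D * Z" using p by (simp add: field_simps)
      also have "D \<le> M powr p"
      proof -
        have "(CK+1) powr (1 - 2/p) \<le> (CK+1) powr 1" using CK p by (intro powr_mono) auto
        then have "K * (CK+1) powr (1 - 2/p) \<le> (K+1) * (CK+1)" using K CK by (intro mult_mono) auto
        then have "D \<le> M powr (p/2)" unfolding D_def M_def using K CK p by (intro powr_mono2) auto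
        also have "\<dots> \<le> M powr p" using M1 p by (intro powr_mono) auto
        finally show ?thesis .
      qed
      then have "D * Z \<le> M powr p * Z" using Z0 by (intro mult_right_mono)
      finally show ?thesis .
    next
      case False
      then have p2: "p < 2" using \<open>p \<noteq> 2\<close> by simp
      then have sp: "s = 1/p - 1/2" using p by (auto simp: s_def field_simps)
      obtain H where H: "\<And>T. T \<in> \<T> \<Longrightarrow> (\<rho> T * U T) powr p \<le> H T"
        "\<And>T T' f. T \<in> \<T> \<Longrightarrow> T' \<in> \<T> \<Longrightarrow> T \<noteq> T' \<Longrightarrow> f \<in> F T \<Longrightarrow> f \<in> F T' \<Longrightarrow> gen T = gen T' + 1 \<Longrightarrow> a * H T \<le> H T'"
        "\<And>T T' f. T \<in> \<T> \<Longrightarrow> T' \<in> \<T> \<Longrightarrow> T \<noteq> T' \<Longrightarrow> f \<in> F T \<Longrightarrow> f \<in> F T' \<Longrightarrow> gen T \<noteq> gen T' + 1 \<Longrightarrow> b * H T \<le> H T'"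
        "(\<Sum>T\<in>\<T>. vol T * H T) \<le> CK * Z"
        unfolding Z_def by (rule maj[of "\<lambda>T. (\<rho> T * U T) powr p"], simp, blast)
      have Hp: "0 < H T" if "T \<in> \<T>" for T
        using H(1)[OF that] powr_pos[OF mult_pos_pos[OF \<rho>(1)[OF that] U[OF that]], of p] by linarith
      have "graded g Q (\<lambda>T. (1/\<rho> T) * H T powr s)"
      proof (rule graded_times_powr[where \<gamma> = \<gamma>])
        fix T T' f assume "T \<in> \<T>" "T' \<in> \<T>" "T \<noteq> T'" "f \<in> F T" "f \<in> F T'"
        then have "\<rho> T \<le> \<gamma> * \<rho> T'" "0 < \<rho> T" "0 < \<rho> T'" using \<rho>(2)[of T' T f] \<rho>(1) by auto
        then show "1/\<rho> T' \<le> \<gamma> * (1/\<rho> T)" by (simp add: field_simps)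
      qed (use \<rho>(1) Hp H c s in \<open>auto simp: a_def b_def\<close>)
      moreover have "(\<lambda>T. (1/\<rho> T) * H T powr s) = (\<lambda>T. 1 / (\<rho> T * H T powr -s))"
        by (simp add: powr_minus divide_inverse)
      ultimately have L: "(\<Sum>T\<in>\<T>. vol T * ((\<rho> T * H T powr -s)\<^sup>2 * (X T)\<^sup>2)) \<le> K * (\<Sum>T\<in>\<T>. vol T * ((\<rho> T * H T powr -s)\<^sup>2 * (U T)\<^sup>2))"
        by (intro L2) simp
      have Hs: "(H T powr -s)\<^sup>2 = H T powr (1 - 2/p)" if "T \<in> \<T>" for T
        using Hp[OF that] by (simp add: sp power2_eq_square powr_add[symmetric])
      \<comment> \<open>For p < 2 the exponent 1-2/p is negative, so the lower bound (\<rho>U)^p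
        \<le> H bounds the power of H from above.\<close>
      have "(\<Sum>T\<in>\<T>. vol T * ((\<rho> T * H T powr -s)\<^sup>2 * (U T)\<^sup>2)) \<le> Z"
        unfolding Z_def
      proof (intro sum_mono mult_left_mono vp)
        fix T assume T: "T \<in> \<T>"
        have rU: "0 < \<rho> T * U T" using \<rho>(1)[OF T] U[OF T] by simp
        have "(\<rho> T * H T powr -s)\<^sup>2 * (U T)\<^sup>2 = (\<rho> T * U T) powr 2 * H T powr (1 - 2/p)"
          using rU Hs[OF T] by (simp add: power_mult_distrib)
        also have "\<dots> \<le> (\<rho> T * U T) powr 2 * ((\<rho> T * U T) powr p) powr (1 - 2/p)"
          using H(1)[OF T] p p2 rU by (intro mult_left_mono powr_mono2') auto
        also have "\<dots> = (\<rho> T * U T) powr p"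
          using p by (intro powr_split_square[symmetric]) auto
        finally show "(\<rho> T * H T powr -s)\<^sup>2 * (U T)\<^sup>2 \<le> (\<rho> T * U T) powr p" .
      qed
      then have L': "(\<Sum>T\<in>\<T>. vol T * ((\<rho> T * H T powr -s)\<^sup>2 * (X T)\<^sup>2)) \<le> K * Z"
        using L K by (meson mult_left_mono order_trans less_imp_le)
      \<comment> \<open>Young's inequality with exponents p/2 and 1-p/2: the factor H^(1-2/p),
        raised to the power p/2, is cancelled by H^(1-p/2).\<close>
      have "Y \<le> (\<Sum>T\<in>\<T>. vol T * (p/2 * ((\<rho> T * H T powr -s)\<^sup>2 * (X T)\<^sup>2) + (1 - p/2) * H T))"
        unfolding Y_def
      proof (intro sum_mono mult_left_mono vp)
        fix T assume T: "T \<in> \<T>"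
        have rX: "0 < \<rho> T * X T" using \<rho>(1)[OF T] X[OF T] by simp
        have e: "(\<rho> T * H T powr -s)\<^sup>2 * (X T)\<^sup>2 = (\<rho> T * X T) powr 2 * H T powr (1 - 2/p)"
          using rX Hs[OF T] by (simp add: power_mult_distrib)
        have "((\<rho> T * X T) powr 2 * H T powr (1 - 2/p)) powr (p/2) * H T powr (1 - p/2)
          = (\<rho> T * X T) powr p * (H T powr ((1 - 2/p) * (p/2)) * H T powr (1 - p/2))"
          using rX Hp[OF T] by (simp add: powr_mult powr_powr)
        also have "\<dots> = (\<rho> T * X T) powr p"
        proof -
          have "(1 - 2/p) * (p/2) + (1 - p/2) = 0" using p by (simp add: field_simps)
          then show ?thesis using Hp[OF T] by (simp only: powr_add[symmetric]) simp
        qed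
        finally have "(\<rho> T * X T) powr p = ((\<rho> T * X T) powr 2 * H T powr (1 - 2/p)) powr (p/2) * H T powr (1 - p/2)" by simp
        also have "\<dots> \<le> p/2 * ((\<rho> T * X T) powr 2 * H T powr (1 - 2/p)) + (1 - p/2) * H T"
          using Hp[OF T] p p2
          by (intro Youngs_inequality_0 mult_pos_pos powr_pos rX) auto
        finally show "(\<rho> T * X T) powr p \<le> p/2 * ((\<rho> T * H T powr -s)\<^sup>2 * (X T)\<^sup>2) + (1 - p/2) * H T" unfolding e .
      qed
      also have "\<dots> = p/2 * (\<Sum>T\<in>\<T>. vol T * ((\<rho> T * H T powr -s)\<^sup>2 * (X T)\<^sup>2)) + (1 - p/2) * (\<Sum>T\<in>\<T>. vol T * H T)"
        unfolding sum_distrib_left sum.distrib[symmetric] by (intro sum.cong refl) (simp only: distrib_left mult.left_commute)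
      also have "\<dots> \<le> 1 * (K * Z) + 1 * (CK * Z)"
        using p p2 L' H(4) K CK Z0 Hp vp
        by (intro add_mono mult_mono) (auto intro!: sum_nonneg mult_nonneg_nonneg intro: less_imp_le)
      also have "\<dots> = (K + CK) * Z" by (simp add: algebra_simps)
      also have "\<dots> \<le> M powr p * Z" using MK Mp Z0 by (intro mult_right_mono) auto
      finally show ?thesis .
    qed
  qed
  then show ?thesis by (simp add: Y_def Z_def M_def)
qed

text \<open>\<open>extrapolate\<close> takes powers of X and U and asks for positive values. Both
  are shifted by \<epsilon>, which turns K into 2K+2, and \<epsilon> tends to 0 on the side of the
  data; the remaining 1 in 2K+3 is the one of \<open>extrapolate\<close>.\<close>

lemma weighted_Lp_bound:
  fixes \<rho> :: "'b \<Rightarrow> real"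
  assumes slack: "\<And>A lab \<tau> e. finite A \<Longrightarrow> card A = d + 1 \<Longrightarrow> V0/V1 * e1 \<le> e \<Longrightarrow> e \<le> e1 \<Longrightarrow>
      labels_ok g Q (A :: 'f set) lab \<tau> \<Longrightarrow>
      \<exists>\<kappa>>0. (\<Sum>f\<in>A. (\<tau> f/\<kappa> + 2 + \<kappa>/\<tau> f)/mass_share e (lab f)) \<le> (d+1)*(2+q+1/q) - \<eta>"
    and e1: "0 < e1" "e1 \<le> 1/16" and \<eta>: "0 < \<eta>"
    and q: "(real d - 2) * ((d + 1) * (2 + q + 1/q)) \<le> 4 * (real d)^2"
    and cu: "0 < cu"
    and \<rho>: "\<And>T. T \<in> \<T> \<Longrightarrow> 0 < \<rho> T"
      "\<And>T T' f. T \<in> \<T> \<Longrightarrow> T' \<in> \<T> \<Longrightarrow> T \<noteq> T' \<Longrightarrow> f \<in> F T \<Longrightarrow> f \<in> F T' \<Longrightarrow> \<rho> T' \<le> \<gamma> * \<rho> T"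
    and c: "1 \<le> \<gamma>" "\<gamma> < g" "g \<le> Q" "\<gamma> < q" "q < Q" and p: "1 \<le> p" "\<gamma> * 2 powr \<bar>1/2 - 1/p\<bar> \<le> q"
    and tested: "tested cu x U" and U: "\<And>T. T \<in> \<T> \<Longrightarrow> 0 \<le> U T"
  defines "K \<equiv> (cu / (min 4 (\<eta>/4) / 2))\<^sup>2 * (d+1) * Q\<^sup>2"
    and "CK \<equiv> 2 * Cg * poly_geom d ((q/Q)\<^sup>2) * poly_geom d ((\<gamma>/g)\<^sup>2)"
  shows "(\<Sum>T\<in>\<T>. vol T * (\<rho> T * sqrt (\<Sum>f\<in>F T. (x f)\<^sup>2)) powr p)
    \<le> ((2 * K + 3) * (CK + 1)) powr p * (\<Sum>T\<in>\<T>. vol T * (\<rho> T * U T) powr p)"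
proof -
  define X where "X T = sqrt (\<Sum>f\<in>F T. (x f)\<^sup>2)" for T
  have X: "0 \<le> X T" "(X T)\<^sup>2 = (\<Sum>f\<in>F T. (x f)\<^sup>2)" for T by (simp_all add: X_def sum_nonneg)
  have g1: "1 \<le> g" using c(1,2) by linarith
  have K: "0 < K" unfolding K_def using cu \<eta> c by auto
  have L2: "(\<Sum>T\<in>\<T>. vol T * ((\<omega> T)\<^sup>2 * (X T + \<epsilon>)\<^sup>2)) \<le> (2*K+2) * (\<Sum>T\<in>\<T>. vol T * ((\<omega> T)\<^sup>2 * (U T + \<epsilon>)\<^sup>2))"
    if \<omega>: "graded g Q \<omega> \<or> graded g Q (\<lambda>T. 1 / \<omega> T)" and "0 < \<epsilon>" for \<omega> \<epsilon>
  proof -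
    have "(\<Sum>T\<in>\<T>. vol T * ((\<omega> T)\<^sup>2 * (X T + \<epsilon>)\<^sup>2)) \<le> (\<Sum>T\<in>\<T>. 2 * (vol T * ((\<omega> T)\<^sup>2 * (X T)\<^sup>2)) + 2 * (vol T * ((\<omega> T)\<^sup>2 * \<epsilon>\<^sup>2)))"
    proof (intro sum_mono)
      fix T assume T: "T \<in> \<T>"
      have "(X T + \<epsilon>)\<^sup>2 \<le> 2 * (X T)\<^sup>2 + 2 * \<epsilon>\<^sup>2"
        using zero_le_power2[of "X T - \<epsilon>"] by (simp add: power2_eq_square algebra_simps)
      then have "vol T * (\<omega> T)\<^sup>2 * (X T + \<epsilon>)\<^sup>2 \<le> vol T * (\<omega> T)\<^sup>2 * (2 * (X T)\<^sup>2 + 2 * \<epsilon>\<^sup>2)"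
        using vol_pos[OF T] by (intro mult_left_mono) auto
      then show "vol T * ((\<omega> T)\<^sup>2 * (X T + \<epsilon>)\<^sup>2) \<le> 2 * (vol T * ((\<omega> T)\<^sup>2 * (X T)\<^sup>2)) + 2 * (vol T * ((\<omega> T)\<^sup>2 * \<epsilon>\<^sup>2))"
        by (simp add: algebra_simps)
    qed
    also have "\<dots> = 2 * (\<Sum>T\<in>\<T>. vol T * ((\<omega> T)\<^sup>2 * (X T)\<^sup>2)) + 2 * (\<Sum>T\<in>\<T>. vol T * ((\<omega> T)\<^sup>2 * \<epsilon>\<^sup>2))"
      by (simp add: sum.distrib sum_distrib_left)
    also have "\<dots> \<le> 2 * (K * (\<Sum>T\<in>\<T>. vol T * ((\<omega> T)\<^sup>2 * (U T)\<^sup>2))) + 2 * (\<Sum>T\<in>\<T>. vol T * ((\<omega> T)\<^sup>2 * \<epsilon>\<^sup>2))"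
    proof -
      have "(\<Sum>T\<in>\<T>. vol T * ((\<omega> T)\<^sup>2 * (X T)\<^sup>2)) \<le> K * (\<Sum>T\<in>\<T>. vol T * ((\<omega> T)\<^sup>2 * (U T)\<^sup>2))"
        unfolding X(2) K_def by (rule weighted_L2_bound[OF slack e1 \<eta> q g1 c(3) cu \<omega> tested])
      then show ?thesis by linarith
    qed
    also have "\<dots> \<le> 2 * (K * (\<Sum>T\<in>\<T>. vol T * ((\<omega> T)\<^sup>2 * (U T + \<epsilon>)\<^sup>2))) + 2 * (\<Sum>T\<in>\<T>. vol T * ((\<omega> T)\<^sup>2 * (U T + \<epsilon>)\<^sup>2))"
    proof -
      have "(\<Sum>T\<in>\<T>. vol T * ((\<omega> T)\<^sup>2 * (U T)\<^sup>2)) \<le> (\<Sum>T\<in>\<T>. vol T * ((\<omega> T)\<^sup>2 * (U T + \<epsilon>)\<^sup>2))"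
        using U \<open>0 < \<epsilon>\<close> vol_pos by (intro sum_mono mult_left_mono power_mono) (simp_all add: less_imp_le)
      moreover have "(\<Sum>T\<in>\<T>. vol T * ((\<omega> T)\<^sup>2 * \<epsilon>\<^sup>2)) \<le> (\<Sum>T\<in>\<T>. vol T * ((\<omega> T)\<^sup>2 * (U T + \<epsilon>)\<^sup>2))"
        using U \<open>0 < \<epsilon>\<close> vol_pos by (intro sum_mono mult_left_mono power_mono) (simp_all add: less_imp_le)
      ultimately show ?thesis using K by (intro add_mono mult_left_mono) simp_all
    qed
    finally show ?thesis by (simp only: distrib_right mult.assoc)
  qed
  have ext: "(\<Sum>T\<in>\<T>. vol T * (\<rho> T * X T) powr p)
      \<le> ((2 * K + 3) * (CK + 1)) powr p * (\<Sum>T\<in>\<T>. vol T * (\<rho> T * (U T + \<epsilon>)) powr p)" if "0 < \<epsilon>" for \<epsilon>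
  proof -
    have "(\<Sum>T\<in>\<T>. vol T * (\<rho> T * X T) powr p) \<le> (\<Sum>T\<in>\<T>. vol T * (\<rho> T * (X T + \<epsilon>)) powr p)"
      using p(1) that
      by (intro sum_mono mult_left_mono powr_mono2 mult_nonneg_nonneg X(1) less_imp_le[OF vol_pos] less_imp_le[OF \<rho>(1)]) simp_all
    also have "\<dots> \<le> ((2 * K + 2 + 1) * (CK + 1)) powr p * (\<Sum>T\<in>\<T>. vol T * (\<rho> T * (U T + \<epsilon>)) powr p)"
      unfolding CK_def
      by (rule extrapolate[OF L2 _ _ _ \<rho> c p]) (use K X(1) U that in \<open>simp_all add: add_nonneg_pos\<close>)
    finally show ?thesis by (simp only: add.assoc) simp
  qed
  have lim: "((\<lambda>\<epsilon>. ((2 * K + 3) * (CK + 1)) powr p * (\<Sum>T\<in>\<T>. vol T * (\<rho> T * (U T + \<epsilon>)) powr p))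
     \<longlongrightarrow> ((2 * K + 3) * (CK + 1)) powr p * (\<Sum>T\<in>\<T>. vol T * (\<rho> T * (U T + 0)) powr p)) (at_right 0)"
  proof (intro tendsto_mult tendsto_const tendsto_sum)
    fix T assume T: "T \<in> \<T>"
    show "((\<lambda>\<epsilon>. (\<rho> T * (U T + \<epsilon>)) powr p) \<longlongrightarrow> (\<rho> T * (U T + 0)) powr p) (at_right 0)"
    proof (rule tendsto_powr2)
      show "((\<lambda>\<epsilon>. \<rho> T * (U T + \<epsilon>)) \<longlongrightarrow> \<rho> T * (U T + 0)) (at_right 0)"
        by (intro tendsto_intros)
      show "\<forall>\<^sub>F \<epsilon> in at_right 0. 0 \<le> \<rho> T * (U T + \<epsilon>)"
        using eventually_at_right_less[of 0] by eventually_elim (use \<rho>(1)[OF T] U[OF T] in auto)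
    qed (use p in auto)
  qed
  have "(\<Sum>T\<in>\<T>. vol T * (\<rho> T * X T) powr p)
      \<le> ((2 * K + 3) * (CK + 1)) powr p * (\<Sum>T\<in>\<T>. vol T * (\<rho> T * (U T + 0)) powr p)"
  proof (rule tendsto_lowerbound[OF lim])
    show "\<forall>\<^sub>F \<epsilon> in at_right 0. (\<Sum>T\<in>\<T>. vol T * (\<rho> T * X T) powr p)
      \<le> ((2 * K + 3) * (CK + 1)) powr p * (\<Sum>T\<in>\<T>. vol T * (\<rho> T * (U T + \<epsilon>)) powr p)"
      using eventually_at_right_less[of 0] by (rule eventually_mono) (rule ext)
  qed simp
  then show ?thesis by (simp add: X_def)
qed

end

text \<open>\<open>M\<close> is chosen before the mesh, the weight, the data and the exponent, and
  it enters as M^p: taking roots gives one constant for all p.\<close>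

theorem discrete_stability:
  fixes d :: nat and \<gamma> q V0 V1 Cg cu :: real
  assumes "2 \<le> d" and \<gamma>: "1 \<le> \<gamma>" "\<gamma> < q" and q: "(real d - 2) * ((d + 1) * (2 + q + 1/q)) \<le> 4 * (real d)^2"
    and V: "0 < V0" "V0 \<le> V1" and Cg: "0 \<le> Cg" and cu: "0 < cu"
  shows "\<exists>M>0. \<forall>(\<T>::'b set) (F::'b \<Rightarrow> 'f set) vol gen \<rho> x U p.
     discrete_mesh \<T> F d vol gen V0 V1 Cg \<and> (\<forall>T\<in>\<T>. 0 < \<rho> T \<and> 0 \<le> U T) \<and>
     (\<forall>T\<in>\<T>. \<forall>T'\<in>\<T>. \<forall>f. T \<noteq> T' \<and> f \<in> F T \<and> f \<in> F T' \<longrightarrow> \<rho> T' \<le> \<gamma> * \<rho> T) \<and>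
     discrete_mesh.tested \<T> F d vol cu x U \<and> 1 \<le> p \<and> \<gamma> * 2 powr \<bar>1/2 - 1/p\<bar> \<le> q \<longrightarrow>
     (\<Sum>T\<in>\<T>. vol T * (\<rho> T * sqrt (\<Sum>f\<in>F T. (x f)\<^sup>2)) powr p) \<le> M powr p * (\<Sum>T\<in>\<T>. vol T * (\<rho> T * U T) powr p)"
proof -
  \<comment> \<open>Any value strictly between \<gamma> and q serves: \<gamma> < g makes the series
    over the other steps converge, g < q gives the slack on faces between equal generations.\<close>
  define g where "g = (\<gamma> + q)/2"
  have g: "\<gamma> < g" "g < q" using \<gamma> by (auto simp: g_def)
  obtain e1 Q \<eta> where e: "0 < e1" "e1 \<le> 1/16" "q < Q" "0 < \<eta>" and
    slack: "\<And>(A::'f set) lab \<tau> e. finite A \<Longrightarrow> card A = d + 1 \<Longrightarrow> V0/V1 * e1 \<le> e \<Longrightarrow> e \<le> e1 \<Longrightarrow>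
      labels_ok g Q A lab \<tau> \<Longrightarrow>
      \<exists>\<kappa>>0. (\<Sum>f\<in>A. (\<tau> f/\<kappa> + 2 + \<kappa>/\<tau> f)/mass_share e (lab f)) \<le> (d+1)*(2+q+1/q) - \<eta>"
    using slack_constants[where 'f = 'f, of g q "V0/V1" "d+1"] V \<gamma> g by auto
  define K where "K = (cu / (min 4 (\<eta>/4) / 2))\<^sup>2 * (d+1) * Q\<^sup>2"
  define CK where "CK = 2 * Cg * poly_geom d ((q/Q)\<^sup>2) * poly_geom d ((\<gamma>/g)\<^sup>2)"
  have r: "0 < (q/Q)\<^sup>2" "(q/Q)\<^sup>2 < 1" "0 < (\<gamma>/g)\<^sup>2" "(\<gamma>/g)\<^sup>2 < 1"
    using \<gamma> g e by (auto simp: power_less_one_iff abs_square_less_1)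
  have "0 \<le> K" "0 \<le> CK" unfolding K_def CK_def using Cg poly_geom(1)[OF r(1,2)] poly_geom(1)[OF r(3,4)] by auto
  then have M: "0 < (2 * K + 3) * (CK + 1)" by simp
  show ?thesis
  proof (intro exI[of _ "(2 * K + 3) * (CK + 1)"] conjI M allI impI; elim conjE)
    fix \<T> :: "'b set" and F :: "'b \<Rightarrow> 'f set" and vol gen \<rho> x U p
    assume m: "discrete_mesh \<T> F d vol gen V0 V1 Cg" and a: "\<forall>T\<in>\<T>. 0 < \<rho> T \<and> 0 \<le> U T"
     "\<forall>T\<in>\<T>. \<forall>T'\<in>\<T>. \<forall>f. T \<noteq> T' \<and> f \<in> F T \<and> f \<in> F T' \<longrightarrow> \<rho> T' \<le> \<gamma> * \<rho> T"
     "discrete_mesh.tested \<T> F d vol cu x U" "1 \<le> p" "\<gamma> * 2 powr \<bar>1/2 - 1/p\<bar> \<le> q"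
    show "(\<Sum>T\<in>\<T>. vol T * (\<rho> T * sqrt (\<Sum>f\<in>F T. (x f)\<^sup>2)) powr p)
       \<le> ((2 * K + 3) * (CK + 1)) powr p * (\<Sum>T\<in>\<T>. vol T * (\<rho> T * U T) powr p)"
      unfolding K_def CK_def
      by (rule discrete_mesh.weighted_Lp_bound[OF m slack e(1,2,4) q cu _ _ \<gamma>(1) g(1) _ \<gamma>(2) e(3) a(4,5,3)])
        (use a g e in auto)
  qed
qed

section \<open>Barycentric coordinates\<close>

lemma lborel_uminus: "distr lborel borel uminus = (lborel :: 'a::euclidean_space measure)"
proof -
  have e: "(\<lambda>x::'a. 0 + (\<Sum>j\<in>Basis. (- 1 * (x \<bullet> j)) *\<^sub>R j)) = uminus"
    by (auto simp: sum_negf euclidean_representation)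
  have "(lborel :: 'a measure) = density (distr lborel borel uminus) (\<lambda>_. 1)"
    using lborel_affine_euclidean[where c = "\<lambda>_::'a. - 1 :: real" and t = "0::'a"] unfolding e by simp
  then have "(lborel :: 'a measure) = distr lborel borel uminus" by (simp only: density_1)
  then show ?thesis by (rule sym)
qed

lemma measurable_indicator_compose:
  "h \<in> M \<rightarrow>\<^sub>M borel \<Longrightarrow> B \<in> sets borel \<Longrightarrow> (\<lambda>x. indicator B (h x) :: ennreal) \<in> borel_measurable M"
  by (rule measurable_compose[OF _ borel_measurable_indicator])

text \<open>Uniqueness of translation invariant measures: the image measure \<nu> is translation
  invariant, and Fubini applied to the indicators of A and of the unit ball E gives |A| \<nu>(E) =
  |E| \<nu>(A). The factor stays unspecified, as later only ratios of integrals are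
  compared.\<close>

lemma lborel_linear_bij:
  fixes L :: "'a::euclidean_space \<Rightarrow> 'a"
  assumes L: "linear L" "bij L"
  shows "\<exists>c>0. distr lborel borel L = density lborel (\<lambda>_. ennreal c)"
proof -
  have Lm: "L \<in> borel_measurable borel"
    using L(1) by (intro borel_measurable_continuous_onI linear_continuous_on) (simp add: linear_conv_bounded_linear)
  define \<nu> where "\<nu> A = (\<integral>\<^sup>+ z. indicator A (L z) \<partial>lborel)" for A :: "'a set"
  define E where "E = ball (0::'a) 1"
  have trans: "(\<integral>\<^sup>+ z. g (z + c) \<partial>lborel) = (\<integral>\<^sup>+ z. g z \<partial>lborel)" if "g \<in> borel_measurable borel" for g :: "'a \<Rightarrow> ennreal" and c
    using nn_integral_distr[of "(+) c" lborel borel g] that by (simp add: lborel_distr_plus add.commute)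
  have refl: "(\<integral>\<^sup>+ z. g (c - z) \<partial>lborel) = (\<integral>\<^sup>+ z. g z \<partial>lborel)" if g: "g \<in> borel_measurable borel" for g :: "'a \<Rightarrow> ennreal" and c
  proof -
    have "(\<integral>\<^sup>+ z. g z \<partial>lborel) = (\<integral>\<^sup>+ z. g (z + c) \<partial>lborel)" using trans[OF g] by simp
    also have "\<dots> = (\<integral>\<^sup>+ z. g (z + c) \<partial>distr lborel borel uminus)" by (simp only: lborel_uminus)
    also have "\<dots> = (\<integral>\<^sup>+ z. g (- z + c) \<partial>lborel)" using g by (intro nn_integral_distr) auto
    finally show ?thesis by simp
  qed
  have \<nu>shift: "(\<integral>\<^sup>+ z. indicator A (L z - x) \<partial>lborel) = \<nu> A" if A: "A \<in> sets borel" for A x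
  proof -
    obtain y where y: "L y = x" using L(2) by (metis bij_pointE)
    have "(\<integral>\<^sup>+ z. indicator A (L z - x) \<partial>lborel) = (\<integral>\<^sup>+ z. indicator A (L (z + - y)) \<partial>lborel)"
      using y by (simp add: linear_diff[OF L(1)])
    also have "\<dots> = \<nu> A" unfolding \<nu>_def by (rule trans) (rule measurable_compose[OF Lm borel_measurable_indicator[OF A]])
    finally show ?thesis .
  qed
  have cross: "emeasure lborel A * \<nu> E = emeasure lborel E * \<nu> A" if A: "A \<in> sets borel" for A
  proof -
    have Em: "E \<in> sets borel" by (simp add: E_def)
    note Lm[measurable]
    have m1: "(\<lambda>(x, z). indicator A x * indicator E (L z - x) :: ennreal) \<in> borel_measurable (lborel \<Otimes>\<^sub>M (lborel::'a measure))"
      unfolding case_prod_beta by (intro borel_measurable_times_ennreal measurable_indicator_compose A Em) measurable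
    have m2: "(\<lambda>(z, y). indicator E y * indicator A (L z - y) :: ennreal) \<in> borel_measurable (lborel \<Otimes>\<^sub>M (lborel::'a measure))"
      unfolding case_prod_beta by (intro borel_measurable_times_ennreal measurable_indicator_compose A Em) measurable
    have "emeasure lborel A * \<nu> E = (\<integral>\<^sup>+ x. indicator A x * \<nu> E \<partial>lborel)"
      using A by (simp add: nn_integral_multc)
    also have "\<dots> = (\<integral>\<^sup>+ x. \<integral>\<^sup>+ z. indicator A x * indicator E (L z - x) \<partial>lborel \<partial>lborel)"
    proof (intro nn_integral_cong)
      fix x :: 'a
      have "(\<lambda>z. indicator E (L z - x) :: ennreal) \<in> borel_measurable lborel" by (intro measurable_indicator_compose Em) measurable
      then show "indicator A x * \<nu> E = (\<integral>\<^sup>+ z. indicator A x * indicator E (L z - x) \<partial>lborel)"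
        by (subst nn_integral_cmult) (simp_all add: \<nu>shift[OF Em])
    qed
    also have "\<dots> = (\<integral>\<^sup>+ z. \<integral>\<^sup>+ x. indicator A x * indicator E (L z - x) \<partial>lborel \<partial>lborel)"
      using lborel_pair.Fubini'[OF m1] by simp
    also have "\<dots> = (\<integral>\<^sup>+ z. \<integral>\<^sup>+ y. indicator E y * indicator A (L z - y) \<partial>lborel \<partial>lborel)"
    proof (rule nn_integral_cong)
      fix z :: 'a
      have "(\<lambda>x. indicator A x * indicator E (L z - x) :: ennreal) \<in> borel_measurable borel" by (intro borel_measurable_times_ennreal measurable_indicator_compose A Em) measurable
      from refl[OF this, of "L z", symmetric] show "(\<integral>\<^sup>+ x. indicator A x * indicator E (L z - x) \<partial>lborel)
        = (\<integral>\<^sup>+ y. indicator E y * indicator A (L z - y) \<partial>lborel)" by (simp add: mult.commute[of "indicator A _"])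
    qed
    also have "\<dots> = (\<integral>\<^sup>+ y. \<integral>\<^sup>+ z. indicator E y * indicator A (L z - y) \<partial>lborel \<partial>lborel)"
      using lborel_pair.Fubini'[OF m2] by simp
    also have "\<dots> = (\<integral>\<^sup>+ y. indicator E y * \<nu> A \<partial>lborel)"
    proof (intro nn_integral_cong)
      fix y :: 'a
      have "(\<lambda>z. indicator A (L z - y) :: ennreal) \<in> borel_measurable lborel" by (intro measurable_indicator_compose A) measurable
      then show "(\<integral>\<^sup>+ z. indicator E y * indicator A (L z - y) \<partial>lborel) = indicator E y * \<nu> A"
        by (subst nn_integral_cmult) (simp_all add: \<nu>shift[OF A])
    qed
    also have "\<dots> = emeasure lborel E * \<nu> A" using Em by (simp add: nn_integral_multc)
    finally show ?thesis .
  qed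
  have E: "0 < emeasure lborel E" "emeasure lborel E < \<infinity>"
    using content_ball_pos[of 1 "0::'a"] emeasure_bounded_finite[of "ball (0::'a) 1"]
    by (auto simp: E_def measure_def enn2real_positive_iff)
  have inj: "inj L" using L(2) by (simp add: bij_is_inj)
  have pre: "{z. L z \<in> E} = L -` E" by auto
  have opn: "open (L -` E)"
    using L(1) by (intro open_vimage linear_continuous_on) (auto simp: E_def linear_conv_bounded_linear)
  have bdd: "bounded (L -` E)"
  proof -
    obtain B where B: "0 < B" "\<And>x. B * norm x \<le> norm (L x)" using linear_inj_bounded_below_pos[OF L(1) inj] by metis
    have "norm x \<le> 1 / B" if "x \<in> L -` E" for x
      using B(2)[of x] that B(1) by (simp add: E_def field_simps)
    then show ?thesis unfolding bounded_iff by blast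
  qed
  have \<nu>E: "\<nu> E = emeasure lborel (L -` E)"
  proof -
    have "(\<lambda>z. indicator E (L z) :: ennreal) = indicator (L -` E)" by (auto simp: indicator_def)
    then show ?thesis unfolding \<nu>_def using opn by simp
  qed
  have \<nu>Ef: "\<nu> E < \<infinity>" unfolding \<nu>E using emeasure_bounded_finite[OF bdd] .
  have "0 \<in> L -` E" using linear_0[OF L(1)] by (simp add: E_def)
  then have \<nu>Ep: "0 < \<nu> E" unfolding \<nu>E
    using emeasure_lborel_countable opn open_not_negligible[of "L -` E"] negligible_iff_null_sets
    by (metis (no_types, lifting) empty_iff gr_zeroI null_setsI null_sets_completionI borel_open sets_lborel)
  obtain a b where ab: "\<nu> E = ennreal a" "emeasure lborel E = ennreal b" "0 \<le> a" "0 \<le> b"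
    using \<nu>Ef E(2) by (cases "\<nu> E"; cases "emeasure lborel E") auto
  define c where "c = a / b"
  have cp: "0 < c" using ab E \<nu>Ep by (auto simp: c_def)
  have cE: "ennreal c = \<nu> E / emeasure lborel E" using ab E by (simp add: c_def divide_ennreal)
  have "distr lborel borel L = density lborel (\<lambda>_. ennreal c)"
  proof (rule measure_eqI)
    fix A assume "A \<in> sets (distr lborel borel L)"
    then have A: "A \<in> sets borel" by simp
    have "emeasure (distr lborel borel L) A = \<nu> A"
      unfolding \<nu>_def using A Lm by (subst nn_integral_distr[symmetric, of L lborel borel "indicator A"]) auto
    also have "\<dots> = ennreal c * emeasure lborel A"
    proof -
      have "emeasure lborel E * \<nu> A / emeasure lborel E = \<nu> A"
        using E by (simp add: ennreal_mult_divide_eq mult.commute less_top[symmetric])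
      then show ?thesis unfolding cE using cross[OF A, symmetric] by (simp add: ennreal_times_divide mult.commute)
    qed
    also have "\<dots> = emeasure (density lborel (\<lambda>_. ennreal c)) A"
      using A by (simp add: emeasure_density nn_integral_cmult)
    finally show "emeasure (distr lborel borel L) A = emeasure (density lborel (\<lambda>_. ennreal c)) A" .
  qed simp
  then show ?thesis using cp by blast
qed

lemma lborel_integral_affine:
  fixes L :: "'a::euclidean_space \<Rightarrow> 'a"
  assumes L: "linear L" "bij L"
  shows "\<exists>c>0. \<forall>z. \<forall>g::'a \<Rightarrow> real. g \<in> borel_measurable borel \<longrightarrow>
    (\<integral>x. g (z + L x) \<partial>lborel) = c * (\<integral>x. g x \<partial>lborel)"
proof -
  obtain c where c: "0 < c" "distr lborel borel L = density lborel (\<lambda>_. ennreal c)"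
    using lborel_linear_bij[OF L] by auto
  have Lm: "L \<in> borel_measurable borel"
    using L(1) by (intro borel_measurable_continuous_onI linear_continuous_on) (simp add: linear_conv_bounded_linear)
  have "(\<integral>x. g (z + L x) \<partial>lborel) = c * (\<integral>x. g x \<partial>lborel)" if g: "g \<in> borel_measurable borel" for z and g :: "'a \<Rightarrow> real"
  proof -
    have "(\<integral>x. g (z + L x) \<partial>lborel) = (\<integral>x. g (z + x) \<partial>distr lborel borel L)"
      using g Lm by (subst integral_distr) auto
    also have "\<dots> = c * (\<integral>x. g (z + x) \<partial>lborel)"
      unfolding c(2) using g c(1) by (subst integral_density) auto
    also have "(\<integral>x. g (z + x) \<partial>lborel) = (\<integral>x. g x \<partial>distr lborel borel ((+) z))"
      using g by (subst integral_distr) auto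
    finally show ?thesis by (simp add: lborel_distr_plus)
  qed
  then show ?thesis using c(1) by blast
qed

section \<open>Full simplices and barycentric coordinates\<close>

definition full_simplex :: "'a::euclidean_space set \<Rightarrow> bool" where
  "full_simplex C \<longleftrightarrow> finite C \<and> \<not> affine_dependent C \<and> card C = DIM('a) + 1"

text \<open>The barycentric coordinate belonging to v, as an affine function on the whole space. The
  vertices span the space, so the vertex values determine it and the choice is unambiguous
  (\<open>bary_unique\<close>).\<close>

definition bary :: "'a::euclidean_space set \<Rightarrow> 'a \<Rightarrow> 'a \<Rightarrow> real" where
  "bary C v = (SOME h. (\<exists>a b. h = (\<lambda>x. a \<bullet> x + b)) \<and> (\<forall>u\<in>C. h u = (if u = v then 1 else 0)))"

lemma affine_sum:
  fixes a :: "'a::real_inner"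
  assumes "sum c S = 1"
  shows "a \<bullet> (\<Sum>u\<in>S. c u *\<^sub>R u) + b = (\<Sum>u\<in>S. c u * (a \<bullet> u + b))"
  using assms by (simp add: inner_sum_right distrib_left sum.distrib sum_distrib_right[symmetric])

text \<open>Applying the functional of v to an affine dependence leaves only the coefficient of v,
  which is therefore 0.\<close>

lemma affine_independent_dual:
  fixes C :: "'a::euclidean_space set"
  assumes "finite C" "\<And>v. v \<in> C \<Longrightarrow> \<exists>a b. \<forall>u\<in>C. a \<bullet> u + b = (if u = v then 1 else 0 :: real)"
  shows "\<not> affine_dependent C"
proof
  assume "affine_dependent C"
  then obtain c where c: "sum c C = 0" "\<exists>v\<in>C. c v \<noteq> 0" "(\<Sum>v\<in>C. c v *\<^sub>R v) = 0"
    using affine_dependent_explicit_finite[OF assms(1)] by auto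
  then obtain v where v: "v \<in> C" "c v \<noteq> 0" by auto
  obtain a b where ab: "\<forall>u\<in>C. a \<bullet> u + b = (if u = v then 1 else 0 :: real)" using assms(2)[OF v(1)] by auto
  have "0 = a \<bullet> (\<Sum>u\<in>C. c u *\<^sub>R u) + b * sum c C" using c by simp
  also have "\<dots> = (\<Sum>u\<in>C. c u * (a \<bullet> u + b))"
    by (simp add: inner_sum_right distrib_left sum.distrib sum_distrib_left mult.commute)
  also have "\<dots> = (\<Sum>u\<in>C. if u = v then c u else 0)" using ab by (intro sum.cong) auto
  also have "\<dots> = c v" using assms(1) v(1) by simp
  finally show False using v(2) by simp
qed

lemma bary_affine_ex:
  fixes C :: "'a::euclidean_space set"
  assumes "full_simplex C" "v \<in> C"
  shows "\<exists>h. (\<exists>a b. h = (\<lambda>x. a \<bullet> x + b)) \<and> (\<forall>u\<in>C. h u = (if u = v then 1 else 0 :: real))"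
proof -
  have C: "finite C" "\<not> affine_dependent C" "card C = DIM('a) + 1" using assms by (auto simp: full_simplex_def)
  have "C - {v} \<noteq> {}"
  proof
    assume "C - {v} = {}"
    then have "card C \<le> 1" using assms(2) by (metis Diff_eq_empty_iff card.empty card_insert_if card_mono finite.emptyI finite.insertI empty_iff One_nat_def)
    then show False using C(3) DIM_positive[where 'a = 'a] by simp
  qed
  \<comment> \<open>A base point different from v, so that v - u0 is one of the independent
    differences.\<close>
  then obtain u0 where u0: "u0 \<in> C" "u0 \<noteq> v" by auto
  define B where "B = (\<lambda>x. - u0 + x) ` (C - {u0})"
  have "insert u0 (C - {u0}) = C" using u0 by auto
  then have ind: "independent B" using affine_dependent_iff_dependent[of u0 "C - {u0}"] C(2) unfolding B_def by simp
  obtain f :: "'a \<Rightarrow> real" where f: "linear f" "\<forall>x\<in>B. f x = (if x = v - u0 then 1 else 0)"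
    using linear_independent_extend[OF ind, of "\<lambda>x. if x = v - u0 then 1 else 0"] by auto
  define a where "a = (\<Sum>i\<in>Basis. f i *\<^sub>R i)"
  have fa: "f x = a \<bullet> x" for x
  proof -
    have "f x = f (\<Sum>i\<in>Basis. (x \<bullet> i) *\<^sub>R i)" by (simp add: euclidean_representation)
    also have "\<dots> = (\<Sum>i\<in>Basis. (x \<bullet> i) * f i)" by (simp add: linear_sum[OF f(1)] linear_cmul[OF f(1)])
    also have "\<dots> = a \<bullet> x" by (simp add: a_def inner_sum_left inner_commute[of x] mult.commute)
    finally show ?thesis .
  qed
  have "a \<bullet> u + (- (a \<bullet> u0)) = (if u = v then 1 else 0)" if "u \<in> C" for u
  proof -
    have "a \<bullet> u + (- (a \<bullet> u0)) = f (- u0 + u)" by (simp add: fa inner_diff_right)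
    also have "\<dots> = (if u = v then 1 else 0)"
    proof (cases "u = u0")
      case False
      then have "- u0 + u \<in> B" using that by (auto simp: B_def)
      then show ?thesis using f(2) by (auto simp: algebra_simps)
    qed (use u0 linear_0[OF f(1)] in auto)
    finally show ?thesis .
  qed
  then show ?thesis by (intro exI[of _ "\<lambda>x. a \<bullet> x + (- (a \<bullet> u0))"] conjI exI[of _ a] exI[of _ "- (a \<bullet> u0)"] refl ballI)
qed

context
  fixes C :: "'a::euclidean_space set"
  assumes C: "full_simplex C"
begin

lemma full_simplex_facts: "finite C" "\<not> affine_dependent C" "card C = DIM('a) + 1" "C \<noteq> {}"
  using C by (auto simp: full_simplex_def)

lemma bary_affine: "v \<in> C \<Longrightarrow> \<exists>a b. bary C v = (\<lambda>x. a \<bullet> x + b)"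
  and bary_vertex: "v \<in> C \<Longrightarrow> u \<in> C \<Longrightarrow> bary C v u = (if u = v then 1 else 0)"
  using someI_ex[OF bary_affine_ex[OF C], of v] unfolding bary_def by auto

lemma bary_sum_scaleR:
  assumes "v \<in> C" "sum c S = 1"
  shows "bary C v (\<Sum>u\<in>S. c u *\<^sub>R u) = (\<Sum>u\<in>S. c u * bary C v u)"
  using bary_affine[OF assms(1)] affine_sum[OF assms(2)] by auto

lemma bary_combination:
  assumes "v \<in> C" "sum c C = 1"
  shows "bary C v (\<Sum>u\<in>C. c u *\<^sub>R u) = c v"
proof -
  have "bary C v (\<Sum>u\<in>C. c u *\<^sub>R u) = (\<Sum>u\<in>C. if u = v then c u else 0)"
    unfolding bary_sum_scaleR[OF assms] using bary_vertex[OF assms(1)] by (intro sum.cong) auto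
  then show ?thesis using assms(1) full_simplex_facts(1) by simp
qed

lemma bary_ex: "\<exists>c. sum c C = 1 \<and> x = (\<Sum>u\<in>C. c u *\<^sub>R u)"
proof -
  have "aff_dim C = int (DIM('a))"
    using aff_dim_affine_independent[of C] full_simplex_facts by simp
  then have "affine hull C = UNIV" by (simp add: aff_dim_eq_full)
  then have "x \<in> affine hull C" by simp
  then show ?thesis unfolding affine_hull_finite[OF full_simplex_facts(1)] by auto
qed

lemma bary_sum: "(\<Sum>v\<in>C. bary C v x) = 1" and bary_repr: "(\<Sum>v\<in>C. bary C v x *\<^sub>R v) = x"
proof -
  obtain c where c: "sum c C = 1" "x = (\<Sum>u\<in>C. c u *\<^sub>R u)" using bary_ex by blast
  have "bary C v x = c v" if "v \<in> C" for v unfolding c(2) using bary_combination[OF that c(1)] .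
  then show "(\<Sum>v\<in>C. bary C v x) = 1" "(\<Sum>v\<in>C. bary C v x *\<^sub>R v) = x" using c by simp_all
qed

lemma affine_eq_bary: "a \<bullet> x + b = (\<Sum>v\<in>C. bary C v x * (a \<bullet> v + b))"
  using affine_sum[OF bary_sum, of a x b] by (simp add: bary_repr)

lemma bary_unique:
  assumes "\<And>u. u \<in> C \<Longrightarrow> a \<bullet> u + b = (if u = v then 1 else 0)" "v \<in> C"
  shows "bary C v x = a \<bullet> x + b"
proof -
  have "a \<bullet> x + b = (\<Sum>u\<in>C. bary C u x * (a \<bullet> u + b))" by (rule affine_eq_bary)
  also have "\<dots> = (\<Sum>u\<in>C. if u = v then bary C u x else 0)"
    using assms(1) by (intro sum.cong) auto
  finally have "a \<bullet> x + b = (\<Sum>u\<in>C. if u = v then bary C u x else 0)" .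
  then show ?thesis using assms(2) full_simplex_facts(1) by simp
qed

lemma in_convex_hull_bary: "x \<in> convex hull C \<longleftrightarrow> (\<forall>v\<in>C. 0 \<le> bary C v x)"
proof
  assume "x \<in> convex hull C"
  then obtain c where "\<forall>v\<in>C. 0 \<le> c v" "sum c C = 1" "(\<Sum>v\<in>C. c v *\<^sub>R v) = x"
    unfolding convex_hull_finite[OF full_simplex_facts(1)] by auto
  then show "\<forall>v\<in>C. 0 \<le> bary C v x" using bary_combination by metis
next
  assume "\<forall>v\<in>C. 0 \<le> bary C v x"
  then show "x \<in> convex hull C"
    unfolding convex_hull_finite[OF full_simplex_facts(1)]
    by (intro CollectI exI[of _ "\<lambda>v. bary C v x"] conjI bary_sum bary_repr)
qed

lemma in_interior_bary: "x \<in> interior (convex hull C) \<longleftrightarrow> (\<forall>v\<in>C. 0 < bary C v x)"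
proof -
  have "interior (convex hull C) = {y. \<exists>u. (\<forall>x\<in>C. 0 < u x) \<and> sum u C = 1 \<and> (\<Sum>x\<in>C. u x *\<^sub>R x) = y}"
    using full_simplex_facts(3) by (subst interior_convex_hull_explicit_minimal[OF full_simplex_facts(2)]) simp
  also have "x \<in> \<dots> \<longleftrightarrow> (\<forall>v\<in>C. 0 < bary C v x)"
  proof
    assume "x \<in> {y. \<exists>u. (\<forall>x\<in>C. 0 < u x) \<and> sum u C = 1 \<and> (\<Sum>x\<in>C. u x *\<^sub>R x) = y}"
    then obtain u where "\<forall>x\<in>C. 0 < u x" "sum u C = 1" "(\<Sum>x\<in>C. u x *\<^sub>R x) = x" by auto
    then show "\<forall>v\<in>C. 0 < bary C v x" using bary_combination by metis
  next
    assume "\<forall>v\<in>C. 0 < bary C v x"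
    then show "x \<in> {y. \<exists>u. (\<forall>x\<in>C. 0 < u x) \<and> sum u C = 1 \<and> (\<Sum>x\<in>C. u x *\<^sub>R x) = y}"
      by (intro CollectI exI[of _ "\<lambda>v. bary C v x"] conjI bary_sum bary_repr)
  qed
  finally show ?thesis .
qed

lemma bary_continuous: "v \<in> C \<Longrightarrow> continuous_on S (bary C v)"
  using bary_affine[of v] by (auto intro!: continuous_intros)

lemma bary_measurable: "v \<in> C \<Longrightarrow> bary C v \<in> borel_measurable borel"
  by (intro borel_measurable_continuous_onI bary_continuous)

lemma interior_simplex_nonempty: "interior (convex hull C) \<noteq> {}"
proof -
  have "(\<Sum>u\<in>C. (1 / card C) *\<^sub>R u) \<in> interior (convex hull C)"
    unfolding in_interior_bary
    using bary_combination[of _ "\<lambda>_. 1 / card C"] full_simplex_facts by (auto simp: card_gt_0_iff)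
  then show ?thesis by auto
qed

lemma measure_simplex_pos: "0 < measure lborel (convex hull C)"
proof -
  have S: "convex hull C \<in> lmeasurable"
    using full_simplex_facts(1) by (simp add: lmeasurable_compact finite_imp_compact_convex_hull)
  have "\<not> negligible (convex hull C)"
    using interior_simplex_nonempty open_not_negligible negligible_subset interior_subset open_interior by metis
  then have "measure lebesgue (convex hull C) \<noteq> 0" using negligible_iff_measure S by blast
  moreover have "measure lebesgue (convex hull C) = measure lborel (convex hull C)"
    using full_simplex_facts(1) by (intro measure_completion) (simp add: borel_compact finite_imp_compact_convex_hull)
  ultimately show ?thesis using measure_nonneg[of lborel "convex hull C"] by linarith
qed

lemma bary_bounded:
  assumes "x \<in> convex hull C" "v \<in> C"
  shows "0 \<le> bary C v x" "bary C v x \<le> 1"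
proof -
  show "0 \<le> bary C v x" using assms in_convex_hull_bary by blast
  have "bary C v x \<le> (\<Sum>v\<in>C. bary C v x)"
    using assms in_convex_hull_bary full_simplex_facts(1) by (intro member_le_sum) auto
  then show "bary C v x \<le> 1" by (simp add: bary_sum)
qed

end

text \<open>The affine map that sends each vertex u to \<sigma> u multiplies all integrals by one
  factor, so integrals of coordinate polynomials over different simplices are proportional. With C =
  C' it provides the symmetries of a simplex.\<close>

lemma bary_transfer:
  fixes C C' :: "'a::euclidean_space set"
  assumes C: "full_simplex C" and C': "full_simplex C'" and \<sigma>: "bij_betw \<sigma> C C'"
  shows "\<exists>\<phi> c. 0 < c \<and> (\<forall>x. \<forall>u\<in>C. bary C' (\<sigma> u) (\<phi> x) = bary C u x) \<and>
    (\<forall>g::'a \<Rightarrow> real. g \<in> borel_measurable borel \<longrightarrow> (\<integral>x. g (\<phi> x) \<partial>lborel) = c * (\<integral>x. g x \<partial>lborel))"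
proof -
  define \<phi> where "\<phi> x = (\<Sum>u\<in>C. bary C u x *\<^sub>R \<sigma> u)" for x
  have inj: "inj_on \<sigma> C" and im: "\<sigma> ` C = C'" using \<sigma> by (auto simp: bij_betw_def)
  have bary: "bary C' (\<sigma> u) (\<phi> x) = bary C u x" if u: "u \<in> C" for u x
  proof -
    define k where "k w = bary C (inv_into C \<sigma> w) x" for w
    have k: "k (\<sigma> w) = bary C w x" if "w \<in> C" for w using that inj by (simp add: k_def)
    have "\<phi> x = (\<Sum>w\<in>C. k (\<sigma> w) *\<^sub>R \<sigma> w)" unfolding \<phi>_def using k by (intro sum.cong) auto
    also have "\<dots> = (\<Sum>w\<in>C'. k w *\<^sub>R w)" unfolding im[symmetric] by (simp add: sum.reindex[OF inj])
    finally have 1: "\<phi> x = (\<Sum>w\<in>C'. k w *\<^sub>R w)" .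
    have "sum k C' = (\<Sum>w\<in>C. k (\<sigma> w))" unfolding im[symmetric] by (simp add: sum.reindex[OF inj])
    also have "\<dots> = 1" using bary_sum[OF C, of x] k by simp
    finally have "bary C' (\<sigma> u) (\<phi> x) = k (\<sigma> u)" unfolding 1 using im u by (intro bary_combination[OF C']) auto
    then show ?thesis using k[OF u] by simp
  qed
  obtain a b where ab: "\<And>u. u \<in> C \<Longrightarrow> bary C u = (\<lambda>x. a u \<bullet> x + b u)"
    using bary_affine[OF C] by metis
  define z where "z = (\<Sum>u\<in>C. b u *\<^sub>R \<sigma> u)"
  define L where "L x = (\<Sum>u\<in>C. (a u \<bullet> x) *\<^sub>R \<sigma> u)" for x
  have \<phi>L: "\<phi> x = z + L x" for x
    unfolding \<phi>_def z_def L_def sum.distrib[symmetric] using ab by (intro sum.cong) (auto simp: scaleR_left_distrib)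
  have lin: "linear L"
    by (rule linearI) (simp_all add: L_def inner_add_right scaleR_left_distrib sum.distrib scaleR_sum_right)
  have "inj L"
  proof (rule injI)
    fix x y assume "L x = L y"
    then have "\<phi> x = \<phi> y" by (simp add: \<phi>L)
    then have "bary C u x = bary C u y" if "u \<in> C" for u using bary[OF that] by metis
    then have "(\<Sum>u\<in>C. bary C u x *\<^sub>R u) = (\<Sum>u\<in>C. bary C u y *\<^sub>R u)" by (intro sum.cong) auto
    then show "x = y" unfolding bary_repr[OF C] .
  qed
  then have "bij L" using linear_injective_imp_surjective[OF lin] by (simp add: bij_def)
  from lborel_integral_affine[OF lin this] obtain c where "c > 0" "\<And>g::'a \<Rightarrow> real. g \<in> borel_measurable borel \<Longrightarrow>
    (\<integral>x. g (z + L x) \<partial>lborel) = c * (\<integral>x. g x \<partial>lborel)" by auto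
  then show ?thesis using bary by (intro exI[of _ \<phi>] exI[of _ c]) (simp add: \<phi>L)
qed

section \<open>Second moments of barycentric coordinates\<close>

definition moment :: "'a::euclidean_space set \<Rightarrow> 'a \<Rightarrow> 'a \<Rightarrow> real" where
  "moment C u v = (\<integral>x. indicator (convex hull C) x * (bary C u x * bary C v x) \<partial>lborel)"

lemma simplex_borel: "finite C \<Longrightarrow> convex hull C \<in> sets borel"
  for C :: "'a::euclidean_space set"
  by (simp add: borel_compact finite_imp_compact_convex_hull)

lemma integral_indicator_simplex: "finite C \<Longrightarrow> (\<integral>x. indicator (convex hull C) x \<partial>lborel) = measure lborel (convex hull C)"
  for C :: "'a::euclidean_space set"
  using simplex_borel[of C] by simp

lemma moment_transfer:
  fixes C C' :: "'a::euclidean_space set"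
  assumes C: "full_simplex C" and C': "full_simplex C'" and \<sigma>: "bij_betw \<sigma> C C'"
  shows "\<exists>c>0. measure lborel (convex hull C) = c * measure lborel (convex hull C') \<and>
    (\<forall>u\<in>C. \<forall>v\<in>C. moment C u v = c * moment C' (\<sigma> u) (\<sigma> v))"
proof -
  obtain \<phi> c where c: "0 < c" and \<phi>: "\<And>x u. u \<in> C \<Longrightarrow> bary C' (\<sigma> u) (\<phi> x) = bary C u x"
    and int: "\<And>g::'a \<Rightarrow> real. g \<in> borel_measurable borel \<Longrightarrow> (\<integral>x. g (\<phi> x) \<partial>lborel) = c * (\<integral>x. g x \<partial>lborel)"
    using bary_transfer[OF assms] by metis
  note fC = full_simplex_facts(1)[OF C] full_simplex_facts(1)[OF C']
  have im: "\<sigma> ` C = C'" using \<sigma> by (auto simp: bij_betw_def)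
  have ind: "indicator (convex hull C') (\<phi> x) = (indicator (convex hull C) x :: real)" for x
  proof -
    have "(\<forall>w\<in>\<sigma> ` C. 0 \<le> bary C' w (\<phi> x)) \<longleftrightarrow> (\<forall>w\<in>C. 0 \<le> bary C w x)" using \<phi> by auto
    then have "\<phi> x \<in> convex hull C' \<longleftrightarrow> x \<in> convex hull C"
      unfolding in_convex_hull_bary[OF C] in_convex_hull_bary[OF C'] im .
    then show ?thesis by (simp add: indicator_def)
  qed
  have "measure lborel (convex hull C) = c * measure lborel (convex hull C')"
    using int[of "indicator (convex hull C')"] simplex_borel[OF fC(2)] integral_indicator_simplex[OF fC(1)] integral_indicator_simplex[OF fC(2)]
    by (simp add: ind)
  moreover have "moment C u v = c * moment C' (\<sigma> u) (\<sigma> v)" if "u \<in> C" "v \<in> C" for u v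
  proof -
    have "(\<lambda>x. indicator (convex hull C') x * (bary C' (\<sigma> u) x * bary C' (\<sigma> v) x)) \<in> borel_measurable borel"
      using bary_measurable[OF C', of "\<sigma> u"] bary_measurable[OF C', of "\<sigma> v"] im that simplex_borel[OF fC(2)]
      by (intro borel_measurable_times borel_measurable_indicator) auto
    from int[OF this] show ?thesis using that by (simp add: moment_def ind \<phi>)
  qed
  ultimately show ?thesis using c by blast
qed

lemma bary_integrable:
  fixes C :: "'a::euclidean_space set"
  assumes "finite C" "continuous_on UNIV g"
  shows "integrable lborel (\<lambda>x. indicator (convex hull C) x * (g x :: real))"
  using borel_integrable_compact[OF finite_imp_compact_convex_hull[OF assms(1)] continuous_on_subset[OF assms(2)]]
  by simp

text \<open>The half on the side of u, where the coordinate at u is at least the one at v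
  (\<open>in_half\<close>).\<close>

definition half :: "'a::euclidean_space set \<Rightarrow> 'a \<Rightarrow> 'a \<Rightarrow> 'a set" where
  "half C u v = insert (midpoint u v) (C - {v})"

context
  fixes C :: "'a::euclidean_space set" and u v :: 'a
  assumes C: "full_simplex C" and uv: "u \<in> C" "v \<in> C" "u \<noteq> v"
begin

lemma bary_midpoint: "w \<in> C \<Longrightarrow> bary C w (midpoint u v) = (if w = u \<or> w = v then 1/2 else 0)"
proof -
  assume w: "w \<in> C"
  obtain a b where ab: "bary C w = (\<lambda>x. a \<bullet> x + b)" using bary_affine[OF C w] by auto
  have "bary C w (midpoint u v) = (bary C w u + bary C w v) / 2"
    by (simp add: ab midpoint_def inner_add_right field_simps)
  then show ?thesis using bary_vertex[OF C w] uv by auto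
qed

lemma midpoint_notin: "midpoint u v \<notin> C"
  using bary_midpoint[OF uv(1)] bary_vertex[OF C uv(1), of "midpoint u v"] by (auto split: if_splits)

text \<open>Candidates for the barycentric coordinates of the half, written in those of C. They give
  both its affine independence and, by uniqueness, the formulas \<open>bary_half\<close>.\<close>

lemma half_dual:
  assumes "w \<in> half C u v"
  defines "h \<equiv> (if w = midpoint u v then (\<lambda>x. 2 * bary C v x) else if w = u then (\<lambda>x. bary C u x - bary C v x) else bary C w)"
  shows "\<exists>a b. h = (\<lambda>x. a \<bullet> x + b)" "w' \<in> half C u v \<Longrightarrow> h w' = (if w' = w then 1 else 0)"
proof -
  have w: "w = midpoint u v \<or> w \<in> C \<and> w \<noteq> v" using assms(1) by (auto simp: half_def)
  obtain av bv where v: "bary C v = (\<lambda>x. av \<bullet> x + bv)" using bary_affine[OF C uv(2)] by auto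
  obtain au bu where u: "bary C u = (\<lambda>x. au \<bullet> x + bu)" using bary_affine[OF C uv(1)] by auto
  show "\<exists>a b. h = (\<lambda>x. a \<bullet> x + b)"
  proof (cases "w = midpoint u v")
    case True
    then have "h = (\<lambda>x. (2 *\<^sub>R av) \<bullet> x + 2 * bv)" by (auto simp: h_def v)
    then show ?thesis by blast
  next
    case False
    then have wC: "w \<in> C" using w by auto
    show ?thesis
    proof (cases "w = u")
      case True
      then have "h = (\<lambda>x. (au - av) \<bullet> x + (bu - bv))" using False by (auto simp: h_def u v inner_diff_left)
      then show ?thesis by blast
    next
      case F: False
      then show ?thesis using bary_affine[OF C wC] False by (auto simp: h_def)
    qed
  qed
  show "h w' = (if w' = w then 1 else 0)" if "w' \<in> half C u v"
  proof (cases "w' = midpoint u v")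
    case True
    then show ?thesis using w uv bary_midpoint midpoint_notin by (auto simp: h_def)
  next
    case False
    then have "w' \<in> C" "w' \<noteq> v" using that by (auto simp: half_def)
    then show ?thesis using w uv bary_vertex[OF C] midpoint_notin by (auto simp: h_def)
  qed
qed

lemma half_full: "full_simplex (half C u v)"
  unfolding full_simplex_def
proof (intro conjI)
  show fin: "finite (half C u v)" using full_simplex_facts(1)[OF C] by (simp add: half_def)
  show "\<not> affine_dependent (half C u v)"
  proof (rule affine_independent_dual[OF fin])
    fix w assume w: "w \<in> half C u v"
    from half_dual(1)[OF w] half_dual(2)[OF w]
    show "\<exists>a b. \<forall>u\<in>half C u v. a \<bullet> u + b = (if u = w then 1 else 0 :: real)" by metis
  qed
  show "card (half C u v) = DIM('a) + 1"
    using full_simplex_facts[OF C] uv midpoint_notin by (simp add: half_def)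
qed

lemma bary_half:
  shows "bary (half C u v) (midpoint u v) x = 2 * bary C v x"
    "bary (half C u v) u x = bary C u x - bary C v x"
    "w \<in> C \<Longrightarrow> w \<noteq> u \<Longrightarrow> w \<noteq> v \<Longrightarrow> bary (half C u v) w x = bary C w x"
proof -
  have *: "bary (half C u v) w x = (if w = midpoint u v then (\<lambda>x. 2 * bary C v x) else if w = u then (\<lambda>x. bary C u x - bary C v x) else bary C w) x"
    if w: "w \<in> half C u v" for w
  proof -
    obtain a b where ab: "(if w = midpoint u v then (\<lambda>x. 2 * bary C v x) else if w = u then (\<lambda>x. bary C u x - bary C v x) else bary C w) = (\<lambda>x. a \<bullet> x + b)"
      using half_dual(1)[OF w] by auto
    show ?thesis unfolding ab
      using half_dual(2)[OF w] unfolding ab by (intro bary_unique[OF half_full _ w])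
  qed
  show "bary (half C u v) (midpoint u v) x = 2 * bary C v x"
    using *[of "midpoint u v"] by (simp add: half_def)
  show "bary (half C u v) u x = bary C u x - bary C v x"
    using *[of u] uv midpoint_notin by (auto simp: half_def)
  show "bary (half C u v) w x = bary C w x" if "w \<in> C" "w \<noteq> u" "w \<noteq> v"
    using *[of w] that midpoint_notin by (auto simp: half_def)
qed

lemma in_half: "x \<in> convex hull half C u v \<longleftrightarrow> x \<in> convex hull C \<and> bary C v x \<le> bary C u x"
proof -
  define H where "H = half C u v"
  have H: "H = insert (midpoint u v) (insert u (C - {u, v}))" using uv by (auto simp: half_def H_def)
  have "(\<forall>w\<in>H. 0 \<le> b w) \<longleftrightarrow> 0 \<le> b (midpoint u v) \<and> 0 \<le> b u \<and> (\<forall>w\<in>C - {u, v}. 0 \<le> b w)" for b :: "'a \<Rightarrow> real"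
    unfolding H by auto
  then have "x \<in> convex hull half C u v \<longleftrightarrow> 0 \<le> bary H (midpoint u v) x \<and> 0 \<le> bary H u x \<and> (\<forall>w\<in>C - {u, v}. 0 \<le> bary H w x)"
    unfolding in_convex_hull_bary[OF half_full] H_def by simp
  also have "\<dots> \<longleftrightarrow> 0 \<le> bary C v x \<and> bary C v x \<le> bary C u x \<and> (\<forall>w\<in>C - {u, v}. 0 \<le> bary C w x)"
    unfolding H_def bary_half(1,2) using bary_half(3) by auto
  also have "\<dots> \<longleftrightarrow> (\<forall>w\<in>C. 0 \<le> bary C w x) \<and> bary C v x \<le> bary C u x"
    using uv by auto
  finally show ?thesis by (simp add: in_convex_hull_bary[OF C])
qed

lemma AE_bary_neq: "AE x in lborel. bary C u x \<noteq> bary C v x"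
proof -
  obtain av bv where v: "bary C v = (\<lambda>x. av \<bullet> x + bv)" using bary_affine[OF C uv(2)] by auto
  obtain au bu where u: "bary C u = (\<lambda>x. au \<bullet> x + bu)" using bary_affine[OF C uv(1)] by auto
  have "au - av \<noteq> 0"
  proof
    assume "au - av = 0"
    then have "bary C u u - bary C v u = bary C u v - bary C v v" by (simp add: u v)
    then show False using bary_vertex[OF C] uv by auto
  qed
  then have "negligible {x. (au - av) \<bullet> x = bv - bu}" by (intro negligible_hyperplane) simp
  then have "AE x in lebesgue. x \<notin> {x. (au - av) \<bullet> x = bv - bu}"
    by (intro AE_not_in) (simp add: negligible_iff_null_sets)
  then have "AE x in lebesgue. bary C u x \<noteq> bary C v x"
    by eventually_elim (auto simp: u v inner_diff_left)
  then show ?thesis by (simp add: AE_completion_iff)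
qed

end

text \<open>The halves overlap only where the coordinates at u and v agree, which is a hyperplane
  and hence null.\<close>

lemma integral_halves:
  fixes C :: "'a::euclidean_space set"
  assumes C: "full_simplex C" and uv: "u \<in> C" "v \<in> C" "u \<noteq> v" and g: "continuous_on UNIV g"
  shows "(\<integral>x. indicator (convex hull C) x * (g x :: real) \<partial>lborel)
    = (\<integral>x. indicator (convex hull half C u v) x * g x \<partial>lborel) + (\<integral>x. indicator (convex hull half C v u) x * g x \<partial>lborel)"
proof -
  have fin: "finite (half C u v)" "finite (half C v u)" "finite C"
    using full_simplex_facts(1)[OF C] by (auto simp: half_def)
  note I = bary_integrable[OF fin(1) g] bary_integrable[OF fin(2) g] bary_integrable[OF fin(3) g]
  have "AE x in lborel. indicator (convex hull C) x * g x = indicator (convex hull half C u v) x * g x + indicator (convex hull half C v u) x * g x"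
    using AE_bary_neq[OF C uv]
  proof eventually_elim
    case (elim x)
    then show ?case using in_half[OF C uv, of x] in_half[OF C uv(2,1) uv(3)[symmetric], of x]
      by (auto simp: indicator_def)
  qed
  then have "(\<integral>x. indicator (convex hull C) x * g x \<partial>lborel)
     = (\<integral>x. indicator (convex hull half C u v) x * g x + indicator (convex hull half C v u) x * g x \<partial>lborel)"
    using I by (intro integral_cong_AE) auto
  then show ?thesis using I by simp
qed

text \<open>Exchanging u and v is an affine symmetry of C. It preserves the volume of C, so its
  integral factor is 1, and it maps one half to the other. The case k = 0 concerns volumes, k = 1
  moments.\<close>

lemma integral_half_swap:
  fixes C :: "'a::euclidean_space set"
  assumes C: "full_simplex C" and uv: "u \<in> C" "v \<in> C" "u \<noteq> v"
  shows "(\<integral>x. indicator (convex hull half C v u) x * (bary C u x * bary C v x) ^ k \<partial>lborel)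
    = (\<integral>x. indicator (convex hull half C u v) x * (bary C u x * bary C v x) ^ k \<partial>lborel)"
proof -
  define \<sigma> where "\<sigma> = (\<lambda>w. if w = u then v else if w = v then u else w)"
  have \<sigma>: "bij_betw \<sigma> C C" using uv by (intro bij_betw_byWitness[of _ \<sigma>]) (auto simp: \<sigma>_def)
  obtain \<phi> c where c: "0 < c" and \<phi>: "\<And>x w. w \<in> C \<Longrightarrow> bary C (\<sigma> w) (\<phi> x) = bary C w x"
    and int: "\<And>g::'a \<Rightarrow> real. g \<in> borel_measurable borel \<Longrightarrow> (\<integral>x. g (\<phi> x) \<partial>lborel) = c * (\<integral>x. g x \<partial>lborel)"
    using bary_transfer[OF C C \<sigma>] by metis
  have fin: "finite C" "finite (half C u v)" "finite (half C v u)"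
    using full_simplex_facts(1)[OF C] by (auto simp: half_def)
  have \<phi>u: "bary C v (\<phi> x) = bary C u x" "bary C u (\<phi> x) = bary C v x" for x
    using \<phi>[OF uv(1), of x] \<phi>[OF uv(2), of x] uv by (auto simp: \<sigma>_def)
  have im: "\<sigma> ` C = C" using \<sigma> by (auto simp: bij_betw_def)
  have hull: "\<phi> x \<in> convex hull C \<longleftrightarrow> x \<in> convex hull C" for x
  proof -
    have "(\<forall>w\<in>\<sigma> ` C. 0 \<le> bary C w (\<phi> x)) \<longleftrightarrow> (\<forall>w\<in>C. 0 \<le> bary C w x)" using \<phi> by auto
    then show ?thesis unfolding in_convex_hull_bary[OF C] im .
  qed
  have "c = 1"
  proof -
    have "measure lborel (convex hull C) = c * measure lborel (convex hull C)"
      using int[of "indicator (convex hull C)"] simplex_borel[OF fin(1)] integral_indicator_simplex[OF fin(1)]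
      by (simp add: hull indicator_def)
    then show ?thesis using measure_simplex_pos[OF C] by simp
  qed
  have half: "\<phi> x \<in> convex hull half C v u \<longleftrightarrow> x \<in> convex hull half C u v" for x
    unfolding in_half[OF C uv] in_half[OF C uv(2,1) uv(3)[symmetric]] hull \<phi>u ..
  have m: "(\<lambda>x. indicator (convex hull half C v u) x * (bary C u x * bary C v x) ^ k) \<in> borel_measurable borel"
    using simplex_borel[OF fin(3)] bary_measurable[OF C uv(1)] bary_measurable[OF C uv(2)]
    by (intro borel_measurable_times borel_measurable_indicator borel_measurable_power)
  have "(\<integral>x. indicator (convex hull half C v u) (\<phi> x) * (bary C u (\<phi> x) * bary C v (\<phi> x)) ^ k \<partial>lborel)
    = (\<integral>x. indicator (convex hull half C u v) x * (bary C u x * bary C v x) ^ k \<partial>lborel)"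
    by (intro Bochner_Integration.integral_cong refl) (simp add: \<phi>u half indicator_def mult.commute)
  then show ?thesis using int[OF m] \<open>c = 1\<close> by simp
qed

lemma measure_half:
  fixes C :: "'a::euclidean_space set"
  assumes C: "full_simplex C" and uv: "u \<in> C" "v \<in> C" "u \<noteq> v"
  shows "measure lborel (convex hull half C u v) = measure lborel (convex hull C) / 2"
proof -
  have fin: "finite C" "finite (half C u v)" "finite (half C v u)"
    using full_simplex_facts(1)[OF C] by (auto simp: half_def)
  show ?thesis
    using integral_halves[OF C uv, of "\<lambda>_. 1"] integral_half_swap[OF C uv, of 0]
      integral_indicator_simplex[OF fin(1)] integral_indicator_simplex[OF fin(2)] integral_indicator_simplex[OF fin(3)]
    by simp
qed

lemma ex_bij_pair:
  assumes "finite C" "finite D" "card C = card D" "u \<in> C" "v \<in> C" "u \<noteq> v" "u' \<in> D" "v' \<in> D" "u' \<noteq> v'"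
  shows "\<exists>\<sigma>. bij_betw \<sigma> C D \<and> \<sigma> u = u' \<and> \<sigma> v = v'"
proof -
  have "card (C - {u, v}) = card C - card {u, v}" "card (D - {u', v'}) = card D - card {u', v'}"
    using assms by (auto intro!: card_Diff_subset)
  then have "card (C - {u, v}) = card (D - {u', v'})" using assms by simp
  then obtain f where f: "bij_betw f (C - {u, v}) (D - {u', v'})"
    using finite_same_card_bij[OF finite_Diff[OF assms(1)] finite_Diff[OF assms(2)]] by meson
  define \<sigma> where "\<sigma> = (\<lambda>w. if w = u then u' else if w = v then v' else f w)"
  have "bij_betw \<sigma> (C - {u, v}) (D - {u', v'})" using f by (rule bij_betw_cong[THEN iffD1, rotated]) (auto simp: \<sigma>_def)
  moreover have "bij_betw \<sigma> {u, v} {u', v'}" using assms by (auto simp: bij_betw_def \<sigma>_def)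
  ultimately have "bij_betw \<sigma> ((C - {u, v}) \<union> {u, v}) ((D - {u', v'}) \<union> {u', v'})" by (rule bij_betw_combine) auto
  moreover have "(C - {u, v}) \<union> {u, v} = C" "(D - {u', v'}) \<union> {u', v'} = D" using assms by auto
  ultimately show ?thesis using assms by (intro exI[of _ \<sigma>]) (auto simp: \<sigma>_def)
qed

lemma moment_proportional:
  fixes C D :: "'a::euclidean_space set"
  assumes C: "full_simplex C" and D: "full_simplex D" and uv: "u \<in> C" "v \<in> C" "u \<noteq> v" "u' \<in> D" "v' \<in> D" "u' \<noteq> v'"
  shows "moment C u v / measure lborel (convex hull C) = moment D u' v' / measure lborel (convex hull D)"
    "moment C u u / measure lborel (convex hull C) = moment D u' u' / measure lborel (convex hull D)"
proof -
  obtain \<sigma> where \<sigma>: "bij_betw \<sigma> C D" "\<sigma> u = u'" "\<sigma> v = v'"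
    using ex_bij_pair[OF full_simplex_facts(1)[OF C] full_simplex_facts(1)[OF D] _ uv]
      full_simplex_facts(3)[OF C] full_simplex_facts(3)[OF D] by auto
  from moment_transfer[OF C D \<sigma>(1)] obtain c where c: "c > 0" "measure lborel (convex hull C) = c * measure lborel (convex hull D)"
    "\<forall>u\<in>C. \<forall>v\<in>C. moment C u v = c * moment D (\<sigma> u) (\<sigma> v)" by blast
  show "moment C u v / measure lborel (convex hull C) = moment D u' v' / measure lborel (convex hull D)"
    "moment C u u / measure lborel (convex hull C) = moment D u' u' / measure lborel (convex hull D)"
    using c uv \<sigma> by auto
qed

lemma other_vertex:
  fixes C :: "'a::euclidean_space set"
  assumes C: "full_simplex C" and "u \<in> C"
  obtains v where "v \<in> C" "v \<noteq> u"
proof -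
  have "card C \<noteq> 1" using full_simplex_facts(3)[OF C] DIM_positive[where 'a = 'a] by simp
  then have "C \<noteq> {u}" by auto
  then show ?thesis using assms(2) that by blast
qed

lemma moment_sum:
  fixes C :: "'a::euclidean_space set"
  assumes C: "full_simplex C"
  shows "(\<Sum>u\<in>C. \<Sum>v\<in>C. moment C u v) = measure lborel (convex hull C)"
    "u \<in> C \<Longrightarrow> (\<Sum>v\<in>C. moment C u v) = (\<integral>x. indicator (convex hull C) x * bary C u x \<partial>lborel)"
proof -
  have fin: "finite C" using full_simplex_facts(1)[OF C] .
  have int: "integrable lborel (\<lambda>x. indicator (convex hull C) x * (bary C u x * bary C v x))" if "u \<in> C" "v \<in> C" for u v
    using bary_integrable[OF fin] that by (intro bary_integrable[OF fin] continuous_intros bary_continuous[OF C])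
  have int1: "integrable lborel (\<lambda>x. indicator (convex hull C) x * bary C u x)" if "u \<in> C" for u
    using that by (intro bary_integrable[OF fin] bary_continuous[OF C])
  show row: "(\<Sum>v\<in>C. moment C u v) = (\<integral>x. indicator (convex hull C) x * bary C u x \<partial>lborel)" if "u \<in> C" for u
  proof -
    have "(\<Sum>v\<in>C. moment C u v) = (\<integral>x. (\<Sum>v\<in>C. indicator (convex hull C) x * (bary C u x * bary C v x)) \<partial>lborel)"
      unfolding moment_def using int that by (subst Bochner_Integration.integral_sum) auto
    also have "(\<lambda>x. (\<Sum>v\<in>C. indicator (convex hull C) x * (bary C u x * bary C v x))) = (\<lambda>x. indicator (convex hull C) x * bary C u x)"
      by (simp add: sum_distrib_left[symmetric] bary_sum[OF C])
    finally show ?thesis .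
  qed
  have "(\<Sum>u\<in>C. \<Sum>v\<in>C. moment C u v) = (\<integral>x. (\<Sum>u\<in>C. indicator (convex hull C) x * bary C u x) \<partial>lborel)"
    using int1 row by (subst Bochner_Integration.integral_sum) auto
  also have "(\<lambda>x. (\<Sum>u\<in>C. indicator (convex hull C) x * bary C u x)) = indicator (convex hull C)"
    by (simp add: sum_distrib_left[symmetric] bary_sum[OF C])
  finally show "(\<Sum>u\<in>C. \<Sum>v\<in>C. moment C u v) = measure lborel (convex hull C)"
    using integral_indicator_simplex[OF fin] by simp
qed

text \<open>All moments of barycentric coordinates are affine invariants. Comparing a simplex with its two
  halves, where \<open>\<lambda>\<^sub>u \<lambda>\<^sub>v = (\<mu>\<^sub>u + \<mu>\<^sub>m/2) \<mu>\<^sub>m/2\<close> in the coordinates \<open>\<mu>\<close> of a half, shows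
  that the diagonal moments are twice the others.\<close>

lemma moment_value:
  fixes C :: "'a::euclidean_space set"
  assumes C: "full_simplex C" and uv: "u \<in> C" "v \<in> C"
  shows "moment C u v = measure lborel (convex hull C) * (if u = v then 2 else 1) / ((real DIM('a) + 1) * (real DIM('a) + 2))"
proof -
  define V where "V = measure lborel (convex hull C)"
  have V: "0 < V" unfolding V_def by (rule measure_simplex_pos[OF C])
  have fin: "finite C" using full_simplex_facts(1)[OF C] .
  have dbl: "moment C u u = 2 * moment C u v" if uv: "u \<in> C" "v \<in> C" "u \<noteq> v" for u v
  proof -
    define H where "H = half C u v"
    define m where "m = midpoint u v"
    have H: "full_simplex H" unfolding H_def by (rule half_full[OF C uv])
    have mH: "m \<in> H" "u \<in> H" "u \<noteq> m" using uv midpoint_notin[OF C uv] by (auto simp: H_def m_def half_def)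
    have finH: "finite H" using full_simplex_facts(1)[OF H] .
    have VH: "measure lborel (convex hull H) = V / 2" unfolding H_def V_def by (rule measure_half[OF C uv])
    have "moment C u v = 2 * (\<integral>x. indicator (convex hull H) x * (bary C u x * bary C v x) \<partial>lborel)"
      using integral_halves[OF C uv, of "\<lambda>x. bary C u x * bary C v x"] integral_half_swap[OF C uv, of 1]
        bary_continuous[OF C uv(1)] bary_continuous[OF C uv(2)]
      by (simp add: moment_def H_def continuous_on_mult)
    also have "(\<lambda>x. indicator (convex hull H) x * (bary C u x * bary C v x))
       = (\<lambda>x. 1/2 * (indicator (convex hull H) x * (bary H u x * bary H m x)) + 1/4 * (indicator (convex hull H) x * (bary H m x * bary H m x)))"
    proof
      fix x
      have b: "bary H m x = 2 * bary C v x" "bary H u x = bary C u x - bary C v x"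
        unfolding H_def m_def by (rule bary_half[OF C uv])+
      show "indicator (convex hull H) x * (bary C u x * bary C v x)
       = 1/2 * (indicator (convex hull H) x * (bary H u x * bary H m x)) + 1/4 * (indicator (convex hull H) x * (bary H m x * bary H m x))"
        unfolding b by (simp add: algebra_simps)
    qed
    also have "(\<integral>x. 1/2 * (indicator (convex hull H) x * (bary H u x * bary H m x)) + 1/4 * (indicator (convex hull H) x * (bary H m x * bary H m x)) \<partial>lborel)
      = 1/2 * moment H u m + 1/4 * moment H m m"
      unfolding moment_def using mH
      by (subst Bochner_Integration.integral_add)
        (auto intro!: bary_integrable[OF finH] continuous_intros bary_continuous[OF H] integrable_mult_right)
    finally have "moment C u v = moment H u m + 1/2 * moment H m m" by simp
    moreover have "moment H u m = moment C u v / 2"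
      using moment_proportional(1)[OF H C mH(2,1,3) uv] VH V by (simp add: V_def field_simps)
    moreover have "moment H m m = moment C u u / 2"
      using moment_proportional(2)[OF H C mH(1,2) mH(3)[symmetric] uv] VH V by (simp add: V_def field_simps)
    ultimately show ?thesis by simp
  qed
  obtain a b where ab: "a \<in> C" "b \<in> C" "a \<noteq> b" using full_simplex_facts(4)[OF C] other_vertex[OF C] by (metis ex_in_conv)
  have val: "moment C u v = (if u = v then 2 else 1) * moment C a b" if uv: "u \<in> C" "v \<in> C" for u v
  proof (cases "u = v")
    case True
    obtain w where w: "w \<in> C" "w \<noteq> u" using other_vertex[OF C uv(1)] by blast
    have "moment C u u = moment C a a"
      using moment_proportional(2)[OF C C uv(1) w(1) w(2)[symmetric] ab] V by (simp add: V_def)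
    then show ?thesis using dbl[OF ab] True by simp
  next
    case False
    then show ?thesis using moment_proportional(1)[OF C C uv False ab] V by (simp add: V_def)
  qed
  \<comment> \<open>The coordinates sum to 1, so all moments together give the volume. With doubled
    diagonal this amounts to (d+1)(d+2) copies of the off-diagonal moment.\<close>
  have "V = (\<Sum>u\<in>C. \<Sum>v\<in>C. (if u = v then 2 else 1) * moment C a b)"
    unfolding V_def moment_sum(1)[OF C, symmetric] using val by (intro sum.cong refl) auto
  also have "\<dots> = (\<Sum>u\<in>C. (real DIM('a) + 2) * moment C a b)"
  proof (intro sum.cong refl)
    fix u assume u: "u \<in> C"
    have "(\<Sum>v\<in>C. (if u = v then 2 else 1) * moment C a b) = (\<Sum>v\<in>C. moment C a b + (if u = v then moment C a b else 0))"
      by (intro sum.cong) auto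
    also have "\<dots> = real (card C) * moment C a b + moment C a b" using fin u by (simp add: sum.distrib)
    finally show "(\<Sum>v\<in>C. (if u = v then 2 else 1) * moment C a b) = (real DIM('a) + 2) * moment C a b"
      by (simp add: full_simplex_facts(3)[OF C] algebra_simps)
  qed
  also have "\<dots> = (real DIM('a) + 1) * (real DIM('a) + 2) * moment C a b"
    by (simp add: full_simplex_facts(3)[OF C] algebra_simps)
  finally have VE: "V = (real DIM('a) + 1) * (real DIM('a) + 2) * moment C a b" .
  have D: "(real DIM('a) + 1) * (real DIM('a) + 2) \<noteq> 0" by (simp add: add_nonneg_eq_0_iff)
  have "moment C a b = V / ((real DIM('a) + 1) * (real DIM('a) + 2))"
    unfolding nonzero_eq_divide_eq[OF D] using VE by (simp only: mult.commute)
  then show ?thesis using val[OF uv] by (simp add: V_def)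
qed

text \<open>1 - d \<lambda>, with \<lambda> the coordinate at v, is the Crouzeix-Raviart basis
  function: 1 at the center of the facet opposite v and 0 at the other centers. Hence
  \<open>y v\<close> is the value at the center opposite v.\<close>

definition CR_local :: "'a::euclidean_space set \<Rightarrow> ('a \<Rightarrow> real) \<Rightarrow> 'a \<Rightarrow> real" where
  "CR_local C y x = (\<Sum>v\<in>C. y v * (1 - real DIM('a) * bary C v x))"

text \<open>In barycentric coordinates the coefficient at v is the sum of all y minus d times
  \<open>y v\<close>. Inserting the moments and collecting terms gives the mass matrix.\<close>

lemma CR_local_mass:
  fixes C :: "'a::euclidean_space set"
  assumes C: "full_simplex C"
  shows "(\<integral>x. indicator (convex hull C) x * (CR_local C y x * CR_local C z x) \<partial>lborel)
    = measure lborel (convex hull C) / ((real DIM('a) + 1) * (real DIM('a) + 2)) *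
      ((real DIM('a))\<^sup>2 * (\<Sum>v\<in>C. y v * z v) - (real DIM('a) - 2) * ((\<Sum>v\<in>C. y v) * (\<Sum>v\<in>C. z v)))"
proof -
  define V where "V = measure lborel (convex hull C)"
  define n where "n = real DIM('a)"
  have n: "0 < n" unfolding n_def by simp
  have fin: "finite C" using full_simplex_facts(1)[OF C] .
  have loc: "CR_local C y x = (\<Sum>v\<in>C. (sum y C - n * y v) * bary C v x)" for y x
  proof -
    have "CR_local C y x = sum y C * (\<Sum>v\<in>C. bary C v x) - n * (\<Sum>v\<in>C. y v * bary C v x)"
      unfolding bary_sum[OF C] CR_local_def n_def by (simp add: right_diff_distrib sum_subtractf sum_distrib_left mult_ac)
    then show ?thesis by (simp only: left_diff_distrib sum_subtractf mult.assoc sum_distrib_left)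
  qed
  define Y Z where "Y v = sum y C - n * y v" and "Z v = sum z C - n * z v" for v
  have "(\<integral>x. indicator (convex hull C) x * (CR_local C y x * CR_local C z x) \<partial>lborel)
    = (\<integral>x. (\<Sum>u\<in>C. \<Sum>v\<in>C. Y u * Z v * (indicator (convex hull C) x * (bary C u x * bary C v x))) \<partial>lborel)"
    unfolding loc Y_def Z_def sum_product by (intro Bochner_Integration.integral_cong refl) (simp add: sum_distrib_left mult_ac)
  also have "\<dots> = (\<Sum>u\<in>C. \<Sum>v\<in>C. Y u * Z v * moment C u v)"
    unfolding moment_def using fin
    by (subst Bochner_Integration.integral_sum Bochner_Integration.integral_mult_right
        | auto intro!: Bochner_Integration.integrable_sum integrable_mult_right bary_integrable[OF fin] continuous_intros bary_continuous[OF C] sum.cong)+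
  also have "\<dots> = (\<Sum>u\<in>C. \<Sum>v\<in>C. V / ((n + 1) * (n + 2)) * (Y u * Z v + (if u = v then Y u * Z v else 0)))"
    by (intro sum.cong refl) (simp add: moment_value[OF C] V_def n_def)
  also have "\<dots> = V / ((n + 1) * (n + 2)) * (sum Y C * sum Z C + (\<Sum>u\<in>C. Y u * Z u))"
  proof -
    have "(\<Sum>v\<in>C. V / ((n + 1) * (n + 2)) * (Y u * Z v + (if u = v then Y u * Z v else 0)))
       = V / ((n + 1) * (n + 2)) * (Y u * sum Z C + Y u * Z u)" if "u \<in> C" for u
      unfolding sum_distrib_left[symmetric] using fin that by (simp add: sum.distrib sum_distrib_left)
    then have "(\<Sum>u\<in>C. \<Sum>v\<in>C. V / ((n + 1) * (n + 2)) * (Y u * Z v + (if u = v then Y u * Z v else 0)))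
      = (\<Sum>u\<in>C. V / ((n + 1) * (n + 2)) * (Y u * sum Z C + Y u * Z u))" by (intro sum.cong refl)
    also have "\<dots> = V / ((n + 1) * (n + 2)) * (\<Sum>u\<in>C. Y u * sum Z C + Y u * Z u)"
      by (rule sum_distrib_left[symmetric])
    also have "(\<Sum>u\<in>C. Y u * sum Z C + Y u * Z u) = sum Y C * sum Z C + (\<Sum>u\<in>C. Y u * Z u)"
      by (simp only: sum.distrib sum_distrib_right)
    finally show ?thesis .
  qed
  also have "sum Y C * sum Z C + (\<Sum>u\<in>C. Y u * Z u) = n\<^sup>2 * (\<Sum>v\<in>C. y v * z v) - (n - 2) * (sum y C * sum z C)"
  proof -
    have cardC: "real (card C) = n + 1" by (simp add: full_simplex_facts(3)[OF C] n_def)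
    have "sum Y C = sum y C" "sum Z C = sum z C"
      by (simp_all add: Y_def Z_def sum_subtractf sum_distrib_left[symmetric] cardC algebra_simps)
    moreover have "(\<Sum>u\<in>C. Y u * Z u) = (\<Sum>u\<in>C. sum y C * sum z C - n * sum y C * z u - n * sum z C * y u + n\<^sup>2 * (y u * z u))"
      by (intro sum.cong refl) (simp add: Y_def Z_def algebra_simps power2_eq_square)
    moreover have "\<dots> = (n+1) * (sum y C * sum z C) - n * sum y C * sum z C - n * sum z C * sum y C + n\<^sup>2 * (\<Sum>u\<in>C. y u * z u)"
      by (simp add: sum.distrib sum_subtractf sum_distrib_left[symmetric] cardC)
    ultimately show ?thesis by (simp add: algebra_simps)
  qed
  finally show ?thesis by (simp add: V_def n_def)
qed

section \<open>Facets and conforming triangulations\<close>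

definition opp :: "'a::euclidean_space set \<Rightarrow> 'a \<Rightarrow> 'a set" where
  "opp C v = convex hull (C - {v})"

definition verts :: "'a::euclidean_space set \<Rightarrow> 'a set" where
  "verts T = {x. x extreme_point_of T}"

context
  fixes C :: "'a::euclidean_space set"
  assumes C: "full_simplex C"
begin

lemma verts_hull: "verts (convex hull C) = C"
  by (simp add: verts_def extreme_point_of_convex_hull_affine_independent[OF full_simplex_facts(2)[OF C]])

lemma verts_opp: "verts (opp C v) = C - {v}"
  unfolding verts_def opp_def
    extreme_point_of_convex_hull_affine_independent[OF affine_independent_Diff[OF full_simplex_facts(2)[OF C]]]
  by (rule Collect_mem_eq)

lemma opp_inj:
  assumes "v \<in> C" "opp C v = opp C w" shows "v = w"
proof -
  have "C - {v} = C - {w}" using verts_opp[of v] verts_opp[of w] assms(2) by simp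
  then show ?thesis using assms(1) by blast
qed

lemma facet_hull: "f facet_of (convex hull C) \<longleftrightarrow> (\<exists>v\<in>C. f = opp C v)"
proof -
  have "opp C v \<noteq> {}" if "v \<in> C" for v
    using other_vertex[OF C that] by (auto simp: opp_def)
  then show ?thesis
    unfolding facet_of_convex_hull_affine_independent[OF full_simplex_facts(2)[OF C]] opp_def[symmetric]
    by blast
qed

lemma facets_hull: "{f. f facet_of (convex hull C)} = opp C ` C"
  using facet_hull by auto

lemma card_opp: "v \<in> C \<Longrightarrow> card (C - {v}) = DIM('a)"
  using full_simplex_facts[OF C] by simp

lemma bary_opp_center:
  assumes "v \<in> C" "u \<in> C"
  shows "bary C u ((\<Sum>w\<in>C - {v}. w) /\<^sub>R real DIM('a)) = (if u = v then 0 else 1 / DIM('a))"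
proof -
  have fin: "finite (C - {v})" using full_simplex_facts(1)[OF C] by simp
  have s: "(\<Sum>w\<in>C - {v}. 1 / real DIM('a)) = 1" using card_opp[OF assms(1)] by simp
  have "(\<Sum>w\<in>C - {v}. w) /\<^sub>R real DIM('a) = (\<Sum>w\<in>C - {v}. (1 / real DIM('a)) *\<^sub>R w)"
    by (simp add: scaleR_sum_right inverse_eq_divide)
  then have "bary C u ((\<Sum>w\<in>C - {v}. w) /\<^sub>R real DIM('a)) = (\<Sum>w\<in>C - {v}. 1 / real DIM('a) * bary C u w)"
    using bary_sum_scaleR[OF C assms(2) s] by simp
  also have "\<dots> = (\<Sum>w\<in>C - {v}. if w = u then 1 / real DIM('a) else 0)"
    using bary_vertex[OF C assms(2)] by (intro sum.cong) auto
  also have "\<dots> = (if u = v then 0 else 1 / DIM('a))" using fin assms by simp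
  finally show ?thesis .
qed

lemma CR_local_center:
  assumes "v \<in> C"
  shows "CR_local C y ((\<Sum>w\<in>C - {v}. w) /\<^sub>R real DIM('a)) = y v"
proof -
  have "CR_local C y ((\<Sum>w\<in>C - {v}. w) /\<^sub>R real DIM('a)) = (\<Sum>u\<in>C. if u = v then y u else 0)"
    unfolding CR_local_def using bary_opp_center[OF assms] by (intro sum.cong) auto
  then show ?thesis using full_simplex_facts(1)[OF C] assms by simp
qed

lemma CR_local_affine: "\<exists>a b. CR_local C y = (\<lambda>x. a \<bullet> x + b)"
proof -
  obtain a b where ab: "\<And>u. u \<in> C \<Longrightarrow> bary C u = (\<lambda>x. a u \<bullet> x + b u)"
    using bary_affine[OF C] by metis
  have "CR_local C y x = (\<Sum>v\<in>C. (- y v * DIM('a)) *\<^sub>R a v) \<bullet> x + (\<Sum>v\<in>C. y v * (1 - DIM('a) * b v))" for x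
    unfolding CR_local_def inner_sum_left sum.distrib[symmetric]
    using ab by (intro sum.cong) (auto simp: algebra_simps)
  then show ?thesis by blast
qed

text \<open>The values at the centers determine an affine function: d times the value at the center
  opposite v is the sum of all vertex values minus the one at v, and substituting this recovers the
  barycentric representation.\<close>

lemma affine_eq_CR_local:
  assumes "\<And>v. v \<in> C \<Longrightarrow> y v = a \<bullet> ((\<Sum>w\<in>C - {v}. w) /\<^sub>R real DIM('a)) + b"
  shows "a \<bullet> x + b = CR_local C y x"
proof -
  define h where "h v = a \<bullet> v + b" for v
  define d where "d = real DIM('a)"
  have d: "0 < d" by (simp add: d_def)
  have fin: "finite C" and card: "real (card C) = d + 1" using full_simplex_facts[OF C] by (auto simp: d_def)
  have y: "d * y v = sum h C - h v" if "v \<in> C" for v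
  proof -
    have "d * y v = (\<Sum>w\<in>C - {v}. a \<bullet> w) + d * b"
      using assms[OF that] d by (simp add: d_def inner_sum_right field_simps)
    also have "\<dots> = (\<Sum>w\<in>C - {v}. h w)" using card_opp[OF that] by (simp add: h_def sum.distrib d_def)
    also have "\<dots> = sum h C - h v" using fin that by (simp add: sum_diff1)
    finally show ?thesis .
  qed
  have "d * CR_local C y x = (\<Sum>v\<in>C. (sum h C - h v) * (1 - d * bary C v x))"
    unfolding CR_local_def sum_distrib_left
  proof (intro sum.cong refl)
    fix v assume "v \<in> C"
    have "d * (y v * (1 - real DIM('a) * bary C v x)) = (d * y v) * (1 - d * bary C v x)" by (simp add: d_def)
    then show "d * (y v * (1 - real DIM('a) * bary C v x)) = (sum h C - h v) * (1 - d * bary C v x)"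
      using y[OF \<open>v \<in> C\<close>] by simp
  qed
  also have "\<dots> = (\<Sum>v\<in>C. sum h C - h v - d * sum h C * bary C v x + d * (bary C v x * h v))"
    by (intro sum.cong refl) (simp add: algebra_simps)
  also have "\<dots> = (d + 1) * sum h C - sum h C - d * sum h C * (\<Sum>v\<in>C. bary C v x) + d * (\<Sum>v\<in>C. bary C v x * h v)"
    by (simp add: sum.distrib sum_subtractf sum_distrib_left[symmetric] card)
  also have "\<dots> = d * (\<Sum>v\<in>C. bary C v x * h v)" by (simp add: bary_sum[OF C] algebra_simps)
  finally have "CR_local C y x = (\<Sum>v\<in>C. bary C v x * (a \<bullet> v + b))" using d by (simp add: h_def)
  then show ?thesis using affine_eq_bary[OF C, of a x b] by simp
qed

lemma CR_local_bound:
  assumes "x \<in> convex hull C"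
  shows "\<bar>CR_local C y x\<bar> \<le> real DIM('a) * (\<Sum>v\<in>C. \<bar>y v :: real\<bar>)"
proof -
  have "\<bar>CR_local C y x\<bar> \<le> (\<Sum>v\<in>C. \<bar>y v * (1 - real DIM('a) * bary C v x)\<bar>)"
    unfolding CR_local_def by (rule sum_abs)
  also have "\<dots> \<le> (\<Sum>v\<in>C. \<bar>y v\<bar> * DIM('a))"
  proof (intro sum_mono)
    fix v assume v: "v \<in> C"
    have "0 \<le> bary C v x" "bary C v x \<le> 1" using bary_bounded[OF C assms v] by auto
    then have "0 \<le> real DIM('a) * bary C v x" "real DIM('a) * bary C v x \<le> real DIM('a) * 1"
      by (auto intro!: mult_left_mono)
    moreover have "1 \<le> real DIM('a)" using DIM_positive[where 'a = 'a] by (simp add: Suc_leI)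
    ultimately have "\<bar>1 - real DIM('a) * bary C v x\<bar> \<le> DIM('a)" by linarith
    then show "\<bar>y v * (1 - real DIM('a) * bary C v x)\<bar> \<le> \<bar>y v\<bar> * DIM('a)"
      by (simp add: abs_mult mult_left_mono)
  qed
  finally show ?thesis by (simp add: sum_distrib_left mult.commute)
qed

lemma rel_interior_opp_center:
  assumes "v \<in> C"
  shows "(\<Sum>w\<in>C - {v}. w) /\<^sub>R real DIM('a) \<in> rel_interior (opp C v)"
proof -
  have fin: "finite (C - {v})" using full_simplex_facts(1)[OF C] by simp
  have ri: "rel_interior (opp C v) = {y. \<exists>u. (\<forall>x\<in>C - {v}. 0 < u x) \<and> sum u (C - {v}) = 1 \<and> (\<Sum>x\<in>C - {v}. u x *\<^sub>R x) = y}"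
    unfolding opp_def by (rule rel_interior_convex_hull_explicit[OF affine_independent_Diff[OF full_simplex_facts(2)[OF C]]])
  have 1: "(\<Sum>w\<in>C - {v}. 1 / real DIM('a)) = 1" using card_opp[OF assms(1)] by simp
  have 2: "(\<Sum>w\<in>C - {v}. (1 / real DIM('a)) *\<^sub>R w) = (\<Sum>w\<in>C - {v}. w) /\<^sub>R real DIM('a)"
    by (simp add: scaleR_sum_right inverse_eq_divide)
  have 3: "\<forall>x\<in>C - {v}. 0 < 1 / real DIM('a)" by simp
  show ?thesis unfolding ri by (intro CollectI exI[of _ "\<lambda>_. 1 / real DIM('a)"] conjI 1 2 3)
qed

end

lemma mid_opp:
  fixes C :: "(real^'n) set"
  assumes "full_simplex C" "v \<in> C"
  shows "mid (opp C v) = (\<Sum>w\<in>C - {v}. w) /\<^sub>R real CARD('n)"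
proof -
  have "{x. x extreme_point_of opp C v} = C - {v}" using verts_opp[OF assms(1), of v] by (simp add: verts_def)
  then show ?thesis unfolding mid_def by (simp add: card_opp[OF assms])
qed

text \<open>If the second simplex had its free vertex on the side of \<open>v\<close>, points close to the center of
  the common facet would be interior to both simplices.\<close>

lemma bary_neighbour_neg:
  fixes C C' :: "'a::euclidean_space set"
  assumes C: "full_simplex C" "v \<in> C" and C': "full_simplex C'" "v' \<in> C'" and eq: "C - {v} = C' - {v'}"
    and disj: "interior (convex hull C) \<inter> interior (convex hull C') = {}"
  shows "bary C v v' < 0" "bary C v x = bary C v v' * bary C' v' x"
proof -
  obtain a b where ab: "bary C v = (\<lambda>x. a \<bullet> x + b)" using bary_affine[OF C] by auto
  have prod: "bary C v x = bary C v v' * bary C' v' x" for x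
  proof -
    have "bary C v x = (\<Sum>w\<in>C'. bary C' w x * bary C v w)" using affine_eq_bary[OF C'(1), of a x b] by (simp add: ab)
    also have "\<dots> = (\<Sum>w\<in>C'. if w = v' then bary C' w x * bary C v v' else 0)"
    proof (intro sum.cong refl)
      fix w assume w: "w \<in> C'"
      show "bary C' w x * bary C v w = (if w = v' then bary C' w x * bary C v v' else 0)"
      proof (cases "w = v'")
        case False
        then have "w \<in> C - {v}" using w eq by auto
        then show ?thesis using False bary_vertex[OF C, of w] by auto
      qed simp
    qed
    also have "\<dots> = bary C v v' * bary C' v' x" using full_simplex_facts(1)[OF C'(1)] C'(2) by simp
    finally show ?thesis .
  qed
  show "bary C v x = bary C v v' * bary C' v' x" by (rule prod)
  \<comment> \<open>At x = v the left-hand side of the product formula is 1, so neither factor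
    vanishes.\<close>
  have nz: "bary C v v' \<noteq> 0" using prod[of v] bary_vertex[OF C C(2)] by auto
  show "bary C v v' < 0"
  proof (rule ccontr)
    assume "\<not> bary C v v' < 0"
    then have pos: "0 < bary C v v'" using nz by simp
    define z where "z = (\<Sum>w\<in>C - {v}. w) /\<^sub>R real DIM('a)"
    \<comment> \<open>Points slightly off the center of the common facet, towards v'. For small
      \<epsilon> all their coordinates with respect to both simplices would be positive.\<close>
    define p where "p \<epsilon> = (1 - \<epsilon>) *\<^sub>R z + \<epsilon> *\<^sub>R v'" for \<epsilon> :: real
    have bp: "bary D w (p \<epsilon>) = (1 - \<epsilon>) * bary D w z + \<epsilon> * bary D w v'" if D: "full_simplex D" "w \<in> D" for D w \<epsilon>
    proof -
      obtain a b where "bary D w = (\<lambda>x. a \<bullet> x + b)" using bary_affine[OF D] by auto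
      then show ?thesis by (simp add: p_def inner_add_right algebra_simps)
    qed
    have ev: "\<forall>\<^sub>F \<epsilon> in at_right 0. 0 < bary C w (p \<epsilon>)" if w: "w \<in> C" for w
    proof (cases "w = v")
      case True
      have "bary C v (p \<epsilon>) = \<epsilon> * bary C v v'" for \<epsilon>
        unfolding bp[OF C] using bary_opp_center[OF C C(2)] by (simp add: z_def)
      then show ?thesis using eventually_at_right_less[of "0::real"] True pos by (auto elim: eventually_mono)
    next
      case False
      have "((\<lambda>\<epsilon>. bary C w (p \<epsilon>)) \<longlongrightarrow> (1 - 0) * bary C w z + 0 * bary C w v') (at_right 0)"
        unfolding bp[OF C(1) w] by (intro tendsto_intros)
      moreover have "0 < bary C w z" unfolding z_def bary_opp_center[OF C w] using False by simp
      ultimately show ?thesis by (intro order_tendstoD(1)) auto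
    qed
    have ev': "\<forall>\<^sub>F \<epsilon> in at_right 0. 0 < bary C' w (p \<epsilon>)" if w: "w \<in> C'" for w
    proof (cases "w = v'")
      case True
      have "bary C' v' (p \<epsilon>) = \<epsilon>" for \<epsilon>
        unfolding bp[OF C'] z_def eq using bary_opp_center[OF C' C'(2)] bary_vertex[OF C' C'(2)] by simp
      then show ?thesis using eventually_at_right_less[of "0::real"] True by simp
    next
      case False
      have "((\<lambda>\<epsilon>. bary C' w (p \<epsilon>)) \<longlongrightarrow> (1 - 0) * bary C' w z + 0 * bary C' w v') (at_right 0)"
        unfolding bp[OF C'(1) w] by (intro tendsto_intros)
      moreover have "0 < bary C' w z" unfolding z_def eq bary_opp_center[OF C' w] using False by simp
      ultimately show ?thesis by (intro order_tendstoD(1)) auto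
    qed
    have "\<forall>\<^sub>F \<epsilon> in at_right (0::real). (\<forall>w\<in>C. 0 < bary C w (p \<epsilon>)) \<and> (\<forall>w\<in>C'. 0 < bary C' w (p \<epsilon>))"
      using full_simplex_facts(1)[OF C(1)] full_simplex_facts(1)[OF C'(1)] ev ev'
      by (simp add: eventually_conj_iff eventually_ball_finite_distrib)
    then obtain \<epsilon> where "(\<forall>w\<in>C. 0 < bary C w (p \<epsilon>)) \<and> (\<forall>w\<in>C'. 0 < bary C' w (p \<epsilon>))"
      using eventually_happens'[OF trivial_limit_at_right_real] by blast
    then have "p \<epsilon> \<in> interior (convex hull C) \<inter> interior (convex hull C')"
      using in_interior_bary[OF C(1)] in_interior_bary[OF C'(1)] by auto
    then show False using disj by auto
  qed
qed

text \<open>By the product formula the coordinate of the third free vertex is a product of two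
  negative numbers, hence positive; seen directly across the facet it must be negative. This is why
  a face has at most two simplices.\<close>

lemma common_facet_unique:
  fixes C C' C'' :: "'a::euclidean_space set"
  assumes C: "full_simplex C" "v \<in> C" and C': "full_simplex C'" "v' \<in> C'" and C'': "full_simplex C''" "v'' \<in> C''"
    and eq: "C - {v} = C' - {v'}" "C - {v} = C'' - {v''}"
    and disj: "interior (convex hull C) \<inter> interior (convex hull C') = {}" "interior (convex hull C) \<inter> interior (convex hull C'') = {}"
     "interior (convex hull C') \<inter> interior (convex hull C'') = {}"
  shows False
proof -
  have "bary C v v'' = bary C v v' * bary C' v' v''" by (rule bary_neighbour_neg(2)[OF C C' eq(1) disj(1)])
  moreover have "bary C v v' < 0" by (rule bary_neighbour_neg(1)[OF C C' eq(1) disj(1)])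
  moreover have "bary C v v'' < 0" by (rule bary_neighbour_neg(1)[OF C C'' eq(2) disj(2)])
  moreover have "bary C' v' v'' < 0" using eq by (intro bary_neighbour_neg(1)[OF C' C'' _ disj(3)]) auto
  ultimately show False using mult_neg_neg[of "bary C v v'" "bary C' v' v''"] by linarith
qed

section \<open>Conforming triangulations\<close>

locale conforming =
  fixes \<Omega> :: "(real^'n) set" and \<T> :: "(real^'n) set set"
  assumes tri: "triangulation_of \<Omega> \<T>"
begin

lemma fin: "finite \<T>" and Union: "\<Union>\<T> = closure \<Omega>"
  and inter_face: "T \<in> \<T> \<Longrightarrow> T' \<in> \<T> \<Longrightarrow> T \<inter> T' face_of T"
  using tri by (simp_all add: triangulation_of_def triangulation_def)

lemma simplex:
  assumes "T \<in> \<T>" shows "full_simplex (verts T)" "convex hull (verts T) = T"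
proof -
  have "int CARD('n) simplex T" using tri assms by (auto simp: triangulation_of_def)
  then obtain C where C: "finite C" "\<not> affine_dependent C" "int (card C) = int CARD('n) + 1" "T = convex hull C"
    unfolding simplex by auto
  then have "full_simplex C" by (auto simp: full_simplex_def)
  then show "full_simplex (verts T)" "convex hull (verts T) = T" using verts_hull[of C] C(4) by simp_all
qed

lemma convexT: assumes "T \<in> \<T>" shows "convex T"
  using convex_convex_hull[of "verts T"] unfolding simplex(2)[OF assms] .

lemma compactT: assumes "T \<in> \<T>" shows "compact T"
  using finite_imp_compact_convex_hull[OF full_simplex_facts(1)[OF simplex(1)[OF assms]]] unfolding simplex(2)[OF assms] .

lemma interior_ne: assumes "T \<in> \<T>" shows "interior T \<noteq> {}"
  using interior_simplex_nonempty[OF simplex(1)[OF assms]] unfolding simplex(2)[OF assms] .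

lemma facets: assumes "T \<in> \<T>" shows "{f. f facet_of T} = opp (verts T) ` verts T"
  using facets_hull[OF simplex(1)[OF assms]] unfolding simplex(2)[OF assms] .

text \<open>The intersection is a face of T, so it misses the interior of T unless T lies in T'. In
  that case T would be a proper face of T' and disjoint from its interior, which contains the
  interior of T.\<close>

lemma interior_disjoint:
  assumes "T \<in> \<T>" "T' \<in> \<T>" "T \<noteq> T'" shows "interior T \<inter> T' = {}"
proof (rule ccontr)
  assume ne: "interior T \<inter> T' \<noteq> {}"
  have "T \<inter> T' = T"
  proof (rule ccontr)
    assume "T \<inter> T' \<noteq> T"
    then have "T \<inter> T' \<inter> interior T = {}" using face_of_disjoint_interior inter_face[OF assms(1,2)] by blast
    then show False using ne interior_subset[of T] by auto
  qed
  then have "T face_of T'" using inter_face[OF assms(2,1)] by (simp add: Int_commute)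
  then have "T \<inter> interior T' = {}" using face_of_disjoint_interior assms(3) by blast
  moreover have "interior T \<subseteq> interior T'" using \<open>T \<inter> T' = T\<close> by (intro interior_mono) auto
  ultimately show False using interior_ne[OF assms(1)] interior_subset[of T] by auto
qed

lemma two_simplices:
  assumes T: "T \<in> \<T>" "T' \<in> \<T>" "T'' \<in> \<T>" and f: "f facet_of T" "f facet_of T'" "f facet_of T''"
  shows "T = T' \<or> T = T'' \<or> T' = T''"
proof (rule ccontr)
  assume ne: "\<not> ?thesis"
  obtain v where v: "v \<in> verts T" "f = opp (verts T) v" using facets[OF T(1)] f(1) by auto
  obtain v' where v': "v' \<in> verts T'" "f = opp (verts T') v'" using facets[OF T(2)] f(2) by auto
  obtain v'' where v'': "v'' \<in> verts T''" "f = opp (verts T'') v''" using facets[OF T(3)] f(3) by auto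
  have "verts T - {v} = verts f" "verts T' - {v'} = verts f" "verts T'' - {v''} = verts f"
    using verts_opp[OF simplex(1)[OF T(1)], of v] verts_opp[OF simplex(1)[OF T(2)], of v'] verts_opp[OF simplex(1)[OF T(3)], of v'']
      v v' v'' by auto
  note VD = this
  have D: "interior (convex hull (verts A)) \<inter> interior (convex hull (verts B)) = {}" if "A \<in> \<T>" "B \<in> \<T>" "A \<noteq> B" for A B
    unfolding simplex(2)[OF that(1)] simplex(2)[OF that(2)]
    using interior_disjoint[OF that] interior_subset[of B] by auto
  show False
    by (rule common_facet_unique[OF simplex(1)[OF T(1)] v(1) simplex(1)[OF T(2)] v'(1) simplex(1)[OF T(3)] v''(1)])
      (use VD D[OF T(1,2)] D[OF T(1,3)] D[OF T(2,3)] ne in simp_all)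
qed

lemma mid_rel_interior:
  assumes "T \<in> \<T>" "f facet_of T" shows "mid f \<in> rel_interior f"
proof -
  obtain v where v: "v \<in> verts T" "f = opp (verts T) v" using facets[OF assms(1)] assms(2) by auto
  show ?thesis using rel_interior_opp_center[OF simplex(1)[OF assms(1)] v(1)]
    by (simp add: v(2) mid_opp[OF simplex(1)[OF assms(1)] v(1)])
qed

text \<open>The center of f lies in its relative interior, so the face \<open>T \<inter> T'\<close>
  of T contains f as soon as it contains the center. It is not all of T, so its dimension is at most
  that of f, and it equals f.\<close>

lemma facet_of_other:
  assumes T: "T \<in> \<T>" "T' \<in> \<T>" and f: "f facet_of T" and sub: "mid f \<in> T' \<or> f \<subseteq> T'"
  shows "f facet_of T'"
proof (cases "T = T'")
  case False
  have fT: "f \<subseteq> T" using f by (simp add: facet_of_imp_subset)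
  have midf: "mid f \<in> rel_interior f" by (rule mid_rel_interior[OF T(1) f])
  then have m: "mid f \<in> f" using rel_interior_subset by auto
  have face: "T \<inter> T' face_of T" by (rule inter_face[OF T])
  have sub: "f \<subseteq> T \<inter> T'"
    using subset_of_face_of[OF face fT] midf m fT sub by auto
  have neT: "T \<inter> T' \<noteq> T"
  proof
    assume "T \<inter> T' = T"
    then show False using interior_disjoint[OF T False] interior_ne[OF T(1)] interior_subset[of T] by auto
  qed
  have aT: "aff_dim S = int CARD('n)" if "S \<in> \<T>" for S
    using interior_ne[OF that] by (simp add: aff_dim_nonempty_interior)
  have "aff_dim (T \<inter> T') < aff_dim T" using face_of_aff_dim_lt[OF convexT[OF T(1)] face neT] .
  then have lt: "aff_dim (T \<inter> T') \<le> aff_dim f" using f by (simp add: facet_of_def)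
  have "f face_of T \<inter> T'"
    using face_of_subset[of f T "T \<inter> T'"] f sub by (simp add: facet_of_def)
  then have eq: "f = T \<inter> T'"
    using face_of_aff_dim_lt[OF convex_Int[OF convexT[OF T(1)] convexT[OF T(2)]], of f] lt by linarith
  have "f face_of T'" using inter_face[OF T(2,1)] eq by (simp add: Int_commute)
  then show ?thesis using f aT[OF T(1)] aT[OF T(2)] by (simp add: facet_of_def)
qed (use f in simp)

end

section \<open>The Crouzeix--Raviart space of a mesh\<close>

text \<open>Elimination of one unknown: \<open>x1\<close> and \<open>x2\<close> solve smaller
  systems, and the pivot \<open>s\<close> is the value of the form at \<open>z\<close>, whose rows
  other than that of \<open>a\<close> vanish. Hence the pivot is positive.\<close>

lemma solve_positive:
  fixes m :: "'f \<Rightarrow> 'f \<Rightarrow> real"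
  assumes "finite S" "\<And>x. \<exists>f\<in>S. x f \<noteq> 0 \<Longrightarrow> (\<Sum>f\<in>S. \<Sum>g\<in>S. m f g * x g * x f) > 0"
  shows "\<exists>x. \<forall>f\<in>S. (\<Sum>g\<in>S. m f g * x g) = r f"
  using assms
proof (induction S arbitrary: r rule: finite_induct)
  case (insert a S)
  have pos: "(\<Sum>f\<in>S. \<Sum>g\<in>S. m f g * x g * x f) > 0" if x: "\<exists>f\<in>S. x f \<noteq> 0" for x
  proof -
    define y where "y = (\<lambda>f. if f = a then 0 else x f)"
    have y: "y a = 0" "f \<in> S \<Longrightarrow> y f = x f" for f using insert.hyps(2) by (auto simp: y_def)
    have "\<exists>f\<in>insert a S. y f \<noteq> 0" using x y by auto
    from insert.prems[OF this] show ?thesis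
      using insert.hyps y by (simp add: sum.insert cong: sum.cong)
  qed
  obtain x1 where x1: "\<forall>f\<in>S. (\<Sum>g\<in>S. m f g * x1 g) = r f" using insert.IH[OF pos] by blast
  obtain x2 where x2: "\<forall>f\<in>S. (\<Sum>g\<in>S. m f g * x2 g) = - m f a" using insert.IH[OF pos, of "\<lambda>f. - m f a"] by blast
  define z where "z = (\<lambda>f. if f = a then 1 else x2 f)"
  have z: "z a = 1" "f \<in> S \<Longrightarrow> z f = x2 f" for f using insert.hyps(2) by (auto simp: z_def)
  have row: "(\<Sum>g\<in>insert a S. m f g * z g) = 0" if "f \<in> S" for f
    using insert.hyps x2 that z by (simp add: sum.insert cong: sum.cong)
  define s where "s = (\<Sum>g\<in>insert a S. m a g * z g)"
  have "(\<Sum>f\<in>insert a S. \<Sum>g\<in>insert a S. m f g * z g * z f) = (\<Sum>f\<in>insert a S. (\<Sum>g\<in>insert a S. m f g * z g) * z f)"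
    by (simp only: sum_distrib_right)
  also have "\<dots> = s * z a + (\<Sum>f\<in>S. (\<Sum>g\<in>insert a S. m f g * z g) * z f)"
    unfolding s_def by (rule sum.insert[OF insert.hyps])
  also have "(\<Sum>f\<in>S. (\<Sum>g\<in>insert a S. m f g * z g) * z f) = 0" using row by (intro sum.neutral) simp
  finally have "(\<Sum>f\<in>insert a S. \<Sum>g\<in>insert a S. m f g * z g * z f) = s" using z by simp
  moreover have "\<exists>f\<in>insert a S. z f \<noteq> 0" using z by auto
  ultimately have s: "0 < s" using insert.prems[of z] by linarith
  define t where "t = (r a - (\<Sum>g\<in>S. m a g * x1 g)) / s"
  define x where "x = (\<lambda>f. if f = a then t else x1 f + t * x2 f)"
  have x: "x a = t" "f \<in> S \<Longrightarrow> x f = x1 f + t * x2 f" for f using insert.hyps(2) by (auto simp: x_def)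
  have xs: "(\<Sum>g\<in>insert a S. m f g * x g) = m f a * t + (\<Sum>g\<in>S. m f g * x1 g) + t * (\<Sum>g\<in>S. m f g * x2 g)" for f
  proof -
    have "(\<Sum>g\<in>insert a S. m f g * x g) = m f a * t + (\<Sum>g\<in>S. m f g * x g)" using insert.hyps x by simp
    also have "(\<Sum>g\<in>S. m f g * x g) = (\<Sum>g\<in>S. m f g * x1 g + t * (m f g * x2 g))"
      using x by (intro sum.cong) (auto simp: algebra_simps)
    also have "\<dots> = (\<Sum>g\<in>S. m f g * x1 g) + t * (\<Sum>g\<in>S. m f g * x2 g)" by (simp add: sum.distrib sum_distrib_left)
    finally show ?thesis by simp
  qed
  have "(\<Sum>g\<in>insert a S. m f g * x g) = r f" if "f \<in> insert a S" for f
  proof (cases "f = a")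
    case True
    have "s = m a a + (\<Sum>g\<in>S. m a g * x2 g)" unfolding s_def using insert.hyps z by (simp cong: sum.cong)
    then have "m a a * t + t * (\<Sum>g\<in>S. m a g * x2 g) = t * s" by (simp add: algebra_simps)
    also have "t * s = r a - (\<Sum>g\<in>S. m a g * x1 g)" using s by (simp add: t_def)
    finally show ?thesis unfolding True xs by linarith
  next
    case False
    then have "f \<in> S" using that by simp
    then show ?thesis unfolding xs using x1 x2 by simp
  qed
  then show ?case by blast
qed simp

locale CR_mesh = conforming \<Omega> \<T> for \<Omega> :: "(real^'n) set" and \<T> +
  assumes dom: "polyhedral_domain \<Omega>" and dim2: "2 \<le> CARD('n)"
begin

text \<open>The domain may have slits, so the interior of a simplex need not be contained in it.\<close>

definition cell :: "(real^'n) set \<Rightarrow> (real^'n) set" where "cell T = interior T \<inter> \<Omega>"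

definition vol :: "(real^'n) set \<Rightarrow> real" where "vol T = measure lborel T"

definition facets_of :: "(real^'n) set \<Rightarrow> (real^'n) set set" where "facets_of T = {f. f facet_of T}"

lemma open_Omega: "open \<Omega>" and bounded_Omega: "bounded \<Omega>"
  using dom by (auto simp: polyhedral_domain_def)

lemma Omega_sets [simp]: "\<Omega> \<in> sets lebesgue" "\<Omega> \<inter> space lebesgue \<in> sets lebesgue"
  using open_Omega by auto

lemma vol_pos: assumes "T \<in> \<T>" shows "0 < vol T"
  using measure_simplex_pos[OF simplex(1)[OF assms]] unfolding simplex(2)[OF assms] vol_def .

text \<open>A polytope is convex, hence null once its interior is empty. An interior point would
  have a neighbourhood inside the closure of the open set \<Omega> yet disjoint from
  \<Omega>.\<close>

lemma negligible_frontier: "negligible (frontier \<Omega>)"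
proof -
  obtain \<P> where P: "finite \<P>" "\<forall>P\<in>\<P>. polytope P" "frontier \<Omega> = \<Union>\<P>"
    using dom by (auto simp: polyhedral_domain_def)
  have "negligible P" if "P \<in> \<P>" for P
  proof -
    have "interior P \<subseteq> frontier \<Omega>" using P(3) that interior_subset[of P] by blast
    then have "interior P \<subseteq> closure \<Omega>" "interior P \<inter> \<Omega> = {}"
      using open_Omega by (auto simp: frontier_def interior_open)
    then have "interior P = {}" using open_Int_closure_eq_empty[of "interior P" \<Omega>] by auto
    then show ?thesis using negligible_convex_interior polytope_imp_convex P(2) that by blast
  qed
  then show ?thesis unfolding P(3) by (intro negligible_Union[OF P(1)])
qed

lemma cell_open: "open (cell T)" unfolding cell_def using open_Omega by (intro open_Int) auto

lemma cell_sub: "cell T \<subseteq> \<Omega>" "cell T \<subseteq> T" using interior_subset by (auto simp: cell_def)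

lemma cell_sets [simp]: "cell T \<in> sets lebesgue" "cell T \<in> sets borel" "cell T \<in> sets (lebesgue_on \<Omega>)"
  using cell_open[of T] cell_sub(1)[of T] by (auto simp: sets_restrict_space_iff)

lemma cell_disjoint: "T \<in> \<T> \<Longrightarrow> T' \<in> \<T> \<Longrightarrow> T \<noteq> T' \<Longrightarrow> x \<in> cell T \<Longrightarrow> x \<notin> T'"
  using interior_disjoint[of T T'] by (auto simp: cell_def)

lemma negligible_diff: "T \<in> \<T> \<Longrightarrow> negligible (T - cell T)"
proof -
  assume T: "T \<in> \<T>"
  have "T - cell T \<subseteq> frontier T \<union> frontier \<Omega>"
    using T Union open_Omega closure_subset[of T] by (auto simp: cell_def frontier_def interior_open)
  then show ?thesis using negligible_subset negligible_Un negligible_convex_frontier[OF convexT[OF T]] negligible_frontier by blast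
qed

lemma AE_Omega: "negligible N \<Longrightarrow> AE x in lebesgue_on \<Omega>. x \<notin> N"
proof -
  assume "negligible N"
  then have "AE x in lebesgue. x \<notin> N" by (intro AE_not_in) (simp add: negligible_iff_null_sets)
  then show ?thesis by (simp add: AE_restrict_space_iff) (auto elim: eventually_mono)
qed

lemma AE_cells: "AE x in lebesgue_on \<Omega>. x \<in> \<Omega> \<and> (\<exists>T\<in>\<T>. x \<in> cell T)"
proof -
  have "negligible (\<Union>T\<in>\<T>. T - cell T)" using negligible_diff fin by (intro negligible_Union) auto
  from AE_Omega[OF this] have "AE x in lebesgue_on \<Omega>. x \<notin> (\<Union>T\<in>\<T>. T - cell T)" .
  moreover have "AE x in lebesgue_on \<Omega>. x \<in> \<Omega>" by (rule AE_I2) simp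
  ultimately show ?thesis
  proof eventually_elim
    case (elim x)
    then have "x \<in> \<Union>\<T>" using Union closure_subset[of \<Omega>] elim by auto
    then show ?case using elim by auto
  qed
qed

lemma sum_cell:
  fixes g :: "(real^'n) set \<Rightarrow> 'b :: semiring_1"
  assumes "T \<in> \<T>" "x \<in> cell T" shows "(\<Sum>S\<in>\<T>. indicator (cell S) x * g S) = g T"
proof -
  have "(\<Sum>S\<in>\<T>. indicator (cell S) x * g S) = (\<Sum>S\<in>\<T>. if S = T then g T else 0)"
    using cell_disjoint[OF assms(1) _ _ assms(2)] cell_sub(2) assms by (intro sum.cong) (auto simp: indicator_def)
  then show ?thesis using fin assms(1) by simp
qed

lemma sum_simplices:
  assumes "T \<in> \<T>" "x \<in> cell T" shows "(\<Sum>S\<in>\<T>. indicator S x * g S) = (g T :: real)"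
proof -
  have "(\<Sum>S\<in>\<T>. indicator S x * g S) = (\<Sum>S\<in>\<T>. if S = T then g T else 0)"
    using cell_disjoint[OF assms(1) _ _ assms(2)] cell_sub(2) assms by (intro sum.cong) (auto simp: indicator_def)
  then show ?thesis using fin assms(1) by simp
qed

lemma nn_split:
  assumes h: "h \<in> borel_measurable (lebesgue_on \<Omega>)"
  shows "(\<integral>\<^sup>+ x. h x \<partial>lebesgue_on \<Omega>) = (\<Sum>T\<in>\<T>. \<integral>\<^sup>+ x. indicator (cell T) x * h x \<partial>lebesgue_on \<Omega>)"
proof -
  have "(\<integral>\<^sup>+ x. h x \<partial>lebesgue_on \<Omega>) = (\<integral>\<^sup>+ x. (\<Sum>T\<in>\<T>. indicator (cell T) x * h x) \<partial>lebesgue_on \<Omega>)"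
  proof (rule nn_integral_cong_AE, rule AE_mp[OF AE_cells], rule AE_I2, rule impI, elim conjE bexE)
    fix x T assume "T \<in> \<T>" "x \<in> cell T"
    then show "h x = (\<Sum>T\<in>\<T>. indicator (cell T) x * h x)" by (rule sum_cell[symmetric, where g = "\<lambda>_. h x"])
  qed
  also have "\<dots> = (\<Sum>T\<in>\<T>. \<integral>\<^sup>+ x. indicator (cell T) x * h x \<partial>lebesgue_on \<Omega>)"
    using h by (intro nn_integral_sum borel_measurable_times_ennreal borel_measurable_indicator cell_sets)
  finally show ?thesis .
qed

lemma integrable_cell:
  fixes h :: "real^'n \<Rightarrow> real"
  shows "integrable (lebesgue_on \<Omega>) h \<Longrightarrow> integrable (lebesgue_on \<Omega>) (\<lambda>x. indicator (cell T) x * h x)"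
  using integrable_mult_indicator[OF cell_sets(3), of h T] by simp

lemma integral_split:
  fixes h :: "real^'n \<Rightarrow> real"
  assumes h: "integrable (lebesgue_on \<Omega>) h"
  shows "(\<integral>x. h x \<partial>lebesgue_on \<Omega>) = (\<Sum>T\<in>\<T>. \<integral>x. indicator (cell T) x * h x \<partial>lebesgue_on \<Omega>)"
proof -
  have "(\<integral>x. h x \<partial>lebesgue_on \<Omega>) = (\<integral>x. (\<Sum>T\<in>\<T>. indicator (cell T) x * h x) \<partial>lebesgue_on \<Omega>)"
  proof (rule integral_cong_AE)
    show "AE x in lebesgue_on \<Omega>. h x = (\<Sum>T\<in>\<T>. indicator (cell T) x * h x)"
    proof (rule AE_mp[OF AE_cells], rule AE_I2, rule impI, elim conjE bexE)
      fix x T assume "T \<in> \<T>" "x \<in> cell T"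
      then show "h x = (\<Sum>T\<in>\<T>. indicator (cell T) x * h x)" by (rule sum_cell[symmetric, where g = "\<lambda>_. h x"])
    qed
  qed (use h integrable_cell[OF h] in \<open>auto intro!: borel_measurable_sum\<close>)
  also have "\<dots> = (\<Sum>T\<in>\<T>. \<integral>x. indicator (cell T) x * h x \<partial>lebesgue_on \<Omega>)"
    using integrable_cell[OF h] by (intro Bochner_Integration.integral_sum)
  finally show ?thesis .
qed

lemma AE_cell_T: "T \<in> \<T> \<Longrightarrow> AE x in lebesgue. x \<in> T \<longleftrightarrow> x \<in> cell T"
proof -
  assume T: "T \<in> \<T>"
  have "AE x in lebesgue. x \<notin> T - cell T"
    using negligible_diff[OF T] by (intro AE_not_in) (simp add: negligible_iff_null_sets)
  then show ?thesis by eventually_elim (use cell_sub(2) in auto)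
qed

lemma T_borel: "T \<in> \<T> \<Longrightarrow> T \<in> sets borel" using compactT borel_compact by blast

lemma integral_cell_continuous:
  fixes g :: "real^'n \<Rightarrow> real"
  assumes T: "T \<in> \<T>" and g: "continuous_on UNIV g"
  shows "(\<integral>x. indicator (cell T) x * g x \<partial>lebesgue_on \<Omega>) = (\<integral>x. indicator T x * g x \<partial>lborel)"
proof -
  have gm: "g \<in> borel_measurable borel" using g by (rule borel_measurable_continuous_onI)
  have "(\<integral>x. indicator (cell T) x * g x \<partial>lebesgue_on \<Omega>) = (\<integral>x. indicator \<Omega> x *\<^sub>R (indicator (cell T) x * g x) \<partial>lebesgue)"
    by (rule integral_restrict_space) simp
  also have "\<dots> = (\<integral>x. indicator T x * g x \<partial>lebesgue)"
  proof (rule integral_cong_AE)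
    show "AE x in lebesgue. indicator \<Omega> x *\<^sub>R (indicator (cell T) x * g x) = indicator T x * g x"
      using AE_cell_T[OF T] by eventually_elim (use cell_sub(1) in \<open>auto simp: indicator_def\<close>)
    have gl: "g \<in> borel_measurable lebesgue" using gm by (simp add: measurable_completion)
    show "(\<lambda>x. indicator \<Omega> x *\<^sub>R (indicator (cell T) x * g x)) \<in> borel_measurable lebesgue"
      using gl by (intro borel_measurable_scaleR borel_measurable_times borel_measurable_indicator) auto
    show "(\<lambda>x. indicator T x * g x) \<in> borel_measurable lebesgue"
      using gl T_borel[OF T] by (intro borel_measurable_times borel_measurable_indicator) auto
  qed
  also have "\<dots> = (\<integral>x. indicator T x * g x \<partial>lborel)"
    using gm T_borel[OF T] by (intro integral_completion) simp
  finally show ?thesis .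
qed

lemma measure_cell: "T \<in> \<T> \<Longrightarrow> emeasure (lebesgue_on \<Omega>) (cell T) = ennreal (vol T)"
proof -
  assume T: "T \<in> \<T>"
  have "emeasure (lebesgue_on \<Omega>) (cell T) = emeasure lebesgue (cell T)"
    using cell_sub by (intro emeasure_restrict_space) auto
  also have "\<dots> = emeasure lebesgue T"
    using T_borel[OF T] AE_cell_T[OF T] by (intro emeasure_eq_AE) auto
  also have "\<dots> = emeasure lborel T" using T_borel[OF T] by simp
  also have "\<dots> = ennreal (vol T)"
    unfolding vol_def using emeasure_compact_finite[OF compactT[OF T]] by (intro emeasure_eq_ennreal_measure) auto
  finally show ?thesis .
qed

lemma faces_eq: "faces \<T> = (\<Union>T\<in>\<T>. facets_of T)" by (auto simp: faces_def facets_of_def)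

lemma facets_of_eq: assumes "T \<in> \<T>" shows "facets_of T = opp (verts T) ` verts T"
  using facets[OF assms] unfolding facets_of_def .

lemma facets_finite: assumes "T \<in> \<T>" shows "finite (facets_of T)"
  unfolding facets_of_eq[OF assms] using full_simplex_facts(1)[OF simplex(1)[OF assms]] by (rule finite_imageI)

lemma faces_finite: "finite (faces \<T>)" unfolding faces_eq using fin facets_finite by blast

lemma opp_inj_on: "T \<in> \<T> \<Longrightarrow> inj_on (opp (verts T)) (verts T)"
  by (rule inj_onI) (rule opp_inj[OF simplex(1)])

lemma card_facets: assumes "T \<in> \<T>" shows "card (facets_of T) = CARD('n) + 1"
  unfolding facets_of_eq[OF assms] card_image[OF opp_inj_on[OF assms]]
  using full_simplex_facts(3)[OF simplex(1)[OF assms]] by simp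

lemma sum_facets: assumes "T \<in> \<T>" shows "(\<Sum>v\<in>verts T. g (opp (verts T) v)) = (\<Sum>f\<in>facets_of T. g f)"
  unfolding facets_of_eq[OF assms] sum.reindex[OF opp_inj_on[OF assms]] by (simp only: comp_def)

section \<open>Discrete functions given by their face values\<close>

definition loc :: "(real^'n) set \<Rightarrow> ((real^'n) set \<Rightarrow> real) \<Rightarrow> real^'n \<Rightarrow> real" where
  "loc T x = CR_local (verts T) (\<lambda>v. x (opp (verts T) v))"

text \<open>Averaging over all simplices containing \<open>p\<close> makes this function Borel measurable and continuous
  at the centers of the faces.\<close>

definition crf :: "((real^'n) set \<Rightarrow> real) \<Rightarrow> real^'n \<Rightarrow> real" where
  "crf x p = (\<Sum>T\<in>\<T>. indicator T p * loc T x p) / (\<Sum>T\<in>\<T>. indicator T p)"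

lemma loc_affine: "T \<in> \<T> \<Longrightarrow> \<exists>a b. loc T x = (\<lambda>p. a \<bullet> p + b)"
  unfolding loc_def by (rule CR_local_affine[OF simplex(1)])

lemma loc_continuous: "T \<in> \<T> \<Longrightarrow> continuous_on S (loc T x)"
  using loc_affine[of T x] by (auto intro!: continuous_intros)

lemma loc_mid:
  assumes "T \<in> \<T>" "f facet_of T" shows "loc T x (mid f) = x f"
proof -
  obtain v where v: "v \<in> verts T" "f = opp (verts T) v" using facets[OF assms(1)] assms(2) by auto
  show ?thesis unfolding loc_def v(2) mid_opp[OF simplex(1)[OF assms(1)] v(1)]
    using CR_local_center[OF simplex(1)[OF assms(1)] v(1)] by simp
qed

lemma loc_unique:
  assumes T: "T \<in> \<T>" and "\<And>f. f facet_of T \<Longrightarrow> x f = a \<bullet> mid f + b"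
  shows "a \<bullet> p + b = loc T x p"
  unfolding loc_def
proof (rule affine_eq_CR_local[OF simplex(1)[OF T]])
  fix v assume v: "v \<in> verts T"
  then have "opp (verts T) v facet_of T" using facets[OF T] by auto
  then show "x (opp (verts T) v) = a \<bullet> ((\<Sum>w\<in>verts T - {v}. w) /\<^sub>R real DIM(real^'n)) + b"
    using assms(2) by (simp add: mid_opp[OF simplex(1)[OF T] v])
qed

lemma loc_bound:
  assumes "T \<in> \<T>" "p \<in> T" shows "\<bar>loc T x p\<bar> \<le> real CARD('n) * (\<Sum>f\<in>facets_of T. \<bar>x f\<bar>)"
  using CR_local_bound[OF simplex(1)[OF assms(1)], of p "\<lambda>v. x (opp (verts T) v)"] assms(2)
  unfolding loc_def simplex(2)[OF assms(1)] sum_facets[OF assms(1), of "\<lambda>f. \<bar>x f\<bar>"] by simp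

lemma crf_cell: assumes "T \<in> \<T>" "p \<in> cell T" shows "crf x p = loc T x p"
  using sum_simplices[OF assms, of "\<lambda>T. loc T x p"] sum_simplices[OF assms, of "\<lambda>_. 1"] by (simp add: crf_def)

text \<open>\<open>CR_space\<close> asks for affinity on the whole interior of a simplex, also on
  the part that a slit removes from \<Omega>, so the statement for cells is not enough.\<close>

lemma crf_interior:
  assumes "T \<in> \<T>" "p \<in> interior T" shows "crf x p = loc T x p"
proof -
  have "(\<Sum>S\<in>\<T>. indicator S p * g S) = (g T :: real)" for g
  proof -
    have "(\<Sum>S\<in>\<T>. indicator S p * g S) = (\<Sum>S\<in>\<T>. if S = T then g T else 0)"
      using interior_disjoint[OF assms(1)] interior_subset[of T] assms by (intro sum.cong) (auto simp: indicator_def)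
    then show ?thesis using fin assms(1) by simp
  qed
  from this[of "\<lambda>T. loc T x p"] this[of "\<lambda>_. 1"] show ?thesis by (simp add: crf_def)
qed

lemma crf_measurable: "crf x \<in> borel_measurable borel" "crf x \<in> borel_measurable (lebesgue_on \<Omega>)"
proof -
  show 1: "crf x \<in> borel_measurable borel" unfolding crf_def
    using T_borel borel_measurable_continuous_onI[OF loc_continuous]
    by (intro borel_measurable_divide borel_measurable_sum borel_measurable_times borel_measurable_indicator) auto
  show "crf x \<in> borel_measurable (lebesgue_on \<Omega>)"
    using 1 by (intro measurable_restrict_space1) (simp add: measurable_completion)
qed

text \<open>\<open>crf\<close> is a convex combination of the local values at p, so a bound common
  to them passes to it.\<close>

lemma crf_average_bound:
  assumes "\<And>T. T \<in> \<T> \<Longrightarrow> p \<in> T \<Longrightarrow> \<bar>loc T x p - y\<bar> \<le> B" "p \<in> \<Union>\<T>"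
  shows "\<bar>crf x p - y\<bar> \<le> B"
proof -
  define N where "N = (\<Sum>T\<in>\<T>. indicator T p :: real)"
  obtain S where "S \<in> \<T>" "p \<in> S" using assms(2) by auto
  then have N: "1 \<le> N" unfolding N_def using member_le_sum[of S \<T> "\<lambda>T. indicator T p :: real"] fin by auto
  have "crf x p - y = (\<Sum>T\<in>\<T>. indicator T p * (loc T x p - y)) / N"
    using N by (simp add: crf_def N_def[symmetric] right_diff_distrib sum_subtractf sum_distrib_right[symmetric] diff_divide_distrib)
  also have "\<bar>\<dots>\<bar> = \<bar>\<Sum>T\<in>\<T>. indicator T p * (loc T x p - y)\<bar> / N" using N by simp
  also have "\<dots> \<le> (\<Sum>T\<in>\<T>. \<bar>indicator T p * (loc T x p - y)\<bar>) / N" using N by (intro divide_right_mono sum_abs) auto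
  also have "\<dots> \<le> (\<Sum>T\<in>\<T>. indicator T p * B) / N"
    using N assms(1) by (intro divide_right_mono sum_mono) (auto simp: indicator_def)
  also have "\<dots> = B" using N by (simp add: sum_distrib_right[symmetric] N_def[symmetric])
  finally show ?thesis .
qed

lemma crf_bounded: "\<exists>B. \<forall>p. \<bar>crf x p\<bar> \<le> B"
proof -
  define B where "B = (\<Sum>T\<in>\<T>. real CARD('n) * (\<Sum>f\<in>facets_of T. \<bar>x f\<bar>))"
  have B: "real CARD('n) * (\<Sum>f\<in>facets_of T. \<bar>x f\<bar>) \<le> B" if "T \<in> \<T>" for T
    unfolding B_def using fin that by (intro member_le_sum[of T \<T> "\<lambda>T. real CARD('n) * (\<Sum>f\<in>facets_of T. \<bar>x f\<bar>)"]) (auto intro: sum_nonneg)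
  have "\<bar>crf x p\<bar> \<le> B" for p
  proof (cases "p \<in> \<Union>\<T>")
    case True
    have "\<bar>crf x p - 0\<bar> \<le> B"
    proof (rule crf_average_bound[OF _ True])
      fix T assume "T \<in> \<T>" "p \<in> T"
      from order_trans[OF loc_bound[OF this] B[OF this(1)]] show "\<bar>loc T x p - 0\<bar> \<le> B" by simp
    qed
    then show ?thesis by simp
  next
    case False
    then have "crf x p = 0" by (auto simp: crf_def indicator_def intro!: sum.neutral)
    then show ?thesis by (auto simp: B_def intro!: sum_nonneg)
  qed
  then show ?thesis by blast
qed

lemma finite_measure_Omega: "finite_measure (lebesgue_on \<Omega>)"
proof
  have "\<Omega> \<in> lmeasurable" using bounded_Omega by (intro bounded_set_imp_lmeasurable) auto
  then show "emeasure (lebesgue_on \<Omega>) (space (lebesgue_on \<Omega>)) \<noteq> \<infinity>"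
    by (auto simp: fmeasurable_def emeasure_restrict_space)
qed

text \<open>Every simplex containing \<open>mid f\<close> has f as a facet, so all local functions
  relevant near \<open>mid f\<close> take the value \<open>x f\<close> there; the remaining
  simplices are closed and stay away. Averaging preserves the limit.\<close>

lemma crf_in_CR_space: "crf x \<in> CR_space \<Omega> \<T>"
  unfolding CR_space_def
proof (intro CollectI conjI exI[of _ "crf x"] ballI)
  obtain B where B: "\<And>p. \<bar>crf x p\<bar> \<le> B" using crf_bounded by blast
  have "(\<lambda>p. ennreal \<bar>crf x p\<bar>) \<in> borel_measurable (lebesgue_on \<Omega>)" using crf_measurable(2) by measurable
  then have "esssup (lebesgue_on \<Omega>) (\<lambda>p. ennreal \<bar>crf x p\<bar>) \<le> ennreal B"
    using B by (intro esssup_I) (auto intro!: ennreal_leI)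
  also have "\<dots> < \<infinity>" by simp
  finally show "crf x \<in> Lp_space \<infinity> \<Omega>" using crf_measurable by (simp add: Lp_space_def Lp_norm_def)
  show "AE p in lebesgue_on \<Omega>. crf x p = crf x p" by simp
  fix T assume T: "T \<in> \<T>"
  obtain a b where "loc T x = (\<lambda>p. a \<bullet> p + b)" using loc_affine[OF T] by blast
  then show "\<exists>a b. \<forall>p\<in>interior T. crf x p = a \<bullet> p + b" using crf_interior[OF T] by auto
next
  fix f assume "f \<in> faces \<T>"
  then obtain T0 where T0: "T0 \<in> \<T>" "f facet_of T0" by (auto simp: faces_def)
  have facet: "f facet_of T" if "T \<in> \<T>" "mid f \<in> T" for T
    using facet_of_other[OF T0(1) that(1) T0(2)] that by blast
  have midT0: "mid f \<in> T0" using mid_rel_interior[OF T0] rel_interior_subset facet_of_imp_subset[OF T0(2)] by blast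
  have crf_mid: "crf x (mid f) = x f"
  proof -
    have "\<bar>crf x (mid f) - x f\<bar> \<le> 0"
    proof (rule crf_average_bound)
      fix T assume T: "T \<in> \<T>" "mid f \<in> T"
      show "\<bar>loc T x (mid f) - x f\<bar> \<le> 0" using loc_mid[OF T(1) facet[OF T]] by simp
    qed (use midT0 T0(1) in blast)
    then show ?thesis by simp
  qed
  have ev: "\<forall>\<^sub>F p in at (mid f) within closure \<Omega>. \<bar>loc T x p - x f\<bar> < e \<or> p \<notin> T" if TE: "T \<in> \<T>" "0 < e" for T e
  proof (cases "mid f \<in> T")
    case True
    have "(loc T x \<longlongrightarrow> loc T x (mid f)) (at (mid f) within closure \<Omega>)"
    proof -
      obtain a b where "loc T x = (\<lambda>p. a \<bullet> p + b)" using loc_affine[OF TE(1)] by blast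
      then show ?thesis by (auto intro!: tendsto_intros)
    qed
    then have "\<forall>\<^sub>F p in at (mid f) within closure \<Omega>. dist (loc T x p) (x f) < e"
      unfolding loc_mid[OF TE(1) facet[OF TE(1) True]] using TE(2) by (rule tendstoD)
    then show ?thesis by eventually_elim (simp add: dist_real_def)
  next
    case False
    have "open (- T)" using compact_imp_closed[OF compactT[OF TE(1)]] by (simp add: open_Compl)
    then have "\<forall>\<^sub>F p in at (mid f) within closure \<Omega>. p \<in> - T"
      unfolding eventually_at_topological using False by (intro exI[of _ "- T"]) simp
    then show ?thesis by eventually_elim simp
  qed
  show "continuous (at (mid f) within closure \<Omega>) (crf x)"
    unfolding continuous_within crf_mid
  proof (rule tendstoI)
    fix e :: real assume e: "0 < e"
    have "\<forall>\<^sub>F p in at (mid f) within closure \<Omega>. \<forall>T\<in>\<T>. \<bar>loc T x p - x f\<bar> < e/2 \<or> p \<notin> T"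
      using ev[of _ "e/2"] e fin by (simp add: eventually_ball_finite_distrib)
    moreover have "\<forall>\<^sub>F p in at (mid f) within closure \<Omega>. p \<in> closure \<Omega>"
      by (simp add: eventually_at_filter)
    ultimately show "\<forall>\<^sub>F p in at (mid f) within closure \<Omega>. dist (crf x p) (x f) < e"
    proof eventually_elim
      case (elim p)
      have "\<bar>crf x p - x f\<bar> \<le> e/2"
        by (rule crf_average_bound) (use elim Union in \<open>auto intro: less_imp_le\<close>)
      then show ?case using e by (simp add: dist_real_def)
    qed
  qed
qed

text \<open>The face values are read off from the continuous representative at the centers.
  Approaching a center from the interior of T identifies them with values of the affine function on
  T, which they determine.\<close>

lemma CR_space_crf:
  assumes "v \<in> CR_space \<Omega> \<T>" shows "\<exists>x. AE p in lebesgue_on \<Omega>. v p = crf x p"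
proof -
  obtain w where w: "AE p in lebesgue_on \<Omega>. v p = w p" "\<And>T. T \<in> \<T> \<Longrightarrow> \<exists>a b. \<forall>p\<in>interior T. w p = a \<bullet> p + b"
    "\<And>f. f \<in> faces \<T> \<Longrightarrow> continuous (at (mid f) within closure \<Omega>) w"
    using assms by (auto simp: CR_space_def)
  define x where "x f = w (mid f)" for f
  have loc_eq: "w p = loc T x p" if T: "T \<in> \<T>" and p: "p \<in> interior T" for T p
  proof -
    obtain a b where ab: "\<And>p. p \<in> interior T \<Longrightarrow> w p = a \<bullet> p + b" using w(2)[OF T] by blast
    have "x f = a \<bullet> mid f + b" if f: "f facet_of T" for f
    proof -
      have "mid f \<in> T" using mid_rel_interior[OF T f] rel_interior_subset facet_of_imp_subset[OF f] by blast
      then have cl: "mid f \<in> closure (interior T)"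
        using convex_closure_interior[OF convexT[OF T] interior_ne[OF T]] closure_subset by blast
      have "f \<in> faces \<T>" using T f by (auto simp: faces_def)
      moreover have "interior T \<subseteq> closure \<Omega>" using interior_subset[of T] Union T by auto
      ultimately have "(w \<longlongrightarrow> w (mid f)) (at (mid f) within interior T)"
        using w(3) tendsto_within_subset unfolding continuous_within by blast
      moreover have "((\<lambda>p. a \<bullet> p + b) \<longlongrightarrow> a \<bullet> mid f + b) (at (mid f) within interior T)"
        by (intro tendsto_intros)
      then have "(w \<longlongrightarrow> a \<bullet> mid f + b) (at (mid f) within interior T)"
        by (rule Lim_transform_eventually) (use ab in \<open>simp add: eventually_at_filter\<close>)
      moreover have "mid f islimpt interior T"
        using cl interior_limit_point[of "mid f" "interior T"] by (cases "mid f \<in> interior T") (simp_all add: closure_def)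
      then have "at (mid f) within interior T \<noteq> bot" using trivial_limit_within[of "mid f" "interior T"] by simp
      ultimately show ?thesis unfolding x_def by (metis tendsto_unique)
    qed
    then show ?thesis using loc_unique[OF T, of x a b p] ab[OF p] by simp
  qed
  have "AE p in lebesgue_on \<Omega>. v p = crf x p"
    using w(1) AE_cells by eventually_elim (auto simp: cell_def crf_interior loc_eq)
  then show ?thesis by blast
qed

end

section \<open>The mass form and the projection\<close>

context CR_mesh
begin

lemma integrable_times_crf:
  assumes "integrable (lebesgue_on \<Omega>) h"
  shows "integrable (lebesgue_on \<Omega>) (\<lambda>p. h p * crf y p)"
proof -
  obtain B where B: "\<And>p. \<bar>crf y p\<bar> \<le> B" using crf_bounded by blast
  show ?thesis
  proof (rule Bochner_Integration.integrable_bound)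
    show "integrable (lebesgue_on \<Omega>) (\<lambda>p. B * h p)" using assms by simp
    show "(\<lambda>p. h p * crf y p) \<in> borel_measurable (lebesgue_on \<Omega>)"
      using assms crf_measurable(2) by (intro borel_measurable_times) auto
    have "norm (h p * crf y p) \<le> norm (B * h p)" for p
      using mult_left_mono[OF order_trans[OF B abs_ge_self], of "\<bar>h p\<bar>" p] by (simp add: abs_mult mult.commute)
    then show "AE p in lebesgue_on \<Omega>. norm (h p * crf y p) \<le> norm (B * h p)" by simp
  qed
qed

lemma integrable_crf: "integrable (lebesgue_on \<Omega>) (crf x)"
proof -
  have "integrable (lebesgue_on \<Omega>) (\<lambda>_. 1 :: real)" using finite_measure_Omega by (rule finite_measure.integrable_const)
  from integrable_times_crf[OF this, of x] show ?thesis by simp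
qed

lemma crf_linear:
  "crf y p = (\<Sum>f\<in>faces \<T>. y f * crf (\<lambda>g. if g = f then 1 else 0) p)"
proof -
  have L: "loc T y p = (\<Sum>f\<in>faces \<T>. y f * loc T (\<lambda>g. if g = f then 1 else 0) p)" if T: "T \<in> \<T>" for T
  proof -
    have o: "opp (verts T) v \<in> faces \<T>" if "v \<in> verts T" for v
      using that T facets_of_eq[OF T] unfolding faces_eq by blast
    have "loc T y p = (\<Sum>v\<in>verts T. \<Sum>f\<in>faces \<T>. y f * ((if opp (verts T) v = f then 1 else 0) * (1 - real CARD('n) * bary (verts T) v p)))"
      unfolding loc_def CR_local_def
    proof (intro sum.cong refl)
      fix v assume v: "v \<in> verts T"
      have "(\<Sum>f\<in>faces \<T>. y f * ((if opp (verts T) v = f then 1 else 0) * (1 - real CARD('n) * bary (verts T) v p)))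
        = (\<Sum>f\<in>faces \<T>. if f = opp (verts T) v then y f * (1 - real CARD('n) * bary (verts T) v p) else 0)"
        by (intro sum.cong) auto
      also have "\<dots> = y (opp (verts T) v) * (1 - real CARD('n) * bary (verts T) v p)"
        using o[OF v] faces_finite by simp
      finally show "y (opp (verts T) v) * (1 - real DIM(real^'n) * bary (verts T) v p) =
        (\<Sum>f\<in>faces \<T>. y f * ((if opp (verts T) v = f then 1 else 0) * (1 - real CARD('n) * bary (verts T) v p)))" by simp
    qed
    also have "\<dots> = (\<Sum>f\<in>faces \<T>. y f * loc T (\<lambda>g. if g = f then 1 else 0) p)"
      unfolding loc_def CR_local_def sum_distrib_left by (subst sum.swap) simp
    finally show ?thesis .
  qed
  have "(\<Sum>T\<in>\<T>. indicator T p * loc T y p)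
    = (\<Sum>T\<in>\<T>. \<Sum>f\<in>faces \<T>. y f * (indicator T p * loc T (\<lambda>g. if g = f then 1 else 0) p))"
    by (intro sum.cong refl) (simp add: L sum_distrib_left mult.left_commute)
  also have "\<dots> = (\<Sum>f\<in>faces \<T>. y f * (\<Sum>T\<in>\<T>. indicator T p * loc T (\<lambda>g. if g = f then 1 else 0) p))"
    unfolding sum_distrib_left by (rule sum.swap)
  finally have e: "(\<Sum>T\<in>\<T>. indicator T p * loc T y p)
    = (\<Sum>f\<in>faces \<T>. y f * (\<Sum>T\<in>\<T>. indicator T p * loc T (\<lambda>g. if g = f then 1 else 0) p))" .
  show ?thesis unfolding crf_def e times_divide_eq_right by (rule sum_divide_distrib)
qed

lemma L2_pairing_crf_sum:
  assumes "integrable (lebesgue_on \<Omega>) h"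
  shows "L2_pairing \<Omega> h (crf y) = (\<Sum>f\<in>faces \<T>. y f * L2_pairing \<Omega> h (crf (\<lambda>g. if g = f then 1 else 0)))"
proof -
  have "L2_pairing \<Omega> h (crf y) = (\<integral>p. (\<Sum>f\<in>faces \<T>. y f * (h p * crf (\<lambda>g. if g = f then 1 else 0) p)) \<partial>lebesgue_on \<Omega>)"
    unfolding L2_pairing_def by (subst crf_linear) (simp add: sum_distrib_left mult.left_commute)
  also have "\<dots> = (\<Sum>f\<in>faces \<T>. \<integral>p. y f * (h p * crf (\<lambda>g. if g = f then 1 else 0) p) \<partial>lebesgue_on \<Omega>)"
    by (intro Bochner_Integration.integral_sum integrable_mult_right integrable_times_crf[OF assms])
  finally show ?thesis by (simp add: L2_pairing_def)
qed

lemma L2_pairing_commute: "L2_pairing \<Omega> u v = L2_pairing \<Omega> v u"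
  by (simp add: L2_pairing_def mult.commute)

lemma L2_pairing_crf:
  "L2_pairing \<Omega> (crf x) (crf y) = (\<Sum>T\<in>\<T>. vol T / ((real CARD('n) + 1) * (real CARD('n) + 2)) *
     ((real CARD('n))\<^sup>2 * (\<Sum>f\<in>facets_of T. x f * y f)
      - (real CARD('n) - 2) * ((\<Sum>f\<in>facets_of T. x f) * (\<Sum>f\<in>facets_of T. y f))))"
proof -
  have "L2_pairing \<Omega> (crf x) (crf y) = (\<Sum>T\<in>\<T>. \<integral>p. indicator (cell T) p * (crf x p * crf y p) \<partial>lebesgue_on \<Omega>)"
    unfolding L2_pairing_def by (rule integral_split[OF integrable_times_crf[OF integrable_crf]])
  also have "\<dots> = (\<Sum>T\<in>\<T>. vol T / ((real CARD('n) + 1) * (real CARD('n) + 2)) *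
     ((real CARD('n))\<^sup>2 * (\<Sum>f\<in>facets_of T. x f * y f)
      - (real CARD('n) - 2) * ((\<Sum>f\<in>facets_of T. x f) * (\<Sum>f\<in>facets_of T. y f))))"
  proof (intro sum.cong refl)
    fix T assume T: "T \<in> \<T>"
    have "(\<integral>p. indicator (cell T) p * (crf x p * crf y p) \<partial>lebesgue_on \<Omega>)
      = (\<integral>p. indicator (cell T) p * (loc T x p * loc T y p) \<partial>lebesgue_on \<Omega>)"
      by (intro Bochner_Integration.integral_cong refl) (auto simp: indicator_def crf_cell[OF T])
    also have "\<dots> = (\<integral>p. indicator T p * (loc T x p * loc T y p) \<partial>lborel)"
      by (intro integral_cell_continuous[OF T] continuous_on_mult loc_continuous[OF T])
    also have "\<dots> = vol T / ((real CARD('n) + 1) * (real CARD('n) + 2)) *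
     ((real CARD('n))\<^sup>2 * (\<Sum>f\<in>facets_of T. x f * y f)
      - (real CARD('n) - 2) * ((\<Sum>f\<in>facets_of T. x f) * (\<Sum>f\<in>facets_of T. y f)))"
      using CR_local_mass[OF simplex(1)[OF T], of "\<lambda>v. x (opp (verts T) v)" "\<lambda>v. y (opp (verts T) v)"]
      unfolding simplex(2)[OF T] loc_def vol_def sum_facets[OF T, of "\<lambda>f. x f * y f"] sum_facets[OF T, of x] sum_facets[OF T, of y]
      by simp
    finally show "(\<integral>p. indicator (cell T) p * (crf x p * crf y p) \<partial>lebesgue_on \<Omega>) = vol T / ((real CARD('n) + 1) * (real CARD('n) + 2)) *
     ((real CARD('n))\<^sup>2 * (\<Sum>f\<in>facets_of T. x f * y f)
      - (real CARD('n) - 2) * ((\<Sum>f\<in>facets_of T. x f) * (\<Sum>f\<in>facets_of T. y f)))" .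
  qed
  finally show ?thesis .
qed

text \<open>On one simplex, the square of the sum of the d+1 face values is at most d+1 times the
  sum of their squares, and d^2 - (d-2)(d+1) = d+2 > 0.\<close>

lemma L2_pairing_crf_pos:
  assumes "\<exists>f\<in>faces \<T>. x f \<noteq> 0" shows "0 < L2_pairing \<Omega> (crf x) (crf x)"
proof -
  define n where "n = real CARD('n)"
  have n: "2 \<le> n" using dim2 by (simp add: n_def)
  have loc: "(n + 2) * (\<Sum>f\<in>facets_of T. x f * x f)
    \<le> n\<^sup>2 * (\<Sum>f\<in>facets_of T. x f * x f) - (n - 2) * ((\<Sum>f\<in>facets_of T. x f) * (\<Sum>f\<in>facets_of T. x f))" if T: "T \<in> \<T>" for T
  proof -
    have "(\<Sum>f\<in>facets_of T. 1 * x f)\<^sup>2 \<le> (\<Sum>f\<in>facets_of T. 1\<^sup>2) * (\<Sum>f\<in>facets_of T. (x f)\<^sup>2)"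
      by (rule Cauchy_Schwarz_ineq_sum)
    then have "(\<Sum>f\<in>facets_of T. x f) * (\<Sum>f\<in>facets_of T. x f) \<le> (n + 1) * (\<Sum>f\<in>facets_of T. x f * x f)"
      by (simp add: power2_eq_square card_facets[OF T] n_def add.commute)
    then have "(n - 2) * ((\<Sum>f\<in>facets_of T. x f) * (\<Sum>f\<in>facets_of T. x f)) \<le> (n - 2) * ((n + 1) * (\<Sum>f\<in>facets_of T. x f * x f))"
      using n by (intro mult_left_mono) auto
    moreover have "(n - 2) * ((n + 1) * s) = n\<^sup>2 * s - (n + 2) * s" for s by (simp add: algebra_simps power2_eq_square)
    ultimately show ?thesis by simp
  qed
  obtain f T where f: "T \<in> \<T>" "f \<in> facets_of T" "x f \<noteq> 0" using assms by (auto simp: faces_eq)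
  have "0 < (\<Sum>T\<in>\<T>. vol T / ((n + 1) * (n + 2)) * ((n + 2) * (\<Sum>f\<in>facets_of T. x f * x f)))"
  proof (rule sum_pos2[OF fin f(1)])
    have "0 < (\<Sum>f\<in>facets_of T. x f * x f)"
      using f facets_finite[OF f(1)] by (intro sum_pos2[of _ f]) (auto simp: zero_less_mult_iff)
    then show "0 < vol T / ((n + 1) * (n + 2)) * ((n + 2) * (\<Sum>f\<in>facets_of T. x f * x f))"
      using vol_pos[OF f(1)] n by simp
    show "0 \<le> vol S / ((n + 1) * (n + 2)) * ((n + 2) * (\<Sum>f\<in>facets_of S. x f * x f))" if "S \<in> \<T>" for S
    proof -
      have "0 \<le> (\<Sum>f\<in>facets_of S. x f * x f)" by (intro sum_nonneg) simp
      then show ?thesis using vol_pos[OF that] n by (intro mult_nonneg_nonneg divide_nonneg_nonneg) simp_all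
    qed
  qed
  also have "\<dots> \<le> L2_pairing \<Omega> (crf x) (crf x)"
    unfolding L2_pairing_crf n_def[symmetric] using loc vol_pos n by (intro sum_mono mult_left_mono) (auto intro: less_imp_le)
  finally show ?thesis .
qed

text \<open>The Gram matrix of the functions with a single unit face value is positive definite, so
  the finite system is solvable. Pairings with an integrable \<open>u\<close> make sense because
  discrete functions are bounded.\<close>

lemma projection_exists:
  assumes u: "integrable (lebesgue_on \<Omega>) u"
  shows "\<exists>x. \<forall>y. L2_pairing \<Omega> (crf x) (crf y) = L2_pairing \<Omega> u (crf y)"
proof -
  define e where "e f = (\<lambda>g. if g = f then 1 else 0 :: real)" for f :: "(real^'n) set"
  define m where "m f g = L2_pairing \<Omega> (crf (e f)) (crf (e g))" for f g
  have row: "L2_pairing \<Omega> (crf x) (crf (e f)) = (\<Sum>g\<in>faces \<T>. m f g * x g)" for x f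
    using L2_pairing_crf_sum[OF integrable_crf, of "e f" x]
    by (simp add: L2_pairing_commute[of "crf x"] m_def e_def mult.commute)
  have "(\<Sum>f\<in>faces \<T>. \<Sum>g\<in>faces \<T>. m f g * x g * x f) > 0" if "\<exists>f\<in>faces \<T>. x f \<noteq> 0" for x
  proof -
    have "L2_pairing \<Omega> (crf x) (crf x) = (\<Sum>f\<in>faces \<T>. x f * L2_pairing \<Omega> (crf x) (crf (e f)))"
      using L2_pairing_crf_sum[OF integrable_crf, of x x] by (simp add: e_def)
    also have "\<dots> = (\<Sum>f\<in>faces \<T>. \<Sum>g\<in>faces \<T>. m f g * x g * x f)"
      by (simp add: row sum_distrib_left mult_ac)
    finally show ?thesis using L2_pairing_crf_pos[OF that] by simp
  qed
  from solve_positive[OF faces_finite this, of "\<lambda>f. L2_pairing \<Omega> u (crf (e f))"]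
  obtain x where x: "\<forall>f\<in>faces \<T>. (\<Sum>g\<in>faces \<T>. m f g * x g) = L2_pairing \<Omega> u (crf (e f))" by auto
  have "L2_pairing \<Omega> (crf x) (crf y) = L2_pairing \<Omega> u (crf y)" for y
  proof -
    have "L2_pairing \<Omega> (crf x) (crf y) = (\<Sum>f\<in>faces \<T>. y f * L2_pairing \<Omega> (crf x) (crf (e f)))"
      using L2_pairing_crf_sum[OF integrable_crf, of x y] by (simp add: e_def)
    also have "\<dots> = (\<Sum>f\<in>faces \<T>. y f * L2_pairing \<Omega> u (crf (e f)))"
      using x row by (intro sum.cong) auto
    also have "\<dots> = L2_pairing \<Omega> u (crf y)" using L2_pairing_crf_sum[OF u, of y] by (simp add: e_def)
    finally show ?thesis .
  qed
  then show ?thesis by blast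
qed

lemma L2_pairing_cong:
  assumes "h \<in> borel_measurable (lebesgue_on \<Omega>)" "v \<in> borel_measurable (lebesgue_on \<Omega>)" "AE p in lebesgue_on \<Omega>. v p = crf y p"
  shows "L2_pairing \<Omega> h v = L2_pairing \<Omega> h (crf y)"
  unfolding L2_pairing_def
proof (rule integral_cong_AE)
  show "AE p in lebesgue_on \<Omega>. h p * v p = h p * crf y p" using assms(3) by eventually_elim simp
qed (use assms crf_measurable(2) in \<open>auto intro!: borel_measurable_times\<close>)

text \<open>Existence justifies the choice made in \<open>Q_CR\<close>; whichever function was
  chosen agrees almost everywhere with a \<open>crf\<close>, so the projection is known through
  finitely many face values.\<close>

lemma Q_CR_crf:
  assumes u: "integrable (lebesgue_on \<Omega>) u"
  shows "\<exists>x. (AE p in lebesgue_on \<Omega>. Q_CR \<Omega> \<T> u p = crf x p) \<and> Q_CR \<Omega> \<T> u \<in> borel_measurable (lebesgue_on \<Omega>) \<and>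
     (\<forall>y. L2_pairing \<Omega> (crf x) (crf y) = L2_pairing \<Omega> u (crf y))"
proof -
  have um: "u \<in> borel_measurable (lebesgue_on \<Omega>)" using u by auto
  obtain x0 where x0: "\<And>y. L2_pairing \<Omega> (crf x0) (crf y) = L2_pairing \<Omega> u (crf y)" using projection_exists[OF u] by blast
  have meas: "v \<in> borel_measurable (lebesgue_on \<Omega>)" if "v \<in> CR_space \<Omega> \<T>" for v
    using that by (simp add: CR_space_def Lp_space_def)
  have "\<exists>w. w \<in> CR_space \<Omega> \<T> \<and> (\<forall>v\<in>CR_space \<Omega> \<T>. L2_pairing \<Omega> w v = L2_pairing \<Omega> u v)"
  proof (intro exI[of _ "crf x0"] conjI ballI crf_in_CR_space)
    fix v assume v: "v \<in> CR_space \<Omega> \<T>"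
    obtain y where y: "AE p in lebesgue_on \<Omega>. v p = crf y p" using CR_space_crf[OF v] by blast
    show "L2_pairing \<Omega> (crf x0) v = L2_pairing \<Omega> u v"
      using L2_pairing_cong[OF crf_measurable(2) meas[OF v] y] L2_pairing_cong[OF um meas[OF v] y] x0 by simp
  qed
  from someI_ex[OF this]
  have Q: "Q_CR \<Omega> \<T> u \<in> CR_space \<Omega> \<T>" "\<And>v. v \<in> CR_space \<Omega> \<T> \<Longrightarrow> L2_pairing \<Omega> (Q_CR \<Omega> \<T> u) v = L2_pairing \<Omega> u v"
    unfolding Q_CR_def by auto
  obtain x where x: "AE p in lebesgue_on \<Omega>. Q_CR \<Omega> \<T> u p = crf x p" using CR_space_crf[OF Q(1)] by blast
  have "L2_pairing \<Omega> (crf x) (crf y) = L2_pairing \<Omega> u (crf y)" for y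
    using Q(2)[OF crf_in_CR_space, of y] L2_pairing_cong[OF crf_measurable(2) meas[OF Q(1)] x, of y]
      L2_pairing_commute by metis
  then show ?thesis using x meas[OF Q(1)] by blast
qed

section \<open>Means of the data and simplexwise weights\<close>

definition avg :: "(real^'n \<Rightarrow> real) \<Rightarrow> (real^'n) set \<Rightarrow> real" where
  "avg u T = (\<integral>p. indicator (cell T) p * \<bar>u p\<bar> \<partial>lebesgue_on \<Omega>) / vol T"

lemma avg_nonneg: assumes "T \<in> \<T>" shows "0 \<le> avg u T"
  unfolding avg_def using vol_pos[OF assms] by (intro divide_nonneg_nonneg integral_nonneg_AE) auto

text \<open>The factor (d+1)(d+2) clears the denominator of the mass matrix; the further d comes
  from bounding a local function by the sum of its face values, after which only the mean of |u| on
  the simplex remains.\<close>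

lemma test_inequality:
  assumes u: "integrable (lebesgue_on \<Omega>) u"
    and x: "\<And>y. L2_pairing \<Omega> (crf x) (crf y) = L2_pairing \<Omega> u (crf y)"
  shows "(\<Sum>T\<in>\<T>. vol T * (\<Sum>f\<in>facets_of T. (real CARD('n))\<^sup>2 * (y f * x f) - (real CARD('n) - 2) * (\<Sum>f\<in>facets_of T. x f) * y f))
     \<le> ((real CARD('n) + 1) * (real CARD('n) + 2) * real CARD('n)) * (\<Sum>T\<in>\<T>. vol T * (\<Sum>f\<in>facets_of T. \<bar>y f\<bar> * avg u T))"
proof -
  define n where "n = real CARD('n)"
  define K where "K = (n + 1) * (n + 2)"
  have K: "0 < K" unfolding K_def n_def by (intro mult_pos_pos) auto
  have "(\<Sum>T\<in>\<T>. vol T * (\<Sum>f\<in>facets_of T. n\<^sup>2 * (y f * x f) - (n - 2) * (\<Sum>f\<in>facets_of T. x f) * y f))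
    = K * L2_pairing \<Omega> (crf x) (crf y)"
    unfolding L2_pairing_crf n_def[symmetric] K_def[symmetric] sum_distrib_left[of K]
  proof (intro sum.cong refl)
    fix T
    have "(\<Sum>f\<in>facets_of T. n\<^sup>2 * (y f * x f) - (n - 2) * (\<Sum>f\<in>facets_of T. x f) * y f)
      = n\<^sup>2 * (\<Sum>f\<in>facets_of T. x f * y f) - (n - 2) * ((\<Sum>f\<in>facets_of T. x f) * (\<Sum>f\<in>facets_of T. y f))"
      by (simp only: sum_subtractf sum_distrib_left[symmetric] mult.assoc mult.commute[of "y _"])
    then show "vol T * (\<Sum>f\<in>facets_of T. n\<^sup>2 * (y f * x f) - (n - 2) * (\<Sum>f\<in>facets_of T. x f) * y f)
      = K * (vol T / K * (n\<^sup>2 * (\<Sum>f\<in>facets_of T. x f * y f) - (n - 2) * ((\<Sum>f\<in>facets_of T. x f) * (\<Sum>f\<in>facets_of T. y f))))"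
      using K by simp
  qed
  also have "\<dots> = K * (\<Sum>T\<in>\<T>. \<integral>p. indicator (cell T) p * (u p * crf y p) \<partial>lebesgue_on \<Omega>)"
    unfolding x unfolding L2_pairing_def by (simp only: integral_split[OF integrable_times_crf[OF u]])
  also have "\<dots> \<le> K * (\<Sum>T\<in>\<T>. n * (vol T * (\<Sum>f\<in>facets_of T. \<bar>y f\<bar> * avg u T)))"
  proof (intro mult_left_mono sum_mono)
    fix T assume T: "T \<in> \<T>"
    have ia: "integrable (lebesgue_on \<Omega>) (\<lambda>p. indicator (cell T) p * \<bar>u p\<bar>)" using u by (intro integrable_cell) simp
    have "(\<integral>p. indicator (cell T) p * (u p * crf y p) \<partial>lebesgue_on \<Omega>)
      \<le> (\<integral>p. (n * (\<Sum>f\<in>facets_of T. \<bar>y f\<bar>)) * (indicator (cell T) p * \<bar>u p\<bar>) \<partial>lebesgue_on \<Omega>)"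
    proof (rule integral_mono)
      show "integrable (lebesgue_on \<Omega>) (\<lambda>p. indicator (cell T) p * (u p * crf y p))"
        by (intro integrable_cell integrable_times_crf[OF u])
      show "integrable (lebesgue_on \<Omega>) (\<lambda>p. (n * (\<Sum>f\<in>facets_of T. \<bar>y f\<bar>)) * (indicator (cell T) p * \<bar>u p\<bar>))"
        using ia by (rule integrable_mult_right)
      fix p
      show "indicator (cell T) p * (u p * crf y p) \<le> (n * (\<Sum>f\<in>facets_of T. \<bar>y f\<bar>)) * (indicator (cell T) p * \<bar>u p\<bar>)"
      proof (cases "p \<in> cell T")
        case True
        have "u p * crf y p \<le> \<bar>u p\<bar> * \<bar>crf y p\<bar>" by (simp add: abs_mult[symmetric])
        also have "\<dots> \<le> \<bar>u p\<bar> * (n * (\<Sum>f\<in>facets_of T. \<bar>y f\<bar>))"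
          unfolding crf_cell[OF T True] n_def using True cell_sub(2) by (intro mult_left_mono loc_bound[OF T]) auto
        finally show ?thesis using True by (simp add: mult.commute)
      qed simp
    qed
    also have "\<dots> = n * (\<Sum>f\<in>facets_of T. \<bar>y f\<bar>) * (vol T * avg u T)"
      unfolding avg_def using vol_pos[OF T] by simp
    also have "\<dots> = n * (vol T * (\<Sum>f\<in>facets_of T. \<bar>y f\<bar> * avg u T))"
      by (simp add: sum_distrib_left sum_distrib_right mult_ac)
    finally show "(\<integral>p. indicator (cell T) p * (u p * crf y p) \<partial>lebesgue_on \<Omega>) \<le> n * (vol T * (\<Sum>f\<in>facets_of T. \<bar>y f\<bar> * avg u T))" .
  qed (use K in simp)
  also have "\<dots> = K * n * (\<Sum>T\<in>\<T>. vol T * (\<Sum>f\<in>facets_of T. \<bar>y f\<bar> * avg u T))"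
    by (simp only: sum_distrib_left[symmetric] mult.assoc)
  finally show ?thesis by (simp add: n_def K_def)
qed

lemma AE_lebesgue_on_T:
  assumes "T \<in> \<T>" "AE p in lebesgue_on T. P p"
  shows "AE p in lebesgue_on \<Omega>. p \<in> cell T \<longrightarrow> P p"
proof -
  have "T \<inter> space lebesgue \<in> sets lebesgue" using T_borel[OF assms(1)] by simp
  then have "AE p in lebesgue. p \<in> T \<longrightarrow> P p" using assms(2) by (simp add: AE_restrict_space_iff)
  then have "AE p in lebesgue. p \<in> \<Omega> \<longrightarrow> (p \<in> cell T \<longrightarrow> P p)" by eventually_elim (use cell_sub(2) in auto)
  then show ?thesis by (simp add: AE_restrict_space_iff)
qed

lemma cell_point:
  assumes "T \<in> \<T>" "AE p in lebesgue_on \<Omega>. p \<in> cell T \<longrightarrow> P p" shows "\<exists>p\<in>cell T. P p"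
proof (rule ccontr)
  assume neg: "\<not> (\<exists>p\<in>cell T. P p)"
  have "AE p in lebesgue_on \<Omega>. p \<notin> cell T" using assms(2) by eventually_elim (use neg in auto)
  then have "emeasure (lebesgue_on \<Omega>) (cell T) = 0"
    using AE_iff_measurable[of "cell T" "lebesgue_on \<Omega>" "\<lambda>p. p \<notin> cell T"] cell_sub(1)[of T] by auto
  then show False using measure_cell[OF assms(1)] vol_pos[OF assms(1)] by simp
qed

lemma delta_CR_neighbour:
  assumes "T \<in> \<T>" "T' \<in> \<T>" "share_facet T T'" shows "delta_CR \<T> T T' = 1"
  unfolding delta_CR_def
proof (rule Least_equality)
  show "\<exists>S. S 0 = T \<and> S 1 = T' \<and> (\<forall>i\<le>1. S i \<in> \<T>) \<and> (\<forall>i<1. share_facet (S i) (S (Suc i)))"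
    using assms by (intro exI[of _ "\<lambda>i. if i = 0 then T else T'"]) auto
  fix N assume "\<exists>S. S 0 = T \<and> S N = T' \<and> (\<forall>i\<le>N. S i \<in> \<T>) \<and> (\<forall>i<N. share_facet (S i) (S (Suc i)))"
  then have "N \<noteq> 0" using assms(3) by (auto simp: share_facet_def)
  then show "1 \<le> N" by simp
qed

text \<open>The discrete argument needs one number per simplex; the essential supremum is taken. By
  the grading it differs from \<rho> on the cell by at most the factor \<gamma>, and it inherits the
  bound between neighbours.\<close>

lemma weight_simplexwise:
  assumes w: "weight_with_grading \<Omega> \<T> \<gamma> \<rho>"
  shows "\<exists>R. (\<forall>T\<in>\<T>. 0 < R T \<and> (AE p in lebesgue_on \<Omega>. p \<in> cell T \<longrightarrow> 0 < \<rho> p \<and> \<rho> p \<le> R T \<and> R T \<le> \<gamma> * \<rho> p)) \<and>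
    (\<forall>T\<in>\<T>. \<forall>T'\<in>\<T>. \<forall>f. T \<noteq> T' \<and> f \<in> facets_of T \<and> f \<in> facets_of T' \<longrightarrow> R T' \<le> \<gamma> * R T)"
proof -
  have g: "1 \<le> \<gamma>" and pos: "AE p in lebesgue_on \<Omega>. 0 < \<rho> p"
    and inf: "\<And>T. T \<in> \<T> \<Longrightarrow> ess_sup_on T \<rho> \<le> ereal \<gamma> * ess_inf_on T \<rho>"
    using w by (auto simp: weight_with_grading_def)
  define R where "R T = real_of_ereal (ess_sup_on T \<rho>)" for T
  have main: "ess_sup_on T \<rho> = ereal (R T) \<and> 0 < R T \<and> (AE p in lebesgue_on \<Omega>. p \<in> cell T \<longrightarrow> 0 < \<rho> p \<and> \<rho> p \<le> R T \<and> R T \<le> \<gamma> * \<rho> p)"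
    if T: "T \<in> \<T>" for T
  proof -
    define S where "S = ess_sup_on T \<rho>"
    define J where "J = ess_inf_on T \<rho>"
    have "AE p in lebesgue_on \<Omega>. p \<in> cell T \<longrightarrow> ereal (\<rho> p) \<le> S"
      unfolding S_def ess_sup_on_def by (intro AE_lebesgue_on_T[OF T] esssup_AE)
    moreover have "AE p in lebesgue_on T. J \<le> ereal (\<rho> p)"
      using esssup_AE[of "\<lambda>x. - ereal (\<rho> x)" "lebesgue_on T"] unfolding J_def ess_inf_on_def
      by eventually_elim (simp add: ereal_uminus_le_reorder)
    from AE_lebesgue_on_T[OF T this] have "AE p in lebesgue_on \<Omega>. p \<in> cell T \<longrightarrow> J \<le> ereal (\<rho> p)" .
    ultimately have ae: "AE p in lebesgue_on \<Omega>. p \<in> cell T \<longrightarrow> 0 < \<rho> p \<and> ereal (\<rho> p) \<le> S \<and> J \<le> ereal (\<rho> p)"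
      using pos by eventually_elim auto
    \<comment> \<open>A single point where all the almost-everywhere bounds hold shows that the
      essential supremum is finite and positive; it exists because the cell has positive
      measure.\<close>
    obtain p0 where p0: "0 < \<rho> p0" "ereal (\<rho> p0) \<le> S" "J \<le> ereal (\<rho> p0)" using cell_point[OF T ae] by auto
    have SJ: "S \<le> ereal \<gamma> * J" unfolding S_def J_def by (rule inf[OF T])
    have SJ': "S \<le> ereal (\<gamma> * \<rho> p)" if "J \<le> ereal (\<rho> p)" for p
    proof -
      have "ereal \<gamma> * J \<le> ereal \<gamma> * ereal (\<rho> p)" using that g by (intro ereal_mult_left_mono) auto
      from order_trans[OF SJ this] show ?thesis by simp
    qed
    have SR: "S = ereal (R T)" unfolding R_def S_def[symmetric] using SJ'[OF p0(3)] p0(2) by (cases S) auto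
    have R: "0 < R T" using p0 unfolding SR by simp
    have RJ: "R T \<le> \<gamma> * \<rho> p" if "J \<le> ereal (\<rho> p)" for p
      using SJ'[OF that] unfolding SR by simp
    have "AE p in lebesgue_on \<Omega>. p \<in> cell T \<longrightarrow> 0 < \<rho> p \<and> \<rho> p \<le> R T \<and> R T \<le> \<gamma> * \<rho> p"
      using ae unfolding SR by eventually_elim (auto intro: RJ)
    then show ?thesis using SR R unfolding S_def by blast
  qed
  have "R T' \<le> \<gamma> * R T" if "T \<in> \<T>" "T' \<in> \<T>" "T \<noteq> T'" "f \<in> facets_of T" "f \<in> facets_of T'" for T T' f
  proof -
    have "share_facet T T'" using that by (auto simp: share_facet_def facets_of_def)
    then have "ess_sup_on T' \<rho> \<le> ereal \<gamma> * ess_sup_on T \<rho>"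
      using w delta_CR_neighbour[OF that(1,2)] that(1,2) unfolding weight_with_grading_def by blast
    moreover have "ess_sup_on T \<rho> = ereal (R T)" "ess_sup_on T' \<rho> = ereal (R T')" using main that(1,2) by blast+
    ultimately show ?thesis by simp
  qed
  then show ?thesis using main by blast
qed

lemma weight_one: "weight_with_grading \<Omega> \<T> 1 (\<lambda>_. 1)"
proof -
  have "emeasure (lebesgue_on T) (space (lebesgue_on T)) \<noteq> 0" if T: "T \<in> \<T>" for T
  proof -
    have "emeasure (lebesgue_on T) (space (lebesgue_on T)) = emeasure lebesgue T"
      using T_borel[OF T] by (simp add: emeasure_restrict_space)
    also have "\<dots> = emeasure lborel T" using T_borel[OF T] by simp
    finally show ?thesis using vol_pos[OF T] unfolding vol_def measure_def by (auto simp: enn2real_positive_iff)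
  qed
  then have "ess_sup_on T (\<lambda>_. 1) = 1" "ess_inf_on T (\<lambda>_. 1) = 1" if "T \<in> \<T>" for T
    using that by (simp_all add: ess_sup_on_def ess_inf_on_def esssup_const one_ereal_def)
  moreover have "integrable (lebesgue_on \<Omega>) (\<lambda>_. 1 :: real)" using finite_measure_Omega by (rule finite_measure.integrable_const)
  ultimately show ?thesis by (simp add: weight_with_grading_def one_ereal_def[symmetric])
qed

end

section \<open>Descendants of tagged simplices\<close>

text \<open>A tagged simplex in the form \<open>(x\<^sub>0, A, B, x\<^sub>d)\<^sub>\<gamma>\<close> with \<open>A = [x\<^sub>1, \<dots>, x\<^sub>\<gamma>]\<close>.\<close>

definition tag :: "real^'n::finite \<Rightarrow> (real^'n) list \<Rightarrow> (real^'n) list \<Rightarrow> real^'n \<Rightarrow> 'n tagged_simplex" where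
  "tag x A B y = (x # A @ B @ [y], length A)"

abbreviation vs :: "'n::finite tagged_simplex \<Rightarrow> (real^'n) set" where "vs T \<equiv> set (fst T)"

lemma is_tagged_full: "is_tagged_simplex T \<Longrightarrow> full_simplex (vs T)"
  by (cases T) (auto simp: is_tagged_simplex_def full_simplex_def distinct_card)

lemma tag_ex:
  fixes T :: "'n::finite tagged_simplex"
  assumes "is_tagged_simplex T" shows "\<exists>x A B y. T = tag x A B y"
proof -
  obtain xs \<gamma> where T: "T = (xs, \<gamma>)" by (cases T)
  have l: "length xs = CARD('n) + 1" "\<gamma> < CARD('n)" using assms T by (auto simp: is_tagged_simplex_def)
  then obtain x ys where xs: "xs = x # ys" by (cases xs) auto
  with l have "ys \<noteq> []" by auto
  then obtain zs y where ys: "ys = zs @ [y]" by (metis append_butlast_last_id)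
  have "\<gamma> \<le> length zs" using l xs ys by auto
  then have "T = tag x (take \<gamma> zs) (drop \<gamma> zs) y" by (simp add: tag_def T xs ys)
  then show ?thesis by blast
qed

lemma vs_tag: "vs (tag x A B y) = insert x (insert y (set A \<union> set B))"
  by (auto simp: tag_def)

lemma is_tagged_tag:
  "is_tagged_simplex (tag x A B y :: 'n::finite tagged_simplex) \<longleftrightarrow>
    length A + length B + 1 = CARD('n) \<and> distinct (x # A @ B @ [y]) \<and> \<not> affine_dependent (vs (tag x A B y))"
  by (auto simp: is_tagged_simplex_def tag_def)

definition child1 :: "real^'n::finite \<Rightarrow> (real^'n) list \<Rightarrow> (real^'n) list \<Rightarrow> real^'n \<Rightarrow> 'n tagged_simplex" where
  "child1 x A B y = (x # midpoint x y # A @ B, (length A + 1) mod CARD('n))"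

definition child2 :: "real^'n::finite \<Rightarrow> (real^'n) list \<Rightarrow> (real^'n) list \<Rightarrow> real^'n \<Rightarrow> 'n tagged_simplex" where
  "child2 x A B y = (y # midpoint x y # A @ rev B, (length A + 1) mod CARD('n))"

lemma children_tag: "children (tag x A B y) = {child1 x A B y, child2 x A B y}"
  unfolding children_def tag_def child1_def child2_def by (simp add: Let_def butlast_append)

lemma reflected_tag: "reflected (tag x A B y) = tag y A (rev B) x"
  unfolding reflected_def tag_def by (simp add: Let_def butlast_append)

text \<open>Reflection exchanges the two children, so facts about the first carry over to the
  second; many case distinctions below are halved in this way.\<close>

lemma child2_reflected: "child2 x A B y = child1 y A (rev B) x" "child1 x A B y = child2 y A (rev B) x"
  by (simp_all add: child1_def child2_def midpoint_sym)

lemma children_reflected: "children (tag y A (rev B) x) = children (tag x A B y)"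
  by (auto simp: children_tag child1_def child2_def midpoint_sym)

lemma refinement_edge_tag: "refinement_edge (tag x A B y) = closed_segment x y"
  by (simp add: refinement_edge_def tag_def)

lemma tagged_reflected: "is_tagged_simplex (tag x A B y) \<Longrightarrow> is_tagged_simplex (tag y A (rev B) x)"
  by (auto simp: is_tagged_tag vs_tag insert_commute)

lemma vs_reflected: "vs (tag y A (rev B) x) = vs (tag x A B y)" by (auto simp: vs_tag)

lemma child1_props:
  fixes x y :: "real^'n::finite"
  assumes "is_tagged_simplex (tag x A B y)"
  shows "vs (child1 x A B y) = half (vs (tag x A B y)) x y" "is_tagged_simplex (child1 x A B y)"
    "x \<in> vs (tag x A B y)" "y \<in> vs (tag x A B y)" "x \<noteq> y"
proof -
  have d: "distinct (x # A @ B @ [y])" and l: "length A + length B + 1 = CARD('n)" using assms by (auto simp: is_tagged_tag)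
  show xy: "x \<in> vs (tag x A B y)" "y \<in> vs (tag x A B y)" "x \<noteq> y" using d by (auto simp: vs_tag)
  show v: "vs (child1 x A B y) = half (vs (tag x A B y)) x y"
    using d by (auto simp: child1_def vs_tag half_def)
  have F: "full_simplex (half (vs (tag x A B y)) x y)"
    by (rule half_full[OF is_tagged_full[OF assms] xy])
  have len: "length (fst (child1 x A B y)) = CARD('n) + 1" using l by (simp add: child1_def)
  have "card (vs (child1 x A B y)) = CARD('n) + 1" using full_simplex_facts(3)[OF F] v by simp
  then have "distinct (fst (child1 x A B y))" using len by (intro card_distinct) simp
  moreover have "\<not> affine_dependent (vs (child1 x A B y))" using full_simplex_facts(2)[OF F] v by simp
  ultimately show "is_tagged_simplex (child1 x A B y)"
    using len by (auto simp: is_tagged_simplex_def child1_def)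
qed

lemma child2_props:
  assumes "is_tagged_simplex (tag x A B y)"
  shows "vs (child2 x A B y) = half (vs (tag x A B y)) y x" "is_tagged_simplex (child2 x A B y)"
  using child1_props[OF tagged_reflected[OF assms]] by (simp_all only: child2_reflected(1) vs_reflected)

lemma children_tagged:
  assumes "is_tagged_simplex T" "C \<in> children T"
  shows "is_tagged_simplex C" "\<exists>u v. u \<in> vs T \<and> v \<in> vs T \<and> u \<noteq> v \<and> vs C = half (vs T) u v"
proof -
  obtain x A B y where T: "T = tag x A B y" using tag_ex[OF assms(1)] by blast
  have C: "C = child1 x A B y \<or> C = child2 x A B y" using assms(2) by (simp add: T children_tag)
  note p = child1_props[OF assms(1)[unfolded T]] child2_props[OF assms(1)[unfolded T]]
  show "is_tagged_simplex C" using C p by auto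
  show "\<exists>u v. u \<in> vs T \<and> v \<in> vs T \<and> u \<noteq> v \<and> vs C = half (vs T) u v" using C p unfolding T by metis
qed

lemma child_sub:
  assumes "is_tagged_simplex T" "C \<in> children T"
  shows "simplex_of C \<subseteq> simplex_of T" "measure lborel (simplex_of C) = measure lborel (simplex_of T) / 2"
proof -
  obtain u v where uv: "u \<in> vs T" "v \<in> vs T" "u \<noteq> v" "vs C = half (vs T) u v" using children_tagged(2)[OF assms] by blast
  note F = is_tagged_full[OF assms(1)]
  show "simplex_of C \<subseteq> simplex_of T" using in_half[OF F uv(1-3)] by (auto simp: simplex_of_def uv(4))
  show "measure lborel (simplex_of C) = measure lborel (simplex_of T) / 2"
    using measure_half[OF F uv(1-3)] by (simp add: simplex_of_def uv(4))
qed

inductive descends :: "'n::finite tagged_simplex \<Rightarrow> nat \<Rightarrow> 'n tagged_simplex \<Rightarrow> bool" for S where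
  zero: "descends S 0 S"
| step: "descends S k T \<Longrightarrow> C \<in> children T \<Longrightarrow> descends S (Suc k) C"

lemma descends_tagged: "descends S k T \<Longrightarrow> is_tagged_simplex S \<Longrightarrow> is_tagged_simplex T"
  by (induction rule: descends.induct) (auto intro: children_tagged)

lemma descends_sub: "descends S k T \<Longrightarrow> is_tagged_simplex S \<Longrightarrow> simplex_of T \<subseteq> simplex_of S"
  by (induction rule: descends.induct) (use child_sub(1) descends_tagged in blast)+

lemma descends_measure: "descends S k T \<Longrightarrow> is_tagged_simplex S \<Longrightarrow>
  measure lborel (simplex_of T) * 2 ^ k = measure lborel (simplex_of S)"
proof (induction rule: descends.induct)
  case (step k T C)
  have "measure lborel (simplex_of C) * 2 ^ Suc k = measure lborel (simplex_of T) * 2 ^ k"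
    unfolding child_sub(2)[OF descends_tagged[OF step(1,4)] step(2)] by simp
  from this step(3)[OF step(4)] show ?case by (rule trans)
qed simp

lemma descends_split: "descends S (j + k) T \<Longrightarrow> \<exists>A. descends S j A \<and> descends A k T"
proof (induction k arbitrary: T)
  case 0
  then have "descends S j T \<and> descends T 0 T" using descends.zero by simp
  then show ?case by (rule exI)
next
  case (Suc k)
  from Suc.prems obtain R where "descends S (j + k) R" "T \<in> children R" by (auto elim: descends.cases)
  with Suc.IH obtain A where "descends S j A" "descends A k R" by blast
  then show ?case using \<open>T \<in> children R\<close> descends.step by blast
qed

lemma descends_first: "descends S (Suc k) T \<Longrightarrow> \<exists>C\<in>children S. descends C k T"
  using descends_split[of S 1 k T] by (auto elim: descends.cases)

section \<open>Shape regularity\<close>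

text \<open>A tagged simplex of type \<open>\<gamma>\<close> is spanned by vectors \<open>e\<^sub>1, \<dots>, e\<^sub>d\<close>: with \<open>k = d - \<gamma>\<close>, the vertices
  \<open>x\<^bsub>\<gamma>+1\<^esub>, \<dots>, x\<^sub>d\<close> form a path from \<open>x\<^sub>0\<close> along \<open>e\<^sub>1, \<dots>, e\<^sub>k\<close>, and \<open>x\<^sub>i = x\<^sub>0 + (e\<^sub>1 + \<dots> + e\<^bsub>k+i\<^esub>)/2\<close>
  for \<open>1 \<le> i \<le> \<gamma>\<close>. Bisection only permutes these vectors, changes signs, and halves them all when
  the type returns to 0.\<close>

definition spanned :: "'n::finite tagged_simplex \<Rightarrow> (real^'n) list \<Rightarrow> bool" where
  "spanned T es \<longleftrightarrow> length es = CARD('n) \<and>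
    (\<forall>i. 1 \<le> i \<and> i \<le> snd T \<longrightarrow> fst T ! i = fst T ! 0 + (1/2) *\<^sub>R sum_list (take (CARD('n) - snd T + i) es)) \<and>
    (\<forall>i. 1 \<le> i \<and> i \<le> CARD('n) - snd T \<longrightarrow> fst T ! (snd T + i) = fst T ! 0 + sum_list (take i es))"

text \<open>Unaffected by permutations and sign changes of the vectors, so one bisection either
  keeps it or halves it.\<close>

definition total :: "(real^'n) list \<Rightarrow> real" where "total es = sum_list (map norm es)"

lemma sum_list_take_diffs:
  fixes P :: "nat \<Rightarrow> 'a::ab_group_add"
  assumes "P 0 = 0" "j \<le> n"
  shows "sum_list (take j (map (\<lambda>i. P (Suc i) - P i) [0..<n])) = P j"
  using assms(2)
proof (induction j)
  case (Suc j)
  then show ?case by (simp add: take_Suc_conv_app_nth)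
qed (simp add: assms(1))

lemma spanned_ex:
  fixes T :: "'n::finite tagged_simplex"
  assumes "is_tagged_simplex T" shows "\<exists>es. spanned T es"
proof -
  have g: "snd T < CARD('n)" using assms by (auto simp: is_tagged_simplex_def)
  \<comment> \<open>\<open>P j\<close> is what the first j vectors must sum to: first the path to
    the last vertex, then twice the offsets of the half-sum vertices. The vectors are its
    increments.\<close>
  define P where "P j = (if j = 0 then 0 else if j \<le> CARD('n) - snd T then fst T ! (snd T + j) - fst T ! 0
    else 2 *\<^sub>R (fst T ! (j - (CARD('n) - snd T)) - fst T ! 0))" for j
  define es where "es = map (\<lambda>i. P (Suc i) - P i) [0..<CARD('n)]"
  have t: "sum_list (take j es) = P j" if "j \<le> CARD('n)" for j
    unfolding es_def using that by (intro sum_list_take_diffs) (simp_all add: P_def)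
  have "spanned T es"
    unfolding spanned_def
  proof (intro conjI allI impI)
    show "length es = CARD('n)" by (simp add: es_def)
    fix i assume i: "1 \<le> i \<and> i \<le> snd T"
    then have "sum_list (take (CARD('n) - snd T + i) es) = 2 *\<^sub>R (fst T ! i - fst T ! 0)"
      using g by (subst t) (auto simp: P_def)
    then show "fst T ! i = fst T ! 0 + (1/2) *\<^sub>R sum_list (take (CARD('n) - snd T + i) es)" by simp
  next
    fix i assume i: "1 \<le> i \<and> i \<le> CARD('n) - snd T"
    then have "sum_list (take i es) = fst T ! (snd T + i) - fst T ! 0" by (subst t) (auto simp: P_def)
    then show "fst T ! (snd T + i) = fst T ! 0 + sum_list (take i es)" by simp
  qed
  then show ?thesis by blast
qed

lemma norm_sum_list: "norm (sum_list (xs :: 'a::real_normed_vector list)) \<le> sum_list (map norm xs)"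
  by (induction xs) (auto intro: norm_triangle_le)

lemma sum_list_map_half: "sum_list (map (\<lambda>e. (1/2) *\<^sub>R e) (xs :: 'a::real_vector list)) = (1/2) *\<^sub>R sum_list xs"
  by (induction xs) (auto simp: scaleR_right_distrib)

lemma norm_sum_list_take: "norm (sum_list (take i es)) \<le> total es"
proof -
  have "norm (sum_list (take i es)) \<le> sum_list (map norm (take i es))"
    by (rule norm_sum_list)
  also have "\<dots> \<le> sum_list (map norm (take i es)) + sum_list (map norm (drop i es))"
    using sum_list_nonneg[of "map norm (drop i es)"] by fastforce
  also have "\<dots> = total es" unfolding total_def by (simp flip: sum_list_append map_append)
  finally show ?thesis .
qed

lemma total_nonneg: "0 \<le> total es" unfolding total_def by (intro sum_list_nonneg) auto

lemma spanned_ball: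
  fixes T :: "'n::finite tagged_simplex"
  assumes "is_tagged_simplex T" "spanned T es"
  shows "simplex_of T \<subseteq> cball (fst T ! 0) (total es)"
proof -
  have l: "length (fst T) = CARD('n) + 1" "snd T < CARD('n)" using assms(1) by (auto simp: is_tagged_simplex_def)
  have "dist (fst T ! 0) (fst T ! i) \<le> total es" if i: "i \<le> CARD('n)" for i
  proof -
    consider "i = 0" | "1 \<le> i" "i \<le> snd T" | "snd T < i" by linarith
    then show ?thesis
    proof cases
      case 1 then show ?thesis by (simp add: total_nonneg)
    next
      case 2
      then have "fst T ! i = fst T ! 0 + (1/2) *\<^sub>R sum_list (take (CARD('n) - snd T + i) es)" using assms(2) by (simp add: spanned_def)
      then have "dist (fst T ! 0) (fst T ! i) = norm (sum_list (take (CARD('n) - snd T + i) es)) / 2" by (simp add: dist_norm)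
      then show ?thesis using norm_sum_list_take[of "CARD('n) - snd T + i" es] total_nonneg[of es] by linarith
    next
      case 3
      then have "fst T ! (snd T + (i - snd T)) = fst T ! 0 + sum_list (take (i - snd T) es)"
        using i by (intro assms(2)[unfolded spanned_def, THEN conjunct2, THEN conjunct2, rule_format]) auto
      then have "fst T ! i = fst T ! 0 + sum_list (take (i - snd T) es)" using 3 by simp
      then show ?thesis using norm_sum_list_take[of "i - snd T" es] by (simp add: dist_norm)
    qed
  qed
  then have "vs T \<subseteq> cball (fst T ! 0) (total es)" using l by (auto simp: in_set_conv_nth less_Suc_eq_le)
  then show ?thesis unfolding simplex_of_def by (intro hull_minimal) auto
qed

text \<open>If the type reaches d it returns to 0: by then every vertex is the first one plus half a
  partial sum, which is a path along the halved vectors.\<close>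

lemma spanned_next_type:
  fixes xs :: "(real^'n::finite) list"
  assumes g: "\<gamma> < CARD('n)" and es: "length es = CARD('n)"
    and mids: "\<And>i. 1 \<le> i \<Longrightarrow> i \<le> \<gamma> + 1 \<Longrightarrow> xs ! i = xs ! 0 + (1/2) *\<^sub>R sum_list (take (CARD('n) - (\<gamma> + 1) + i) es)"
    and path: "\<And>i. 1 \<le> i \<Longrightarrow> i \<le> CARD('n) - (\<gamma> + 1) \<Longrightarrow> xs ! (\<gamma> + 1 + i) = xs ! 0 + sum_list (take i es)"
  shows "\<exists>es'. spanned (xs, (\<gamma> + 1) mod CARD('n)) es' \<and> total es' = total es / (if \<gamma> + 1 = CARD('n) then 2 else 1)"
proof (cases "\<gamma> + 1 = CARD('n)")
  case False
  then have "(\<gamma> + 1) mod CARD('n) = \<gamma> + 1" using g by simp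
  then have "spanned (xs, (\<gamma> + 1) mod CARD('n)) es" using es mids path by (auto simp: spanned_def)
  then show ?thesis using False by auto
next
  case True
  define es' where "es' = map (\<lambda>e. (1/2) *\<^sub>R e) es"
  have s: "sum_list (take i es') = (1/2) *\<^sub>R sum_list (take i es)" for i
    unfolding es'_def take_map sum_list_map_half ..
  have "spanned (xs, (\<gamma> + 1) mod CARD('n)) es'"
    using True es mids by (auto simp: spanned_def s) (auto simp: es'_def)
  moreover have "total es' = total es / 2"
    unfolding total_def es'_def by (induction es) auto
  ultimately show ?thesis using True by auto
qed

text \<open>The first child keeps the spanning vectors: y is x plus the first k of them, so the
  midpoint is x plus half that sum, which is the first half-sum vertex required for the next
  type.\<close>

lemma spanned_child1:
  assumes t: "is_tagged_simplex (tag x A B y :: 'n::finite tagged_simplex)" and es: "spanned (tag x A B y) es"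
  shows "\<exists>es'. spanned (child1 x A B y) es' \<and>
    total es' = total es / (if length A + 1 = CARD('n) then 2 else 1)"
  unfolding child1_def
proof (rule spanned_next_type)
  have l: "length A + length B + 1 = CARD('n)" using t by (simp add: is_tagged_tag)
  show "length A < CARD('n)" using l by simp
  show "length es = CARD('n)" using es by (simp add: spanned_def)
  have mids: "(A @ B @ [y]) ! (i - 1) = x + (1/2) *\<^sub>R sum_list (take (CARD('n) - length A + i) es)"
    if "1 \<le> i" "i \<le> length A" for i
    using es that by (auto simp: spanned_def tag_def nth_Cons')
  have path: "(B @ [y]) ! (i - 1) = x + sum_list (take i es)" if "1 \<le> i" "i \<le> length B + 1" for i
  proof -
    have "(x # A @ B @ [y]) ! (length A + i) = x + sum_list (take i es)"
      using es that l unfolding spanned_def by (simp add: tag_def)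
    moreover have "(x # A @ B @ [y]) ! (length A + i) = (B @ [y]) ! (i - 1)"
      using that by (cases i) simp_all
    ultimately show ?thesis by simp
  qed
  have y: "y = x + sum_list (take (length B + 1) es)" using path[of "length B + 1"] by simp
  fix i :: nat assume i: "1 \<le> i"
  { assume i2: "i \<le> length A + 1"
    show "(x # midpoint x y # A @ B) ! i = (x # midpoint x y # A @ B) ! 0 +
        (1/2) *\<^sub>R sum_list (take (CARD('n) - (length A + 1) + i) es)"
    proof (cases "i = 1")
      case True
      have "x + (1/2) *\<^sub>R (y - x) = midpoint x y" by (simp add: vec_eq_iff midpoint_def field_simps)
      moreover have "y - x = sum_list (take (length B + 1) es)" by (subst y) simp
      moreover have "CARD('n) - (length A + 1) + 1 = length B + 1" using l by simp
      ultimately show ?thesis using True by simp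
    next
      case False
      obtain j where j: "i = Suc (Suc j)" using False i by (metis One_nat_def Suc_le_D less_one linorder_not_le not0_implies_Suc)
      have "(x # midpoint x y # A @ B) ! i = (A @ B @ [y]) ! (i - 1 - 1)"
        using i2 by (simp add: j nth_append)
      moreover have "CARD('n) - (length A + 1) + i = CARD('n) - length A + (i - 1)" using False i l by simp
      ultimately show ?thesis using mids[of "i - 1"] False i i2 by simp
    qed }
  { assume i2: "i \<le> CARD('n) - (length A + 1)"
    have "(x # midpoint x y # A @ B) ! (length A + 1 + i) = (B @ [y]) ! (i - 1)"
      using i i2 l by (cases i) (auto simp: nth_append)
    then show "(x # midpoint x y # A @ B) ! (length A + 1 + i) = (x # midpoint x y # A @ B) ! 0 + sum_list (take i es)"
      using path[of i] i i2 l by simp }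
qed

lemma sum_list_take_drop: "sum_list (take i xs) = sum_list xs - sum_list (drop i (xs :: 'a::ab_group_add list))"
  using sum_list_append[of "take i xs" "drop i xs"] by (simp only: append_take_drop_id) simp

lemma sum_list_uminus_rev: "sum_list (map uminus (rev xs)) = - sum_list (xs :: 'a::ab_group_add list)"
  by (induction xs) auto

text \<open>Seen from y the path runs backwards, so its k vectors are reversed and negated. The
  half-sum vertices keep their form: the new partial sums differ from the old ones by minus twice
  the sum over the path, which matches the change of base point.\<close>

lemma spanned_reflected:
  assumes t: "is_tagged_simplex (tag x A B y :: 'n::finite tagged_simplex)" and es: "spanned (tag x A B y) es"
  shows "\<exists>es'. spanned (tag y A (rev B) x) es' \<and> total es' = total es"
proof -
  have l: "length A + length B + 1 = CARD('n)" using t by (simp add: is_tagged_tag)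
  define k where "k = length B + 1"
  have k: "CARD('n) - length A = k" using l by (simp add: k_def)
  have les: "length es = CARD('n)" using es by (simp add: spanned_def)
  have kes: "k \<le> length es" using les l by (simp add: k_def)
  define es' where "es' = map uminus (rev (take k es)) @ drop k es"
  have tot: "total es' = total es"
  proof -
    have "total es' = sum_list (map norm (take k es)) + sum_list (map norm (drop k es))"
      by (simp add: total_def es'_def rev_map[symmetric] comp_def)
    then show ?thesis unfolding total_def by (simp flip: sum_list_append map_append)
  qed
  have mids: "(A @ B @ [y]) ! (i - 1) = x + (1/2) *\<^sub>R sum_list (take (k + i) es)"
    if "1 \<le> i" "i \<le> length A" for i
    using es that k by (auto simp: spanned_def tag_def nth_Cons')
  have path: "(x # B @ [y]) ! i = x + sum_list (take i es)" if "i \<le> k" for i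
  proof (cases "i = 0")
    case False
    have "(x # A @ B @ [y]) ! (length A + i) = x + sum_list (take i es)"
      using es that l False k unfolding spanned_def by (simp add: tag_def)
    moreover have "(x # A @ B @ [y]) ! (length A + i) = (x # B @ [y]) ! i"
      using False by (cases i) simp_all
    ultimately show ?thesis by simp
  qed simp
  have y: "y = x + sum_list (take k es)" using path[of k] by (simp add: k_def)
  have t1: "sum_list (take i es') = sum_list (take (k - i) es) - sum_list (take k es)" if "i \<le> k" for i
  proof -
    have "take i es' = map uminus (rev (drop (k - i) (take k es)))"
      using that kes by (simp add: es'_def take_map take_rev)
    then have "sum_list (take i es') = - sum_list (drop (k - i) (take k es))" by (simp only: sum_list_uminus_rev)
    also have "\<dots> = sum_list (take (k - i) (take k es)) - sum_list (take k es)"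
      unfolding sum_list_take_drop[of "k - i" "take k es"] by simp
    finally show ?thesis by simp
  qed
  have t2: "sum_list (take (k + i) es') = sum_list (take (k + i) es) - 2 *\<^sub>R sum_list (take k es)" for i
  proof -
    have "take (k + i) es' = take k es' @ take i (drop k es)" using kes by (simp add: es'_def)
    then have "sum_list (take (k + i) es') = - sum_list (take k es) + sum_list (take i (drop k es))"
      using t1[of k] by simp
    moreover have "sum_list (take (k + i) es) = sum_list (take k es) + sum_list (take i (drop k es))"
      by (simp add: take_add)
    ultimately show ?thesis by (simp add: scaleR_2)
  qed
  have "spanned (tag y A (rev B) x) es'"
    unfolding spanned_def
  proof (intro conjI allI impI)
    show "length es' = CARD('n)" using kes les by (simp add: es'_def)
    fix i assume i: "1 \<le> i \<and> i \<le> snd (tag y A (rev B) x)"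
    then have i': "1 \<le> i" "i \<le> length A" by (simp_all add: tag_def)
    have "fst (tag y A (rev B) x) ! i = (A @ B @ [y]) ! (i - 1)"
      using i' by (cases i) (simp_all add: tag_def nth_append)
    also have "\<dots> = x + (1/2) *\<^sub>R sum_list (take (k + i) es)" using mids[OF i'] .
    also have "\<dots> = (x + sum_list (take k es)) + (1/2) *\<^sub>R sum_list (take (k + i) es')"
      unfolding t2 by (simp add: algebra_simps)
    finally show "fst (tag y A (rev B) x) ! i = fst (tag y A (rev B) x) ! 0 +
        (1/2) *\<^sub>R sum_list (take (CARD('n) - snd (tag y A (rev B) x) + i) es')"
      using y k by (simp add: tag_def)
  next
    fix i assume i: "1 \<le> i \<and> i \<le> CARD('n) - snd (tag y A (rev B) x)"
    then have i': "1 \<le> i" "i \<le> k" using k by (simp_all add: tag_def)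
    have "fst (tag y A (rev B) x) ! (length A + i) = (rev B @ [x]) ! (i - 1)"
      using i' by (cases i) (simp_all add: tag_def)
    also have "\<dots> = rev (x # B) ! (i - 1)" by simp
    also have "\<dots> = (x # B) ! (k - i)" using i' by (subst rev_nth) (simp_all add: k_def)
    also have "\<dots> = (x # B @ [y]) ! (k - i)"
      using i' nth_append[of "x # B" "[y]" "k - i"] by (simp add: k_def)
    also have "\<dots> = x + sum_list (take (k - i) es)" by (rule path) simp
    also have "\<dots> = (x + sum_list (take k es)) + sum_list (take i es')" unfolding t1[OF i'(2)] by simp
    finally show "fst (tag y A (rev B) x) ! (snd (tag y A (rev B) x) + i) = fst (tag y A (rev B) x) ! 0 + sum_list (take i es')"
      using y by (simp add: tag_def)
  qed
  with tot show ?thesis by blast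
qed

lemma spanned_child:
  fixes T :: "'n::finite tagged_simplex"
  assumes "is_tagged_simplex T" "spanned T es" "C \<in> children T"
  shows "\<exists>es'. spanned C es' \<and> total es' = total es / (if snd T + 1 = CARD('n) then 2 else 1)"
proof -
  obtain x A B y where T: "T = tag x A B y" using tag_ex[OF assms(1)] by blast
  have sT: "snd T = length A" by (simp add: T tag_def)
  note t = assms(1)[unfolded T] and s = assms(2)[unfolded T]
  have "C = child1 x A B y \<or> C = child1 y A (rev B) x"
    using assms(3) by (simp add: T children_tag child2_reflected(1))
  then show ?thesis
  proof
    assume "C = child1 x A B y"
    then show ?thesis using spanned_child1[OF t s] by (simp only: sT)
  next
    assume C: "C = child1 y A (rev B) x"
    obtain es' where "spanned (tag y A (rev B) x) es'" "total es' = total es"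
      using spanned_reflected[OF t s] by blast
    then show ?thesis using spanned_child1[OF tagged_reflected[OF t], of es'] by (simp only: sT C)
  qed
qed

lemma snd_child: "C \<in> children (T :: 'n::finite tagged_simplex) \<Longrightarrow> snd C = (snd T + 1) mod CARD('n)"
  by (cases T) (auto simp: children_def Let_def)

lemma descends_type:
  fixes S :: "'n::finite tagged_simplex"
  assumes "descends S k T" "is_tagged_simplex S" shows "snd T = (snd S + k) mod CARD('n)"
  using assms
proof (induction rule: descends.induct)
  case zero
  then show ?case by (auto simp: is_tagged_simplex_def)
next
  case (step k T C)
  then show ?case by (simp add: snd_child[OF step(2)] mod_Suc_eq)
qed

lemma descends_spanned:
  fixes S :: "'n::finite tagged_simplex"
  assumes "descends S k T" "is_tagged_simplex S" "spanned S es"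
  shows "\<exists>es'. spanned T es' \<and> total es' * 2 ^ ((snd S + k) div CARD('n)) = total es"
  using assms
proof (induction rule: descends.induct)
  case zero
  then have "(snd S + 0) div CARD('n) = 0" by (auto simp: is_tagged_simplex_def)
  then have "spanned S es \<and> total es * 2 ^ ((snd S + 0) div CARD('n)) = total es" using zero(2) by simp
  then show ?case by (rule exI)
next
  case (step k T C)
  note tT = descends_tagged[OF step(1,4)]
  have type: "snd T = (snd S + k) mod CARD('n)" by (rule descends_type[OF step(1,4)])
  obtain es1 where es1: "spanned T es1" "total es1 * 2 ^ ((snd S + k) div CARD('n)) = total es"
    using step(3)[OF step(4,5)] by (elim exE conjE)
  obtain es2 where es2: "spanned C es2" "total es2 = total es1 / (if snd T + 1 = CARD('n) then 2 else 1)"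
    using spanned_child[OF tT es1(1) step(2)] by (elim exE conjE)
  have "(snd S + Suc k) div CARD('n) = (snd S + k) div CARD('n) + (if snd T + 1 = CARD('n) then 1 else 0)"
    unfolding type add_Suc_right div_Suc mod_Suc by (simp split: if_splits)
  then have "total es2 * 2 ^ ((snd S + Suc k) div CARD('n)) = total es"
    using es1(2) es2(2) by (simp split: if_splits)
  with es2(1) show ?case by (intro exI conjI)
qed

text \<open>\<open>total\<close> halves once in d bisections, that is like 2^(-k/d) up to a factor 2
  from rounding. This is the 2 in \<open>\<Phi>\<close>; the added 1 keeps it positive.\<close>

lemma descends_ball:
  fixes S :: "'n::finite tagged_simplex"
  assumes "is_tagged_simplex S"
  shows "\<exists>\<Phi>>0. \<forall>k T. descends S k T \<longrightarrow> (\<exists>c. simplex_of T \<subseteq> cball c (\<Phi> * 2 powr (- real k / real CARD('n))))"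
proof -
  obtain es where es: "spanned S es" using spanned_ex[OF assms] by blast
  define \<Phi> where "\<Phi> = 2 * (total es + 1)"
  have P: "0 < \<Phi>" using total_nonneg[of es] by (simp add: \<Phi>_def)
  have "\<exists>c. simplex_of T \<subseteq> cball c (\<Phi> * 2 powr (- real k / real CARD('n)))" if D: "descends S k T" for k T
  proof -
    obtain es' where es': "spanned T es'" "total es' * 2 ^ ((snd S + k) div CARD('n)) = total es"
      using descends_spanned[OF D assms es] by blast
    define m where "m = (snd S + k) div CARD('n)"
    have c: "0 < real CARD('n)" by simp
    have "k < (m + 1) * CARD('n)"
    proof -
      have "snd S + k = CARD('n) * m + (snd S + k) mod CARD('n)" by (simp add: m_def)
      moreover have "(snd S + k) mod CARD('n) < CARD('n)" by (rule mod_less_divisor) simp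
      moreover have "(m + 1) * CARD('n) = CARD('n) * m + CARD('n)" by simp
      ultimately show ?thesis by linarith
    qed
    then have "real k < real ((m + 1) * CARD('n))" by (simp only: of_nat_less_iff)
    then have "real k \<le> (real m + 1) * real CARD('n)" by (simp add: algebra_simps)
    then have "real k / real CARD('n) \<le> real m + 1" using c by (simp add: pos_divide_le_eq)
    then have neg: "- (real m + 1) \<le> - real k / real CARD('n)" by simp
    have "2 powr (- (real m + 1)) \<le> 2 powr (- real k / real CARD('n))" by (rule powr_mono[OF neg]) simp
    moreover have "2 powr (real (Suc m)) = (2::real) ^ Suc m" by (rule powr_realpow) simp
    then have "2 powr (- (real m + 1)) = 1 / (2 * 2 ^ m)"
      using powr_minus_divide[of 2 "real m + 1"] by (simp add: add.commute)
    ultimately have le: "1 / (2 * 2 ^ m) \<le> 2 powr (- real k / real CARD('n))" by (simp only:)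
    have "total es' = (2 * total es) * (1 / (2 * 2 ^ m))" using es'(2) by (simp add: m_def field_simps)
    also have "\<dots> \<le> \<Phi> * 2 powr (- real k / real CARD('n))"
      using le total_nonneg[of es] by (intro mult_mono) (auto simp: \<Phi>_def)
    finally have "cball (fst T ! 0) (total es') \<subseteq> cball (fst T ! 0) (\<Phi> * 2 powr (- real k / real CARD('n)))"
      by (simp add: subset_cball)
    then show ?thesis using spanned_ball[OF descends_tagged[OF D assms] es'(1)] by blast
  qed
  with P show ?thesis by blast
qed

section \<open>Neighbouring tagged simplices\<close>

lemma bary_zero_off:
  assumes V: "full_simplex V" and k: "k \<in> V" and z: "z \<in> convex hull W" and W: "W \<subseteq> V - {k}"
  shows "bary V k z = 0"
proof -
  have fin: "finite W" using W full_simplex_facts(1)[OF V] finite_subset by blast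
  obtain c where c: "sum c W = 1" "z = (\<Sum>w\<in>W. c w *\<^sub>R w)"
    using z unfolding convex_hull_finite[OF fin] by blast
  have "bary V k z = (\<Sum>w\<in>W. c w * bary V k w)" unfolding c(2) by (rule bary_sum_scaleR[OF V k c(1)])
  also have "\<dots> = 0"
  proof (rule sum.neutral, rule ballI)
    fix w assume "w \<in> W"
    with W have "w \<in> V" "w \<noteq> k" by auto
    then show "c w * bary V k w = 0" using bary_vertex[OF V k] by simp
  qed
  finally show ?thesis .
qed

lemma bary_common:
  assumes V: "full_simplex V" and V': "full_simplex V'" and W: "W \<subseteq> V" "W \<subseteq> V'"
    and z: "z \<in> convex hull W" and w: "w \<in> W"
  shows "bary V w z = bary V' w z"
proof -
  have fin: "finite W" using W full_simplex_facts(1)[OF V] finite_subset by blast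
  obtain c where c: "sum c W = 1" "z = (\<Sum>w\<in>W. c w *\<^sub>R w)"
    using z unfolding convex_hull_finite[OF fin] by blast
  have wV: "w \<in> V" "w \<in> V'" using W w by auto
  have "bary V w u = bary V' w u" if "u \<in> W" for u
    using bary_vertex[OF V wV(1) subsetD[OF W(1) that]] bary_vertex[OF V' wV(2) subsetD[OF W(2) that]] by simp
  then show ?thesis
    unfolding c(2) bary_sum_scaleR[OF V wV(1) c(1)] bary_sum_scaleR[OF V' wV(2) c(1)]
    by (intro sum.cong) auto
qed

lemma in_hull_minus:
  assumes V: "full_simplex V" and z: "z \<in> convex hull V" and K: "\<And>k. k \<in> K \<Longrightarrow> k \<in> V \<Longrightarrow> bary V k z = 0"
  shows "z \<in> convex hull (V - K)"
proof -
  have fin: "finite V" using full_simplex_facts(1)[OF V] .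
  have s: "(\<Sum>v\<in>V - K. g v) = (\<Sum>v\<in>V. g v)" if "\<And>v. v \<in> V \<Longrightarrow> v \<in> K \<Longrightarrow> g v = 0" for g :: "'a \<Rightarrow> 'b::comm_monoid_add"
    using fin that by (intro sum.mono_neutral_left) auto
  have "(\<Sum>v\<in>V - K. bary V v z) = 1" using s[of "\<lambda>v. bary V v z"] K bary_sum[OF V] by simp
  moreover have "(\<Sum>v\<in>V - K. bary V v z *\<^sub>R v) = z" using s[of "\<lambda>v. bary V v z *\<^sub>R v"] K bary_repr[OF V] by simp
  moreover have "\<forall>v\<in>V - K. 0 \<le> bary V v z" using z in_convex_hull_bary[OF V] by blast
  ultimately show ?thesis
    unfolding convex_hull_finite[OF finite_Diff[OF fin]] by (intro CollectI exI[of _ "\<lambda>v. bary V v z"] conjI)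
qed

text \<open>Two vanishing barycentric coordinates confine f to a face of codimension two.\<close>

lemma facet_dim_two_zeros:
  fixes V :: "'a::euclidean_space set"
  assumes V: "full_simplex V" and f: "f \<subseteq> convex hull V" "aff_dim f = int DIM('a) - 1"
    and k: "k \<in> V" "l \<in> V" "k \<noteq> l" and z: "\<And>z. z \<in> f \<Longrightarrow> bary V k z = 0" "\<And>z. z \<in> f \<Longrightarrow> bary V l z = 0"
  shows False
proof -
  have "f \<subseteq> convex hull (V - {k, l})" using in_hull_minus[OF V, of _ "{k, l}"] f(1) z by blast
  then have "aff_dim f \<le> aff_dim (V - {k, l})" using aff_dim_subset[of f "convex hull (V - {k, l})"] by (simp only: aff_dim_convex_hull)
  moreover have "int (card (V - {k, l})) = aff_dim (V - {k, l}) + 1"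
    by (rule aff_dim_affine_independent[OF affine_independent_Diff[OF full_simplex_facts(2)[OF V]]])
  moreover have "card (V - {k, l}) = card V - 2" using k by (subst card_Diff_subset) auto
  ultimately show False using f(2) full_simplex_facts(3)[OF V] DIM_positive[where 'a='a] by simp
qed

text \<open>Meeting in exactly a full common facet, expressed by vertices. Ancestors that are no
  longer in the mesh have to be compared, so this is stated for a pair alone and not for a
  conforming triangulation.\<close>

definition linked :: "'n::finite tagged_simplex \<Rightarrow> 'n tagged_simplex \<Rightarrow> bool" where
  "linked T T' \<longleftrightarrow> simplex_of T \<inter> simplex_of T' = convex hull (vs T \<inter> vs T') \<and> card (vs T \<inter> vs T') = CARD('n)"

text \<open>The initial matching condition for a single pair, in the form that the induction over
  generations carries along.\<close>

definition matched :: "'n::finite tagged_simplex \<Rightarrow> 'n tagged_simplex \<Rightarrow> bool" where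
  "matched T T' \<longleftrightarrow>
    (if refinement_edge T \<subseteq> simplex_of T \<inter> simplex_of T' \<or> refinement_edge T' \<subseteq> simplex_of T \<inter> simplex_of T'
     then reflected_neighbors T T'
     else \<forall>C\<in>children T. \<forall>C'\<in>children T'. share_facet (simplex_of C) (simplex_of C') \<longrightarrow> reflected_neighbors C C')"

lemma linked_opp:
  fixes T T' :: "'n::finite tagged_simplex"
  assumes T: "is_tagged_simplex T" and T': "is_tagged_simplex T'" and "linked T T'"
  shows "\<exists>v\<in>vs T. vs T \<inter> vs T' = vs T - {v} \<and> v \<notin> vs T'" "\<exists>v'\<in>vs T'. vs T \<inter> vs T' = vs T' - {v'} \<and> v' \<notin> vs T"
proof -
  have *: "\<exists>v\<in>vs A. vs A \<inter> X = vs A - {v} \<and> v \<notin> X"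
    if A: "is_tagged_simplex A" and c: "card (vs A \<inter> X) = CARD('n)" for A :: "'n tagged_simplex" and X
  proof -
    have "card (vs A - (vs A \<inter> X)) = 1"
      using full_simplex_facts(1,3)[OF is_tagged_full[OF A]] c by (subst card_Diff_subset) auto
    then obtain v where "vs A - (vs A \<inter> X) = {v}" by (rule card_1_singletonE)
    then show ?thesis by (intro bexI[of _ v]) auto
  qed
  show "\<exists>v\<in>vs T. vs T \<inter> vs T' = vs T - {v} \<and> v \<notin> vs T'"
    using *[OF T] assms(3) by (simp add: linked_def)
  show "\<exists>v'\<in>vs T'. vs T \<inter> vs T' = vs T' - {v'} \<and> v' \<notin> vs T"
    using *[OF T', of "vs T"] assms(3) by (simp add: linked_def Int_commute)
qed

lemma linked_share_facet:
  assumes T: "is_tagged_simplex T" and T': "is_tagged_simplex T'" and L: "linked T T'"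
  shows "share_facet (simplex_of T) (simplex_of T')"
proof -
  obtain v where v: "v \<in> vs T" "vs T \<inter> vs T' = vs T - {v}" "v \<notin> vs T'" using linked_opp(1)[OF assms] by blast
  obtain v' where v': "v' \<in> vs T'" "vs T \<inter> vs T' = vs T' - {v'}" "v' \<notin> vs T" using linked_opp(2)[OF assms] by blast
  have "verts (simplex_of T) = vs T" "verts (simplex_of T') = vs T'"
    unfolding simplex_of_def using verts_hull[OF is_tagged_full[OF T]] verts_hull[OF is_tagged_full[OF T']] by simp_all
  then have "simplex_of T \<noteq> simplex_of T'" using v by auto
  moreover have "opp (vs T) v facet_of simplex_of T" "opp (vs T') v' facet_of simplex_of T'"
    unfolding simplex_of_def facet_hull[OF is_tagged_full[OF T]] facet_hull[OF is_tagged_full[OF T']] using v v' by blast+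
  moreover have "opp (vs T) v = opp (vs T') v'" using v v' by (simp add: opp_def)
  ultimately show ?thesis unfolding share_facet_def by auto
qed

lemma linked_vertex:
  assumes T: "is_tagged_simplex T" and L: "linked T T'" and x: "x \<in> vs T"
  shows "x \<in> simplex_of T' \<longleftrightarrow> x \<in> vs T'"
proof
  assume "x \<in> simplex_of T'"
  moreover have "x \<in> simplex_of T" using x by (simp add: simplex_of_def hull_inc)
  ultimately have xW: "x \<in> convex hull (vs T \<inter> vs T')" using L by (auto simp: linked_def)
  show "x \<in> vs T'"
  proof (rule ccontr)
    assume "x \<notin> vs T'"
    then have "bary (vs T) x x = 0" by (intro bary_zero_off[OF is_tagged_full[OF T] x xW]) auto
    then show False using bary_vertex[OF is_tagged_full[OF T] x x] by simp
  qed
qed (simp add: simplex_of_def hull_inc)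

lemma linked_edge:
  assumes T: "is_tagged_simplex (tag x A B y)" and L: "linked (tag x A B y) T'"
  shows "refinement_edge (tag x A B y) \<subseteq> simplex_of (tag x A B y) \<inter> simplex_of T' \<longleftrightarrow> x \<in> vs T' \<and> y \<in> vs T'"
proof -
  let ?S = "simplex_of (tag x A B y) \<inter> simplex_of T'"
  have xy: "x \<in> vs (tag x A B y)" "y \<in> vs (tag x A B y)" by (simp_all add: vs_tag)
  have "convex ?S" by (simp add: simplex_of_def convex_Int)
  then have "closed_segment x y \<subseteq> ?S \<longleftrightarrow> x \<in> ?S \<and> y \<in> ?S"
    using closed_segment_subset[of x ?S y] ends_in_segment by blast
  moreover have "x \<in> simplex_of (tag x A B y)" "y \<in> simplex_of (tag x A B y)"
    using xy by (simp_all add: simplex_of_def hull_inc)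
  ultimately show ?thesis
    using linked_vertex[OF T L xy(1)] linked_vertex[OF T L xy(2)] by (auto simp: refinement_edge_tag)
qed

lemma linked_sym: "linked T T' \<longleftrightarrow> linked T' T" by (simp add: linked_def Int_commute)

lemma linked_edge':
  assumes T: "is_tagged_simplex (tag x A B y)" and L: "linked T (tag x A B y)"
  shows "refinement_edge (tag x A B y) \<subseteq> simplex_of T \<inter> simplex_of (tag x A B y) \<longleftrightarrow> x \<in> vs T \<and> y \<in> vs T"
  using linked_edge[OF T linked_sym[THEN iffD1, OF L]] by (simp only: Int_commute)

lemma agree_but_one_iff:
  "agree_but_one xs ys \<longleftrightarrow> (\<exists>P a b R. xs = P @ a # R \<and> ys = P @ b # R \<and> a \<noteq> b)"
proof
  assume ag: "agree_but_one xs ys"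
  then obtain i where "{i. i < length xs \<and> xs ! i \<noteq> ys ! i} = {i}" unfolding agree_but_one_def by (elim conjE card_1_singletonE)
  then have i: "i < length xs" "xs ! i \<noteq> ys ! i" "\<And>j. j < length xs \<Longrightarrow> j \<noteq> i \<Longrightarrow> xs ! j = ys ! j" by auto
  have l: "length xs = length ys" using ag by (simp add: agree_but_one_def)
  have t: "take i xs = take i ys" using i l by (intro nth_equalityI) auto
  have d: "drop (Suc i) xs = drop (Suc i) ys" using i l by (intro nth_equalityI) auto
  have "xs = take i xs @ xs ! i # drop (Suc i) xs" "ys = take i ys @ ys ! i # drop (Suc i) ys"
    using i(1) l by (auto intro: id_take_nth_drop)
  then show "\<exists>P a b R. xs = P @ a # R \<and> ys = P @ b # R \<and> a \<noteq> b" using i(2) t d by metis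
next
  assume "\<exists>P a b R. xs = P @ a # R \<and> ys = P @ b # R \<and> a \<noteq> b"
  then obtain P a b R where *: "xs = P @ a # R" "ys = P @ b # R" "a \<noteq> b" by blast
  have "{i. i < length xs \<and> xs ! i \<noteq> ys ! i} = {length P}"
    using * by (auto simp: nth_append nth_Cons' split: if_splits)
  then show "agree_but_one xs ys" using * by (simp add: agree_but_one_def)
qed

section \<open>Children along a common facet\<close>

lemma linkedI:
  fixes C C' :: "'n::finite tagged_simplex"
  assumes C: "is_tagged_simplex C" and C': "is_tagged_simplex C'"
    and l: "fst C = P @ a # R" "fst C' = P' @ b # R'" "set P' \<union> set R' = set P \<union> set R" "a \<noteq> b"
    and sub: "simplex_of C \<inter> simplex_of C' \<subseteq> convex hull (set P \<union> set R)"
  shows "linked C C'"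
proof -
  have "distinct (P @ a # R)" "length (P @ a # R) = CARD('n) + 1" using C l(1) by (auto simp: is_tagged_simplex_def)
  then have a: "a \<notin> set P \<union> set R" "distinct (P @ R)" "length (P @ R) = CARD('n)" by auto
  have b: "b \<notin> set P' \<union> set R'" using C' l(2) by (auto simp: is_tagged_simplex_def)
  have W: "vs C \<inter> vs C' = set P \<union> set R" using a(1) b l by auto
  have "card (set P \<union> set R) = CARD('n)" using distinct_card[OF a(2)] a(3) by simp
  moreover have "convex hull (vs C \<inter> vs C') \<subseteq> simplex_of C \<inter> simplex_of C'"
    unfolding simplex_of_def by (simp add: hull_mono)
  ultimately show ?thesis using sub W unfolding linked_def by auto
qed

text \<open>On the facet opposite x the coordinate at x vanishes. The first child is the half where
  the coordinate at y is at most the one at x, so there both vanish.\<close>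

lemma child1_misses_facet:
  fixes f :: "(real^'n::finite) set"
  assumes T: "is_tagged_simplex (tag x A B y)" and f: "f \<subseteq> simplex_of (child1 x A B y)"
    "f \<subseteq> convex hull (vs (tag x A B y) - {x})" "aff_dim f = int CARD('n) - 1"
  shows False
proof -
  note V = is_tagged_full[OF T] and p = child1_props[OF T]
  note hf = half_full[OF V p(3-5)] and bh = bary_half[OF V p(3-5)]
  have m: "midpoint x y \<in> half (vs (tag x A B y)) x y" "x \<in> half (vs (tag x A B y)) x y"
    using p(3-5) by (auto simp: half_def)
  have mx: "midpoint x y \<noteq> x" using p(5) by (auto simp: midpoint_eq_endpoint)
  have fh: "f \<subseteq> convex hull half (vs (tag x A B y)) x y" using f(1) by (simp add: simplex_of_def p(1))
  have z: "bary (vs (tag x A B y)) x z = 0" "bary (vs (tag x A B y)) y z = 0" if zf: "z \<in> f" for z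
  proof -
    show x0: "bary (vs (tag x A B y)) x z = 0" using f(2) zf by (intro bary_zero_off[OF V p(3)]) auto
    have "0 \<le> bary (vs (tag x A B y)) y z" "bary (vs (tag x A B y)) y z \<le> bary (vs (tag x A B y)) x z"
      using fh zf in_half[OF V p(3-5)] in_convex_hull_bary[OF V] p(4) by blast+
    with x0 show "bary (vs (tag x A B y)) y z = 0" by linarith
  qed
  show False
    by (rule facet_dim_two_zeros[OF hf fh _ m mx]) (use f(3) bh z in simp_all)
qed

text \<open>Children at different ends of a common edge overlap only where the coordinates at x and
  y agree. On the common facet the coordinate at v vanishes as well, so the overlap has codimension
  at least two.\<close>

lemma crossing_children:
  fixes f :: "(real^'n::finite) set"
  assumes V: "full_simplex V" and V': "full_simplex V'" and W: "W \<subseteq> V" "W \<subseteq> V'" and v: "v \<in> V" "W \<subseteq> V - {v}"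
    and xy: "x \<in> W" "y \<in> W" "x \<noteq> y"
    and f: "f \<subseteq> convex hull half V x y" "f \<subseteq> convex hull half V' y x" "f \<subseteq> convex hull W" "aff_dim f = int CARD('n) - 1"
  shows False
proof -
  have xV: "x \<in> V" "y \<in> V" "x \<in> V'" "y \<in> V'" using W xy by auto
  note hf = half_full[OF V xV(1,2) xy(3)] and bh = bary_half[OF V xV(1,2) xy(3)]
  have vx: "v \<noteq> x" "v \<noteq> y" using v xy by auto
  have vh: "v \<in> half V x y" "x \<in> half V x y" using v(1) vx xV xy by (auto simp: half_def)
  have z: "bary V v z = 0" "bary V x z = bary V y z" if z: "z \<in> f" for z
  proof -
    have zW: "z \<in> convex hull W" using f(3) z by blast
    show "bary V v z = 0" by (rule bary_zero_off[OF V v(1) zW v(2)])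
    have "bary V y z \<le> bary V x z" using in_half[OF V xV(1,2) xy(3)] f(1) z by blast
    moreover have "bary V' x z \<le> bary V' y z" using in_half[OF V' xV(4,3)] xy(3) f(2) z by blast
    ultimately show "bary V x z = bary V y z"
      using bary_common[OF V V' W zW xy(1)] bary_common[OF V V' W zW xy(2)] by linarith
  qed
  have hz: "bary (half V x y) v z = 0" "bary (half V x y) x z = 0" if "z \<in> f" for z
    unfolding bh(3)[OF v(1) vx] bh(2) using z[OF that] by simp_all
  show False by (rule facet_dim_two_zeros[OF hf f(1) _ vh vx(1) hz]) (use f(4) in simp)
qed

lemma facet_dim:
  assumes T: "is_tagged_simplex T" and f: "f facet_of simplex_of (T :: 'n::finite tagged_simplex)"
  shows "aff_dim f = int CARD('n) - 1"
proof -
  note F = is_tagged_full[OF T]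
  have "aff_dim (simplex_of T) = int CARD('n)"
    using aff_dim_affine_independent[OF full_simplex_facts(2)[OF F]] full_simplex_facts(3)[OF F]
    by (simp add: simplex_of_def aff_dim_convex_hull)
  then show ?thesis using f by (simp add: facet_of_def)
qed

lemma share_facetE:
  fixes T T' :: "'n::finite tagged_simplex"
  assumes "is_tagged_simplex T" "share_facet (simplex_of T) (simplex_of T')"
  obtains f where "f facet_of simplex_of T" "f facet_of simplex_of T'" "f \<subseteq> simplex_of T" "f \<subseteq> simplex_of T'"
    "aff_dim f = int CARD('n) - 1"
proof -
  obtain f where f: "f facet_of simplex_of T" "f facet_of simplex_of T'" using assms(2) by (auto simp: share_facet_def)
  show ?thesis by (rule that[OF f facet_of_imp_subset[OF f(1)] facet_of_imp_subset[OF f(2)] facet_dim[OF assms(1) f(1)]])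
qed

lemma snd_children: "snd (child1 x A B y) = (length A + 1) mod CARD('n)"
  "snd (child2 (x :: real^'n::finite) A B y) = (length A + 1) mod CARD('n)"
  by (simp_all add: child1_def child2_def)

lemma midpoint_cancel: "midpoint a (c :: 'a::real_vector) = midpoint b c \<longleftrightarrow> a = b"
  by (simp add: midpoint_def)

lemma linked_minus:
  assumes T: "is_tagged_simplex T" and T': "is_tagged_simplex T'" and L: "linked T T'" and x: "x \<in> vs T" "x \<notin> vs T'"
  shows "vs T \<inter> vs T' = vs T - {x}"
proof -
  obtain v where v: "vs T \<inter> vs T' = vs T - {v}" using linked_opp(1)[OF T T' L] by blast
  then have "x = v" using x by blast
  with v show ?thesis by simp
qed

text \<open>If x is off the common facet, the child that keeps x contains no (d-1)-dimensional part
  of the facet.\<close>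

lemma other_children:
  fixes f :: "(real^'n::finite) set"
  assumes T: "is_tagged_simplex (tag x A B y)" and T': "is_tagged_simplex T'" and L: "linked (tag x A B y) T'"
    and x: "x \<notin> vs T'" and C: "C \<in> children (tag x A B y)"
    and f: "f \<subseteq> simplex_of C" "f \<subseteq> simplex_of T'" "aff_dim f = int CARD('n) - 1"
  shows "C = child2 x A B y"
proof -
  have "f \<subseteq> simplex_of (tag x A B y)" using f(1) child_sub(1)[OF T C] by blast
  then have "f \<subseteq> convex hull (vs (tag x A B y) \<inter> vs T')" using f(2) L by (auto simp: linked_def)
  then have "f \<subseteq> convex hull (vs (tag x A B y) - {x})"
    using linked_minus[OF T T' L child1_props(3)[OF T] x] by (simp only:)
  then have "C \<noteq> child1 x A B y" using child1_misses_facet[OF T _ _ f(3)] f(1) by blast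
  then show ?thesis using C by (simp add: children_tag)
qed

text \<open>The first vertices are off the common facet, so the children that meet are the second
  ones; their lists differ only in the midpoint.\<close>

lemma first_differs:
  fixes x :: "real^'n::finite"
  assumes T: "is_tagged_simplex (tag x A B y)" and T': "is_tagged_simplex (tag x' A B y)"
    and L: "linked (tag x A B y) (tag x' A B y)" and x: "x \<noteq> x'"
    and C: "C \<in> children (tag x A B y)" "C' \<in> children (tag x' A B y)"
    and sh: "share_facet (simplex_of C) (simplex_of C')"
  shows "reflected_neighbors C C'"
proof -
  have "x \<notin> vs (tag x' A B y)" "x' \<notin> vs (tag x A B y)"
    using T T' x by (auto simp: vs_tag is_tagged_tag)
  note nin = this
  obtain f where f: "f \<subseteq> simplex_of C" "f \<subseteq> simplex_of C'" "aff_dim f = int CARD('n) - 1"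
    by (rule share_facetE[OF children_tagged(1)[OF T C(1)] sh])
  have "f \<subseteq> simplex_of (tag x' A B y)" "f \<subseteq> simplex_of (tag x A B y)"
    using f child_sub(1)[OF T C(1)] child_sub(1)[OF T' C(2)] by blast+
  then have "C = child2 x A B y" "C' = child2 x' A B y"
    using other_children[OF T T' L nin(1) C(1) f(1) _ f(3)]
      other_children[OF T' T linked_sym[THEN iffD1, OF L] nin(2) C(2) f(2) _ f(3)] by blast+
  note CC = this
  have "agree_but_one (fst C) (fst C')"
    unfolding agree_but_one_iff CC child2_def
    by (rule exI[of _ "[y]"], rule exI[of _ "midpoint x y"], rule exI[of _ "midpoint x' y"], rule exI[of _ "A @ rev B"])
      (simp add: midpoint_cancel x)
  then show ?thesis using sh by (simp add: reflected_neighbors_def CC snd_children)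
qed

text \<open>The refinement edge is not shared, so the single difference sits at the first or the
  last vertex; reflection turns the last into the first.\<close>

lemma agreeing_children:
  fixes x :: "real^'n::finite"
  assumes T: "is_tagged_simplex (tag x A B y)" and T': "is_tagged_simplex (tag x' A' B' y')"
    and L: "linked (tag x A B y) (tag x' A' B' y')" and len: "length A = length A'"
    and ag: "agree_but_one (fst (tag x A B y)) (fst (tag x' A' B' y'))"
    and e: "\<not> (x \<in> vs (tag x' A' B' y') \<and> y \<in> vs (tag x' A' B' y'))"
    and C: "C \<in> children (tag x A B y)" "C' \<in> children (tag x' A' B' y')"
    and sh: "share_facet (simplex_of C) (simplex_of C')"
  shows "reflected_neighbors C C'"
proof -
  obtain P a b R where PR: "x # A @ B @ [y] = P @ a # R" "x' # A' @ B' @ [y'] = P @ b # R" "a \<noteq> b"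
    using ag unfolding agree_but_one_iff tag_def by auto
  consider "P = []" | "R = []" | "P \<noteq> []" "R \<noteq> []" by blast
  then show ?thesis
  proof cases
    case 1
    then have h: "x = a" "x' = b" "A @ B @ [y] = R" "A' @ B' @ [y'] = R" using PR by auto
    then have "A = A'" "B = B'" "y = y'" using len append_eq_append_conv[of A A' "B @ [y]" "B' @ [y']"] by auto
    then show ?thesis using first_differs[OF T _ _ _ C(1)] T' L C(2) sh h(1,2) PR(3) by simp
  next
    case 2
    then have h: "y = a" "y' = b" "x # A @ B = P" "x' # A' @ B' = P" using PR by auto
    then have eq: "A = A'" "B = B'" "x = x'" using len append_eq_append_conv[of A A' B B'] by auto
    have "linked (tag y A (rev B) x) (tag y' A (rev B) x)"
      using L unfolding linked_def simplex_of_def vs_reflected eq[symmetric] .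
    moreover have "C \<in> children (tag y A (rev B) x)" "C' \<in> children (tag y' A (rev B) x)"
      using C unfolding children_reflected eq[symmetric] by auto
    moreover have "is_tagged_simplex (tag y' A (rev B) x)" using tagged_reflected[OF T'] by (simp only: eq)
    ultimately show ?thesis using first_differs[OF tagged_reflected[OF T]] sh h(1,2) PR(3) by blast
  next
    case 3
    obtain P1 where P1: "P = x # P1" "P = x' # P1" using 3(1) PR(1,2) by (cases P) auto
    obtain R1 r where "R = R1 @ [r]" using 3(2) by (metis append_butlast_last_id)
    moreover have "(x # A @ B) @ [y] = (P @ a # R1) @ [r]" "(x' # A' @ B') @ [y'] = (P @ b # R1) @ [r]"
      using PR calculation by simp_all
    ultimately have "y = y'" by simp
    then show ?thesis using e P1 by (auto simp: vs_tag)
  qed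
qed

lemma linked_reflected: "linked (tag y A (rev B) x) T' \<longleftrightarrow> linked (tag x A B y) T'"
  unfolding linked_def simplex_of_def vs_reflected ..

text \<open>With a refinement edge in the intersection nothing is left to show; otherwise the
  neighbouring children are handled by \<open>agreeing_children\<close>. In the induction it thus
  suffices to produce reflected neighbours.\<close>

lemma reflected_neighbors_matched:
  fixes T T' :: "'n::finite tagged_simplex"
  assumes T: "is_tagged_simplex T" and T': "is_tagged_simplex T'" and L: "linked T T'" and R: "reflected_neighbors T T'"
  shows "matched T T'"
proof -
  obtain x A B y where tT: "T = tag x A B y" using tag_ex[OF T] by blast
  obtain x' A' B' y' where tT': "T' = tag x' A' B' y'" using tag_ex[OF T'] by blast
  have len: "length A = length A'" using R by (simp add: reflected_neighbors_def tT tT' tag_def)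
  have ag: "agree_but_one (fst (tag x A B y)) (fst T') \<or> agree_but_one (fst (tag y A (rev B) x)) (fst T')"
    using R by (simp add: reflected_neighbors_def tT reflected_tag)
  show ?thesis
  proof (cases "refinement_edge T \<subseteq> simplex_of T \<inter> simplex_of T' \<or> refinement_edge T' \<subseteq> simplex_of T \<inter> simplex_of T'")
    case True
    then show ?thesis using R by (simp add: matched_def)
  next
    case False
    then have e: "\<not> (x \<in> vs T' \<and> y \<in> vs T')" using linked_edge[OF T[unfolded tT] L[unfolded tT]] unfolding tT by blast
    have "reflected_neighbors C C'"
      if C: "C \<in> children T" "C' \<in> children T'" and sh: "share_facet (simplex_of C) (simplex_of C')" for C C'
      using ag
    proof
      assume "agree_but_one (fst (tag x A B y)) (fst T')"
      then show ?thesis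
        by (intro agreeing_children[OF T[unfolded tT] T'[unfolded tT'] L[unfolded tT tT'] len _ _ _ _ sh])
          (use e C in \<open>simp_all only: tT tT' not_False_eq_True\<close>)
    next
      assume "agree_but_one (fst (tag y A (rev B) x)) (fst T')"
      moreover have "linked (tag y A (rev B) x) T'" using L unfolding tT linked_reflected .
      moreover have "C \<in> children (tag y A (rev B) x)" using C(1) unfolding tT children_reflected .
      ultimately show ?thesis
        by (intro agreeing_children[OF tagged_reflected[OF T[unfolded tT]] T'[unfolded tT'] _ len _ _ _ _ sh])
          (use e C in \<open>simp_all only: tT tT' conj_commute not_False_eq_True\<close>)
    qed
    then show ?thesis unfolding matched_def if_not_P[OF False] by blast
  qed
qed

text \<open>Second children contain the reversal of the part behind position \<gamma>. A single
  difference survives because both lists are cut at the same place.\<close>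

lemma split_rev:
  assumes "A @ B = P @ a # R" "A' @ B' = P @ b # R" "length A = length A'"
  shows "\<exists>P2 R2. A @ rev B = P2 @ a # R2 \<and> A' @ rev B' = P2 @ b # R2 \<and> set P2 \<union> set R2 = set P \<union> set R"
proof -
  have AB: "A = take (length A) (P @ a # R)" "B = drop (length A) (P @ a # R)"
    "A' = take (length A) (P @ b # R)" "B' = drop (length A) (P @ b # R)"
    unfolding assms(1,2)[symmetric] using assms(3) by simp_all
  show ?thesis
  proof (cases "length P < length A")
    case True
    then obtain k where k: "length A = Suc (length P + k)" using less_iff_Suc_add by blast
    have "A @ rev B = P @ a # (take k R @ rev (drop k R))" "A' @ rev B' = P @ b # (take k R @ rev (drop k R))"
      unfolding AB(2,4) by (subst AB(1), simp add: k) (subst AB(3), simp add: k)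
    moreover have "set (take k R) \<union> set (drop k R) = set R" by (metis append_take_drop_id set_append)
    ultimately show ?thesis by (intro exI[of _ P] exI[of _ "take k R @ rev (drop k R)"]) auto
  next
    case False
    then have le: "length A \<le> length P" by simp
    define j where "j = length A"
    have "A @ rev B = (take j P @ rev R) @ a # rev (drop j P)" "A' @ rev B' = (take j P @ rev R) @ b # rev (drop j P)"
      unfolding AB(2,4) by (subst AB(1), use le in \<open>simp add: j_def\<close>) (subst AB(3), use le in \<open>simp add: j_def\<close>)
    moreover have "set (take j P) \<union> set (drop j P) = set P" by (metis append_take_drop_id set_append)
    ultimately show ?thesis by (intro exI[of _ "take j P @ rev R"] exI[of _ "rev (drop j P)"]) auto
  qed
qed

lemma half_minus:
  assumes V: "full_simplex V" and uv: "u \<in> V" "v \<in> V" "u \<noteq> v" and a: "a \<in> V" "a \<noteq> u" "a \<noteq> v"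
    and z: "z \<in> convex hull half V u v" "bary V a z = 0"
  shows "z \<in> convex hull (half V u v - {a})"
proof (rule in_hull_minus[OF half_full[OF V uv] z(1)])
  fix k assume "k \<in> {a}"
  then show "bary (half V u v) k z = 0" using bary_half(3)[OF V uv a] z(2) by simp
qed

text \<open>A refinement edge inside the facet forces the differing entry strictly inside the lists,
  so edges and midpoints coincide. Children at the same end then differ in one entry, and children
  at opposite ends are excluded by \<open>crossing_children\<close>.\<close>

lemma inner_children:
  fixes x :: "real^'n::finite"
  assumes T: "is_tagged_simplex (tag x A B y)" and T': "is_tagged_simplex (tag x' A' B' y')"
    and L: "linked (tag x A B y) (tag x' A' B' y')" and len: "length A = length A'"
    and ag: "agree_but_one (fst (tag x A B y)) (fst (tag x' A' B' y'))"
    and e: "x \<in> vs (tag x' A' B' y') \<and> y \<in> vs (tag x' A' B' y') \<or> x' \<in> vs (tag x A B y) \<and> y' \<in> vs (tag x A B y)"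
    and C: "C \<in> children (tag x A B y)" "C' \<in> children (tag x' A' B' y')"
    and f: "f \<subseteq> simplex_of C" "f \<subseteq> simplex_of C'" "aff_dim f = int CARD('n) - 1"
  shows "linked C C' \<and> reflected_neighbors C C'"
proof -
  define V V' where "V = vs (tag x A B y)" and "V' = vs (tag x' A' B' y')"
  note F = is_tagged_full[OF T, folded V_def] is_tagged_full[OF T', folded V'_def]
  obtain P a b R where PR: "x # A @ B @ [y] = P @ a # R" "x' # A' @ B' @ [y'] = P @ b # R" "a \<noteq> b"
    using ag unfolding agree_but_one_iff tag_def by auto
  have d: "distinct (P @ a # R)" "distinct (P @ b # R)"
    using T T' unfolding is_tagged_simplex_def tag_def by (simp_all only: prod.case PR(1,2))
  have VV: "V = set (P @ a # R)" "V' = set (P @ b # R)"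
    unfolding V_def V'_def tag_def by (simp_all only: fst_conv PR(1,2))
  have ab: "a \<notin> V'" "b \<notin> V" "a \<in> V" using d PR(3) by (auto simp: VV)
  have "P \<noteq> []"
  proof
    assume "P = []"
    then have "x = a" "x' = b" using PR by auto
    then show False using e ab by (simp add: V_def V'_def)
  qed
  moreover have "R \<noteq> []"
  proof
    assume "R = []"
    then have "y = a" "y' = b" using PR by auto
    then show False using e ab by (simp add: V_def V'_def)
  qed
  ultimately obtain P1 R1 where P1: "P = x # P1" "P = x' # P1" and R1: "R = R1 @ [y]" "R = R1 @ [y']"
  proof -
    assume P: "P \<noteq> []" and R: "R \<noteq> []" and th: "\<And>P1 R1. P = x # P1 \<Longrightarrow> P = x' # P1 \<Longrightarrow> R = R1 @ [y] \<Longrightarrow> R = R1 @ [y'] \<Longrightarrow> thesis"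
    obtain P1 where P1: "P = x # P1" "P = x' # P1" using P PR(1,2) by (cases P) auto
    obtain R1 r where R1: "R = R1 @ [r]" using R by (metis append_butlast_last_id)
    have "(x # A @ B) @ [y] = (P @ a # R1) @ [r]" "(x' # A' @ B') @ [y'] = (P @ b # R1) @ [r]"
      using PR R1 by simp_all
    then have "r = y" "r = y'" by simp_all
    then show thesis using th P1 R1 by simp
  qed
  have xx: "x' = x" "y' = y" using P1 R1 by simp_all
  have AB: "A @ B = P1 @ a # R1" "A' @ B' = P1 @ b # R1" using PR P1 R1 by simp_all
  obtain P2 R2 where AB2: "A @ rev B = P2 @ a # R2" "A' @ rev B' = P2 @ b # R2" "set P2 \<union> set R2 = set P1 \<union> set R1"
    using split_rev[OF AB len] by blast
  note p = child1_props[OF T, folded V_def] and p2 = child2_props[OF T, folded V_def]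
  note p' = child1_props[OF T', folded V'_def, unfolded xx] and p2' = child2_props[OF T', folded V'_def, unfolded xx]
  have axy: "a \<noteq> x" "a \<noteq> y" using d(1) P1 R1 by auto
  define W where "W = V \<inter> V'"
  have W: "W \<subseteq> V" "W \<subseteq> V'" "W \<subseteq> V - {a}" "x \<in> W" "y \<in> W"
    using ab p(3,4) p'(3,4) by (auto simp: W_def)
  have TW: "simplex_of (tag x A B y) \<inter> simplex_of (tag x' A' B' y') = convex hull W"
    using L by (simp add: linked_def W_def V_def V'_def)
  have CW: "simplex_of C \<inter> simplex_of C' \<subseteq> convex hull W"
    using child_sub(1)[OF T C(1)] child_sub(1)[OF T' C(2)] TW by blast
  have fW: "f \<subseteq> convex hull W" using f CW by blast
  have za: "bary V a z = 0" if "z \<in> simplex_of C" "z \<in> simplex_of C'" for z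
    by (rule bary_zero_off[OF F(1) ab(3) _ W(3)]) (use CW that in blast)
  have tC: "is_tagged_simplex C" "is_tagged_simplex C'" using children_tagged(1)[OF T C(1)] children_tagged(1)[OF T' C(2)] .
  have sn: "snd C = snd C'" using C len by (auto simp: children_tag snd_children)
  have fin: "linked C C' \<and> reflected_neighbors C C'"
    if l: "fst C = Q @ a # S" "fst C' = Q @ b # S" and h: "vs C = half V u v" "{u, v} = {x, y}" "u \<noteq> v" for Q S u v
  proof -
    have "u = x \<and> v = y \<or> u = y \<and> v = x" using h(2) by (simp only: doubleton_eq_iff)
    then have uv: "u \<in> V" "v \<in> V" "a \<noteq> u" "a \<noteq> v" by (elim disjE; use p(3,4) axy in simp)+
    have Lk: "linked C C'"
    proof (rule linkedI[OF tC l refl PR(3)], rule subsetI)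
      fix z assume z: "z \<in> simplex_of C \<inter> simplex_of C'"
      have "z \<in> convex hull half V u v" using z by (simp add: simplex_of_def h(1))
      then have "z \<in> convex hull (half V u v - {a})"
        by (rule half_minus[OF F(1) uv(1,2) h(3) ab(3) uv(3,4)]) (use z za in simp)
      moreover have "half V u v - {a} \<subseteq> set Q \<union> set S" unfolding h(1)[symmetric] l(1) by auto
      ultimately show "z \<in> convex hull (set Q \<union> set S)" by (rule hull_mono[THEN subsetD, rotated])
    qed
    have "agree_but_one (fst C) (fst C')" using l PR(3) unfolding agree_but_one_iff by blast
    then show ?thesis using Lk linked_share_facet[OF tC Lk] sn by (simp add: reflected_neighbors_def)
  qed
  have C1: "simplex_of C = convex hull half V x y" if "C = child1 x A B y" unfolding simplex_of_def that p(1) ..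
  have C2: "simplex_of C = convex hull half V y x" if "C = child2 x A B y" unfolding simplex_of_def that p2(1) ..
  have C1': "simplex_of C' = convex hull half V' x y" if "C' = child1 x A' B' y" unfolding simplex_of_def that p'(1) ..
  have C2': "simplex_of C' = convex hull half V' y x" if "C' = child2 x A' B' y" unfolding simplex_of_def that p2'(1) ..
  have "C = child1 x A B y \<or> C = child2 x A B y" using C(1) by (simp add: children_tag)
  moreover have "C' = child1 x A' B' y \<or> C' = child2 x A' B' y" using C(2) by (simp add: children_tag xx)
  ultimately consider "C = child1 x A B y" "C' = child1 x A' B' y" | "C = child2 x A B y" "C' = child2 x A' B' y"
    | "C = child1 x A B y" "C' = child2 x A' B' y" | "C = child2 x A B y" "C' = child1 x A' B' y" by blast
  then show ?thesis
  proof cases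
    case 1
    show ?thesis
      by (rule fin[of "x # midpoint x y # P1" R1 x y]) (use 1 AB p in \<open>simp_all add: child1_def\<close>)
  next
    case 2
    show ?thesis
      by (rule fin[of "y # midpoint x y # P2" R2 y x]) (use 2 AB2 p p2 in \<open>simp_all add: child2_def insert_commute\<close>)
  next
    case 3
    have False
      by (rule crossing_children[OF F W(1,2) ab(3) W(3-5) p(5) _ _ fW f(3)]) (use f C1 C2' 3 in simp_all)
    then show ?thesis ..
  next
    case 4
    have False
      by (rule crossing_children[OF F W(1,2) ab(3) W(3) W(5,4) p(5)[symmetric] _ _ fW f(3)]) (use f C2 C1' 4 in simp_all)
    then show ?thesis ..
  qed
qed

text \<open>Both edges leave the common facet, so each neighbouring child keeps the whole facet. The
  new midpoints differ: a common one would lie on the facet, where the coordinate at x is 0 and not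
  1/2.\<close>

lemma outer_children:
  fixes x :: "real^'n::finite"
  assumes T: "is_tagged_simplex (tag x A B y)" and T': "is_tagged_simplex (tag x' A' B' y')"
    and L: "linked (tag x A B y) (tag x' A' B' y')"
    and nin: "x \<notin> vs (tag x' A' B' y')" "x' \<notin> vs (tag x A B y)"
    and C: "C \<in> children (tag x A B y)" "C' \<in> children (tag x' A' B' y')"
    and f: "f \<subseteq> simplex_of C" "f \<subseteq> simplex_of C'" "aff_dim f = int CARD('n) - 1"
  shows "linked C C'"
proof -
  note L' = linked_sym[THEN iffD1, OF L]
  have sub: "simplex_of C \<subseteq> simplex_of (tag x A B y)" "simplex_of C' \<subseteq> simplex_of (tag x' A' B' y')"
    using child_sub(1)[OF T C(1)] child_sub(1)[OF T' C(2)] .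
  have "C = child2 x A B y" by (rule other_children[OF T T' L nin(1) C(1) f(1) _ f(3)]) (use f(2) sub in blast)
  moreover have "C' = child2 x' A' B' y'" by (rule other_children[OF T' T L' nin(2) C(2) f(2) _ f(3)]) (use f(1) sub in blast)
  ultimately have l: "fst C = [y] @ midpoint x y # (A @ rev B)" "fst C' = [y'] @ midpoint x' y' # (A' @ rev B')"
    by (simp_all add: child2_def)
  have W: "vs (tag x A B y) \<inter> vs (tag x' A' B' y') = set [y] \<union> set (A @ rev B)"
    unfolding linked_minus[OF T T' L child1_props(3)[OF T] nin(1)] using T by (auto simp: vs_tag is_tagged_tag)
  have W': "vs (tag x A B y) \<inter> vs (tag x' A' B' y') = set [y'] \<union> set (A' @ rev B')"
    unfolding Int_commute[of "vs (tag x A B y)"] linked_minus[OF T' T L' child1_props(3)[OF T'] nin(2)]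
    using T' by (auto simp: vs_tag is_tagged_tag)
  have sub': "simplex_of C \<inter> simplex_of C' \<subseteq> convex hull (set [y] \<union> set (A @ rev B))"
    using sub L unfolding linked_def W by blast
  note F = is_tagged_full[OF T] and p = child1_props[OF T]
  have "midpoint x y \<noteq> midpoint x' y'"
  proof
    assume m: "midpoint x y = midpoint x' y'"
    have "midpoint x y \<in> simplex_of C \<inter> simplex_of C'"
      using l m by (auto simp: simplex_of_def intro!: hull_inc)
    then have "midpoint x y \<in> convex hull (set [y] \<union> set (A @ rev B))" using sub' by blast
    then have "bary (vs (tag x A B y)) x (midpoint x y) = 0"
      by (rule bary_zero_off[OF F p(3)]) (use T in \<open>auto simp: vs_tag is_tagged_tag\<close>)
    then show False using bary_midpoint[OF F p(3-5) p(3)] by simp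
  qed
  then show ?thesis
    using linkedI[OF children_tagged(1)[OF T C(1)] children_tagged(1)[OF T' C(2)] l _ _ sub'] W W' by (simp only: simp_thms)
qed

text \<open>The inheritance step. The set f of dimension d-1 singles out the children that really
  meet along the facet, and whether a refinement edge lies in the facet decides between
  \<open>inner_children\<close> and \<open>outer_children\<close>.\<close>

lemma neighbouring_children:
  fixes T T' :: "'n::finite tagged_simplex"
  assumes T: "is_tagged_simplex T" and T': "is_tagged_simplex T'" and ty: "snd T = snd T'"
    and L: "linked T T'" and M: "matched T T'" and C: "C \<in> children T" "C' \<in> children T'"
    and f: "f \<subseteq> simplex_of C" "f \<subseteq> simplex_of C'" "aff_dim f = int CARD('n) - 1"
  shows "linked C C' \<and> matched C C'"
proof -
  obtain x A B y where tT: "T = tag x A B y" using tag_ex[OF T] by blast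
  obtain x' A' B' y' where tT': "T' = tag x' A' B' y'" using tag_ex[OF T'] by blast
  have tC: "is_tagged_simplex C" "is_tagged_simplex C'" using children_tagged(1)[OF T C(1)] children_tagged(1)[OF T' C(2)] .
  note t = T[unfolded tT] and t' = T'[unfolded tT'] and l = L[unfolded tT tT'] and c = C[unfolded tT tT']
  note r = tagged_reflected[OF t] and r' = tagged_reflected[OF t']
  have lr: "linked (tag y A (rev B) x) (tag x' A' B' y')" using l unfolding linked_reflected .
  have cr: "C \<in> children (tag y A (rev B) x)" "C' \<in> children (tag y' A' (rev B') x')" using c unfolding children_reflected .
  have len: "length A = length A'" using ty by (simp add: tT tT' tag_def)
  note edge = linked_edge[OF t l] linked_edge'[OF t' l]
  show ?thesis
  proof (cases "refinement_edge T \<subseteq> simplex_of T \<inter> simplex_of T' \<or> refinement_edge T' \<subseteq> simplex_of T \<inter> simplex_of T'")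
    case True
    then have "reflected_neighbors T T'" using M by (simp add: matched_def)
    then have ag: "agree_but_one (fst (tag x A B y)) (fst (tag x' A' B' y')) \<or> agree_but_one (fst (tag y A (rev B) x)) (fst (tag x' A' B' y'))"
      by (simp add: reflected_neighbors_def tT tT' reflected_tag)
    have e: "x \<in> vs (tag x' A' B' y') \<and> y \<in> vs (tag x' A' B' y') \<or> x' \<in> vs (tag x A B y) \<and> y' \<in> vs (tag x A B y)"
      using True edge unfolding tT tT' by blast
    have "linked C C' \<and> reflected_neighbors C C'"
      using ag
    proof
      assume "agree_but_one (fst (tag x A B y)) (fst (tag x' A' B' y'))"
      then show ?thesis by (rule inner_children[OF t t' l len _ e c f])
    next
      assume "agree_but_one (fst (tag y A (rev B) x)) (fst (tag x' A' B' y'))"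
      then show ?thesis
        by (rule inner_children[OF r t' lr len _ _ cr(1) c(2) f]) (use e in \<open>simp only: vs_reflected conj_commute\<close>)
    qed
    then show ?thesis using reflected_neighbors_matched[OF tC] by blast
  next
    case False
    then have e: "\<not> (x \<in> vs (tag x' A' B' y') \<and> y \<in> vs (tag x' A' B' y'))" "\<not> (x' \<in> vs (tag x A B y) \<and> y' \<in> vs (tag x A B y))"
      using edge unfolding tT tT' by blast+
    have l2: "linked (tag x A B y) (tag y' A' (rev B') x')"
      using l unfolding linked_sym[of "tag x A B y"] linked_reflected .
    have lr2: "linked (tag y A (rev B) x) (tag y' A' (rev B') x')" using l2 unfolding linked_reflected .
    \<comment> \<open>The cases tell which end of each edge is off the common facet; reflecting one
      or both simplices moves it to the first position.\<close>
    consider "x \<notin> vs (tag x' A' B' y')" "x' \<notin> vs (tag x A B y)" | "y \<notin> vs (tag x' A' B' y')" "x' \<notin> vs (tag x A B y)"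
      | "x \<notin> vs (tag x' A' B' y')" "y' \<notin> vs (tag x A B y)" | "y \<notin> vs (tag x' A' B' y')" "y' \<notin> vs (tag x A B y)"
      using e by blast
    then have "linked C C'"
    proof cases
      case 1 then show ?thesis by (rule outer_children[OF t t' l _ _ c f])
    next
      case 2 then show ?thesis
        by (intro outer_children[OF r t' lr _ _ cr(1) c(2) f]) (simp_all only: vs_reflected not_False_eq_True)
    next
      case 3 then show ?thesis
        by (intro outer_children[OF t r' l2 _ _ c(1) cr(2) f]) (simp_all only: vs_reflected not_False_eq_True)
    next
      case 4 then show ?thesis
        by (intro outer_children[OF r r' lr2 _ _ cr f]) (simp_all only: vs_reflected not_False_eq_True)
    qed
    moreover have "reflected_neighbors C C'"
      using M[unfolded matched_def if_not_P[OF False]] C linked_share_facet[OF tC calculation] by blast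
    ultimately show ?thesis using reflected_neighbors_matched[OF tC] by blast
  qed
qed

text \<open>If at most one vertex is affected by the reversal, the lists of the siblings differ in
  the first entry only. Otherwise the refinement edges of the siblings leave their common facet, and
  the children there differ, after reflecting one of them, only in the new midpoints.\<close>

lemma siblings:
  fixes x :: "real^'n::finite"
  assumes T: "is_tagged_simplex (tag x A B y)"
  shows "linked (child1 x A B y) (child2 x A B y) \<and> matched (child1 x A B y) (child2 x A B y)"
proof -
  define C C' where "C = child1 x A B y" and "C' = child2 x A B y"
  note F = is_tagged_full[OF T] and p = child1_props[OF T, folded C_def] and p2 = child2_props[OF T, folded C'_def]
  have L: "linked C C'"
  proof (rule linkedI[OF p(2) p2(2), where P = "[]" and P' = "[]" and a = x and b = y])
    show "fst C = [] @ x # (midpoint x y # A @ B)" "fst C' = [] @ y # (midpoint x y # A @ rev B)"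
      by (simp_all add: C_def C'_def child1_def child2_def)
    show "set [] \<union> set (midpoint x y # A @ rev B) = set [] \<union> set (midpoint x y # A @ B)" by simp
    show "x \<noteq> y" by (rule p(5))
    show "simplex_of C \<inter> simplex_of C' \<subseteq> convex hull (set [] \<union> set (midpoint x y # A @ B))"
    proof
      fix z assume z: "z \<in> simplex_of C \<inter> simplex_of C'"
      have z1: "z \<in> convex hull half (vs (tag x A B y)) x y" "z \<in> convex hull half (vs (tag x A B y)) y x"
        using z by (auto simp: simplex_of_def p(1) p2(1))
      then have "bary (vs (tag x A B y)) x z = bary (vs (tag x A B y)) y z"
        unfolding in_half[OF F p(3-5)] in_half[OF F p(4,3) p(5)[symmetric]] by simp
      then have b0: "bary (half (vs (tag x A B y)) x y) x z = 0" unfolding bary_half(2)[OF F p(3-5)] by simp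
      have "z \<in> convex hull (half (vs (tag x A B y)) x y - {x})"
        by (rule in_hull_minus[OF half_full[OF F p(3-5)] z1(1)]) (use b0 in simp)
      moreover have "half (vs (tag x A B y)) x y - {x} \<subseteq> set [] \<union> set (midpoint x y # A @ B)"
        unfolding p(1)[symmetric] C_def child1_def by auto
      ultimately show "z \<in> convex hull (set [] \<union> set (midpoint x y # A @ B))" using hull_mono by blast
    qed
  qed
  have sh: "share_facet (simplex_of C) (simplex_of C')" by (rule linked_share_facet[OF p(2) p2(2) L])
  have "matched C C'"
  proof (cases "length B \<le> 1")
    case True
    then have rB: "rev B = B" by (cases B) auto
    have "agree_but_one (fst C) (fst C')"
      unfolding agree_but_one_iff C_def C'_def child1_def child2_def rB using p(5)
      by (intro exI[of _ "[]"] exI[of _ x] exI[of _ y] exI[of _ "midpoint x y # A @ B"]) simp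
    then have "reflected_neighbors C C'" using sh by (simp add: reflected_neighbors_def C_def C'_def snd_children)
    then show ?thesis by (rule reflected_neighbors_matched[OF p(2) p2(2) L])
  next
    case False
    then obtain b1 B0 where B0: "B = b1 # B0" "B0 \<noteq> []" by (cases B) auto
    then obtain B1 b2 where B: "B = b1 # B1 @ [b2]" by (metis append_butlast_last_id)
    have l: "length A + length B1 + 3 = CARD('n)" using T by (simp add: is_tagged_tag B)
    have d: "distinct (x # y # A @ b1 # b2 # B1)" using T by (auto simp: is_tagged_tag B)
    define m where "m = midpoint x y"
    have m1: "(length A + 1) mod CARD('n) = length A + 1" "(length A + 1 + 1) mod CARD('n) = length A + 2"
      using l by simp_all
    \<comment> \<open>The type is still below d, so the refinement edges run from x to
      \<open>b2\<close> and, because of the reversal, from y to \<open>b1\<close>.\<close>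
    have tC: "C = tag x (m # A) (b1 # B1) b2" "C' = tag y (m # A) (b2 # rev B1) b1"
      using m1 by (simp_all add: C_def C'_def child1_def child2_def tag_def B m_def)
    have mV: "m \<notin> vs (tag x A B y)" unfolding m_def by (rule midpoint_notin[OF F p(3-5)])
    have nin: "x \<notin> vs C'" "y \<notin> vs C" using d mV p(3,4) unfolding tC vs_tag by auto
    have e: "\<not> (refinement_edge C \<subseteq> simplex_of C \<inter> simplex_of C' \<or> refinement_edge C' \<subseteq> simplex_of C \<inter> simplex_of C')"
      using linked_edge[OF p(2)[unfolded tC] L[unfolded tC(1)]] linked_edge'[OF p2(2)[unfolded tC] L[unfolded tC(2)]] nin
      unfolding tC by blast
    have "reflected_neighbors D D'"
      if D: "D \<in> children C" "D' \<in> children C'" and sh: "share_facet (simplex_of D) (simplex_of D')" for D D'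
    proof -
      obtain f where f: "f \<subseteq> simplex_of D" "f \<subseteq> simplex_of D'" "aff_dim f = int CARD('n) - 1"
        by (rule share_facetE[OF children_tagged(1)[OF p(2) D(1)] sh])
      have "D = child2 x (m # A) (b1 # B1) b2"
        by (rule other_children[OF p(2)[unfolded tC] p2(2) L[unfolded tC(1)] nin(1) D(1)[unfolded tC] f(1) _ f(3)])
          (use f(2) child_sub(1)[OF p2(2) D(2)] in blast)
      then have tD: "D = tag b2 (midpoint x b2 # m # A) (rev B1) b1" using m1(2) by (simp add: child2_def tag_def)
      have tD': "D' = child2 y (m # A) (b2 # rev B1) b1"
        by (rule other_children[OF p2(2)[unfolded tC] p(2) linked_sym[THEN iffD1, OF L, unfolded tC(2)] nin(2) D(2)[unfolded tC] f(2) _ f(3)])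
          (use f(1) child_sub(1)[OF p(2) D(1)] in blast)
      have "midpoint x b2 \<noteq> midpoint y b1"
      proof
        assume "midpoint x b2 = midpoint y b1"
        moreover have "bary (vs (tag x A B y)) x (midpoint x b2) = 1/2"
          by (subst bary_midpoint[OF F p(3) _ _ p(3)]) (use d in \<open>auto simp: vs_tag B\<close>)
        moreover have "bary (vs (tag x A B y)) x (midpoint y b1) = 0"
          by (subst bary_midpoint[OF F p(4) _ _ p(3)]) (use d in \<open>auto simp: vs_tag B\<close>)
        ultimately show False by simp
      qed
      then have "agree_but_one (fst (reflected D)) (fst D')"
        unfolding agree_but_one_iff tD tD' reflected_tag
        by (intro exI[of _ "[b1]"] exI[of _ "midpoint x b2"] exI[of _ "midpoint y b1"] exI[of _ "m # A @ B1 @ [b2]"])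
          (simp add: tag_def child2_def)
      moreover have "snd D = snd D'" using m1(2) by (simp add: tD tD' snd_children tag_def)
      ultimately show ?thesis using sh by (simp add: reflected_neighbors_def)
    qed
    then show ?thesis unfolding matched_def if_not_P[OF e] by blast
  qed
  with L show ?thesis by (simp add: C_def C'_def)
qed

lemma siblings_matched:
  fixes T :: "'n::finite tagged_simplex"
  assumes T: "is_tagged_simplex T" and C: "C \<in> children T" "C' \<in> children T" "C \<noteq> C'"
  shows "linked C C' \<and> matched C C'"
proof -
  obtain x A B y where tT: "T = tag x A B y" using tag_ex[OF T] by blast
  have "C = child1 x A B y \<and> C' = child2 x A B y \<or> C = child2 x A B y \<and> C' = child1 x A B y"
    using C by (auto simp: tT children_tag)
  then show ?thesis
  proof
    assume "C = child1 x A B y \<and> C' = child2 x A B y"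
    then show ?thesis using siblings[OF T[unfolded tT]] by simp
  next
    assume "C = child2 x A B y \<and> C' = child1 x A B y"
    then have "C = child1 y A (rev B) x" "C' = child2 y A (rev B) x" using child2_reflected[of x A B y] by simp_all
    then show ?thesis using siblings[OF tagged_reflected[OF T[unfolded tT]]] by simp
  qed
qed

text \<open>In each generation the two ancestors containing f either coincide, and then their
  children are equal or siblings, or are linked and matched, which passes to the children. The count
  \<open>k\<close> is the same on both sides, so the types agree throughout.\<close>

lemma descendants_matched:
  fixes S S' :: "'n::finite tagged_simplex"
  assumes S: "is_tagged_simplex S" "is_tagged_simplex S'" "snd S = snd S'" and R: "S = S' \<or> linked S S' \<and> matched S S'"
    and D: "descends S k T" "descends S' k T'"
    and f: "f \<subseteq> simplex_of T" "f \<subseteq> simplex_of T'" "aff_dim f = int CARD('n) - 1"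
  shows "T = T' \<or> linked T T' \<and> matched T T'"
  using D f(1,2)
proof (induction k arbitrary: T T')
  case 0
  have "T = S" "T' = S'" using 0(1,2) by (auto elim: descends.cases)
  then show ?case using R by simp
next
  case (Suc k)
  obtain P where P: "descends S k P" "T \<in> children P" using Suc.prems(1) by (cases rule: descends.cases) auto
  obtain P' where P': "descends S' k P'" "T' \<in> children P'" using Suc.prems(2) by (cases rule: descends.cases) auto
  note tP = descends_tagged[OF P(1) S(1)] and tP' = descends_tagged[OF P'(1) S(2)]
  have "f \<subseteq> simplex_of P" "f \<subseteq> simplex_of P'" using Suc.prems(3,4) child_sub(1)[OF tP P(2)] child_sub(1)[OF tP' P'(2)] by blast+
  from Suc.IH[OF P(1) P'(1) this] show ?case
  proof
    assume "P = P'"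
    then show ?thesis using siblings_matched[OF tP P(2)] P'(2) by blast
  next
    assume "linked P P' \<and> matched P P'"
    then show ?thesis
      using neighbouring_children[OF tP tP' _ _ _ P(2) P'(2) Suc.prems(3,4) f(3)]
        descends_type[OF P(1) S(1)] descends_type[OF P'(1) S(2)] S(3) by simp
  qed
qed

section \<open>Generations in a mesh\<close>

text \<open>Each child lies on one side of the bisecting hyperplane, and the opposite end of the
  edge lies strictly on the other side.\<close>

lemma edge_bisected:
  assumes T: "is_tagged_simplex (tag x A B y)" and C: "C \<in> children (tag x A B y)"
    and xy: "x \<in> simplex_of C" "y \<in> simplex_of C"
  shows False
proof -
  note F = is_tagged_full[OF T] and p = child1_props[OF T] and p2 = child2_props[OF T]
  have "C = child1 x A B y \<or> C = child2 x A B y" using C by (simp add: children_tag)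
  then show False
  proof
    assume "C = child1 x A B y"
    then have "y \<in> convex hull half (vs (tag x A B y)) x y" using xy(2) by (simp add: simplex_of_def p(1))
    then show False unfolding in_half[OF F p(3-5)] using bary_vertex[OF F p(4) p(4)] bary_vertex[OF F p(3,4)] p(5) by simp
  next
    assume "C = child2 x A B y"
    then have "x \<in> convex hull half (vs (tag x A B y)) y x" using xy(1) by (simp add: simplex_of_def p2(1))
    then show False unfolding in_half[OF F p(4,3) p(5)[symmetric]]
      using bary_vertex[OF F p(3) p(3)] bary_vertex[OF F p(4,3)] p(5) by simp
  qed
qed

text \<open>The facet opposite x stays whole in the second child only. The refinement edge of that
  child runs from y to its last vertex, which for d \<ge> 2 again belongs to the facet, so the next
  bisection cuts the facet.\<close>

lemma facet_bisected_aux: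
  fixes x :: "real^'n::finite"
  assumes d: "2 \<le> CARD('n)" and E: "is_tagged_simplex (tag x A B y)" and C: "C \<in> children (tag x A B y)"
    and G: "G \<in> children C" and f: "convex hull (vs (tag x A B y) - {x}) \<subseteq> simplex_of G"
    "aff_dim (convex hull (vs (tag x A B y) - {x})) = int CARD('n) - 1"
  shows False
proof -
  have tC: "is_tagged_simplex C" by (rule children_tagged(1)[OF E C])
  have "simplex_of G \<subseteq> simplex_of C" by (rule child_sub(1)[OF tC G])
  then have "C \<noteq> child1 x A B y" using child1_misses_facet[OF E _ order_refl f(2)] f(1) by blast
  then have C2: "C = child2 x A B y" using C by (simp add: children_tag)
  obtain u A2 B2 w where tg: "C = tag u A2 B2 w" using tag_ex[OF tC] by blast
  have ne: "A @ rev B \<noteq> []" using E d by (auto simp: is_tagged_tag)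
  have fC: "y # midpoint x y # A @ rev B = u # A2 @ B2 @ [w]" using C2 tg by (simp add: child2_def tag_def)
  then have u: "u = y" by simp
  have "w = last (u # A2 @ B2 @ [w])" by simp
  also have "\<dots> = last (A @ rev B)" unfolding fC[symmetric] using ne by (simp only: last_ConsR list.distinct not_False_eq_True)
  finally have "w \<in> set (A @ rev B)" using last_in_set[OF ne] by (simp only:)
  then have "w \<in> set A \<union> set B" by simp
  then have "u \<in> vs (tag x A B y) - {x}" "w \<in> vs (tag x A B y) - {x}"
    using E u by (auto simp: is_tagged_tag vs_tag)
  then have "u \<in> simplex_of G" "w \<in> simplex_of G" by (auto intro!: subsetD[OF f(1)] hull_inc)
  then show False by (rule edge_bisected[OF tC[unfolded tg] G[unfolded tg]])
qed

text \<open>A facet opposite an end of the refinement edge survives one bisection but not the next;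
  every other facet contains the edge and is cut at once.\<close>

lemma facet_bisected:
  fixes E :: "'n::finite tagged_simplex"
  assumes d: "2 \<le> CARD('n)" and E: "is_tagged_simplex E" and C: "C \<in> children E"
    and G: "G \<in> children C" and e: "e \<in> vs E" and f: "convex hull (vs E - {e}) \<subseteq> simplex_of G"
  shows False
proof -
  note F = is_tagged_full[OF E]
  have "convex hull (vs E - {e}) facet_of simplex_of E"
    unfolding simplex_of_def facet_hull[OF F] opp_def using e by blast
  note dim = facet_dim[OF E this]
  obtain x A B y where tg: "E = tag x A B y" using tag_ex[OF E] by blast
  note tE = E[unfolded tg]
  consider "e = x" | "e = y" | "e \<noteq> x" "e \<noteq> y" by blast
  then show False
  proof cases
    case 1
    show False by (rule facet_bisected_aux[OF d tE C[unfolded tg] G]) (use f dim in \<open>simp_all only: tg 1\<close>)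
  next
    case 2
    show False
      by (rule facet_bisected_aux[OF d tagged_reflected[OF tE] _ G])
        (use f dim C in \<open>simp_all only: tg 2 vs_reflected children_reflected\<close>)
  next
    case 3
    have "x \<in> vs E - {e}" "y \<in> vs E - {e}" using 3 by (simp_all add: tg vs_tag)
    then have "x \<in> simplex_of G" "y \<in> simplex_of G" by (auto intro!: subsetD[OF f] hull_inc)
    moreover have GC: "simplex_of G \<subseteq> simplex_of C" by (rule child_sub(1)[OF children_tagged(1)[OF E C] G])
    ultimately show False by (intro edge_bisected[OF tE C[unfolded tg]] subsetD[OF GC])
  qed
qed

lemma matching_facts:
  assumes "matching_neighbor_condition \<Omega> \<T>\<^sub>0"
  shows "T \<in> \<T>\<^sub>0 \<Longrightarrow> is_tagged_simplex T" "inj_on simplex_of \<T>\<^sub>0" "triangulation_of \<Omega> (simplex_of ` \<T>\<^sub>0)"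
    "T \<in> \<T>\<^sub>0 \<Longrightarrow> T' \<in> \<T>\<^sub>0 \<Longrightarrow> snd T = snd T'"
    "T \<in> \<T>\<^sub>0 \<Longrightarrow> T' \<in> \<T>\<^sub>0 \<Longrightarrow> share_facet (simplex_of T) (simplex_of T') \<Longrightarrow> matched T T'"
proof -
  note m = assms[unfolded matching_neighbor_condition_def, folded matched_def]
  note m1 = conjunct1[OF m] and m2 = conjunct2[OF m]
  note m3 = conjunct2[OF m2] and m4 = conjunct2[OF conjunct2[OF m2]]
  show "T \<in> \<T>\<^sub>0 \<Longrightarrow> is_tagged_simplex T" by (rule bspec[OF m1])
  show "inj_on simplex_of \<T>\<^sub>0" by (rule conjunct1[OF m2])
  show "triangulation_of \<Omega> (simplex_of ` \<T>\<^sub>0)" by (rule conjunct1[OF m3])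
  show "T \<in> \<T>\<^sub>0 \<Longrightarrow> T' \<in> \<T>\<^sub>0 \<Longrightarrow> snd T = snd T'" by (rule bspec[OF bspec[OF conjunct1[OF m4]]])
  show "T \<in> \<T>\<^sub>0 \<Longrightarrow> T' \<in> \<T>\<^sub>0 \<Longrightarrow> share_facet (simplex_of T) (simplex_of T') \<Longrightarrow> matched T T'"
    by (rule mp[OF bspec[OF bspec[OF conjunct2[OF m4]]]])
qed

text \<open>The overlap of dimension d-1 makes the intersection, a proper face, a facet of both
  roots, and the initial condition applies.\<close>

lemma roots_matched:
  fixes S S' :: "'n::finite tagged_simplex"
  assumes M: "matching_neighbor_condition \<Omega> \<T>\<^sub>0" and S: "S \<in> \<T>\<^sub>0" "S' \<in> \<T>\<^sub>0"
    and f: "f \<subseteq> simplex_of S" "f \<subseteq> simplex_of S'" "aff_dim f = int CARD('n) - 1"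
  shows "S = S' \<or> linked S S' \<and> matched S S'"
proof (cases "S = S'")
  case False
  interpret conforming \<Omega> "simplex_of ` \<T>\<^sub>0" using matching_facts(3)[OF M] by unfold_locales
  note t = matching_facts(1)[OF M S(1)] and t' = matching_facts(1)[OF M S(2)]
  define K where "K = simplex_of S \<inter> simplex_of S'"
  have in_mesh: "simplex_of S \<in> simplex_of ` \<T>\<^sub>0" "simplex_of S' \<in> simplex_of ` \<T>\<^sub>0" using S by auto
  have ne: "simplex_of S \<noteq> simplex_of S'" using matching_facts(2)[OF M] S False by (auto dest: inj_onD)
  have facet: "K facet_of A"
    if A: "A \<in> simplex_of ` \<T>\<^sub>0" "B \<in> simplex_of ` \<T>\<^sub>0" "A \<noteq> B" and KAB: "K = A \<inter> B" for A B
  proof -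
    have face: "K face_of A" unfolding KAB by (rule inter_face[OF A(1,2)])
    have "K \<noteq> A" using interior_disjoint[OF A] interior_ne[OF A(1)] interior_subset[of A] KAB by blast
    then have "aff_dim K < aff_dim A" by (rule face_of_aff_dim_lt[OF convexT[OF A(1)] face])
    moreover have "aff_dim A = int CARD('n)" using interior_ne[OF A(1)] by (simp add: aff_dim_nonempty_interior)
    moreover have "aff_dim f \<le> aff_dim K" using f(1,2) by (intro aff_dim_subset) (simp add: K_def)
    moreover have "K \<noteq> {}"
    proof
      assume "K = {}"
      then have "aff_dim K = -1" by simp
      then show False using \<open>aff_dim f \<le> aff_dim K\<close> f(3) by simp
    qed
    ultimately show ?thesis using face f(3) by (simp add: facet_of_def)
  qed
  have "K facet_of simplex_of S" by (rule facet[OF in_mesh ne]) (simp add: K_def)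
  then obtain v where v: "v \<in> vs S" "K = opp (vs S) v"
    unfolding simplex_of_def facet_hull[OF is_tagged_full[OF t]] by blast
  have "K facet_of simplex_of S'" by (rule facet[OF in_mesh(2,1) ne[symmetric]]) (auto simp: K_def)
  then obtain v' where v': "v' \<in> vs S'" "K = opp (vs S') v'"
    unfolding simplex_of_def facet_hull[OF is_tagged_full[OF t']] by blast
  have eq: "vs S - {v} = vs S' - {v'}"
    using verts_opp[OF is_tagged_full[OF t], of v] verts_opp[OF is_tagged_full[OF t'], of v'] v v' by simp
  have "vs S \<noteq> vs S'" using ne by (auto simp: simplex_of_def)
  then have W: "vs S \<inter> vs S' = vs S - {v}" using eq v v' by blast
  have "card (vs S - {v}) = CARD('n)" using card_opp[OF is_tagged_full[OF t] v(1)] by simp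
  then have L: "linked S S'" using v(2) by (simp add: linked_def W K_def opp_def)
  then show ?thesis using matching_facts(5)[OF M S linked_share_facet[OF t t' L]] by blast
qed simp

text \<open>If k' were at least k+2, let E be the ancestor of D' of generation k. If E = D, then D'
  would lie in D. Otherwise D and E are linked, f is their whole common facet, and it lies in a
  grandchild of E, contrary to \<open>facet_bisected\<close>.\<close>

lemma generation_difference:
  fixes D D' :: "'n::finite tagged_simplex"
  assumes d: "2 \<le> CARD('n)" and M: "matching_neighbor_condition \<Omega> \<T>\<^sub>0"
    and S: "S \<in> \<T>\<^sub>0" "S' \<in> \<T>\<^sub>0" and D: "descends S k D" "descends S' k' D'"
    and \<T>: "triangulation_of \<Omega> \<T>" "simplex_of D \<in> \<T>" "simplex_of D' \<in> \<T>" "simplex_of D \<noteq> simplex_of D'"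
    and f: "f facet_of simplex_of D" "f facet_of simplex_of D'"
  shows "k' \<le> k + 1"
proof (rule ccontr)
  assume "\<not> k' \<le> k + 1"
  then obtain j where "k' = Suc (Suc k) + j" using less_iff_Suc_add[of "Suc k" k'] by auto
  then have "k' = k + Suc (Suc j)" by simp
  with D(2) obtain E where E: "descends S' k E" "descends E (Suc (Suc j)) D'" using descends_split by blast
  interpret conforming \<Omega> \<T> using \<T>(1) by unfold_locales
  note tS = matching_facts(1)[OF M S(1)] and tS' = matching_facts(1)[OF M S(2)]
  note tD = descends_tagged[OF D(1) tS] and tD' = descends_tagged[OF D(2) tS'] and tE = descends_tagged[OF E(1) tS']
  have fs: "f \<subseteq> simplex_of D" "f \<subseteq> simplex_of D'" using f by (simp_all add: facet_of_imp_subset)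
  have fE: "f \<subseteq> simplex_of E" using fs(2) descends_sub[OF E(2) tE] by blast
  have dim: "aff_dim f = int CARD('n) - 1" by (rule facet_dim[OF tD f(1)])
  have "S = S' \<or> linked S S' \<and> matched S S'"
    by (rule roots_matched[OF M S _ _ dim])
      (use fs descends_sub[OF D(1) tS] descends_sub[OF D(2) tS'] in blast)+
  then have "D = E \<or> linked D E \<and> matched D E"
    by (rule descendants_matched[OF tS tS' matching_facts(4)[OF M S] _ D(1) E(1) fs(1) fE dim])
  then show False
  proof
    assume "D = E"
    then have "simplex_of D' \<subseteq> simplex_of D" using descends_sub[OF E(2) tE] by simp
    then show False
      using interior_disjoint[OF \<T>(3,2) \<T>(4)[symmetric]] interior_ne[OF \<T>(3)] interior_subset[of "simplex_of D'"] by blast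
  next
    assume "linked D E \<and> matched D E"
    then have L: "linked D E" by blast
    note F = is_tagged_full[OF tD]
    obtain a where a: "a \<in> vs D" "f = opp (vs D) a"
      using f(1) unfolding simplex_of_def facet_hull[OF F] by blast
    obtain v where v: "v \<in> vs D" "vs D \<inter> vs E = vs D - {v}" using linked_opp(1)[OF tD tE L] by blast
    obtain e where e: "e \<in> vs E" "vs D \<inter> vs E = vs E - {e}" using linked_opp(2)[OF tD tE L] by blast
    have fW: "f \<subseteq> convex hull (vs D - {v})" using fs(1) fE L v(2) by (auto simp: linked_def)
    have "v = a"
    proof (rule ccontr)
      assume "v \<noteq> a"
      then have "v \<in> f" using v(1) a(2) by (auto simp: opp_def intro: hull_inc)
      then have "bary (vs D) v v = 0" using fW by (intro bary_zero_off[OF F v(1)]) auto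
      then show False using bary_vertex[OF F v(1) v(1)] by simp
    qed
    then have fe: "f = convex hull (vs E - {e})" using a(2) v(2) e(2) by (simp add: opp_def)
    obtain C where C: "C \<in> children E" "descends C (Suc j) D'" using descends_first[OF E(2)] by blast
    note tC = children_tagged(1)[OF tE C(1)]
    obtain G where G: "G \<in> children C" "descends G j D'" using descends_first[OF C(2)] by blast
    have "f \<subseteq> simplex_of G" using fs(2) descends_sub[OF G(2) children_tagged(1)[OF tC G(1)]] by blast
    then show False using facet_bisected[OF d tE C(1) G(1) e(1)] by (simp add: fe)
  qed
qed

lemma bisection_refinement_descends:
  assumes "bisection_refinement \<P> \<P>'" "\<forall>T\<in>\<P>. \<exists>S\<in>\<T>\<^sub>0. \<exists>k. descends S k T"
  shows "\<forall>T\<in>\<P>'. \<exists>S\<in>\<T>\<^sub>0. \<exists>k. descends S k T"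
  using assms unfolding bisection_refinement_def
proof (induction rule: rtranclp_induct)
  case (step \<P>' \<P>'')
  obtain R where R: "R \<in> \<P>'" "\<P>'' = bisect {R} \<P>'" using step.hyps(2) by (elim bexE)
  note IH = step.IH[OF step.prems]
  show ?case
  proof
    fix T assume "T \<in> \<P>''"
    then consider "T \<in> \<P>'" | "T \<in> children R" by (auto simp: bisect_def R(2))
    then show "\<exists>S\<in>\<T>\<^sub>0. \<exists>k. descends S k T"
    proof cases
      case 1 then show ?thesis by (rule bspec[OF IH])
    next
      case 2
      obtain S k where "S \<in> \<T>\<^sub>0" "descends S k R" using bspec[OF IH R(1)] by (elim bexE exE)
      then show ?thesis using descends.step[OF _ 2] by (intro bexI exI)
    qed
  qed
qed simp

lemma meshes_descend:
  assumes M: "matching_neighbor_condition \<Omega> \<T>\<^sub>0" and P: "\<P> \<in> BiSec_MT_meshes \<Omega> \<T>\<^sub>0"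
  shows "triangulation_of \<Omega> (simplex_of ` \<P>) \<and> (\<forall>T\<in>\<P>. \<exists>S\<in>\<T>\<^sub>0. \<exists>k. descends S k T)"
  using P
proof induction
  case initial
  show ?case using matching_facts(3)[OF M] descends.zero by (intro conjI ballI bexI exI)
next
  case (refine \<P> \<M> \<P>')
  have "\<forall>T\<in>bisect \<M> \<P>. \<exists>S\<in>\<T>\<^sub>0. \<exists>k. descends S k T"
  proof
    fix T assume "T \<in> bisect \<M> \<P>"
    then consider "T \<in> \<P>" | R where "R \<in> \<P>" "T \<in> children R" using refine(2) by (auto simp: bisect_def)
    then show "\<exists>S\<in>\<T>\<^sub>0. \<exists>k. descends S k T"
    proof cases
      case 1 then show ?thesis by (rule bspec[OF conjunct2[OF refine.IH]])
    next
      case 2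
      obtain S k where "S \<in> \<T>\<^sub>0" "descends S k R" using bspec[OF conjunct2[OF refine.IH] 2(1)] by (elim bexE exE)
      then show ?thesis using descends.step[OF _ 2(2)] by (intro bexI exI)
    qed
  qed
  note D = this
  have "bisection_refinement (bisect \<M> \<P>) \<P>'" "triangulation_of \<Omega> (simplex_of ` \<P>')"
    using refine.hyps(3) by (simp_all add: smallest_conforming_refinement_def)
  then show ?case using bisection_refinement_descends[OF _ D] by (intro conjI)
qed

definition generations ::
    "real \<Rightarrow> real \<Rightarrow> real \<Rightarrow> (real^'n) set set \<Rightarrow> ((real^'n) set \<Rightarrow> nat) \<Rightarrow> bool" where
  "generations V0 V1 \<Phi> \<T> gen \<longleftrightarrow>
    (\<forall>T\<in>\<T>. V0 \<le> measure lborel T * 2 ^ gen T \<and> measure lborel T * 2 ^ gen T \<le> V1 \<and>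
      (\<exists>c. T \<subseteq> cball c (\<Phi> * 2 powr (- real (gen T) / real CARD('n))))) \<and>
    (\<forall>T\<in>\<T>. \<forall>T'\<in>\<T>. \<forall>f. f facet_of T \<and> f facet_of T' \<longrightarrow> gen T \<le> gen T' + 1)"

text \<open>There are finitely many initial simplices, so extreme values over them provide constants
  depending on the initial triangulation only.\<close>

lemma mesh_generations:
  fixes \<T>\<^sub>0 :: "'n::finite tagged_simplex set"
  assumes d: "2 \<le> CARD('n)" and M: "matching_neighbor_condition \<Omega> \<T>\<^sub>0"
  shows "\<exists>V0 V1 \<Phi>. 0 < V0 \<and> V0 \<le> V1 \<and> 0 < \<Phi> \<and>
    (\<forall>\<P>\<in>BiSec_MT_meshes \<Omega> \<T>\<^sub>0. triangulation_of \<Omega> (simplex_of ` \<P>) \<and> (\<exists>gen. generations V0 V1 \<Phi> (simplex_of ` \<P>) gen))"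
proof -
  interpret conforming \<Omega> "simplex_of ` \<T>\<^sub>0" using matching_facts(3)[OF M] by unfold_locales
  have fin: "finite \<T>\<^sub>0" using fin finite_imageD matching_facts(2)[OF M] by blast
  note tag = matching_facts(1)[OF M]
  have "\<forall>S\<in>\<T>\<^sub>0. \<exists>\<phi>>0. \<forall>k T. descends S k T \<longrightarrow> (\<exists>c. simplex_of T \<subseteq> cball c (\<phi> * 2 powr (- real k / real CARD('n))))"
    using descends_ball tag by blast
  then obtain \<phi> where \<phi>: "\<And>S k T. S \<in> \<T>\<^sub>0 \<Longrightarrow> descends S k T \<Longrightarrow> \<exists>c. simplex_of T \<subseteq> cball c (\<phi> S * 2 powr (- real k / real CARD('n)))"
    unfolding Ball_def by metis
  define \<mu> where "\<mu> S = measure lborel (simplex_of S)" for S :: "'n tagged_simplex"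
  \<comment> \<open>Inserting 1 keeps the extrema defined and makes the order and positivity of the
    constants immediate.\<close>
  define V0 V1 \<Phi> where "V0 = Min (insert 1 (\<mu> ` \<T>\<^sub>0))" and "V1 = Max (insert 1 (\<mu> ` \<T>\<^sub>0))" and "\<Phi> = Max (insert 1 (\<phi> ` \<T>\<^sub>0))"
  have \<mu>0: "0 < \<mu> S" if "S \<in> \<T>\<^sub>0" for S
    unfolding \<mu>_def simplex_of_def by (rule measure_simplex_pos[OF is_tagged_full[OF tag[OF that]]])
  have V: "0 < V0" "V0 \<le> 1" "1 \<le> V1" "1 \<le> \<Phi>"
    unfolding V0_def V1_def \<Phi>_def using fin \<mu>0 by (auto simp: Min_gr_iff)
  have B: "V0 \<le> \<mu> S" "\<mu> S \<le> V1" "\<phi> S \<le> \<Phi>" if "S \<in> \<T>\<^sub>0" for S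
    unfolding V0_def V1_def \<Phi>_def using fin that by auto
  have "\<exists>gen. generations V0 V1 \<Phi> (simplex_of ` \<P>) gen" if P: "\<P> \<in> BiSec_MT_meshes \<Omega> \<T>\<^sub>0" for \<P>
  proof -
    note md = meshes_descend[OF M P]
    have "\<forall>T\<in>simplex_of ` \<P>. \<exists>k. \<exists>S\<in>\<T>\<^sub>0. \<exists>D. descends S k D \<and> simplex_of D = T" using md by blast
    \<comment> \<open>A possible number of bisections is chosen for every simplex of the mesh; the
      bounds hold for any such choice.\<close>
    then obtain gen where gen: "\<forall>T\<in>simplex_of ` \<P>. \<exists>S\<in>\<T>\<^sub>0. \<exists>D. descends S (gen T) D \<and> simplex_of D = T"
      by (rule bchoice[THEN exE])
    have "generations V0 V1 \<Phi> (simplex_of ` \<P>) gen"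
      unfolding generations_def
    proof (intro conjI ballI allI impI)
      fix T assume T: "T \<in> simplex_of ` \<P>"
      obtain S D where SD: "S \<in> \<T>\<^sub>0" "descends S (gen T) D" "simplex_of D = T" using bspec[OF gen T] by blast
      have "measure lborel T * 2 ^ gen T = \<mu> S"
        using descends_measure[OF SD(2) tag[OF SD(1)]] by (simp add: \<mu>_def SD(3))
      then show "V0 \<le> measure lborel T * 2 ^ gen T" "measure lborel T * 2 ^ gen T \<le> V1" using B[OF SD(1)] by simp_all
      obtain c where c: "T \<subseteq> cball c (\<phi> S * 2 powr (- real (gen T) / real CARD('n)))"
        using \<phi>[OF SD(1,2)] by (auto simp: SD(3))
      have "\<phi> S * 2 powr (- real (gen T) / real CARD('n)) \<le> \<Phi> * 2 powr (- real (gen T) / real CARD('n))"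
        using B(3)[OF SD(1)] by (intro mult_right_mono) auto
      then show "\<exists>c. T \<subseteq> cball c (\<Phi> * 2 powr (- real (gen T) / real CARD('n)))"
        using order_trans[OF c subset_cball] by blast
    next
      fix T T' f assume T: "T \<in> simplex_of ` \<P>" "T' \<in> simplex_of ` \<P>" and f: "f facet_of T \<and> f facet_of T'"
      obtain S D where SD: "S \<in> \<T>\<^sub>0" "descends S (gen T) D" "simplex_of D = T" using bspec[OF gen T(1)] by blast
      obtain S' D' where SD': "S' \<in> \<T>\<^sub>0" "descends S' (gen T') D'" "simplex_of D' = T'" using bspec[OF gen T(2)] by blast
      show "gen T \<le> gen T' + 1"
      proof (cases "T = T'")
        case False
        show ?thesis
          by (rule generation_difference[OF d M SD'(1) SD(1) SD'(2) SD(2) conjunct1[OF md]])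
            (use T f False SD(3) SD'(3) in auto)
      qed simp
    qed
    then show ?thesis by blast
  qed
  moreover have "0 < V0 \<and> V0 \<le> V1 \<and> 0 < \<Phi>" using V by linarith
  ultimately show ?thesis using meshes_descend[OF M] by blast
qed

section \<open>Volume of the simplices reached by chains of neighbours\<close>

context CR_mesh
begin

context
  fixes gen :: "(real^'n) set \<Rightarrow> nat" and V0 V1 \<Phi> :: real
  assumes gen: "generations V0 V1 \<Phi> \<T> gen" and V: "0 < V0" "0 < \<Phi>"
begin

lemma gen_step:
  assumes "T \<in> \<T>" "T' \<in> \<T>" "f \<in> facets_of T" "f \<in> facets_of T'"
  shows "gen T \<le> gen T' + 1"
  by (rule gen[unfolded generations_def, THEN conjunct2, rule_format, of T T' f])
    (use assms in \<open>simp_all add: facets_of_def\<close>)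

text \<open>Covers every simplex that is at most \<open>u\<close> generations coarser than
  T.\<close>

definition radius :: "(real^'n) set \<Rightarrow> nat \<Rightarrow> real" where
  "radius T u = \<Phi> * 2 powr ((real u - real (gen T)) / real CARD('n))"

lemma radius_nonneg: "0 \<le> radius T u" using V(2) by (simp add: radius_def)

lemma radius_mono: "u \<le> u' \<Longrightarrow> radius T u \<le> radius T u'"
  unfolding radius_def using V(2) by (intro mult_left_mono powr_mono) (auto intro!: divide_right_mono)

lemma small_simplex:
  assumes T': "T' \<in> \<T>" "gen T \<le> gen T' + u" and zw: "z \<in> T'" "w \<in> T'"
  shows "dist z w \<le> 2 * radius T u"
proof -
  obtain b where b: "T' \<subseteq> cball b (\<Phi> * 2 powr (- real (gen T') / real CARD('n)))" using gen T'(1) by (auto simp: generations_def)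
  have "- real (gen T') \<le> real u - real (gen T)" using T'(2) by linarith
  then have "- real (gen T') / real CARD('n) \<le> (real u - real (gen T)) / real CARD('n)" by (intro divide_right_mono) auto
  then have "\<Phi> * 2 powr (- real (gen T') / real CARD('n)) \<le> radius T u"
    unfolding radius_def using V(2) by (intro mult_left_mono powr_mono) auto
  moreover have "dist b z \<le> \<Phi> * 2 powr (- real (gen T') / real CARD('n))" "dist b w \<le> \<Phi> * 2 powr (- real (gen T') / real CARD('n))"
    using subsetD[OF b zw(1)] subsetD[OF b zw(2)] by (simp_all only: mem_cball)
  moreover have "dist z w \<le> dist b z + dist b w" using dist_triangle[of z w b] by (simp add: dist_commute)
  ultimately show ?thesis by linarith
qed

text \<open>Only an \<open>up\<close> step lowers the generation, because generations of neighbours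
  differ by at most one. So all simplices of the chain are at most u generations coarser than T, and
  each step moves at most by the diameter of such a simplex.\<close>

lemma reach_ball:
  assumes "reach \<T> facets_of gen u v T T'"
  shows "gen T \<le> gen T' + u \<and> T' \<subseteq> cball (SOME c. c \<in> T) (2 * (real u + real v + 1) * radius T u)"
  using assms
proof (induction rule: reach.induct)
  case (start S)
  have "S \<noteq> {}" using interior_ne[OF start] interior_subset[of S] by blast
  then have c: "(SOME c. c \<in> S) \<in> S" by (rule some_in_eq[THEN iffD2])
  have "dist (SOME c. c \<in> S) w \<le> 2 * radius S 0" if "w \<in> S" for w
    by (rule small_simplex[OF start _ c that]) simp
  then show ?case by (simp add: subset_iff)
next
  case (up u v T T' T'' f)
  have f: "f \<noteq> {}" "f \<subseteq> T'" "f \<subseteq> T''"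
    using up(4,5) by (auto simp: facets_of_def facet_of_def facet_of_imp_subset face_of_imp_subset)
  then obtain z where z: "z \<in> T'" "z \<in> T''" by blast
  have g: "gen T \<le> gen T'' + Suc u" using up by linarith
  have "dist (SOME c. c \<in> T) w \<le> 2 * (real (Suc u) + real v + 1) * radius T (Suc u)" if w: "w \<in> T''" for w
  proof -
    have "dist (SOME c. c \<in> T) z \<le> 2 * (real u + real v + 1) * radius T u" using up.IH z(1) by auto
    also have "\<dots> \<le> 2 * (real u + real v + 1) * radius T (Suc u)" by (intro mult_left_mono radius_mono) auto
    finally have "dist (SOME c. c \<in> T) z \<le> 2 * (real u + real v + 1) * radius T (Suc u)" .
    moreover have "dist z w \<le> 2 * radius T (Suc u)" by (rule small_simplex[OF up(2) g z(2) w])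
    moreover have "2 * (real (Suc u) + real v + 1) * radius T (Suc u)
        = 2 * (real u + real v + 1) * radius T (Suc u) + 2 * radius T (Suc u)" by (simp add: algebra_simps)
    ultimately show ?thesis using dist_triangle[of "SOME c. c \<in> T" w z] by linarith
  qed
  then show ?case using g by (simp add: subset_iff)
next
  case (level u v T T' T'' f)
  have f: "f \<noteq> {}" "f \<subseteq> T'" "f \<subseteq> T''"
    using level(4,5) by (auto simp: facets_of_def facet_of_def facet_of_imp_subset face_of_imp_subset)
  then obtain z where z: "z \<in> T'" "z \<in> T''" by blast
  have "T' \<in> \<T>" using reach_in[OF level(1)] by simp
  then have "gen T' \<le> gen T'' + 1" using gen_step level(2,4,5) by blast
  then have g: "gen T \<le> gen T'' + u" using level by linarith
  have "dist (SOME c. c \<in> T) w \<le> 2 * (real u + real (Suc v) + 1) * radius T u" if w: "w \<in> T''" for w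
  proof -
    have "dist (SOME c. c \<in> T) z \<le> 2 * (real u + real v + 1) * radius T u" using level.IH z(1) by auto
    moreover have "dist z w \<le> 2 * radius T u" by (rule small_simplex[OF level(2) g z(2) w])
    moreover have "2 * (real u + real (Suc v) + 1) * radius T u
        = 2 * (real u + real v + 1) * radius T u + 2 * radius T u" by (simp add: algebra_simps)
    ultimately show ?thesis using dist_triangle[of "SOME c. c \<in> T" w z] by linarith
  qed
  then show ?case using g by (simp add: subset_iff)
qed

text \<open>Distinct simplices may touch; passing to their cells, which are disjoint and have the
  same volume, makes volumes additive.\<close>

lemma sum_vol_in_ball:
  assumes X: "X \<subseteq> \<T>" "\<And>T. T \<in> X \<Longrightarrow> T \<subseteq> cball c r" and r: "0 \<le> r"
  shows "(\<Sum>T\<in>X. vol T) \<le> unit_ball_vol (real CARD('n)) * r ^ CARD('n)"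
proof -
  have fX: "finite X" using X(1) fin finite_subset by blast
  have vp: "0 \<le> vol T" for T by (simp add: vol_def)
  have "(\<Sum>T\<in>X. emeasure (lebesgue_on \<Omega>) (cell T)) = (\<Sum>T\<in>X. ennreal (vol T))"
    using measure_cell X(1) by (intro sum.cong) auto
  also have "\<dots> = ennreal (\<Sum>T\<in>X. vol T)" using vp by (intro sum_ennreal) auto
  finally have "ennreal (\<Sum>T\<in>X. vol T) = (\<Sum>T\<in>X. emeasure (lebesgue_on \<Omega>) (cell T))" ..
  also have "\<dots> = emeasure (lebesgue_on \<Omega>) (\<Union>T\<in>X. cell T)"
  proof (rule sum_emeasure)
    show "cell ` X \<subseteq> sets (lebesgue_on \<Omega>)" by auto
    show "disjoint_family_on cell X"
      unfolding disjoint_family_on_def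
    proof (intro ballI impI)
      fix T T' assume "T \<in> X" "T' \<in> X" "T \<noteq> T'"
      then show "cell T \<inter> cell T' = {}" using cell_disjoint[of T T'] X(1) cell_sub(2)[of T'] by blast
    qed
  qed (rule fX)
  also have "\<dots> = emeasure lebesgue (\<Union>T\<in>X. cell T)" using cell_sub(1) by (intro emeasure_restrict_space) auto
  also have "\<dots> \<le> emeasure lebesgue (cball c r)"
  proof (rule emeasure_mono)
    show "(\<Union>T\<in>X. cell T) \<subseteq> cball c r" using X(2) cell_sub(2) by blast
  qed simp
  also have "\<dots> = ennreal (unit_ball_vol (real CARD('n)) * r ^ CARD('n))" using emeasure_cball[OF r, of c] by simp
  finally show ?thesis
    using r by (subst (asm) ennreal_le_iff) (auto intro!: mult_nonneg_nonneg)
qed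

text \<open>The d-th power of the radius is a multiple of 2^u/2^gen, and 2^(-gen) is at most the
  volume of T divided by \<open>V0\<close>. This turns the bound by a ball into
  \<open>growth\<close>.\<close>

lemma mesh_discrete:
  assumes V1: "V0 \<le> V1"
  shows "discrete_mesh \<T> facets_of CARD('n) vol gen V0 V1 (unit_ball_vol (real CARD('n)) * (2 * \<Phi>) ^ CARD('n) / V0)"
proof
  show "finite \<T>" by (rule fin)
  show "2 \<le> CARD('n)" by (rule dim2)
  show "finite (facets_of T)" if "T \<in> \<T>" for T using facets_finite[OF that] .
  show "card (facets_of T) = CARD('n) + 1" if "T \<in> \<T>" for T using card_facets[OF that] by simp
  show "T = T' \<or> T = T'' \<or> T' = T''"
    if "T \<in> \<T>" "T' \<in> \<T>" "T'' \<in> \<T>" "f \<in> facets_of T" "f \<in> facets_of T'" "f \<in> facets_of T''" for T T' T'' f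
    using two_simplices[OF that(1-3)] that(4-6) by (simp add: facets_of_def)
  show "gen T \<le> gen T' + 1" if "T \<in> \<T>" "T' \<in> \<T>" "f \<in> facets_of T" "f \<in> facets_of T'" for T T' f
    by (rule gen_step[OF that])
  show "0 < V0" "V0 \<le> V1" by (rule V V1)+
  show "0 \<le> unit_ball_vol (real CARD('n)) * (2 * \<Phi>) ^ CARD('n) / V0" using V by simp
  show "V0 \<le> vol T * 2 ^ gen T" "vol T * 2 ^ gen T \<le> V1" if "T \<in> \<T>" for T
    using gen that by (simp_all add: generations_def vol_def)
  fix T u v assume T: "T \<in> \<T>"
  define r where "r = 2 * (real u + real v + 1) * radius T u"
  have r: "0 \<le> r" unfolding r_def using radius_nonneg by (intro mult_nonneg_nonneg) auto
  have "(\<Sum>T'\<in>{T'. reach \<T> facets_of gen u v T T'}. vol T') \<le> unit_ball_vol (real CARD('n)) * r ^ CARD('n)"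
    by (rule sum_vol_in_ball[OF _ _ r, of _ "SOME c. c \<in> T"]) (use reach_in[of \<T> facets_of gen u v T] reach_ball[of u v T] in \<open>unfold r_def, blast+\<close>)
  also have "r ^ CARD('n) = (2 * \<Phi>) ^ CARD('n) * (real u + real v + 1) ^ CARD('n) * (2 ^ u / 2 ^ gen T)"
  proof -
    have "(2 powr ((real u - real (gen T)) / real CARD('n))) ^ CARD('n) = (2::real) powr (real u - real (gen T))"
      by (simp add: powr_powr flip: powr_realpow)
    also have "\<dots> = 2 ^ u / 2 ^ gen T" by (simp add: powr_diff powr_realpow)
    finally have p: "(2 powr ((real u - real (gen T)) / real CARD('n))) ^ CARD('n) = (2::real) ^ u / 2 ^ gen T" .
    show ?thesis unfolding r_def radius_def power_mult_distrib p by (simp only: mult_ac)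
  qed
  also have "unit_ball_vol (real CARD('n)) * \<dots> \<le> unit_ball_vol (real CARD('n)) * ((2 * \<Phi>) ^ CARD('n) * (real u + real v + 1) ^ CARD('n) * (2 ^ u * (vol T / V0)))"
  proof -
    have "V0 \<le> vol T * 2 ^ gen T" using gen T by (simp add: generations_def vol_def)
    then have "1 / 2 ^ gen T \<le> vol T / V0" using V(1) by (simp add: field_simps)
    then have "2 ^ u * (1 / 2 ^ gen T) \<le> 2 ^ u * (vol T / V0)" by (rule mult_left_mono) simp
    then show ?thesis using V by (intro mult_left_mono) auto
  qed
  finally show "(\<Sum>T'\<in>{T'. reach \<T> facets_of gen u v T T'}. vol T')
      \<le> unit_ball_vol (real CARD('n)) * (2 * \<Phi>) ^ CARD('n) / V0 * (real u + real v + 1) ^ CARD('n) * 2 ^ u * vol T"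
    by (simp add: mult_ac)
qed

end

end

section \<open>Passage to Lebesgue norms\<close>

text \<open>Convexity: the graph of t^p lies above its tangent at a. For t > 0 this is Young's
  inequality applied to t^p and a^p.\<close>

lemma powr_tangent:
  fixes p a t :: real
  assumes p: "1 \<le> p" and a: "0 < a" and t: "0 \<le> t"
  shows "a powr p + p * a powr (p - 1) * (t - a) \<le> t powr p"
proof (cases "t = 0")
  case True
  have "a powr (p - 1) * a = a powr p" using powr_add[of a "p - 1" 1] a by simp
  then have "a powr p + p * a powr (p - 1) * (t - a) = (1 - p) * a powr p" using True by (simp add: algebra_simps)
  also have "\<dots> \<le> 0" using p by (simp add: mult_nonpos_nonneg)
  finally show ?thesis using True by simp
next
  case False
  then have t: "0 < t" using t by simp
  have eq: "1/p + (1 - 1/p) = 1" by simp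
  have "(t powr p) powr (1/p) * (a powr p) powr (1 - 1/p) \<le> 1/p * t powr p + (1 - 1/p) * a powr p"
    using p t a by (intro Youngs_inequality_0 eq) auto
  moreover have "(t powr p) powr (1/p) = t" using p t by (simp add: powr_powr)
  moreover have "(a powr p) powr (1 - 1/p) = a powr (p - 1)" proof -
    have "p * (1 - 1/p) = p - 1" using p by (simp add: right_diff_distrib)
    then show ?thesis by (simp only: powr_powr)
  qed
  ultimately have "t * a powr (p - 1) \<le> 1/p * t powr p + (1 - 1/p) * a powr p" by simp
  then have "p * (t * a powr (p - 1)) \<le> p * (1/p * t powr p + (1 - 1/p) * a powr p)" using p by (intro mult_left_mono) auto
  also have "\<dots> = t powr p + (p - 1) * a powr p" using p by (simp add: field_simps)
  finally have "p * (t * a powr (p - 1)) \<le> t powr p + (p - 1) * a powr p" .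
  moreover have "a powr (p - 1) * a = a powr p" using powr_add[of a "p - 1" 1] a by simp
  ultimately show ?thesis by (simp add: algebra_simps)
qed

lemma Lp_norm_mono:
  fixes p :: real
  assumes p: "1 \<le> p" and c: "0 < c"
    and le: "(\<integral>\<^sup>+ x. ennreal (\<bar>f x\<bar> powr p) \<partial>lebesgue_on \<Omega>) \<le> ennreal (c powr p) * (\<integral>\<^sup>+ x. ennreal (\<bar>g x\<bar> powr p) \<partial>lebesgue_on \<Omega>)"
  shows "Lp_norm (ennreal p) \<Omega> f \<le> ennreal c * Lp_norm (ennreal p) \<Omega> g"
proof -
  define I J where "I = (\<integral>\<^sup>+ x. ennreal (\<bar>f x\<bar> powr p) \<partial>lebesgue_on \<Omega>)"
    and "J = (\<integral>\<^sup>+ x. ennreal (\<bar>g x\<bar> powr p) \<partial>lebesgue_on \<Omega>)"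
  have e: "enn2real (ennreal p) = p" using p by simp
  have N: "Lp_norm (ennreal p) \<Omega> f = (if I = \<infinity> then \<infinity> else ennreal (enn2real I powr (1 / p)))"
    "Lp_norm (ennreal p) \<Omega> g = (if J = \<infinity> then \<infinity> else ennreal (enn2real J powr (1 / p)))"
    unfolding Lp_norm_def I_def J_def e by (simp_all add: Let_def)
  show ?thesis
  proof (cases "J = \<infinity>")
    case True
    then show ?thesis unfolding N using c by (simp add: ennreal_mult_top)
  next
    case False
    then obtain j where j: "0 \<le> j" "J = ennreal j" by (cases J) auto
    have "I \<le> ennreal (c powr p * j)" using le j c by (simp add: I_def[symmetric] J_def[symmetric] ennreal_mult)
    then obtain i where i: "0 \<le> i" "I = ennreal i" "i \<le> c powr p * j"
      using c j by (cases I) (auto simp: top_unique)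
    have "i powr (1/p) \<le> (c powr p * j) powr (1/p)" using i p by (intro powr_mono2) auto
    also have "\<dots> = c * j powr (1/p)" using c p j by (simp add: powr_mult powr_powr)
    finally show ?thesis unfolding N using i j c by (simp add: ennreal_mult[symmetric])
  qed
qed

context CR_mesh
begin

lemma crf_root_bound:
  assumes "T \<in> \<T>" "p \<in> cell T"
  shows "\<bar>crf x p\<bar> \<le> real CARD('n) * sqrt (real CARD('n) + 1) * sqrt (\<Sum>f\<in>facets_of T. (x f)\<^sup>2)"
proof -
  have "(\<Sum>f\<in>facets_of T. \<bar>x f\<bar>)\<^sup>2 \<le> (\<Sum>f\<in>facets_of T. \<bar>x f\<bar>\<^sup>2) * (\<Sum>f\<in>facets_of T. 1\<^sup>2)"
    using Cauchy_Schwarz_ineq_sum[of "\<lambda>f. \<bar>x f\<bar>" "\<lambda>_. 1" "facets_of T"] by simp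
  also have "\<dots> = (real CARD('n) + 1) * (\<Sum>f\<in>facets_of T. (x f)\<^sup>2)" using card_facets[OF assms(1)] by simp
  finally have "\<bar>\<Sum>f\<in>facets_of T. \<bar>x f\<bar>\<bar> \<le> sqrt ((real CARD('n) + 1) * (\<Sum>f\<in>facets_of T. (x f)\<^sup>2))"
    by (rule real_le_rsqrt[OF order_trans[OF eq_refl[OF power2_abs]]])
  then have "(\<Sum>f\<in>facets_of T. \<bar>x f\<bar>) \<le> sqrt (real CARD('n) + 1) * sqrt (\<Sum>f\<in>facets_of T. (x f)\<^sup>2)"
    unfolding real_sqrt_mult by linarith
  then have "real CARD('n) * (\<Sum>f\<in>facets_of T. \<bar>x f\<bar>) \<le> real CARD('n) * (sqrt (real CARD('n) + 1) * sqrt (\<Sum>f\<in>facets_of T. (x f)\<^sup>2))"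
    by (rule mult_left_mono) simp
  moreover have "\<bar>crf x p\<bar> \<le> real CARD('n) * (\<Sum>f\<in>facets_of T. \<bar>x f\<bar>)"
    unfolding crf_cell[OF assms] using loc_bound[OF assms(1)] cell_sub(2) assms(2) by blast
  ultimately show ?thesis unfolding mult.assoc by linarith
qed

text \<open>Jensen's inequality, obtained by integrating the tangent at the mean value over the
  cell.\<close>

lemma avg_powr:
  assumes T: "T \<in> \<T>" and p: "1 \<le> p" and u: "integrable (lebesgue_on \<Omega>) u" "integrable (lebesgue_on \<Omega>) (\<lambda>x. \<bar>u x\<bar> powr p)"
  shows "vol T * avg u T powr p \<le> (\<integral>x. indicator (cell T) x * \<bar>u x\<bar> powr p \<partial>lebesgue_on \<Omega>)"
proof (cases "avg u T = 0")
  case True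
  then show ?thesis by (auto intro!: integral_nonneg_AE)
next
  case False
  define a where "a = avg u T"
  have a: "0 < a" using False avg_nonneg[OF T, of u] by (simp add: a_def)
  note V = vol_pos[OF T]
  have iu: "integrable (lebesgue_on \<Omega>) (\<lambda>x. indicator (cell T) x * \<bar>u x\<bar>)" using u(1) by (intro integrable_cell) auto
  have i1: "integrable (lebesgue_on \<Omega>) (\<lambda>x. indicator (cell T) x * (1::real))"
    using finite_measure.integrable_const[OF finite_measure_Omega] by (intro integrable_cell)
  have "vol T = (\<integral>x. indicator (cell T) x * (1::real) \<partial>lebesgue_on \<Omega>)"
    using measure_cell[OF T] V cell_sub(1)[of T] by (simp add: measure_def Int_absorb2)
  note m1 = this[symmetric]
  have mu: "(\<integral>x. indicator (cell T) x * \<bar>u x\<bar> \<partial>lebesgue_on \<Omega>) = a * vol T" using V by (simp add: a_def avg_def)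
  have "vol T * a powr p = (a powr p - p * a powr (p - 1) * a) * vol T + p * a powr (p - 1) * (a * vol T)"
    by (simp add: algebra_simps)
  also have "\<dots> = (\<integral>x. (a powr p - p * a powr (p - 1) * a) * (indicator (cell T) x * 1)
      + p * a powr (p - 1) * (indicator (cell T) x * \<bar>u x\<bar>) \<partial>lebesgue_on \<Omega>)"
  proof -
    have "(\<integral>x. (a powr p - p * a powr (p - 1) * a) * (indicator (cell T) x * 1)
      + p * a powr (p - 1) * (indicator (cell T) x * \<bar>u x\<bar>) \<partial>lebesgue_on \<Omega>)
      = (\<integral>x. (a powr p - p * a powr (p - 1) * a) * (indicator (cell T) x * 1) \<partial>lebesgue_on \<Omega>)
      + (\<integral>x. p * a powr (p - 1) * (indicator (cell T) x * \<bar>u x\<bar>) \<partial>lebesgue_on \<Omega>)"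
      using iu i1 by (intro Bochner_Integration.integral_add integrable_mult_right)
    then show ?thesis unfolding Bochner_Integration.integral_mult_right_zero m1 mu ..
  qed
  also have "\<dots> \<le> (\<integral>x. indicator (cell T) x * \<bar>u x\<bar> powr p \<partial>lebesgue_on \<Omega>)"
  proof (rule integral_mono)
    show "integrable (lebesgue_on \<Omega>) (\<lambda>x. (a powr p - p * a powr (p - 1) * a) * (indicator (cell T) x * 1)
      + p * a powr (p - 1) * (indicator (cell T) x * \<bar>u x\<bar>))"
      using iu i1 by (intro Bochner_Integration.integrable_add integrable_mult_right) auto
    show "integrable (lebesgue_on \<Omega>) (\<lambda>x. indicator (cell T) x * \<bar>u x\<bar> powr p)" using u(2) by (rule integrable_cell)
    fix x
    have "a powr p - p * a powr (p - 1) * a + p * a powr (p - 1) * \<bar>u x\<bar> \<le> \<bar>u x\<bar> powr p"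
      using powr_tangent[OF p a abs_ge_zero[of "u x"]] by (simp add: algebra_simps)
    then show "(a powr p - p * a powr (p - 1) * a) * (indicator (cell T) x * 1)
      + p * a powr (p - 1) * (indicator (cell T) x * \<bar>u x\<bar>) \<le> indicator (cell T) x * \<bar>u x\<bar> powr p"
      by (simp add: indicator_def)
  qed
  finally show ?thesis by (simp add: a_def)
qed

text \<open>On a bounded domain |u| \<le> 1 + |u|^p makes u integrable, so its pairings with
  discrete functions are meaningful.\<close>

lemma Lp_space_integrable:
  fixes p :: real
  assumes p: "1 \<le> p" and u: "u \<in> Lp_space (ennreal p) \<Omega>"
  shows "integrable (lebesgue_on \<Omega>) u" "integrable (lebesgue_on \<Omega>) (\<lambda>x. \<bar>u x\<bar> powr p)"
proof -
  have um: "u \<in> borel_measurable (lebesgue_on \<Omega>)" and fin: "Lp_norm (ennreal p) \<Omega> u < \<infinity>"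
    using u by (auto simp: Lp_space_def)
  have e: "enn2real (ennreal p) = p" using p by simp
  have "(\<integral>\<^sup>+ x. ennreal (\<bar>u x\<bar> powr p) \<partial>lebesgue_on \<Omega>) \<noteq> \<infinity>"
    using fin unfolding Lp_norm_def e by (auto simp: Let_def split: if_splits)
  then show i: "integrable (lebesgue_on \<Omega>) (\<lambda>x. \<bar>u x\<bar> powr p)"
    using um by (intro integrableI_nonneg) (auto simp: less_top)
  show "integrable (lebesgue_on \<Omega>) u"
  proof (rule Bochner_Integration.integrable_bound[OF Bochner_Integration.integrable_add[OF finite_measure.integrable_const[OF finite_measure_Omega, of 1] i] um], rule AE_I2)
    fix x
    have "\<bar>u x\<bar> \<le> 1 + \<bar>u x\<bar> powr p"
    proof (cases "\<bar>u x\<bar> \<le> 1")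
      case False
      then have "\<bar>u x\<bar> powr 1 \<le> \<bar>u x\<bar> powr p" using p by (intro powr_mono) auto
      then show ?thesis using False by simp
    qed (use powr_ge_zero[of "\<bar>u x\<bar>" p] in linarith)
    then show "norm (u x) \<le> norm (1 + \<bar>u x\<bar> powr p)" by simp
  qed
qed

text \<open>On a cell, \<rho> \<le> \<open>R T\<close> is used on the left and \<open>R T\<close>
  \<le> \<gamma> \<rho> on the right, at the cost of \<gamma>. The factor d sqrt(d+1) bounds a
  discrete function by the root of the sum of its squared face values, and \<open>avg_powr\<close>
  treats the data.\<close>

lemma Lp_bound_finite:
  fixes p \<gamma> M :: real
  assumes p: "1 \<le> p" and \<gamma>: "1 \<le> \<gamma>" and M: "0 < M"
    and \<rho>: "\<rho> \<in> borel_measurable (lebesgue_on \<Omega>)" and u: "u \<in> Lp_space (ennreal p) \<Omega>"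
    and R: "\<And>T. T \<in> \<T> \<Longrightarrow> 0 < R T \<and> (AE q in lebesgue_on \<Omega>. q \<in> cell T \<longrightarrow> 0 < \<rho> q \<and> \<rho> q \<le> R T \<and> R T \<le> \<gamma> * \<rho> q)"
    and w: "w \<in> borel_measurable (lebesgue_on \<Omega>)" "AE q in lebesgue_on \<Omega>. w q = crf x q"
    and disc: "(\<Sum>T\<in>\<T>. vol T * (R T * sqrt (\<Sum>f\<in>facets_of T. (x f)\<^sup>2)) powr p) \<le> M powr p * (\<Sum>T\<in>\<T>. vol T * (R T * avg u T) powr p)"
  shows "Lp_norm (ennreal p) \<Omega> (\<lambda>q. \<rho> q * w q) \<le> ennreal (real CARD('n) * sqrt (real CARD('n) + 1) * M * \<gamma>) * Lp_norm (ennreal p) \<Omega> (\<lambda>q. \<rho> q * u q)"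
proof (rule Lp_norm_mono[OF p])
  define n where "n = real CARD('n) * sqrt (real CARD('n) + 1)"
  have n: "0 < n" by (simp add: n_def)
  show "0 < real CARD('n) * sqrt (real CARD('n) + 1) * M * \<gamma>" using n M \<gamma> by (simp add: n_def)
  define X where "X T = sqrt (\<Sum>f\<in>facets_of T. (x f)\<^sup>2)" for T
  have X0: "0 \<le> X T" for T unfolding X_def by (intro real_sqrt_ge_zero sum_nonneg) auto
  have um: "u \<in> borel_measurable (lebesgue_on \<Omega>)" using u by (simp add: Lp_space_def)
  note ui = Lp_space_integrable[OF p u]
  have hm: "(\<lambda>q. ennreal (\<bar>\<rho> q * u q\<bar> powr p)) \<in> borel_measurable (lebesgue_on \<Omega>)" using \<rho> um by measurable
  have V: "0 < vol T" if "T \<in> \<T>" for T by (rule vol_pos[OF that])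
  have "(\<integral>\<^sup>+ q. ennreal (\<bar>\<rho> q * w q\<bar> powr p) \<partial>lebesgue_on \<Omega>)
      = (\<Sum>T\<in>\<T>. \<integral>\<^sup>+ q. indicator (cell T) q * ennreal (\<bar>\<rho> q * w q\<bar> powr p) \<partial>lebesgue_on \<Omega>)"
    using \<rho> w(1) by (intro nn_split) measurable
  also have "\<dots> \<le> (\<Sum>T\<in>\<T>. ennreal (vol T * (n * (R T * X T)) powr p))"
  proof (rule sum_mono)
    fix T assume T: "T \<in> \<T>"
    have "(\<integral>\<^sup>+ q. indicator (cell T) q * ennreal (\<bar>\<rho> q * w q\<bar> powr p) \<partial>lebesgue_on \<Omega>)
      \<le> (\<integral>\<^sup>+ q. ennreal ((n * (R T * X T)) powr p) * indicator (cell T) q \<partial>lebesgue_on \<Omega>)"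
    proof (rule nn_integral_mono_AE)
      show "AE q in lebesgue_on \<Omega>. indicator (cell T) q * ennreal (\<bar>\<rho> q * w q\<bar> powr p)
          \<le> ennreal ((n * (R T * X T)) powr p) * indicator (cell T) q"
        using conjunct2[OF R[OF T]] w(2)
      proof eventually_elim
        case (elim q)
        show ?case
        proof (cases "q \<in> cell T")
          case True
          then have r: "0 < \<rho> q" "\<rho> q \<le> R T" using elim by auto
          have "\<bar>w q\<bar> \<le> n * X T" unfolding n_def X_def elim(2) by (rule crf_root_bound[OF T True])
          then have "\<rho> q * \<bar>w q\<bar> \<le> R T * (n * X T)" using r by (intro mult_mono) auto
          then have "\<bar>\<rho> q * w q\<bar> \<le> n * (R T * X T)" using r by (simp add: abs_mult mult_ac)
          then have "\<bar>\<rho> q * w q\<bar> powr p \<le> (n * (R T * X T)) powr p" using p by (intro powr_mono2) auto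
          then show ?thesis using True by (simp add: ennreal_leI)
        qed simp
      qed
    qed
    also have "\<dots> = ennreal ((n * (R T * X T)) powr p) * ennreal (vol T)"
      by (subst nn_integral_cmult_indicator) (auto simp: measure_cell[OF T])
    also have "\<dots> = ennreal (vol T * (n * (R T * X T)) powr p)"
      using V[OF T] by (simp add: ennreal_mult[symmetric] mult.commute)
    finally show "(\<integral>\<^sup>+ q. indicator (cell T) q * ennreal (\<bar>\<rho> q * w q\<bar> powr p) \<partial>lebesgue_on \<Omega>)
      \<le> ennreal (vol T * (n * (R T * X T)) powr p)" .
  qed
  also have "\<dots> = ennreal (\<Sum>T\<in>\<T>. vol T * (n * (R T * X T)) powr p)"
    by (intro sum_ennreal mult_nonneg_nonneg less_imp_le[OF V] powr_ge_zero)
  also have "(\<Sum>T\<in>\<T>. vol T * (n * (R T * X T)) powr p) = n powr p * (\<Sum>T\<in>\<T>. vol T * (R T * X T) powr p)"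
    unfolding sum_distrib_left
  proof (intro sum.cong refl)
    fix T assume T: "T \<in> \<T>"
    have "0 \<le> R T * X T" using R[OF T] X0[of T] by (intro mult_nonneg_nonneg) auto
    then show "vol T * (n * (R T * X T)) powr p = n powr p * (vol T * (R T * X T) powr p)"
      using n powr_mult[of n "R T * X T" p] by simp
  qed
  also have "ennreal (n powr p * (\<Sum>T\<in>\<T>. vol T * (R T * X T) powr p)) \<le> ennreal (n powr p * (M powr p * (\<Sum>T\<in>\<T>. vol T * (R T * avg u T) powr p)))"
    using disc unfolding X_def[symmetric] by (intro ennreal_leI mult_left_mono) auto
  also have "\<dots> = ennreal ((n * M) powr p) * ennreal (\<Sum>T\<in>\<T>. vol T * (R T * avg u T) powr p)"
    using n M by (simp add: powr_mult mult.assoc[symmetric] ennreal_mult'[symmetric])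
  also have "ennreal (\<Sum>T\<in>\<T>. vol T * (R T * avg u T) powr p) = (\<Sum>T\<in>\<T>. ennreal (vol T * (R T * avg u T) powr p))"
    by (intro sum_ennreal[symmetric] mult_nonneg_nonneg less_imp_le[OF V] powr_ge_zero)
  also have "\<dots> \<le> (\<Sum>T\<in>\<T>. ennreal (\<gamma> powr p) * (\<integral>\<^sup>+ q. indicator (cell T) q * ennreal (\<bar>\<rho> q * u q\<bar> powr p) \<partial>lebesgue_on \<Omega>))"
  proof (rule sum_mono)
    fix T assume T: "T \<in> \<T>"
    have r: "0 < R T" using R[OF T] by blast
    have ic: "integrable (lebesgue_on \<Omega>) (\<lambda>q. indicator (cell T) q * \<bar>u q\<bar> powr p)" using ui(2) by (rule integrable_cell)
    have "vol T * (R T * avg u T) powr p = R T powr p * (vol T * avg u T powr p)"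
      using r avg_nonneg[OF T, of u] by (simp add: powr_mult)
    also have "\<dots> \<le> R T powr p * (\<integral>q. indicator (cell T) q * \<bar>u q\<bar> powr p \<partial>lebesgue_on \<Omega>)"
      by (intro mult_left_mono avg_powr[OF T p ui]) simp
    finally have "ennreal (vol T * (R T * avg u T) powr p) \<le> ennreal (R T powr p * (\<integral>q. indicator (cell T) q * \<bar>u q\<bar> powr p \<partial>lebesgue_on \<Omega>))"
      by (rule ennreal_leI)
    also have "\<dots> = ennreal (\<integral>q. R T powr p * (indicator (cell T) q * \<bar>u q\<bar> powr p) \<partial>lebesgue_on \<Omega>)" by simp
    also have "\<dots> = (\<integral>\<^sup>+ q. ennreal (R T powr p * (indicator (cell T) q * \<bar>u q\<bar> powr p)) \<partial>lebesgue_on \<Omega>)"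
      by (rule nn_integral_eq_integral[symmetric]) (use ic in auto)
    also have "\<dots> \<le> (\<integral>\<^sup>+ q. ennreal (\<gamma> powr p) * (indicator (cell T) q * ennreal (\<bar>\<rho> q * u q\<bar> powr p)) \<partial>lebesgue_on \<Omega>)"
    proof (rule nn_integral_mono_AE)
      show "AE q in lebesgue_on \<Omega>. ennreal (R T powr p * (indicator (cell T) q * \<bar>u q\<bar> powr p))
        \<le> ennreal (\<gamma> powr p) * (indicator (cell T) q * ennreal (\<bar>\<rho> q * u q\<bar> powr p))"
        using conjunct2[OF R[OF T]]
      proof eventually_elim
        case (elim q)
        show ?case
        proof (cases "q \<in> cell T")
          case True
          then have le: "0 < \<rho> q" "R T \<le> \<gamma> * \<rho> q" using elim by auto
          have "R T powr p * \<bar>u q\<bar> powr p \<le> (\<gamma> * \<rho> q) powr p * \<bar>u q\<bar> powr p"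
            using le r p by (intro mult_right_mono powr_mono2) auto
          also have "\<dots> = \<gamma> powr p * \<bar>\<rho> q * u q\<bar> powr p" using le \<gamma> by (simp add: powr_mult abs_mult)
          finally show ?thesis using True by (simp add: ennreal_mult[symmetric] ennreal_leI)
        qed simp
      qed
    qed
    also have "\<dots> = ennreal (\<gamma> powr p) * (\<integral>\<^sup>+ q. indicator (cell T) q * ennreal (\<bar>\<rho> q * u q\<bar> powr p) \<partial>lebesgue_on \<Omega>)"
      by (intro nn_integral_cmult borel_measurable_times_ennreal borel_measurable_indicator cell_sets(3) hm)
    finally show "ennreal (vol T * (R T * avg u T) powr p)
      \<le> ennreal (\<gamma> powr p) * (\<integral>\<^sup>+ q. indicator (cell T) q * ennreal (\<bar>\<rho> q * u q\<bar> powr p) \<partial>lebesgue_on \<Omega>)" .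
  qed
  also have "\<dots> = ennreal (\<gamma> powr p) * (\<integral>\<^sup>+ q. ennreal (\<bar>\<rho> q * u q\<bar> powr p) \<partial>lebesgue_on \<Omega>)"
    unfolding sum_distrib_left[symmetric] nn_split[OF hm] ..
  finally have "(\<integral>\<^sup>+ q. ennreal (\<bar>\<rho> q * w q\<bar> powr p) \<partial>lebesgue_on \<Omega>)
      \<le> ennreal ((n * M) powr p) * (ennreal (\<gamma> powr p) * (\<integral>\<^sup>+ q. ennreal (\<bar>\<rho> q * u q\<bar> powr p) \<partial>lebesgue_on \<Omega>))"
    by (simp add: mult_left_mono)
  also have "\<dots> = ennreal ((n * M * \<gamma>) powr p) * (\<integral>\<^sup>+ q. ennreal (\<bar>\<rho> q * u q\<bar> powr p) \<partial>lebesgue_on \<Omega>)"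
    using n M \<gamma> by (simp add: powr_mult mult.assoc[symmetric] ennreal_mult'[symmetric])
  finally show "(\<integral>\<^sup>+ q. ennreal (\<bar>\<rho> q * w q\<bar> powr p) \<partial>lebesgue_on \<Omega>)
      \<le> ennreal ((real CARD('n) * sqrt (real CARD('n) + 1) * M * \<gamma>) powr p) * (\<integral>\<^sup>+ q. ennreal (\<bar>\<rho> q * u q\<bar> powr p) \<partial>lebesgue_on \<Omega>)"
    by (simp only: n_def)
qed

text \<open>For a fixed simplex the estimate with finite p gives the bound \<open>b\<close> times
  W^(1/p), where W is the total volume divided by that of the simplex. Since \<open>M\<close> is the
  same for all p, letting p grow removes the extra factor.\<close>

lemma Lp_bound_infinite:
  fixes \<gamma> M :: real
  assumes \<gamma>: "1 \<le> \<gamma>" and M: "0 < M" and \<rho>: "\<rho> \<in> borel_measurable (lebesgue_on \<Omega>)" and u: "integrable (lebesgue_on \<Omega>) u"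
    and R: "\<And>T. T \<in> \<T> \<Longrightarrow> 0 < R T \<and> (AE q in lebesgue_on \<Omega>. q \<in> cell T \<longrightarrow> 0 < \<rho> q \<and> \<rho> q \<le> R T \<and> R T \<le> \<gamma> * \<rho> q)"
    and w: "w \<in> borel_measurable (lebesgue_on \<Omega>)" "AE q in lebesgue_on \<Omega>. w q = crf x q"
    and disc: "\<And>p. 1 \<le> p \<Longrightarrow> (\<Sum>T\<in>\<T>. vol T * (R T * sqrt (\<Sum>f\<in>facets_of T. (x f)\<^sup>2)) powr p) \<le> M powr p * (\<Sum>T\<in>\<T>. vol T * (R T * avg u T) powr p)"
  shows "Lp_norm \<infinity> \<Omega> (\<lambda>q. \<rho> q * w q) \<le> ennreal (real CARD('n) * sqrt (real CARD('n) + 1) * M * \<gamma>) * Lp_norm \<infinity> \<Omega> (\<lambda>q. \<rho> q * u q)"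
proof -
  define n where "n = real CARD('n) * sqrt (real CARD('n) + 1)"
  have n: "0 < n" by (simp add: n_def)
  define X where "X T = sqrt (\<Sum>f\<in>facets_of T. (x f)\<^sup>2)" for T
  have X0: "0 \<le> X T" for T unfolding X_def by (intro real_sqrt_ge_zero sum_nonneg) auto
  have V: "0 < vol T" if "T \<in> \<T>" for T by (rule vol_pos[OF that])
  define N where "N = esssup (lebesgue_on \<Omega>) (\<lambda>q. ennreal \<bar>\<rho> q * u q\<bar>)"
  have norms: "Lp_norm \<infinity> \<Omega> (\<lambda>q. \<rho> q * u q) = N" "Lp_norm \<infinity> \<Omega> (\<lambda>q. \<rho> q * w q) = esssup (lebesgue_on \<Omega>) (\<lambda>q. ennreal \<bar>\<rho> q * w q\<bar>)"
    by (simp_all add: Lp_norm_def N_def)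
  show ?thesis
  proof (cases "N = \<infinity>")
    case True
    define c where "c = real CARD('n) * sqrt (real CARD('n) + 1) * M * \<gamma>"
    have "0 < c" using n M \<gamma> by (simp add: n_def c_def)
    then show ?thesis unfolding norms True c_def[symmetric] by (simp add: ennreal_mult_top)
  next
    case False
    then obtain \<nu> where \<nu>: "0 \<le> \<nu>" "N = ennreal \<nu>" by (cases N) auto
    have AEN: "AE q in lebesgue_on \<Omega>. \<bar>\<rho> q * u q\<bar> \<le> \<nu>"
      using esssup_AE[where M = "lebesgue_on \<Omega>" and f = "\<lambda>q. ennreal \<bar>\<rho> q * u q\<bar>"] unfolding N_def[symmetric] \<nu>(2)
      by eventually_elim (use \<nu>(1) in simp)
    have ga: "R T * avg u T \<le> \<gamma> * \<nu>" if T: "T \<in> \<T>" for T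
    proof -
      have r: "0 < R T" using R[OF T] by blast
      have "(\<integral>q. indicator (cell T) q * \<bar>u q\<bar> \<partial>lebesgue_on \<Omega>) \<le> (\<integral>q. indicator (cell T) q * (\<gamma> * \<nu> / R T) \<partial>lebesgue_on \<Omega>)"
      proof (rule integral_mono_AE)
        show "integrable (lebesgue_on \<Omega>) (\<lambda>q. indicator (cell T) q * \<bar>u q\<bar>)" using u by (intro integrable_cell) auto
        show "integrable (lebesgue_on \<Omega>) (\<lambda>q. indicator (cell T) q * (\<gamma> * \<nu> / R T))"
          using finite_measure.integrable_const[OF finite_measure_Omega] by (intro integrable_cell)
        show "AE q in lebesgue_on \<Omega>. indicator (cell T) q * \<bar>u q\<bar> \<le> indicator (cell T) q * (\<gamma> * \<nu> / R T)"
          using conjunct2[OF R[OF T]] AEN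
        proof eventually_elim
          case (elim q)
          show ?case
          proof (cases "q \<in> cell T")
            case True
            then have le: "0 < \<rho> q" "R T \<le> \<gamma> * \<rho> q" using elim by auto
            have "R T * \<bar>u q\<bar> \<le> \<gamma> * \<rho> q * \<bar>u q\<bar>" using le(2) by (intro mult_right_mono) auto
            also have "\<dots> = \<gamma> * \<bar>\<rho> q * u q\<bar>" using le(1) by (simp add: abs_mult)
            also have "\<dots> \<le> \<gamma> * \<nu>" using elim(2) \<gamma> by (intro mult_left_mono) auto
            finally show ?thesis using True r by (simp add: pos_le_divide_eq mult.commute)
          qed simp
        qed
      qed
      also have "\<dots> = vol T * (\<gamma> * \<nu> / R T)"
        using measure_cell[OF T] V[OF T] cell_sub(1)[of T] by (simp add: measure_def Int_absorb2)
      finally show ?thesis using r V[OF T] by (simp add: avg_def field_simps)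
    qed
    define b where "b = M * (\<gamma> * \<nu>)"
    have b0: "0 \<le> b" using M \<gamma> \<nu> by (simp add: b_def)
    have RX: "R T * X T \<le> b" if T: "T \<in> \<T>" for T
    proof -
      have r: "0 \<le> R T * X T" using R[OF T] X0[of T] by (intro mult_nonneg_nonneg) auto
      define W where "W = (\<Sum>T\<in>\<T>. vol T) / vol T"
      have W: "0 < W" unfolding W_def using V T fin by (intro divide_pos_pos sum_pos) auto
      have le: "R T * X T \<le> b * W powr (1 / p)" if p: "1 \<le> p" for p
      proof -
        have nn: "0 \<le> vol S * (R S * X S) powr p" if "S \<in> \<T>" for S
          by (intro mult_nonneg_nonneg less_imp_le[OF V[OF that]] powr_ge_zero)
        have "vol T * (R T * X T) powr p \<le> (\<Sum>T\<in>\<T>. vol T * (R T * X T) powr p)"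
          by (rule member_le_sum[OF T _ fin, where f = "\<lambda>T. vol T * (R T * X T) powr p"]) (use nn in simp)
        also have "\<dots> \<le> M powr p * (\<Sum>T\<in>\<T>. vol T * (R T * avg u T) powr p)" using disc[OF p] by (simp add: X_def)
        also have "\<dots> \<le> M powr p * (\<Sum>T\<in>\<T>. vol T * (\<gamma> * \<nu>) powr p)"
        proof (intro mult_left_mono sum_mono)
          fix S assume S: "S \<in> \<T>"
          have "0 \<le> R S * avg u S" using R[OF S] avg_nonneg[OF S] by (intro mult_nonneg_nonneg) auto
          then show "(R S * avg u S) powr p \<le> (\<gamma> * \<nu>) powr p" using ga[OF S] p by (intro powr_mono2) auto
          show "0 \<le> vol S" using V[OF S] by simp
        qed simp
        also have "\<dots> = b powr p * (\<Sum>T\<in>\<T>. vol T)"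
          unfolding b_def using M \<gamma> \<nu> by (simp add: powr_mult sum_distrib_right[symmetric])
        finally have "(R T * X T) powr p \<le> b powr p * W" using V[OF T] by (simp add: W_def field_simps)
        then have "((R T * X T) powr p) powr (1/p) \<le> (b powr p * W) powr (1/p)" using p by (intro powr_mono2) auto
        moreover have "p * (1/p) = 1" using p by simp
        then have "((R T * X T) powr p) powr (1/p) = R T * X T" "(b powr p) powr (1/p) = b"
          unfolding powr_powr by (simp_all only: powr_one[OF r] powr_one[OF b0])
        moreover have "(b powr p * W) powr (1/p) = (b powr p) powr (1/p) * W powr (1/p)"
          by (rule powr_mult)
        ultimately show ?thesis by simp
      qed
      have "(\<lambda>k. b * W powr (1 / real (Suc k))) \<longlonglongrightarrow> b * W powr 0"
        using W by (intro tendsto_intros LIMSEQ_Suc[OF lim_1_over_n]) auto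
      then have "(\<lambda>k. b * W powr (1 / real (Suc k))) \<longlonglongrightarrow> b" using W by simp
      then show ?thesis by (rule tendsto_lowerbound) (auto intro!: always_eventually le simp del: of_nat_Suc)
    qed
    have "esssup (lebesgue_on \<Omega>) (\<lambda>q. ennreal \<bar>\<rho> q * w q\<bar>) \<le> ennreal (n * b)"
    proof (rule esssup_I)
      show "(\<lambda>q. ennreal \<bar>\<rho> q * w q\<bar>) \<in> borel_measurable (lebesgue_on \<Omega>)" using \<rho> w(1) by measurable
      have "AE q in lebesgue_on \<Omega>. \<forall>T\<in>\<T>. q \<in> cell T \<longrightarrow> 0 < \<rho> q \<and> \<rho> q \<le> R T \<and> R T \<le> \<gamma> * \<rho> q"
        using R fin by (intro AE_finite_allI) auto
      with AE_cells w(2) show "AE q in lebesgue_on \<Omega>. ennreal \<bar>\<rho> q * w q\<bar> \<le> ennreal (n * b)"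
      proof eventually_elim
        case (elim q)
        then obtain T where T: "T \<in> \<T>" "q \<in> cell T" by blast
        then have r: "0 < \<rho> q" "\<rho> q \<le> R T" using elim by auto
        have "\<bar>w q\<bar> \<le> n * X T" unfolding n_def X_def elim(2) by (rule crf_root_bound[OF T])
        then have "\<rho> q * \<bar>w q\<bar> \<le> R T * (n * X T)" using r by (intro mult_mono) auto
        also have "\<dots> = n * (R T * X T)" by simp
        also have "\<dots> \<le> n * b" using RX[OF T(1)] n by (intro mult_left_mono) auto
        finally show ?case using r by (simp add: abs_mult ennreal_leI)
      qed
    qed
    also have "\<dots> = ennreal (n * M * \<gamma>) * ennreal \<nu>" using n M \<gamma> \<nu> by (simp add: b_def ennreal_mult'[symmetric] mult_ac)
    finally show ?thesis by (simp only: norms n_def \<nu>(2))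
  qed
qed

lemma Lp_infinity_integrable:
  assumes u: "u \<in> Lp_space \<infinity> \<Omega>" shows "integrable (lebesgue_on \<Omega>) u"
proof -
  have um: "u \<in> borel_measurable (lebesgue_on \<Omega>)" and fin: "esssup (lebesgue_on \<Omega>) (\<lambda>x. ennreal \<bar>u x\<bar>) < \<infinity>"
    using u by (auto simp: Lp_space_def Lp_norm_def)
  then obtain \<nu> where \<nu>: "0 \<le> \<nu>" "esssup (lebesgue_on \<Omega>) (\<lambda>x. ennreal \<bar>u x\<bar>) = ennreal \<nu>"
    by (cases "esssup (lebesgue_on \<Omega>) (\<lambda>x. ennreal \<bar>u x\<bar>)") auto
  have "AE x in lebesgue_on \<Omega>. norm (u x) \<le> \<nu>"
    using esssup_AE[where M = "lebesgue_on \<Omega>" and f = "\<lambda>x. ennreal \<bar>u x\<bar>"] unfolding \<nu>(2) by eventually_elim (use \<nu>(1) in simp)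
  then show ?thesis using um by (intro finite_measure.integrable_const_bound[OF finite_measure_Omega])
qed

end

section \<open>The threshold and the theorem\<close>

lemma threshold_constant:
  fixes n q :: real
  assumes n: "3 \<le> n" and q: "q = (n + sqrt (n + 2)) / (n - sqrt (n + 2))"
  shows "0 < q" "(n - 2) * ((n + 1) * (2 + q + 1/q)) \<le> 4 * n\<^sup>2"
proof -
  define r where "r = sqrt (n + 2)"
  have r2: "r\<^sup>2 = n + 2" and r0: "0 \<le> r" using n by (simp_all add: r_def)
  have "3 * n \<le> n * n" using n by (intro mult_right_mono) auto
  then have "r\<^sup>2 < n\<^sup>2" unfolding r2 unfolding power2_eq_square using n by linarith
  then have rn: "r < n" using n by (intro power2_less_imp_less[of r n]) auto
  have q': "q = (n + r) / (n - r)" by (simp add: q r_def)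
  then show "0 < q" using n rn r0 by simp
  have pos: "0 < n - r" "0 < n + r" using rn n r0 by auto
  \<comment> \<open>With r = sqrt(n+2) one has (n-2)(n+1) = n^2 - r^2 and 2 + q + 1/q = 4n^2/(n^2 -
    r^2): the threshold is the value of q that gives equality in the local condition.\<close>
  have "(n - 2) * (n + 1) = (n - r) * (n + r)" using r2 by (simp add: algebra_simps power2_eq_square)
  moreover have "2 + q + 1/q = 4 * n\<^sup>2 / ((n - r) * (n + r))"
    using pos unfolding q' by (simp add: field_simps power2_eq_square)
  ultimately have "(n - 2) * (n + 1) * (2 + q + 1/q) = 4 * n\<^sup>2" using pos by simp
  then show "(n - 2) * ((n + 1) * (2 + q + 1/q)) \<le> 4 * n\<^sup>2" by (simp add: mult.assoc)
qed

lemma half_minus_inverse: "1 \<le> p \<Longrightarrow> \<bar>1/2 - 1/p\<bar> \<le> 1/2" for p :: real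
proof -
  assume "1 \<le> p"
  then have "0 \<le> 1/p" "1/p \<le> 1" by simp_all
  then show ?thesis unfolding abs_le_iff by linarith
qed

text \<open>For \<open>d = 2\<close> the threshold is infinite, and any \<open>q > \<gamma>\<close> is admissible in the discrete estimate.\<close>

lemma threshold_bound:
  assumes d: "2 \<le> d" and \<gamma>: "1 \<le> \<gamma>" and lt: "\<exists>e::real. 0 \<le> e \<and> ereal (\<gamma> * 2 powr e) < CR_threshold d"
  shows "\<exists>q>\<gamma>. (real d - 2) * (real (d + 1) * (2 + q + 1/q)) \<le> 4 * (real d)\<^sup>2 \<and>
    (\<forall>e\<le>1/2. ereal (\<gamma> * 2 powr e) < CR_threshold d \<longrightarrow> \<gamma> * 2 powr e \<le> q)"
proof (cases "d = 2")
  case True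
  have "\<gamma> * 2 powr e \<le> 2 * \<gamma>" if "e \<le> 1/2" for e :: real
  proof -
    have "2 powr e \<le> (2::real) powr 1" using that by (intro powr_mono) auto
    then show ?thesis using \<gamma> by simp
  qed
  then show ?thesis using True \<gamma> by (intro exI[of _ "2 * \<gamma>"]) auto
next
  case False
  define q where "q = (real d + sqrt (real d + 2)) / (real d - sqrt (real d + 2))"
  have th: "CR_threshold d = ereal q" using False by (simp add: CR_threshold_def q_def)
  have "3 \<le> real d" using d False by simp
  note q = threshold_constant[OF this q_def]
  obtain e :: real where e: "0 \<le> e" "\<gamma> * 2 powr e < q" using lt by (auto simp: th)
  have "\<gamma> * 1 \<le> \<gamma> * 2 powr e" using \<gamma> e(1) by (intro mult_left_mono ge_one_powr_ge_zero) auto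
  then have "\<gamma> < q" using e(2) by simp
  then show ?thesis using q(2) by (intro exI[of _ q]) (auto simp: th add.commute)
qed

lemma weighted_stability:
  fixes \<Omega> :: "(real^'n) set" and \<T>\<^sub>0 :: "'n tagged_simplex set" and \<gamma> :: real
  assumes d: "2 \<le> CARD('n)" and dom: "polyhedral_domain \<Omega>" and M0: "matching_neighbor_condition \<Omega> \<T>\<^sub>0" and \<gamma>: "1 \<le> \<gamma>"
  shows "\<exists>c::real. c > 0 \<and>
    (\<forall>(p::ennreal) \<P> \<T> \<rho> u.
       1 \<le> p \<and> \<P> \<in> BiSec_MT_meshes \<Omega> \<T>\<^sub>0 \<and> \<T> = simplex_of ` \<P> \<and>
       weight_with_grading \<Omega> \<T> \<gamma> \<rho> \<and>
       ereal (\<gamma> * 2 powr \<bar>1/2 - enn2real (1 / p)\<bar>) < CR_threshold CARD('n) \<and>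
       u \<in> Lp_space p \<Omega> \<longrightarrow>
       Lp_norm p \<Omega> (\<lambda>x. \<rho> x * Q_CR \<Omega> \<T> u x) \<le> ennreal c * Lp_norm p \<Omega> (\<lambda>x. \<rho> x * u x))"
proof (cases "\<exists>e::real. 0 \<le> e \<and> ereal (\<gamma> * 2 powr e) < CR_threshold CARD('n)")
  \<comment> \<open>Then no exponent satisfies the condition, and any constant will do.\<close>
  case False
  then have "\<not> ereal (\<gamma> * 2 powr \<bar>1/2 - enn2real (1 / p)\<bar>) < CR_threshold CARD('n)" for p by auto
  then show ?thesis by (intro exI[of _ 1]) auto
next
  case True
  obtain q where q: "\<gamma> < q" "(real CARD('n) - 2) * (real (CARD('n) + 1) * (2 + q + 1/q)) \<le> 4 * (real CARD('n))\<^sup>2"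
    and thr: "\<forall>e\<le>1/2. ereal (\<gamma> * 2 powr e) < CR_threshold CARD('n) \<longrightarrow> \<gamma> * 2 powr e \<le> q"
    using threshold_bound[OF d \<gamma> True] by (elim exE conjE)
  obtain V0 V1 \<Phi> where V: "0 < V0" "V0 \<le> V1" "0 < \<Phi>" and
    meshes: "\<forall>\<P>\<in>BiSec_MT_meshes \<Omega> \<T>\<^sub>0. triangulation_of \<Omega> (simplex_of ` \<P>) \<and> (\<exists>gen. generations V0 V1 \<Phi> (simplex_of ` \<P>) gen)"
    using mesh_generations[OF d M0] by (elim exE conjE)
  define Cg where "Cg = unit_ball_vol (real CARD('n)) * (2 * \<Phi>) ^ CARD('n) / V0"
  define cu where "cu = (real CARD('n) + 1) * (real CARD('n) + 2) * real CARD('n)"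
  have c: "0 \<le> Cg" "0 < cu" using V by (simp_all add: Cg_def cu_def)
  obtain M where M: "0 < M" and disc:
    "\<forall>(\<T>::(real^'n) set set) (F::(real^'n) set \<Rightarrow> (real^'n) set set) vol gen \<rho> x U p.
     discrete_mesh \<T> F CARD('n) vol gen V0 V1 Cg \<and> (\<forall>T\<in>\<T>. 0 < \<rho> T \<and> 0 \<le> U T) \<and>
     (\<forall>T\<in>\<T>. \<forall>T'\<in>\<T>. \<forall>f. T \<noteq> T' \<and> f \<in> F T \<and> f \<in> F T' \<longrightarrow> \<rho> T' \<le> \<gamma> * \<rho> T) \<and>
     discrete_mesh.tested \<T> F CARD('n) vol cu x U \<and> 1 \<le> p \<and> \<gamma> * 2 powr \<bar>1/2 - 1/p\<bar> \<le> q \<longrightarrow>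
     (\<Sum>T\<in>\<T>. vol T * (\<rho> T * sqrt (\<Sum>f\<in>F T. (x f)\<^sup>2)) powr p) \<le> M powr p * (\<Sum>T\<in>\<T>. vol T * (\<rho> T * U T) powr p)"
    using discrete_stability[OF d \<gamma> q V(1,2) c, where 'b = "(real^'n) set" and 'f = "(real^'n) set"] by (elim exE conjE)
  define C where "C = real CARD('n) * sqrt (real CARD('n) + 1) * M * \<gamma>"
  have C: "0 < C" using M \<gamma> by (simp add: C_def)
  have "Lp_norm p \<Omega> (\<lambda>x. \<rho> x * Q_CR \<Omega> \<T> u x) \<le> ennreal C * Lp_norm p \<Omega> (\<lambda>x. \<rho> x * u x)"
    if p: "1 \<le> p" and P: "\<P> \<in> BiSec_MT_meshes \<Omega> \<T>\<^sub>0" and T: "\<T> = simplex_of ` \<P>"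
      and w: "weight_with_grading \<Omega> \<T> \<gamma> \<rho>"
      and lt: "ereal (\<gamma> * 2 powr \<bar>1/2 - enn2real (1 / p)\<bar>) < CR_threshold CARD('n)" and u: "u \<in> Lp_space p \<Omega>"
    for p \<P> \<T> \<rho> u
  proof -
    interpret CR_mesh \<Omega> \<T> using conjunct1[OF bspec[OF meshes P]] dom d by unfold_locales (simp_all only: T)
    obtain gen where gen: "generations V0 V1 \<Phi> \<T> gen" using conjunct2[OF bspec[OF meshes P]] unfolding T by (elim exE)
    have mesh: "discrete_mesh \<T> facets_of CARD('n) vol gen V0 V1 Cg"
      unfolding Cg_def by (rule mesh_discrete[OF gen V(1,3,2)])
    have \<rho>: "\<rho> \<in> borel_measurable (lebesgue_on \<Omega>)" using w by (auto simp: weight_with_grading_def)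
    obtain R where R0: "\<forall>T\<in>\<T>. 0 < R T \<and> (AE q in lebesgue_on \<Omega>. q \<in> cell T \<longrightarrow> 0 < \<rho> q \<and> \<rho> q \<le> R T \<and> R T \<le> \<gamma> * \<rho> q)"
      and R2: "\<forall>T\<in>\<T>. \<forall>T'\<in>\<T>. \<forall>f. T \<noteq> T' \<and> f \<in> facets_of T \<and> f \<in> facets_of T' \<longrightarrow> R T' \<le> \<gamma> * R T"
      using weight_simplexwise[OF w] by (elim exE conjE)
    note R = bspec[OF R0]
    have ui: "integrable (lebesgue_on \<Omega>) u"
    proof (cases "p = \<infinity>")
      case False
      then obtain r where r: "p = ennreal r" "0 \<le> r" by (cases p) auto
      then have "1 \<le> r" using p by (simp add: ennreal_ge_1)
      then show ?thesis using Lp_space_integrable(1)[of r u] u r(1) by simp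
    qed (use Lp_infinity_integrable u in simp)
    obtain x where x: "AE q in lebesgue_on \<Omega>. Q_CR \<Omega> \<T> u q = crf x q" "Q_CR \<Omega> \<T> u \<in> borel_measurable (lebesgue_on \<Omega>)"
      "\<forall>y. L2_pairing \<Omega> (crf x) (crf y) = L2_pairing \<Omega> u (crf y)"
      using Q_CR_crf[OF ui] by (elim exE conjE)
    have tested: "discrete_mesh.tested \<T> facets_of CARD('n) vol cu x (avg u)"
      unfolding discrete_mesh.tested_def[OF mesh] cu_def
      by (intro allI test_inequality[OF ui x(3)[rule_format]])
    have D: "(\<Sum>T\<in>\<T>. vol T * (R T * sqrt (\<Sum>f\<in>facets_of T. (x f)\<^sup>2)) powr r) \<le> M powr r * (\<Sum>T\<in>\<T>. vol T * (R T * avg u T) powr r)"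
      if r: "1 \<le> r" "ereal (\<gamma> * 2 powr e) < CR_threshold CARD('n)" "\<bar>1/2 - 1/r\<bar> \<le> e" "e \<le> 1/2" for r e :: real
    proof (rule disc[rule_format, of \<T> facets_of vol gen], intro conjI mesh R2 tested r(1))
      show "\<forall>T\<in>\<T>. 0 < R T \<and> 0 \<le> avg u T" by (intro ballI conjI conjunct1[OF R] avg_nonneg)
      have "\<gamma> * 2 powr \<bar>1/2 - 1/r\<bar> \<le> \<gamma> * 2 powr e" using \<gamma> r(3) by (intro mult_left_mono powr_mono) auto
      also have "\<dots> \<le> q" by (rule thr[rule_format, OF r(4,2)])
      finally show "\<gamma> * 2 powr \<bar>1/2 - 1/r\<bar> \<le> q" .
    qed
    show ?thesis
    proof (cases "p = \<infinity>")
      case True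
      \<comment> \<open>At p = \<infinity> the reciprocal is 0, so the hypothesis is the one with
        exponent 1/2, which covers all finite exponents needed for the limit.\<close>
      have lt2: "ereal (\<gamma> * 2 powr (1/2)) < CR_threshold CARD('n)" using lt True by simp
      show ?thesis
        unfolding True C_def
        by (rule Lp_bound_infinite[OF \<gamma> M \<rho> ui R x(2,1) D[OF _ lt2 half_minus_inverse order_refl]])
    next
      case False
      then obtain r where r0: "p = ennreal r" "0 \<le> r" by (cases p) auto
      then have r: "1 \<le> r" using p by (simp add: ennreal_ge_1)
      have "1 / p = ennreal (1 / r)" unfolding r0(1) using r divide_ennreal[of 1 r] by simp
      then have e: "enn2real (1 / p) = 1 / r" using r by simp
      show ?thesis
        unfolding r0(1) C_def
        by (rule Lp_bound_finite[OF r \<gamma> M \<rho> u[unfolded r0(1)] R x(2,1) D[OF r lt[unfolded e] order_refl half_minus_inverse[OF r]]])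
    qed
  qed
  note bound = this
  show ?thesis
  proof (intro exI[of _ C] conjI C allI impI)
    fix p \<P> \<T> \<rho> u
    assume "1 \<le> p \<and> \<P> \<in> BiSec_MT_meshes \<Omega> \<T>\<^sub>0 \<and> \<T> = simplex_of ` \<P> \<and> weight_with_grading \<Omega> \<T> \<gamma> \<rho> \<and>
       ereal (\<gamma> * 2 powr \<bar>1/2 - enn2real (1 / p)\<bar>) < CR_threshold CARD('n) \<and> u \<in> Lp_space p \<Omega>"
    then show "Lp_norm p \<Omega> (\<lambda>x. \<rho> x * Q_CR \<Omega> \<T> u x) \<le> ennreal C * Lp_norm p \<Omega> (\<lambda>x. \<rho> x * u x)"
      by (elim conjE) (rule bound)
  qed
qed

text \<open>The exponent 1/2 asks for sqrt 2 < (n+r)/(n-r) with r = sqrt(n+2), that is n/r < (1 +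
  sqrt 2)^2, about 5.83. The quotient is about 5.75 for n = 35 and about 5.84 for n = 36, whence the
  bound 35.\<close>

lemma threshold_sqrt2:
  assumes d: "2 \<le> d" "d \<le> 35" and e: "e \<le> 1/2"
  shows "ereal (1 * 2 powr e) < CR_threshold d"
proof (cases "d = 2")
  case False
  define n where "n = real d"
  define r where "r = sqrt (n + 2)"
  have n: "3 \<le> n" "n \<le> 35" using d False by (simp_all add: n_def)
  have r2: "r\<^sup>2 = n + 2" and r0: "0 \<le> r" using n by (simp_all add: r_def)
  have "3 * n \<le> n * n" using n by (intro mult_right_mono) auto
  then have "r\<^sup>2 < n\<^sup>2" unfolding r2 unfolding power2_eq_square using n by linarith
  then have rn: "r < n" using n by (intro power2_less_imp_less[of r n]) auto
  have s2: "sqrt 2 < 14143 / 10000" by (rule real_less_lsqrt) (simp_all add: power2_eq_square)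
  \<comment> \<open>The inequality with 14143/10000 for sqrt 2, cleared of denominators; this
    rational upper bound is precise enough at n = 35.\<close>
  have key: "4143 * n < 24143 * r"
  proof (rule power2_less_imp_less)
    have "4143\<^sup>2 * n\<^sup>2 \<le> 4143\<^sup>2 * (35 * n)" using n by (simp add: power2_eq_square)
    also have "\<dots> < 24143\<^sup>2 * (n + 2)" using n by (simp add: power2_eq_square)
    finally show "(4143 * n)\<^sup>2 < (24143 * r)\<^sup>2" by (simp only: power_mult_distrib r2)
  qed (use r0 in simp)
  have "2 powr e \<le> (2::real) powr (1/2)" using e by (intro powr_mono) auto
  also have "\<dots> < 14143 / 10000" using s2 by (simp add: powr_half_sqrt)
  also have "\<dots> < (n + r) / (n - r)" using rn key by (simp add: field_simps)
  finally show ?thesis using False by (simp add: CR_threshold_def n_def r_def)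
qed (simp add: CR_threshold_def)

text \<open>The dependence of the constants is encoded in the order of the quantifiers: c is fixed
  after the domain, the initial triangulation and \<gamma>, but before the exponent, the mesh, the
  weight and the data.\<close>

theorem corollary6p5:
  fixes \<Omega> :: "(real^'n) set" and \<T>\<^sub>0 :: "'n tagged_simplex set"
  assumes "2 \<le> CARD('n)"
    and "polyhedral_domain \<Omega>"
    and "matching_neighbor_condition \<Omega> \<T>\<^sub>0"
  shows "(\<forall>\<gamma>::real. \<gamma> \<ge> 1 \<longrightarrow> (\<exists>c::real. c > 0 \<and>
            (\<forall>(p::ennreal) \<P> \<T> \<rho> u.
               1 \<le> p \<and> \<P> \<in> BiSec_MT_meshes \<Omega> \<T>\<^sub>0 \<and> \<T> = simplex_of ` \<P> \<and>
               weight_with_grading \<Omega> \<T> \<gamma> \<rho> \<and>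
               ereal (\<gamma> * 2 powr \<bar>1/2 - enn2real (1 / p)\<bar>) < CR_threshold CARD('n) \<and>
               u \<in> Lp_space p \<Omega> \<longrightarrow>
               Lp_norm p \<Omega> (\<lambda>x. \<rho> x * Q_CR \<Omega> \<T> u x)
                 \<le> ennreal c * Lp_norm p \<Omega> (\<lambda>x. \<rho> x * u x)))) \<and>
         (CARD('n) \<le> 35 \<longrightarrow> (\<exists>c::real. c > 0 \<and>
            (\<forall>(p::ennreal) \<P> \<T> u.
               1 \<le> p \<and> \<P> \<in> BiSec_MT_meshes \<Omega> \<T>\<^sub>0 \<and> \<T> = simplex_of ` \<P> \<and>
               u \<in> Lp_space p \<Omega> \<longrightarrow>
               Lp_norm p \<Omega> (Q_CR \<Omega> \<T> u) \<le> ennreal c * Lp_norm p \<Omega> u)))"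
proof (intro conjI allI impI)
  fix \<gamma> :: real assume "1 \<le> \<gamma>"
  then show "\<exists>c::real. c > 0 \<and>
            (\<forall>(p::ennreal) \<P> \<T> \<rho> u.
               1 \<le> p \<and> \<P> \<in> BiSec_MT_meshes \<Omega> \<T>\<^sub>0 \<and> \<T> = simplex_of ` \<P> \<and>
               weight_with_grading \<Omega> \<T> \<gamma> \<rho> \<and>
               ereal (\<gamma> * 2 powr \<bar>1/2 - enn2real (1 / p)\<bar>) < CR_threshold CARD('n) \<and>
               u \<in> Lp_space p \<Omega> \<longrightarrow>
               Lp_norm p \<Omega> (\<lambda>x. \<rho> x * Q_CR \<Omega> \<T> u x)
                 \<le> ennreal c * Lp_norm p \<Omega> (\<lambda>x. \<rho> x * u x))"
    by (rule weighted_stability[OF assms])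
next
  assume d35: "CARD('n) \<le> 35"
  \<comment> \<open>The unweighted bound is the case \<gamma> = 1 with constant weight; the exponent
    |1/2 - 1/p| never exceeds 1/2, so \<open>threshold_sqrt2\<close> covers every p.\<close>
  obtain c :: real where cst: "0 < c \<and>
    (\<forall>(p::ennreal) \<P> \<T> \<rho> u.
       1 \<le> p \<and> \<P> \<in> BiSec_MT_meshes \<Omega> \<T>\<^sub>0 \<and> \<T> = simplex_of ` \<P> \<and>
       weight_with_grading \<Omega> \<T> 1 \<rho> \<and>
       ereal (1 * 2 powr \<bar>1/2 - enn2real (1 / p)\<bar>) < CR_threshold CARD('n) \<and>
       u \<in> Lp_space p \<Omega> \<longrightarrow>
       Lp_norm p \<Omega> (\<lambda>x. \<rho> x * Q_CR \<Omega> \<T> u x) \<le> ennreal c * Lp_norm p \<Omega> (\<lambda>x. \<rho> x * u x))"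
    using weighted_stability[OF assms, of 1, OF order_refl] by (rule exE)
  note c = conjunct1[OF cst] and st = conjunct2[OF cst]
  have "Lp_norm p \<Omega> (Q_CR \<Omega> \<T> u) \<le> ennreal c * Lp_norm p \<Omega> u"
    if p: "1 \<le> p" and P: "\<P> \<in> BiSec_MT_meshes \<Omega> \<T>\<^sub>0" "\<T> = simplex_of ` \<P>" and u: "u \<in> Lp_space p \<Omega>"
    for p :: ennreal and \<P> \<T> u
  proof -
    interpret CR_mesh \<Omega> \<T>
      using conjunct1[OF meshes_descend[OF assms(3) P(1)]] assms(1,2) by unfold_locales (simp_all only: P(2))
    have "enn2real (1 / p) \<le> 1"
    proof (cases p)
      case (real r)
      then have "1 \<le> r" using p by simp
      then have "1 / p = ennreal (1 / r)" "1 / r \<le> 1" using divide_ennreal[of 1 r] real by simp_all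
      then show ?thesis using \<open>1 \<le> r\<close> by simp
    qed simp
    then have e: "\<bar>1/2 - enn2real (1 / p)\<bar> \<le> 1/2"
      unfolding abs_le_iff using enn2real_nonneg[of "1 / p"] by linarith
    have "1 \<le> p \<and> \<P> \<in> BiSec_MT_meshes \<Omega> \<T>\<^sub>0 \<and> \<T> = simplex_of ` \<P> \<and> weight_with_grading \<Omega> \<T> 1 (\<lambda>_. 1) \<and>
        ereal (1 * 2 powr \<bar>1/2 - enn2real (1 / p)\<bar>) < CR_threshold CARD('n) \<and> u \<in> Lp_space p \<Omega>"
      by (intro conjI p P u weight_one threshold_sqrt2[OF assms(1) d35 e])
    from st[THEN spec, THEN spec, THEN spec, THEN spec, THEN spec, THEN mp, OF this]
    show ?thesis by (simp only: mult_1)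
  qed
  then show "\<exists>c::real. c > 0 \<and>
            (\<forall>(p::ennreal) \<P> \<T> u.
               1 \<le> p \<and> \<P> \<in> BiSec_MT_meshes \<Omega> \<T>\<^sub>0 \<and> \<T> = simplex_of ` \<P> \<and>
               u \<in> Lp_space p \<Omega> \<longrightarrow>
               Lp_norm p \<Omega> (Q_CR \<Omega> \<T> u) \<le> ennreal c * Lp_norm p \<Omega> u)"
    using c by (intro exI[of _ c] conjI allI impI) (simp_all only:)
qed

end
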